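(* Let $\mathcal{C}$ be a groupoidant 2-category. Then the (ana-)2-functor $\mathrm{Nv}:\mathcal{C}\to\mathrm{Cong}(\mathcal{C})$ is a strict equivalence of 2-categories; that is, every complete congruence in $\mathcal{C}$ is equivalent in $\mathrm{Cong}(\mathcal{C})$ to some $\mathrm{Nv}(X)$, and for all $X,Y\in\mathcal{C}$ the functor $\mathrm{Nv}:\mathcal{C}(X,Y)\to\mathrm{Cong}(\mathcal{C})(\mathrm{Nv}(X),\mathrm{Nv}(Y))$ is an isomorphism of categories.
   Context: Conventions. 2-categories are strict. Composition is in diagrammatic order: $fg$ means first $f$, then $g$ (also for functors and whiskerings). $|\mathcal{C}|$ is the underlying 1-category of $\mathcal{C}$. For $f:X\to Y$, $f_*:\mathcal{C}(A,X)\to\mathcal{C}(A,Y)$ is composition with $f$. $[k]$ is the linear order $\{0<\dots<k\}$ viewed as a category, and $\delta_{a_0\dots a_k}:[k]\to[l]$ is the functor $j\mapsto a_j$. Limits. A functor $F$ is an isofibration if every isomorphism $Fx\to b$ lifts to an isomorphism with domain $x$; it is a discrete opfibration (DOF) if every morphism $Fx\to b$ has a unique lift with domain $x$. A morphism $f$ of $\mathcal{C}$ is an isofibration (resp. DOF) if $f_*:\mathcal{C}(A,X)\to\mathcal{C}(A,Y)$ is one for all $A$. A commutative square with vertex $P$ over a cospan $X\to Z\leftarrow Y$ is a strict pullback if $\mathcal{C}(B,P)\to\mathcal{C}(B,X)\times_{\mathcal{C}(B,Z)}\mathcal{C}(B,Y)$ is an isomorphism of categories for all $B$. A strict terminal object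 has all $\mathcal{C}(A,\mathbf 1)$ equal to the one-morphism category. A strict cotensor of $X$ with a category $J$ is an object $X^J$ with a functor $\mathrm{ev}:J\to\mathcal{C}(X^J,X)$ inducing isomorphisms of categories $\mathcal{C}(A,X^J)\cong\mathrm{Fun}(J,\mathcal{C}(A,X))$ for all $A$; functors $J\to J'$ induce $X^{J'}\to X^J$ and morphisms $f:X\to Y$ induce $f^J:X^J\to Y^J$. The arrow object is $X^\to=X^{[1]}$, with universal 2-cell $\partial:\partial_0\Rightarrow\partial_1:X^\to\to X$. $\mathcal{C}$ is pita if it has a strict terminal object, strict arrow objects, and strict pullbacks of isofibrations along arbitrary morphisms (it then has cotensors with finite categories). Groupoids and cores. $X$ is a groupoid if every $\mathcal{C}(A,X)$ is a groupoid. $f:A\to X$ is an arrow-wise iso if $\alpha f$ is invertible for every 2-cell $\alpha$ between morphisms into $A$. A core of $X$ is an object $X^{\mathrm{iso}}$ with an arrow-wise iso $i:X^{\mathrm{iso}}\to X$ such that for all $A$, $i_*$ is an isomorphism from $\mathcal{C}(A,X^{\mathrm{iso}})$ onto the subcategory of $\mathcal{C}(A,X)$ of arrow-wise isos and invertible 2-cells. Any $f:X\to Y$ induces $f^{\mathrm{iso}}:X^{\mathrm{iso}}\to Y^{\mathrm{iso}}$ with $f^{\mathrm{iso}}i=if$. Congruences. An internal category $C$ in a 1-category has objects $C_0,C_1,C_2$ and morphisms $\pi_0,\pi_1:C_1\to C_0$ (source, target), $e:C_0\to C_1$ (identities), $\pi_{01},\pi_{12},\pi_{02}:C_2\to C_1$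 (first arrow, second arrow, composite), with $C_2=C_1\times_{C_0}C_1$ via $\pi_{01}\pi_1=\pi_{12}\pi_0$, satisfying the usual axioms. $C_3=C_2\times_{C_1}C_2$ (along $\pi_{12},\pi_{01}$) is the object of composable triples; $\langle a,b,c\rangle:A\to C_3$ is the morphism with consecutive components $a,b,c:A\to C_1$, and $\pi_{02},\pi_{13}:C_3\to C_1$ give the composite of the first two, resp. last two, arrows. In a pita 2-category $\mathcal{C}$, an internal double category is an internal category in $|\mathcal{C}|$ with $\langle\pi_0,\pi_1\rangle:C_1\to C_0\times C_0$ an isofibration. It is a gbo-congruence if $C_0,C_1,C_2$ are groupoids and $\langle\pi_0,\pi_1\rangle$ is a DOF. Then there is a unique $r:C_0^\to\to C_1$ (the reflection morphism) for which there exists a 2-cell $\bar\rho:r\Rightarrow\partial_1e$ with $\bar\rho\langle\pi_0,\pi_1\rangle=\langle\partial,\mathrm{id}_{\partial_1}\rangle$. Let $\tau:C_0^\to\to C_0^\to$ be the morphism with $\tau\partial=\partial^{-1}$. A gbo-congruence $C$ is complete (a complete congruence) if the square with top $\langle r,\tau r,r\rangle:C_0^\to\to C_3$, left $\langle\partial_0,\partial_1\rangle:C_0^\to\to C_0\times C_0$, right $\langle\pi_{02},\pi_{13}\rangle:C_3\to C_1\times C_1$ and bottom $e\times e$ is a strict pullback. Nerves and quotients. A nerve $\mathrm{Nv}(X)$ of $X$ is the internal double category with objects $X^{\mathrm{iso}},(X^\to)^{\mathrm{iso}},(X^{[2]})^{\mathrm{iso}}$ (for some choice of cores and cotensors) and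 structure maps $\pi_{jk}=(X^{\delta_{jk}})^{\mathrm{iso}}$, $\pi_j=(X^{\delta_j})^{\mathrm{iso}}=\partial_j^{\mathrm{iso}}$, $e=(X^{\delta_{00}})^{\mathrm{iso}}$. A cocone under $C$ with vertex $Y$ is a morphism $\gamma:C_0\to Y$ and a 2-cell $\gamma_{01}:\pi_0\gamma\Rightarrow\pi_1\gamma$ with $e\gamma_{01}=\mathrm{id}_\gamma$ and $\pi_{02}\gamma_{01}=(\pi_{01}\gamma_{01})(\pi_{12}\gamma_{01})$; a morphism $(\gamma,\gamma_{01})\to(\gamma',\gamma'_{01})$ is a 2-cell $\alpha:\gamma\Rightarrow\gamma'$ with $(\pi_0\alpha)\gamma'_{01}=\gamma_{01}(\pi_1\alpha)$. A cocone with vertex $X$ is a strict quotient of $C$ if the induced functor $\mathcal{C}(X,Y)\to\mathrm{Cocone}(C,Y)$ is an isomorphism for all $Y$. The tautological cocone under $\mathrm{Nv}(X)$ is $\gamma=i:X^{\mathrm{iso}}\to X$, $\gamma_{01}=i\partial$ (with $i:(X^\to)^{\mathrm{iso}}\to X^\to$). $\mathcal{C}$ is groupoidant if: it is pita; every object has a core; every complete congruence is a nerve (of some object); and the tautological cocone under any nerve is a strict quotient. The 2-functor. $\mathrm{Cong}(\mathcal{C})$ is the full sub-2-category, on the complete congruences in $\mathcal{C}$, of the 2-category of internal categories in $|\mathcal{C}|$, internal functors, and internal natural transformations; an internal natural transformation $F\Rightarrow G:C\to D$ is a morphism $\alpha:C_0\to D_1$ with $\alpha\pi_0=F_0$, $\alpha\pi_1=G_0$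 and satisfying the usual naturality condition. $\mathrm{Nv}$ sends $X$ to its nerve (depending on the choice of cores and cotensors, hence "ana-"), $f:X\to Y$ to the internal functor with components $f^{\mathrm{iso}},(f^{\to})^{\mathrm{iso}},(f^{[2]})^{\mathrm{iso}}$, and a 2-cell $\alpha:f\Rightarrow g:X\to Y$ to the unique morphism $\mathrm{Nv}(\alpha):X^{\mathrm{iso}}\to(Y^\to)^{\mathrm{iso}}$ with $\mathrm{Nv}(\alpha)i\partial=i\alpha$. *)

theory Defs
  imports Main "HOL-Library.FuncSet"
begin

text \<open>All compositions are written in diagrammatic order.\<close>

section \<open>Categories and functors\<close>

record ('o, 'a) cat =
  Ob :: "'o set"
  Ar :: "'a set"
  Dm :: "'a \<Rightarrow> 'o"
  Cd :: "'a \<Rightarrow> 'o"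
  Idn :: "'o \<Rightarrow> 'a"
  Cmp :: "'a \<Rightarrow> 'a \<Rightarrow> 'a" (infixl "\<odot>\<index>" 70)

definition arr :: "('o, 'a) cat \<Rightarrow> 'a \<Rightarrow> 'o \<Rightarrow> 'o \<Rightarrow> bool" where
  "arr D f x y \<longleftrightarrow> f \<in> Ar D \<and> Dm D f = x \<and> Cd D f = y"

locale category =
  fixes D :: "('o, 'a) cat" (structure)
  assumes Dm_in: "f \<in> Ar D \<Longrightarrow> Dm D f \<in> Ob D"
    and Cd_in: "f \<in> Ar D \<Longrightarrow> Cd D f \<in> Ob D"
    and Idn_arr: "x \<in> Ob D \<Longrightarrow> arr D (Idn D x) x x"
    and Cmp_arr: "arr D f x y \<Longrightarrow> arr D g y z \<Longrightarrow> arr D (f \<odot> g) x z"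
    and Idn_left: "arr D f x y \<Longrightarrow> Idn D x \<odot> f = f"
    and Idn_right: "arr D f x y \<Longrightarrow> f \<odot> Idn D y = f"
    and Cmp_assoc: "arr D f w x \<Longrightarrow> arr D g x y \<Longrightarrow> arr D h y z \<Longrightarrow>
      (f \<odot> g) \<odot> h = f \<odot> (g \<odot> h)"

definition inverse_arrows :: "('o, 'a) cat \<Rightarrow> 'a \<Rightarrow> 'a \<Rightarrow> bool" where
  "inverse_arrows D f g \<longleftrightarrow>
     f \<in> Ar D \<and> arr D g (Cd D f) (Dm D f) \<and>
     f \<odot>\<^bsub>D\<^esub> g = Idn D (Dm D f) \<and> g \<odot>\<^bsub>D\<^esub> f = Idn D (Cd D f)"

definition iso_arrow :: "('o, 'a) cat \<Rightarrow> 'a \<Rightarrow> bool" where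
  "iso_arrow D f \<longleftrightarrow> (\<exists>g. inverse_arrows D f g)"

definition groupoid_cat :: "('o, 'a) cat \<Rightarrow> bool" where
  "groupoid_cat D \<longleftrightarrow> category D \<and> (\<forall>f \<in> Ar D. iso_arrow D f)"

record ('o, 'a, 'p, 'b) fctr =
  fob :: "'o \<Rightarrow> 'p"
  far :: "'a \<Rightarrow> 'b"

definition is_functor :: "('o, 'a) cat \<Rightarrow> ('p, 'b) cat \<Rightarrow> ('o, 'a, 'p, 'b) fctr \<Rightarrow> bool" where
  "is_functor D E F \<longleftrightarrow>
     category D \<and> category E \<and>
     (\<forall>x \<in> Ob D. fob F x \<in> Ob E) \<and>
     (\<forall>f \<in> Ar D. arr E (far F f) (fob F (Dm D f)) (fob F (Cd D f))) \<and>
     (\<forall>x \<in> Ob D. far F (Idn D x) = Idn E (fob F x)) \<and>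
     (\<forall>f \<in> Ar D. \<forall>g \<in> Ar D. Cd D f = Dm D g \<longrightarrow>
        far F (f \<odot>\<^bsub>D\<^esub> g) = far F f \<odot>\<^bsub>E\<^esub> far F g)"

definition cat_isomorphism :: "('o, 'a) cat \<Rightarrow> ('p, 'b) cat \<Rightarrow> ('o, 'a, 'p, 'b) fctr \<Rightarrow> bool" where
  "cat_isomorphism D E F \<longleftrightarrow>
     is_functor D E F \<and> bij_betw (fob F) (Ob D) (Ob E) \<and> bij_betw (far F) (Ar D) (Ar E)"

definition isofibration_functor ::
    "('o, 'a) cat \<Rightarrow> ('p, 'b) cat \<Rightarrow> ('o, 'a, 'p, 'b) fctr \<Rightarrow> bool" where
  "isofibration_functor D E F \<longleftrightarrow>
     is_functor D E F \<and>
     (\<forall>x \<in> Ob D. \<forall>\<phi>. iso_arrow E \<phi> \<and> Dm E \<phi> = fob F x \<longrightarrow>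
        (\<exists>\<psi>. iso_arrow D \<psi> \<and> Dm D \<psi> = x \<and> far F \<psi> = \<phi>))"

definition DOF_functor ::
    "('o, 'a) cat \<Rightarrow> ('p, 'b) cat \<Rightarrow> ('o, 'a, 'p, 'b) fctr \<Rightarrow> bool" where
  "DOF_functor D E F \<longleftrightarrow>
     is_functor D E F \<and>
     (\<forall>x \<in> Ob D. \<forall>\<phi> \<in> Ar E. Dm E \<phi> = fob F x \<longrightarrow>
        (\<exists>!\<psi>. \<psi> \<in> Ar D \<and> Dm D \<psi> = x \<and> far F \<psi> = \<phi>))"

definition prod_cat :: "('o, 'a) cat \<Rightarrow> ('p, 'b) cat \<Rightarrow> ('o \<times> 'p, 'a \<times> 'b) cat" where
  "prod_cat D E = \<lparr>
     Ob = Ob D \<times> Ob E,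
     Ar = Ar D \<times> Ar E,
     Dm = (\<lambda>(f, g). (Dm D f, Dm E g)),
     Cd = (\<lambda>(f, g). (Cd D f, Cd E g)),
     Idn = (\<lambda>(x, y). (Idn D x, Idn E y)),
     Cmp = (\<lambda>(f, g) (f', g'). (f \<odot>\<^bsub>D\<^esub> f', g \<odot>\<^bsub>E\<^esub> g'))\<rparr>"

definition pullback_cat ::
    "('o, 'a) cat \<Rightarrow> ('p, 'b) cat \<Rightarrow> ('o, 'a, 'q, 'd) fctr \<Rightarrow> ('p, 'b, 'q, 'd) fctr \<Rightarrow>
     ('o \<times> 'p, 'a \<times> 'b) cat" where
  "pullback_cat D E F G = (prod_cat D E)\<lparr>
     Ob := {(x, y). x \<in> Ob D \<and> y \<in> Ob E \<and> fob F x = fob G y},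
     Ar := {(f, g). f \<in> Ar D \<and> g \<in> Ar E \<and> far F f = far G g}\<rparr>"

text \<open>Functors and families of components are taken extensional, so that equality in the
  functor category is equality of functions on the carriers.\<close>

definition fun_cat :: "('j, 'k) cat \<Rightarrow> ('o, 'a) cat \<Rightarrow>
    (('j, 'k, 'o, 'a) fctr,
     ('j, 'k, 'o, 'a) fctr \<times> ('j, 'k, 'o, 'a) fctr \<times> ('j \<Rightarrow> 'a)) cat" where
  "fun_cat J D = \<lparr>
     Ob = {F. is_functor J D F \<and> fob F \<in> extensional (Ob J) \<and> far F \<in> extensional (Ar J)},
     Ar = {(F, G, \<eta>).
            is_functor J D F \<and> fob F \<in> extensional (Ob J) \<and> far F \<in> extensional (Ar J) \<and>
            is_functor J D G \<and> fob G \<in> extensional (Ob J) \<and> far G \<in> extensional (Ar J) \<and>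
            \<eta> \<in> extensional (Ob J) \<and>
            (\<forall>j \<in> Ob J. arr D (\<eta> j) (fob F j) (fob G j)) \<and>
            (\<forall>\<phi> \<in> Ar J. far F \<phi> \<odot>\<^bsub>D\<^esub> \<eta> (Cd J \<phi>) = \<eta> (Dm J \<phi>) \<odot>\<^bsub>D\<^esub> far G \<phi>)},
     Dm = (\<lambda>(F, G, \<eta>). F),
     Cd = (\<lambda>(F, G, \<eta>). G),
     Idn = (\<lambda>F. (F, F, \<lambda>j \<in> Ob J. Idn D (fob F j))),
     Cmp = (\<lambda>(F, G, \<eta>) (F', G', \<eta>'). (F, G', \<lambda>j \<in> Ob J. \<eta> j \<odot>\<^bsub>D\<^esub> \<eta>' j))\<rparr>"

definition ord_cat :: "nat \<Rightarrow> (nat, nat \<times> nat) cat" where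
  "ord_cat k = \<lparr>
     Ob = {0..k},
     Ar = {(i, j). i \<le> j \<and> j \<le> k},
     Dm = fst,
     Cd = snd,
     Idn = (\<lambda>i. (i, i)),
     Cmp = (\<lambda>f g. (fst f, snd g))\<rparr>"

definition delta :: "nat list \<Rightarrow> (nat, nat \<times> nat, nat, nat \<times> nat) fctr" where
  "delta as = \<lparr>fob = (\<lambda>j. as ! j), far = (\<lambda>(i, j). (as ! i, as ! j))\<rparr>"

section \<open>Strict 2-categories\<close>

record ('o, 'm, 'c) two_cat =
  Cell0 :: "'o set"
  Cell1 :: "'m set"
  Cell2 :: "'c set"
  dom1 :: "'m \<Rightarrow> 'o"
  cod1 :: "'m \<Rightarrow> 'o"
  id1 :: "'o \<Rightarrow> 'm"
  comp1 :: "'m \<Rightarrow> 'm \<Rightarrow> 'm" (infixl "\<cdot>\<index>" 70)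
  dom2 :: "'c \<Rightarrow> 'm"
  cod2 :: "'c \<Rightarrow> 'm"
  id2 :: "'m \<Rightarrow> 'c"
  vcomp :: "'c \<Rightarrow> 'c \<Rightarrow> 'c" (infixl "\<bullet>\<index>" 65)
  hcomp :: "'c \<Rightarrow> 'c \<Rightarrow> 'c" (infixl "\<star>\<index>" 70)

definition under :: "('o, 'm, 'c) two_cat \<Rightarrow> ('o, 'm) cat" where
  "under C = \<lparr>Ob = Cell0 C, Ar = Cell1 C, Dm = dom1 C, Cd = cod1 C, Idn = id1 C, Cmp = comp1 C\<rparr>"

definition vert :: "('o, 'm, 'c) two_cat \<Rightarrow> ('m, 'c) cat" where
  "vert C = \<lparr>Ob = Cell1 C, Ar = Cell2 C, Dm = dom2 C, Cd = cod2 C, Idn = id2 C, Cmp = vcomp C\<rparr>"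

abbreviation mor :: "('o, 'm, 'c) two_cat \<Rightarrow> 'm \<Rightarrow> 'o \<Rightarrow> 'o \<Rightarrow> bool" where
  "mor C f X Y \<equiv> arr (under C) f X Y"

abbreviation cell :: "('o, 'm, 'c) two_cat \<Rightarrow> 'c \<Rightarrow> 'm \<Rightarrow> 'm \<Rightarrow> bool" where
  "cell C \<alpha> f g \<equiv> arr (vert C) \<alpha> f g"

definition Hom :: "('o, 'm, 'c) two_cat \<Rightarrow> 'o \<Rightarrow> 'o \<Rightarrow> ('m, 'c) cat" where
  "Hom C A B = (vert C)\<lparr>
     Ob := {f. mor C f A B},
     Ar := {\<alpha> \<in> Cell2 C. mor C (dom2 C \<alpha>) A B \<and> mor C (cod2 C \<alpha>) A B}\<rparr>"

definition hcomposable :: "('o, 'm, 'c) two_cat \<Rightarrow> 'c \<Rightarrow> 'c \<Rightarrow> bool" where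
  "hcomposable C \<alpha> \<beta> \<longleftrightarrow>
     \<alpha> \<in> Cell2 C \<and> \<beta> \<in> Cell2 C \<and> cod1 C (dom2 C \<alpha>) = dom1 C (dom2 C \<beta>)"

locale two_category =
  fixes C :: "('o, 'm, 'c) two_cat" (structure)
  assumes under_category: "category (under C)"
    and vert_category: "category (vert C)"
    and globular_dom: "\<alpha> \<in> Cell2 C \<Longrightarrow> dom1 C (dom2 C \<alpha>) = dom1 C (cod2 C \<alpha>)"
    and globular_cod: "\<alpha> \<in> Cell2 C \<Longrightarrow> cod1 C (dom2 C \<alpha>) = cod1 C (cod2 C \<alpha>)"
    and hcomp_cell: "hcomposable C \<alpha> \<beta> \<Longrightarrow>
      cell C (\<alpha> \<star> \<beta>) (dom2 C \<alpha> \<cdot> dom2 C \<beta>) (cod2 C \<alpha> \<cdot> cod2 C \<beta>)"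
    and hcomp_assoc: "hcomposable C \<alpha> \<beta> \<Longrightarrow> hcomposable C \<beta> \<gamma> \<Longrightarrow>
      (\<alpha> \<star> \<beta>) \<star> \<gamma> = \<alpha> \<star> (\<beta> \<star> \<gamma>)"
    and hcomp_id_left: "\<alpha> \<in> Cell2 C \<Longrightarrow> id2 C (id1 C (dom1 C (dom2 C \<alpha>))) \<star> \<alpha> = \<alpha>"
    and hcomp_id_right: "\<alpha> \<in> Cell2 C \<Longrightarrow> \<alpha> \<star> id2 C (id1 C (cod1 C (dom2 C \<alpha>))) = \<alpha>"
    and hcomp_id2: "mor C f X Y \<Longrightarrow> mor C g Y Z \<Longrightarrow> id2 C f \<star> id2 C g = id2 C (f \<cdot> g)"
    and interchange: "cell C \<alpha> f g \<Longrightarrow> cell C \<beta> g h \<Longrightarrow> cell C \<alpha>' f' g' \<Longrightarrow> cell C \<beta>' g' h' \<Longrightarrow>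
      cod1 C f = dom1 C f' \<Longrightarrow>
      (\<alpha> \<bullet> \<beta>) \<star> (\<alpha>' \<bullet> \<beta>') = (\<alpha> \<star> \<alpha>') \<bullet> (\<beta> \<star> \<beta>')"

definition lwhisk :: "('o, 'm, 'c) two_cat \<Rightarrow> 'm \<Rightarrow> 'c \<Rightarrow> 'c" (infixr "\<rhd>\<index>" 75) where
  "f \<rhd>\<^bsub>C\<^esub> \<alpha> = id2 C f \<star>\<^bsub>C\<^esub> \<alpha>"

definition rwhisk :: "('o, 'm, 'c) two_cat \<Rightarrow> 'c \<Rightarrow> 'm \<Rightarrow> 'c" (infixl "\<lhd>\<index>" 75) where
  "\<alpha> \<lhd>\<^bsub>C\<^esub> f = \<alpha> \<star>\<^bsub>C\<^esub> id2 C f"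

definition post :: "('o, 'm, 'c) two_cat \<Rightarrow> 'm \<Rightarrow> ('m, 'c, 'm, 'c) fctr" where
  "post C f = \<lparr>fob = (\<lambda>g. g \<cdot>\<^bsub>C\<^esub> f), far = (\<lambda>\<alpha>. \<alpha> \<lhd>\<^bsub>C\<^esub> f)\<rparr>"

definition full_sub :: "('o, 'm, 'c) two_cat \<Rightarrow> ('o \<Rightarrow> bool) \<Rightarrow> ('o, 'm, 'c) two_cat" where
  "full_sub C S = C\<lparr>
     Cell0 := {X \<in> Cell0 C. S X},
     Cell1 := {f \<in> Cell1 C. S (dom1 C f) \<and> S (cod1 C f)},
     Cell2 := {\<alpha> \<in> Cell2 C. S (dom1 C (dom2 C \<alpha>)) \<and> S (cod1 C (dom2 C \<alpha>))}\<rparr>"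

definition equivalent_in :: "('o, 'm, 'c) two_cat \<Rightarrow> 'o \<Rightarrow> 'o \<Rightarrow> bool" where
  "equivalent_in C X Y \<longleftrightarrow>
     (\<exists>f g \<eta> \<epsilon>. mor C f X Y \<and> mor C g Y X \<and>
        cell C \<eta> (id1 C X) (f \<cdot>\<^bsub>C\<^esub> g) \<and> iso_arrow (vert C) \<eta> \<and>
        cell C \<epsilon> (g \<cdot>\<^bsub>C\<^esub> f) (id1 C Y) \<and> iso_arrow (vert C) \<epsilon>)"

record ('o, 'm, 'c, 'p, 'n, 'd) two_fctr =
  T0 :: "'o \<Rightarrow> 'p"
  T1 :: "'m \<Rightarrow> 'n"
  T2 :: "'c \<Rightarrow> 'd"

definition two_functor ::
    "('o, 'm, 'c) two_cat \<Rightarrow> ('p, 'n, 'd) two_cat \<Rightarrow> ('o, 'm, 'c, 'p, 'n, 'd) two_fctr \<Rightarrow> bool" where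
  "two_functor C D T \<longleftrightarrow>
     two_category C \<and> two_category D \<and>
     is_functor (under C) (under D) \<lparr>fob = T0 T, far = T1 T\<rparr> \<and>
     is_functor (vert C) (vert D) \<lparr>fob = T1 T, far = T2 T\<rparr> \<and>
     (\<forall>\<alpha> \<beta>. hcomposable C \<alpha> \<beta> \<longrightarrow> T2 T (\<alpha> \<star>\<^bsub>C\<^esub> \<beta>) = T2 T \<alpha> \<star>\<^bsub>D\<^esub> T2 T \<beta>)"

definition strict_equivalence ::
    "('o, 'm, 'c) two_cat \<Rightarrow> ('p, 'n, 'd) two_cat \<Rightarrow> ('o, 'm, 'c, 'p, 'n, 'd) two_fctr \<Rightarrow> bool" where
  "strict_equivalence C D T \<longleftrightarrow>
     two_functor C D T \<and>
     (\<forall>K \<in> Cell0 D. \<exists>X \<in> Cell0 C. equivalent_in D K (T0 T X)) \<and>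
     (\<forall>X \<in> Cell0 C. \<forall>Y \<in> Cell0 C.
        cat_isomorphism (Hom C X Y) (Hom D (T0 T X) (T0 T Y)) \<lparr>fob = T1 T, far = T2 T\<rparr>)"

section \<open>Strict limits and pita 2-categories\<close>

definition isofibration :: "('o, 'm, 'c) two_cat \<Rightarrow> 'm \<Rightarrow> bool" where
  "isofibration C f \<longleftrightarrow> f \<in> Cell1 C \<and>
     (\<forall>A \<in> Cell0 C. isofibration_functor (Hom C A (dom1 C f)) (Hom C A (cod1 C f)) (post C f))"

definition DOF :: "('o, 'm, 'c) two_cat \<Rightarrow> 'm \<Rightarrow> bool" where
  "DOF C f \<longleftrightarrow> f \<in> Cell1 C \<and>
     (\<forall>A \<in> Cell0 C. DOF_functor (Hom C A (dom1 C f)) (Hom C A (cod1 C f)) (post C f))"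

definition strict_terminal :: "('o, 'm, 'c) two_cat \<Rightarrow> 'o \<Rightarrow> bool" where
  "strict_terminal C I \<longleftrightarrow> I \<in> Cell0 C \<and>
     (\<forall>A \<in> Cell0 C. (\<exists>!f. f \<in> Ob (Hom C A I)) \<and> (\<exists>!\<alpha>. \<alpha> \<in> Ar (Hom C A I)))"

definition pairing_functor :: "('o, 'm, 'c) two_cat \<Rightarrow> 'm \<Rightarrow> 'm \<Rightarrow> ('m, 'c, 'm \<times> 'm, 'c \<times> 'c) fctr" where
  "pairing_functor C p q =
     \<lparr>fob = (\<lambda>m. (m \<cdot>\<^bsub>C\<^esub> p, m \<cdot>\<^bsub>C\<^esub> q)), far = (\<lambda>\<alpha>. (\<alpha> \<lhd>\<^bsub>C\<^esub> p, \<alpha> \<lhd>\<^bsub>C\<^esub> q))\<rparr>"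

text \<open>The commutative square with legs \<open>p : P \<rightarrow> X\<close>, \<open>q : P \<rightarrow> Y\<close> over the cospan
  \<open>u : X \<rightarrow> Z\<close>, \<open>v : Y \<rightarrow> Z\<close>.\<close>

definition strict_pullback :: "('o, 'm, 'c) two_cat \<Rightarrow> 'm \<Rightarrow> 'm \<Rightarrow> 'm \<Rightarrow> 'm \<Rightarrow> bool" where
  "strict_pullback C p q u v \<longleftrightarrow>
     mor C p (dom1 C p) (dom1 C u) \<and> mor C q (dom1 C p) (dom1 C v) \<and>
     mor C u (dom1 C u) (cod1 C u) \<and> mor C v (dom1 C v) (cod1 C u) \<and>
     p \<cdot>\<^bsub>C\<^esub> u = q \<cdot>\<^bsub>C\<^esub> v \<and>
     (\<forall>B \<in> Cell0 C. cat_isomorphism (Hom C B (dom1 C p))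
        (pullback_cat (Hom C B (dom1 C u)) (Hom C B (dom1 C v)) (post C u) (post C v))
        (pairing_functor C p q))"

definition strict_product :: "('o, 'm, 'c) two_cat \<Rightarrow> 'm \<Rightarrow> 'm \<Rightarrow> bool" where
  "strict_product C p q \<longleftrightarrow>
     p \<in> Cell1 C \<and> q \<in> Cell1 C \<and> dom1 C p = dom1 C q \<and>
     (\<forall>B \<in> Cell0 C. cat_isomorphism (Hom C B (dom1 C p))
        (prod_cat (Hom C B (cod1 C p)) (Hom C B (cod1 C q))) (pairing_functor C p q))"

text \<open>The relation \<open>m = \<langle>a, b\<rangle>\<close> for the strict product with projections \<open>p\<close> and \<open>q\<close>.\<close>

definition is_pairing :: "('o, 'm, 'c) two_cat \<Rightarrow> 'm \<Rightarrow> 'm \<Rightarrow> 'm \<Rightarrow> 'm \<Rightarrow> 'm \<Rightarrow> bool" where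
  "is_pairing C p q a b m \<longleftrightarrow>
     strict_product C p q \<and> mor C a (dom1 C m) (cod1 C p) \<and> mor C b (dom1 C m) (cod1 C q) \<and>
     mor C m (dom1 C m) (dom1 C p) \<and> m \<cdot>\<^bsub>C\<^esub> p = a \<and> m \<cdot>\<^bsub>C\<^esub> q = b"

definition cotensor_functor :: "('o, 'm, 'c) two_cat \<Rightarrow> ('j, 'k) cat \<Rightarrow> ('j, 'k, 'm, 'c) fctr \<Rightarrow>
    ('m, 'c, ('j, 'k, 'm, 'c) fctr,
     ('j, 'k, 'm, 'c) fctr \<times> ('j, 'k, 'm, 'c) fctr \<times> ('j \<Rightarrow> 'c)) fctr" where
  "cotensor_functor C J ev =
     (let \<Phi> = (\<lambda>m. \<lparr>fob = (\<lambda>j \<in> Ob J. m \<cdot>\<^bsub>C\<^esub> fob ev j), far = (\<lambda>\<phi> \<in> Ar J. m \<rhd>\<^bsub>C\<^esub> far ev \<phi>)\<rparr>)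
      in \<lparr>fob = \<Phi>,
          far = (\<lambda>\<alpha>. (\<Phi> (dom2 C \<alpha>), \<Phi> (cod2 C \<alpha>), \<lambda>j \<in> Ob J. \<alpha> \<lhd>\<^bsub>C\<^esub> fob ev j))\<rparr>)"

definition strict_cotensor ::
    "('o, 'm, 'c) two_cat \<Rightarrow> ('j, 'k) cat \<Rightarrow> 'o \<Rightarrow> 'o \<Rightarrow> ('j, 'k, 'm, 'c) fctr \<Rightarrow> bool" where
  "strict_cotensor C J X P ev \<longleftrightarrow>
     X \<in> Cell0 C \<and> P \<in> Cell0 C \<and> is_functor J (Hom C P X) ev \<and>
     (\<forall>A \<in> Cell0 C.
        cat_isomorphism (Hom C A P) (fun_cat J (Hom C A X)) (cotensor_functor C J ev))"

text \<open>For a functor \<open>u : J \<rightarrow> J'\<close>, the induced \<open>X\<^sup>J\<^sup>' \<rightarrow> X\<^sup>J\<close>, where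
  \<open>(P, ev)\<close> and \<open>(P', ev')\<close> are the cotensors of \<open>X\<close> with \<open>J\<close> and \<open>J'\<close>.\<close>

definition cotensor_reindex :: "('o, 'm, 'c) two_cat \<Rightarrow> ('j, 'k) cat \<Rightarrow> ('j, 'k, 'l, 'h) fctr \<Rightarrow>
    'o \<Rightarrow> ('l, 'h, 'm, 'c) fctr \<Rightarrow> 'o \<Rightarrow> ('j, 'k, 'm, 'c) fctr \<Rightarrow> 'm" where
  "cotensor_reindex C J u P' ev' P ev =
     (THE m. mor C m P' P \<and>
        (\<forall>j \<in> Ob J. m \<cdot>\<^bsub>C\<^esub> fob ev j = fob ev' (fob u j)) \<and>
        (\<forall>\<phi> \<in> Ar J. m \<rhd>\<^bsub>C\<^esub> far ev \<phi> = far ev' (far u \<phi>)))"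

text \<open>For \<open>f : X \<rightarrow> Y\<close>, the induced \<open>X\<^sup>J \<rightarrow> Y\<^sup>J\<close>, where \<open>(P, ev)\<close> and \<open>(Q, ew)\<close> are
  the cotensors of \<open>X\<close> and \<open>Y\<close> with \<open>J\<close>.\<close>

definition cotensor_map :: "('o, 'm, 'c) two_cat \<Rightarrow> ('j, 'k) cat \<Rightarrow> 'm \<Rightarrow>
    'o \<Rightarrow> ('j, 'k, 'm, 'c) fctr \<Rightarrow> 'o \<Rightarrow> ('j, 'k, 'm, 'c) fctr \<Rightarrow> 'm" where
  "cotensor_map C J f P ev Q ew =
     (THE m. mor C m P Q \<and>
        (\<forall>j \<in> Ob J. m \<cdot>\<^bsub>C\<^esub> fob ew j = fob ev j \<cdot>\<^bsub>C\<^esub> f) \<and>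
        (\<forall>\<phi> \<in> Ar J. m \<rhd>\<^bsub>C\<^esub> far ew \<phi> = far ev \<phi> \<lhd>\<^bsub>C\<^esub> f))"

text \<open>An object \<open>X\<close>, regarded as its own cotensor with \<open>[0]\<close>.\<close>

definition ev_point :: "('o, 'm, 'c) two_cat \<Rightarrow> 'o \<Rightarrow> (nat, nat \<times> nat, 'm, 'c) fctr" where
  "ev_point C X = \<lparr>fob = (\<lambda>_. id1 C X), far = (\<lambda>_. id2 C (id1 C X))\<rparr>"

text \<open>An arrow object is a cotensor with \<open>[1]\<close>; its universal 2-cell is the value of the
  evaluation functor at \<open>0 < 1\<close>.\<close>

abbreviation arrow_object ::
    "('o, 'm, 'c) two_cat \<Rightarrow> 'o \<Rightarrow> 'o \<Rightarrow> (nat, nat \<times> nat, 'm, 'c) fctr \<Rightarrow> bool" where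
  "arrow_object C X P ev \<equiv> strict_cotensor C (ord_cat 1) X P ev"

abbreviation bdry :: "(nat, nat \<times> nat, 'm, 'c) fctr \<Rightarrow> 'c" where
  "bdry ev \<equiv> far ev (0, 1)"

definition pita :: "('o, 'm, 'c) two_cat \<Rightarrow> bool" where
  "pita C \<longleftrightarrow>
     (\<exists>I. strict_terminal C I) \<and>
     (\<forall>X \<in> Cell0 C. \<exists>P ev. arrow_object C X P ev) \<and>
     (\<forall>u \<in> Cell1 C. \<forall>v \<in> Cell1 C. cod1 C u = cod1 C v \<and> isofibration C u \<longrightarrow>
        (\<exists>p q. strict_pullback C p q u v))"

section \<open>Groupoids and cores\<close>

definition groupoid_object :: "('o, 'm, 'c) two_cat \<Rightarrow> 'o \<Rightarrow> bool" where
  "groupoid_object C X \<longleftrightarrow> X \<in> Cell0 C \<and> (\<forall>A \<in> Cell0 C. groupoid_cat (Hom C A X))"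

definition arrow_wise_iso :: "('o, 'm, 'c) two_cat \<Rightarrow> 'm \<Rightarrow> bool" where
  "arrow_wise_iso C f \<longleftrightarrow> f \<in> Cell1 C \<and>
     (\<forall>\<alpha> \<in> Cell2 C. cod1 C (dom2 C \<alpha>) = dom1 C f \<longrightarrow> iso_arrow (vert C) (\<alpha> \<lhd>\<^bsub>C\<^esub> f))"

definition core_cat :: "('o, 'm, 'c) two_cat \<Rightarrow> 'o \<Rightarrow> 'o \<Rightarrow> ('m, 'c) cat" where
  "core_cat C A X = (Hom C A X)\<lparr>
     Ob := {f \<in> Ob (Hom C A X). arrow_wise_iso C f},
     Ar := {\<alpha> \<in> Ar (Hom C A X). iso_arrow (vert C) \<alpha> \<and>
              arrow_wise_iso C (dom2 C \<alpha>) \<and> arrow_wise_iso C (cod2 C \<alpha>)}\<rparr>"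

definition is_core :: "('o, 'm, 'c) two_cat \<Rightarrow> 'o \<Rightarrow> 'm \<Rightarrow> bool" where
  "is_core C X i \<longleftrightarrow>
     mor C i (dom1 C i) X \<and> arrow_wise_iso C i \<and>
     (\<forall>A \<in> Cell0 C. cat_isomorphism (Hom C A (dom1 C i)) (core_cat C A X) (post C i))"

text \<open>The induced morphism between the cores \<open>i\<close> and \<open>j\<close> of the domain and codomain of \<open>f\<close>.\<close>

definition core_map :: "('o, 'm, 'c) two_cat \<Rightarrow> 'm \<Rightarrow> 'm \<Rightarrow> 'm \<Rightarrow> 'm" where
  "core_map C i j f = (THE m. mor C m (dom1 C i) (dom1 C j) \<and> m \<cdot>\<^bsub>C\<^esub> j = i \<cdot>\<^bsub>C\<^esub> f)"

section \<open>Internal categories\<close>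

definition is_pullback :: "('o, 'm) cat \<Rightarrow> 'm \<Rightarrow> 'm \<Rightarrow> 'm \<Rightarrow> 'm \<Rightarrow> bool" where
  "is_pullback D p q u v \<longleftrightarrow>
     arr D p (Dm D p) (Dm D u) \<and> arr D q (Dm D p) (Dm D v) \<and>
     arr D u (Dm D u) (Cd D u) \<and> arr D v (Dm D v) (Cd D u) \<and>
     p \<odot>\<^bsub>D\<^esub> u = q \<odot>\<^bsub>D\<^esub> v \<and>
     (\<forall>A a b. arr D a A (Dm D u) \<and> arr D b A (Dm D v) \<and> a \<odot>\<^bsub>D\<^esub> u = b \<odot>\<^bsub>D\<^esub> v \<longrightarrow>
        (\<exists>!m. arr D m A (Dm D p) \<and> m \<odot>\<^bsub>D\<^esub> p = a \<and> m \<odot>\<^bsub>D\<^esub> q = b))"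

record ('o, 'm) icat =
  C0 :: 'o
  C1 :: 'o
  C2 :: 'o
  pi0 :: 'm
  pi1 :: 'm
  ie :: 'm
  pi01 :: 'm
  pi12 :: 'm
  pi02 :: 'm

text \<open>The composite of generalized elements \<open>a, b : A \<rightarrow> C\<^sub>1\<close>, i.e. \<open>\<langle>a, b\<rangle> \<pi>\<^sub>0\<^sub>2\<close>.\<close>

definition icomp :: "('o, 'm) cat \<Rightarrow> ('o, 'm) icat \<Rightarrow> 'm \<Rightarrow> 'm \<Rightarrow> 'm" where
  "icomp D K a b =
     (THE m. arr D m (Dm D a) (C2 K) \<and> m \<odot>\<^bsub>D\<^esub> pi01 K = a \<and> m \<odot>\<^bsub>D\<^esub> pi12 K = b) \<odot>\<^bsub>D\<^esub> pi02 K"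

definition internal_category :: "('o, 'm) cat \<Rightarrow> ('o, 'm) icat \<Rightarrow> bool" where
  "internal_category D K \<longleftrightarrow>
     C0 K \<in> Ob D \<and> C1 K \<in> Ob D \<and> C2 K \<in> Ob D \<and>
     arr D (pi0 K) (C1 K) (C0 K) \<and> arr D (pi1 K) (C1 K) (C0 K) \<and> arr D (ie K) (C0 K) (C1 K) \<and>
     arr D (pi01 K) (C2 K) (C1 K) \<and> arr D (pi12 K) (C2 K) (C1 K) \<and> arr D (pi02 K) (C2 K) (C1 K) \<and>
     is_pullback D (pi01 K) (pi12 K) (pi1 K) (pi0 K) \<and>
     ie K \<odot>\<^bsub>D\<^esub> pi0 K = Idn D (C0 K) \<and> ie K \<odot>\<^bsub>D\<^esub> pi1 K = Idn D (C0 K) \<and>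
     pi02 K \<odot>\<^bsub>D\<^esub> pi0 K = pi01 K \<odot>\<^bsub>D\<^esub> pi0 K \<and> pi02 K \<odot>\<^bsub>D\<^esub> pi1 K = pi12 K \<odot>\<^bsub>D\<^esub> pi1 K \<and>
     icomp D K (pi0 K \<odot>\<^bsub>D\<^esub> ie K) (Idn D (C1 K)) = Idn D (C1 K) \<and>
     icomp D K (Idn D (C1 K)) (pi1 K \<odot>\<^bsub>D\<^esub> ie K) = Idn D (C1 K) \<and>
     (\<forall>A a b c. arr D a A (C1 K) \<and> arr D b A (C1 K) \<and> arr D c A (C1 K) \<and>
        a \<odot>\<^bsub>D\<^esub> pi1 K = b \<odot>\<^bsub>D\<^esub> pi0 K \<and> b \<odot>\<^bsub>D\<^esub> pi1 K = c \<odot>\<^bsub>D\<^esub> pi0 K \<longrightarrow>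
        icomp D K (icomp D K a b) c = icomp D K a (icomp D K b c))"

record ('o, 'm) ifun =
  fsrc :: "('o, 'm) icat"
  ftrg :: "('o, 'm) icat"
  F0 :: 'm
  F1 :: 'm
  F2 :: 'm

definition internal_functor :: "('o, 'm) cat \<Rightarrow> ('o, 'm) ifun \<Rightarrow> bool" where
  "internal_functor D F \<longleftrightarrow>
     (let K = fsrc F; L = ftrg F in
      internal_category D K \<and> internal_category D L \<and>
      arr D (F0 F) (C0 K) (C0 L) \<and> arr D (F1 F) (C1 K) (C1 L) \<and> arr D (F2 F) (C2 K) (C2 L) \<and>
      F1 F \<odot>\<^bsub>D\<^esub> pi0 L = pi0 K \<odot>\<^bsub>D\<^esub> F0 F \<and>
      F1 F \<odot>\<^bsub>D\<^esub> pi1 L = pi1 K \<odot>\<^bsub>D\<^esub> F0 F \<and>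
      ie K \<odot>\<^bsub>D\<^esub> F1 F = F0 F \<odot>\<^bsub>D\<^esub> ie L \<and>
      F2 F \<odot>\<^bsub>D\<^esub> pi01 L = pi01 K \<odot>\<^bsub>D\<^esub> F1 F \<and>
      F2 F \<odot>\<^bsub>D\<^esub> pi12 L = pi12 K \<odot>\<^bsub>D\<^esub> F1 F \<and>
      F2 F \<odot>\<^bsub>D\<^esub> pi02 L = pi02 K \<odot>\<^bsub>D\<^esub> F1 F)"

record ('o, 'm) inat =
  nsrc :: "('o, 'm) ifun"
  ntrg :: "('o, 'm) ifun"
  ncomp :: 'm

definition internal_nat :: "('o, 'm) cat \<Rightarrow> ('o, 'm) inat \<Rightarrow> bool" where
  "internal_nat D \<alpha> \<longleftrightarrow>
     (let F = nsrc \<alpha>; G = ntrg \<alpha>; K = fsrc F; L = ftrg F in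
      internal_functor D F \<and> internal_functor D G \<and> fsrc G = K \<and> ftrg G = L \<and>
      arr D (ncomp \<alpha>) (C0 K) (C1 L) \<and>
      ncomp \<alpha> \<odot>\<^bsub>D\<^esub> pi0 L = F0 F \<and> ncomp \<alpha> \<odot>\<^bsub>D\<^esub> pi1 L = F0 G \<and>
      icomp D L (F1 F) (pi1 K \<odot>\<^bsub>D\<^esub> ncomp \<alpha>) = icomp D L (pi0 K \<odot>\<^bsub>D\<^esub> ncomp \<alpha>) (F1 G))"

definition IntCat :: "('o, 'm) cat \<Rightarrow>
    (('o, 'm) icat, ('o, 'm) ifun, ('o, 'm) inat) two_cat" where
  "IntCat D = \<lparr>
     Cell0 = {K. internal_category D K},
     Cell1 = {F. internal_functor D F},
     Cell2 = {\<alpha>. internal_nat D \<alpha>},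
     dom1 = fsrc,
     cod1 = ftrg,
     id1 = (\<lambda>K. \<lparr>fsrc = K, ftrg = K, F0 = Idn D (C0 K), F1 = Idn D (C1 K), F2 = Idn D (C2 K)\<rparr>),
     comp1 = (\<lambda>F G. \<lparr>fsrc = fsrc F, ftrg = ftrg G,
        F0 = F0 F \<odot>\<^bsub>D\<^esub> F0 G, F1 = F1 F \<odot>\<^bsub>D\<^esub> F1 G, F2 = F2 F \<odot>\<^bsub>D\<^esub> F2 G\<rparr>),
     dom2 = nsrc,
     cod2 = ntrg,
     id2 = (\<lambda>F. \<lparr>nsrc = F, ntrg = F, ncomp = F0 F \<odot>\<^bsub>D\<^esub> ie (ftrg F)\<rparr>),
     vcomp = (\<lambda>\<alpha> \<beta>. \<lparr>nsrc = nsrc \<alpha>, ntrg = ntrg \<beta>,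
        ncomp = icomp D (ftrg (nsrc \<alpha>)) (ncomp \<alpha>) (ncomp \<beta>)\<rparr>),
     hcomp = (\<lambda>\<alpha> \<beta>.
        let F = nsrc \<alpha>; G = ntrg \<alpha>; H = nsrc \<beta>; K = ntrg \<beta> in
        \<lparr>nsrc = \<lparr>fsrc = fsrc F, ftrg = ftrg H,
                F0 = F0 F \<odot>\<^bsub>D\<^esub> F0 H, F1 = F1 F \<odot>\<^bsub>D\<^esub> F1 H, F2 = F2 F \<odot>\<^bsub>D\<^esub> F2 H\<rparr>,
         ntrg = \<lparr>fsrc = fsrc G, ftrg = ftrg K,
                F0 = F0 G \<odot>\<^bsub>D\<^esub> F0 K, F1 = F1 G \<odot>\<^bsub>D\<^esub> F1 K, F2 = F2 G \<odot>\<^bsub>D\<^esub> F2 K\<rparr>,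
         ncomp = icomp D (ftrg H) (ncomp \<alpha> \<odot>\<^bsub>D\<^esub> F1 H) (F0 G \<odot>\<^bsub>D\<^esub> ncomp \<beta>)\<rparr>)\<rparr>"

section \<open>Congruences\<close>

definition internal_double_category :: "('o, 'm, 'c) two_cat \<Rightarrow> ('o, 'm) icat \<Rightarrow> bool" where
  "internal_double_category C K \<longleftrightarrow>
     internal_category (under C) K \<and>
     (\<exists>p q m. cod1 C p = C0 K \<and> cod1 C q = C0 K \<and>
        is_pairing C p q (pi0 K) (pi1 K) m \<and> isofibration C m)"

definition gbo_congruence :: "('o, 'm, 'c) two_cat \<Rightarrow> ('o, 'm) icat \<Rightarrow> bool" where
  "gbo_congruence C K \<longleftrightarrow>
     internal_double_category C K \<and>
     groupoid_object C (C0 K) \<and> groupoid_object C (C1 K) \<and> groupoid_object C (C2 K) \<and>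
     (\<exists>p q m. cod1 C p = C0 K \<and> cod1 C q = C0 K \<and>
        is_pairing C p q (pi0 K) (pi1 K) m \<and> DOF C m)"

text \<open>Here \<open>(P, ev)\<close> is an arrow object of \<open>C\<^sub>0\<close>. The equation for the 2-cell \<open>\<rho>\<close> after
  \<open>\<langle>\<pi>\<^sub>0, \<pi>\<^sub>1\<rangle>\<close> is written out in its two components.\<close>

definition is_reflection :: "('o, 'm, 'c) two_cat \<Rightarrow> ('o, 'm) icat \<Rightarrow>
    'o \<Rightarrow> (nat, nat \<times> nat, 'm, 'c) fctr \<Rightarrow> 'm \<Rightarrow> bool" where
  "is_reflection C K P ev r \<longleftrightarrow>
     mor C r P (C1 K) \<and>
     (\<exists>\<rho>. cell C \<rho> r (fob ev 1 \<cdot>\<^bsub>C\<^esub> ie K) \<and>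
        \<rho> \<lhd>\<^bsub>C\<^esub> pi0 K = bdry ev \<and> \<rho> \<lhd>\<^bsub>C\<^esub> pi1 K = id2 C (fob ev 1))"

text \<open>Below, \<open>s, t : C\<^sub>3 \<rightarrow> C\<^sub>2\<close> project a composable triple to its first and last two arrows,
  \<open>p\<^sub>0, p\<^sub>1\<close> and \<open>q\<^sub>0, q\<^sub>1\<close> are the projections of \<open>C\<^sub>0 \<times> C\<^sub>0\<close> and \<open>C\<^sub>1 \<times> C\<^sub>1\<close>,
  and the square has the sides \<open>top = \<langle>r, \<tau>r, r\<rangle>\<close>, \<open>left = \<langle>\<partial>\<^sub>0, \<partial>\<^sub>1\<rangle>\<close>,
  \<open>right = \<langle>\<pi>\<^sub>0\<^sub>2, \<pi>\<^sub>1\<^sub>3\<rangle>\<close> and \<open>bot = e \<times> e\<close>. All of these are determined up to isomorphism.\<close>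

definition complete_congruence :: "('o, 'm, 'c) two_cat \<Rightarrow> ('o, 'm) icat \<Rightarrow> bool" where
  "complete_congruence C K \<longleftrightarrow>
     gbo_congruence C K \<and>
     (\<exists>P ev r \<tau> s t p\<^sub>0 p\<^sub>1 q\<^sub>0 q\<^sub>1 top left right bot.
        arrow_object C (C0 K) P ev \<and>
        is_reflection C K P ev r \<and>
        mor C \<tau> P P \<and> inverse_arrows (vert C) (bdry ev) (\<tau> \<rhd>\<^bsub>C\<^esub> bdry ev) \<and>
        is_pullback (under C) s t (pi12 K) (pi01 K) \<and>
        mor C top P (dom1 C s) \<and>
        (top \<cdot>\<^bsub>C\<^esub> s) \<cdot>\<^bsub>C\<^esub> pi01 K = r \<and>
        (top \<cdot>\<^bsub>C\<^esub> s) \<cdot>\<^bsub>C\<^esub> pi12 K = \<tau> \<cdot>\<^bsub>C\<^esub> r \<and>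
        (top \<cdot>\<^bsub>C\<^esub> t) \<cdot>\<^bsub>C\<^esub> pi12 K = r \<and>
        cod1 C p\<^sub>0 = C0 K \<and> cod1 C p\<^sub>1 = C0 K \<and> cod1 C q\<^sub>0 = C1 K \<and> cod1 C q\<^sub>1 = C1 K \<and>
        is_pairing C p\<^sub>0 p\<^sub>1 (fob ev 0) (fob ev 1) left \<and>
        is_pairing C q\<^sub>0 q\<^sub>1 (s \<cdot>\<^bsub>C\<^esub> pi02 K) (t \<cdot>\<^bsub>C\<^esub> pi02 K) right \<and>
        is_pairing C q\<^sub>0 q\<^sub>1 (p\<^sub>0 \<cdot>\<^bsub>C\<^esub> ie K) (p\<^sub>1 \<cdot>\<^bsub>C\<^esub> ie K) bot \<and>
        strict_pullback C top left right bot)"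

definition Cong :: "('o, 'm, 'c) two_cat \<Rightarrow>
    (('o, 'm) icat, ('o, 'm) ifun, ('o, 'm) inat) two_cat" where
  "Cong C = full_sub (IntCat (under C)) (complete_congruence C)"

section \<open>Nerves and quotients\<close>

text \<open>The choices entering a nerve of \<open>X\<close>: the cotensors \<open>X\<^sup>[\<^sup>1\<^sup>]\<close>, \<open>X\<^sup>[\<^sup>2\<^sup>]\<close> with their evaluation
  functors, and core inclusions of \<open>X\<close>, \<open>X\<^sup>[\<^sup>1\<^sup>]\<close>, \<open>X\<^sup>[\<^sup>2\<^sup>]\<close>.\<close>

record ('o, 'm, 'c) nerve_data =
  cot1 :: 'o
  ev1 :: "(nat, nat \<times> nat, 'm, 'c) fctr"
  cot2 :: 'o
  ev2 :: "(nat, nat \<times> nat, 'm, 'c) fctr"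
  core0 :: 'm
  core1 :: 'm
  core2 :: 'm

definition is_nerve_data :: "('o, 'm, 'c) two_cat \<Rightarrow> 'o \<Rightarrow> ('o, 'm, 'c) nerve_data \<Rightarrow> bool" where
  "is_nerve_data C X N \<longleftrightarrow>
     strict_cotensor C (ord_cat 1) X (cot1 N) (ev1 N) \<and>
     strict_cotensor C (ord_cat 2) X (cot2 N) (ev2 N) \<and>
     is_core C X (core0 N) \<and> is_core C (cot1 N) (core1 N) \<and> is_core C (cot2 N) (core2 N)"

definition nerve :: "('o, 'm, 'c) two_cat \<Rightarrow> 'o \<Rightarrow> ('o, 'm, 'c) nerve_data \<Rightarrow> ('o, 'm) icat" where
  "nerve C X N =
     (let d0 = (\<lambda>j. cotensor_reindex C (ord_cat 0) (delta [j]) (cot1 N) (ev1 N) X (ev_point C X));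
          d00 = cotensor_reindex C (ord_cat 1) (delta [0, 0]) X (ev_point C X) (cot1 N) (ev1 N);
          d = (\<lambda>j k. cotensor_reindex C (ord_cat 1) (delta [j, k])
                       (cot2 N) (ev2 N) (cot1 N) (ev1 N))
      in \<lparr>C0 = dom1 C (core0 N), C1 = dom1 C (core1 N), C2 = dom1 C (core2 N),
          pi0 = core_map C (core1 N) (core0 N) (d0 0),
          pi1 = core_map C (core1 N) (core0 N) (d0 1),
          ie = core_map C (core0 N) (core1 N) d00,
          pi01 = core_map C (core2 N) (core1 N) (d 0 1),
          pi12 = core_map C (core2 N) (core1 N) (d 1 2),
          pi02 = core_map C (core2 N) (core1 N) (d 0 2)\<rparr>)"

definition is_cocone ::
    "('o, 'm, 'c) two_cat \<Rightarrow> ('o, 'm) icat \<Rightarrow> 'o \<Rightarrow> 'm \<times> 'c \<Rightarrow> bool" where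
  "is_cocone C K Y = (\<lambda>(\<gamma>, \<gamma>\<^sub>0\<^sub>1).
     mor C \<gamma> (C0 K) Y \<and> cell C \<gamma>\<^sub>0\<^sub>1 (pi0 K \<cdot>\<^bsub>C\<^esub> \<gamma>) (pi1 K \<cdot>\<^bsub>C\<^esub> \<gamma>) \<and>
     ie K \<rhd>\<^bsub>C\<^esub> \<gamma>\<^sub>0\<^sub>1 = id2 C \<gamma> \<and>
     pi02 K \<rhd>\<^bsub>C\<^esub> \<gamma>\<^sub>0\<^sub>1 = (pi01 K \<rhd>\<^bsub>C\<^esub> \<gamma>\<^sub>0\<^sub>1) \<bullet>\<^bsub>C\<^esub> (pi12 K \<rhd>\<^bsub>C\<^esub> \<gamma>\<^sub>0\<^sub>1))"

definition cocone_cat :: "('o, 'm, 'c) two_cat \<Rightarrow> ('o, 'm) icat \<Rightarrow> 'o \<Rightarrow>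
    ('m \<times> 'c, ('m \<times> 'c) \<times> ('m \<times> 'c) \<times> 'c) cat" where
  "cocone_cat C K Y = \<lparr>
     Ob = {g. is_cocone C K Y g},
     Ar = {(g, g', \<alpha>). is_cocone C K Y g \<and> is_cocone C K Y g' \<and> cell C \<alpha> (fst g) (fst g') \<and>
             (pi0 K \<rhd>\<^bsub>C\<^esub> \<alpha>) \<bullet>\<^bsub>C\<^esub> snd g' = snd g \<bullet>\<^bsub>C\<^esub> (pi1 K \<rhd>\<^bsub>C\<^esub> \<alpha>)},
     Dm = (\<lambda>(g, g', \<alpha>). g),
     Cd = (\<lambda>(g, g', \<alpha>). g'),
     Idn = (\<lambda>g. (g, g, id2 C (fst g))),
     Cmp = (\<lambda>(g, g', \<alpha>) (h, h', \<beta>). (g, h', \<alpha> \<bullet>\<^bsub>C\<^esub> \<beta>))\<rparr>"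

definition strict_quotient ::
    "('o, 'm, 'c) two_cat \<Rightarrow> ('o, 'm) icat \<Rightarrow> 'o \<Rightarrow> 'm \<times> 'c \<Rightarrow> bool" where
  "strict_quotient C K X g \<longleftrightarrow>
     X \<in> Cell0 C \<and> is_cocone C K X g \<and>
     (\<forall>Y \<in> Cell0 C. cat_isomorphism (Hom C X Y) (cocone_cat C K Y)
        (let \<Phi> = (\<lambda>f. (fst g \<cdot>\<^bsub>C\<^esub> f, snd g \<lhd>\<^bsub>C\<^esub> f))
         in \<lparr>fob = \<Phi>, far = (\<lambda>\<alpha>. (\<Phi> (dom2 C \<alpha>), \<Phi> (cod2 C \<alpha>), fst g \<rhd>\<^bsub>C\<^esub> \<alpha>))\<rparr>))"

definition tautological_cocone ::
    "('o, 'm, 'c) two_cat \<Rightarrow> ('o, 'm, 'c) nerve_data \<Rightarrow> 'm \<times> 'c" where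
  "tautological_cocone C N = (core0 N, core1 N \<rhd>\<^bsub>C\<^esub> bdry (ev1 N))"

definition groupoidant :: "('o, 'm, 'c) two_cat \<Rightarrow> bool" where
  "groupoidant C \<longleftrightarrow>
     pita C \<and>
     (\<forall>X \<in> Cell0 C. \<exists>i. is_core C X i) \<and>
     (\<forall>K. complete_congruence C K \<longrightarrow>
        (\<exists>X \<in> Cell0 C. \<exists>N. is_nerve_data C X N \<and> K = nerve C X N)) \<and>
     (\<forall>X \<in> Cell0 C. \<forall>N. is_nerve_data C X N \<longrightarrow>
        strict_quotient C (nerve C X N) X (tautological_cocone C N))"

section \<open>The 2-functor \<open>Nv\<close>\<close>

definition nerve_choice :: "('o, 'm, 'c) two_cat \<Rightarrow> ('o \<Rightarrow> ('o, 'm, 'c) nerve_data) \<Rightarrow> bool" where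
  "nerve_choice C \<nu> \<longleftrightarrow> (\<forall>X \<in> Cell0 C. is_nerve_data C X (\<nu> X))"

definition Nv1 :: "('o, 'm, 'c) two_cat \<Rightarrow> ('o \<Rightarrow> ('o, 'm, 'c) nerve_data) \<Rightarrow> 'm \<Rightarrow> ('o, 'm) ifun" where
  "Nv1 C \<nu> f =
     (let X = dom1 C f; Y = cod1 C f; N = \<nu> X; M = \<nu> Y
      in \<lparr>fsrc = nerve C X N, ftrg = nerve C Y M,
          F0 = core_map C (core0 N) (core0 M) f,
          F1 = core_map C (core1 N) (core1 M)
                 (cotensor_map C (ord_cat 1) f (cot1 N) (ev1 N) (cot1 M) (ev1 M)),
          F2 = core_map C (core2 N) (core2 M)
                 (cotensor_map C (ord_cat 2) f (cot2 N) (ev2 N) (cot2 M) (ev2 M))\<rparr>)"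

definition Nv2 :: "('o, 'm, 'c) two_cat \<Rightarrow> ('o \<Rightarrow> ('o, 'm, 'c) nerve_data) \<Rightarrow> 'c \<Rightarrow> ('o, 'm) inat" where
  "Nv2 C \<nu> \<alpha> =
     (let N = \<nu> (dom1 C (dom2 C \<alpha>)); M = \<nu> (cod1 C (dom2 C \<alpha>))
      in \<lparr>nsrc = Nv1 C \<nu> (dom2 C \<alpha>), ntrg = Nv1 C \<nu> (cod2 C \<alpha>),
          ncomp = (THE m. mor C m (dom1 C (core0 N)) (dom1 C (core1 M)) \<and>
                     (m \<cdot>\<^bsub>C\<^esub> core1 M) \<rhd>\<^bsub>C\<^esub> bdry (ev1 M) = core0 N \<rhd>\<^bsub>C\<^esub> \<alpha>)\<rparr>)"

definition Nv :: "('o, 'm, 'c) two_cat \<Rightarrow> ('o \<Rightarrow> ('o, 'm, 'c) nerve_data) \<Rightarrow>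
    ('o, 'm, 'c, ('o, 'm) icat, ('o, 'm) ifun, ('o, 'm) inat) two_fctr" where
  "Nv C \<nu> = \<lparr>T0 = (\<lambda>X. nerve C X (\<nu> X)), T1 = Nv1 C \<nu>, T2 = Nv2 C \<nu>\<rparr>"

end

theory Submission
  imports Defs
begin

text \<open>For every \<open>A\<close>, the category \<open>|C|(A, Nv X)\<close> is the full subcategory of \<open>C(A, X)\<close> on
  the arrow-wise isos: morphisms \<open>A \<rightarrow> X\<^sup>i\<^sup>s\<^sup>o\<close> are arrow-wise isos, and morphisms
  \<open>A \<rightarrow> (X\<^sup>\<rightarrow>)\<^sup>i\<^sup>s\<^sup>o\<close> are the 2-cells between them. Everything about nerves is checked on these
  generalized elements. In particular a nerve is a complete congruence, because three composable
  2-cells whose two binary composites are identities amount to one invertible 2-cell, that is, to a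
  morphism into \<open>(X\<^sup>i\<^sup>s\<^sup>o)\<^sup>\<rightarrow>\<close>.

  The objects of a congruence are groupoids, so all morphisms out of them are arrow-wise isos. Hence
  internal functors \<open>K \<rightarrow> Nv Y\<close> from a congruence are the same as cocones under \<open>K\<close> with vertex \<open>Y\<close>,
  and internal transformations are the same as morphisms of cocones. For \<open>K = Nv X\<close> these are the
  morphisms and 2-cells \<open>X \<rightarrow> Y\<close>, because \<open>X\<close> is the quotient of its nerve. A complete congruence is
  the nerve of some \<open>X\<close> for some choice of cores and cotensors, and the tautological cocones compare
  the nerves for two choices.\<close>

section \<open>Categories\<close>

text \<open>Two demands are hidden in the conclusion: a strict equivalence presupposes that
  \<open>Cong C\<close> is a 2-category and that nerves lie in it. The first holds for internal
  categories in any 1-category and rests on \<open>icomp\<close> being stable under precomposition,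
  so that internal arrows can be composed like ordinary ones. For the second, a pita 2-category only
  offers a terminal object, arrow objects and pullbacks along isofibrations. Hence
  \<open>X^[2]\<close>, binary products and the object of composable triples are built by hand, each
  time after one leg of the cospan has been shown to be an isofibration. Structure maps of nerves
  and components of \<open>Nv\<close> are defined by unique existence and are never computed.
  Instead, morphisms into \<open>C0 K\<close> are compared after \<open>i\<close>, morphisms into
  \<open>C1 K\<close> after whiskering \<open>\<theta>\<close>, and morphisms into
  \<open>C2 K\<close> by their two projections; these three injectivity statements carry almost all
  equations, including the comparison of different choices of cores and cotensors.\<close>

context category
begin

text \<open>The axioms are typed by \<open>arr\<close>. With membership and the two endpoint
  equations as separate rules the simplifier can infer the type of a composite from its factors; the
  2-categorical and internal calculi below follow the same pattern.\<close>

lemma ar_closed [simp]: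
  "f \<in> Ar D \<Longrightarrow> Dm D f \<in> Ob D" "f \<in> Ar D \<Longrightarrow> Cd D f \<in> Ob D"
  "x \<in> Ob D \<Longrightarrow> Idn D x \<in> Ar D" "x \<in> Ob D \<Longrightarrow> Dm D (Idn D x) = x"
  "x \<in> Ob D \<Longrightarrow> Cd D (Idn D x) = x"
  using Dm_in Cd_in Idn_arr by (auto simp: arr_def)

lemma cmp_closed [simp]:
  assumes "f \<in> Ar D" "g \<in> Ar D" "Cd D f = Dm D g"
  shows "f \<odot> g \<in> Ar D" "Dm D (f \<odot> g) = Dm D f" "Cd D (f \<odot> g) = Cd D g"
  using Cmp_arr[of f "Dm D f" "Cd D f" g "Cd D g"] assms by (auto simp: arr_def)

lemma cmp_id_left [simp]: "f \<in> Ar D \<Longrightarrow> Dm D f = x \<Longrightarrow> Idn D x \<odot> f = f"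
  and cmp_id_right [simp]: "f \<in> Ar D \<Longrightarrow> Cd D f = x \<Longrightarrow> f \<odot> Idn D x = f"
  using Idn_left Idn_right by (auto simp: arr_def)

lemma cmp_assoc [simp]:
  "f \<in> Ar D \<Longrightarrow> g \<in> Ar D \<Longrightarrow> h \<in> Ar D \<Longrightarrow> Cd D f = Dm D g \<Longrightarrow> Cd D g = Dm D h \<Longrightarrow>
    (f \<odot> g) \<odot> h = f \<odot> (g \<odot> h)"
  using Cmp_assoc by (auto simp: arr_def)

lemma inverse_arrows_unique:
  assumes "inverse_arrows D f g" "inverse_arrows D f h"
  shows "g = h"
proof -
  have "g = g \<odot> (f \<odot> h)" using assms by (auto simp: inverse_arrows_def arr_def)
  also have "\<dots> = (g \<odot> f) \<odot> h" using assms by (subst cmp_assoc) (auto simp: inverse_arrows_def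
    arr_def)
  also have "\<dots> = h" using assms by (auto simp: inverse_arrows_def arr_def)
  finally show ?thesis .
qed

end

text \<open>Bijectivity on arrows is reduced to fixed endpoints. This is enough because injectivity
  on objects recovers the endpoints of an arrow from those of its image.\<close>

lemma cat_isomorphismI:
  assumes "is_functor D E F"
    and "\<And>y. y \<in> Ob E \<Longrightarrow> \<exists>x \<in> Ob D. fob F x = y"
    and "\<And>x x'. x \<in> Ob D \<Longrightarrow> x' \<in> Ob D \<Longrightarrow> fob F x = fob F x' \<Longrightarrow> x = x'"
    and "\<And>x x' \<psi>. x \<in> Ob D \<Longrightarrow> x' \<in> Ob D \<Longrightarrow> arr E \<psi> (fob F x) (fob F x') \<Longrightarrow>
      \<exists>\<phi>. arr D \<phi> x x' \<and> far F \<phi> = \<psi>"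
    and "\<And>x x' \<phi> \<phi>'. x \<in> Ob D \<Longrightarrow> x' \<in> Ob D \<Longrightarrow> arr D \<phi> x x' \<Longrightarrow> arr D \<phi>' x x' \<Longrightarrow> far F \<phi> = far F \<phi>' \<Longrightarrow> \<phi>
        = \<phi>'"
  shows "cat_isomorphism D E F"
proof -
  interpret D: category D using assms(1) by (simp add: is_functor_def)
  interpret E: category E using assms(1) by (simp add: is_functor_def)
  have ar: "arr E (far F f) (fob F (Dm D f)) (fob F (Cd D f))" if "f \<in> Ar D" for f
    using assms(1) that by (simp add: is_functor_def)
  have ob: "fob F x \<in> Ob E" if "x \<in> Ob D" for x
    using assms(1) that by (simp add: is_functor_def)
  have "bij_betw (fob F) (Ob D) (Ob E)"
    unfolding bij_betw_def inj_on_def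
  proof (intro conjI ballI impI)
    show "fob F ` Ob D = Ob E" using assms(2) ob by blast
  qed (use assms(3) in blast)
  moreover have "inj_on (far F) (Ar D)"
  proof (rule inj_onI)
    fix \<phi> \<phi>' assume *: "\<phi> \<in> Ar D" "\<phi>' \<in> Ar D" "far F \<phi> = far F \<phi>'"
    have "Dm D \<phi> = Dm D \<phi>'" "Cd D \<phi> = Cd D \<phi>'"
      using ar[OF *(1)] ar[OF *(2)] *(3) assms(3) * by (auto simp: arr_def)
    then show "\<phi> = \<phi>'" using * assms(5)[of "Dm D \<phi>" "Cd D \<phi>" \<phi> \<phi>'] by (auto simp: arr_def)
  qed
  moreover have "far F ` Ar D = Ar E"
  proof
    show "far F ` Ar D \<subseteq> Ar E" using ar by (auto simp: arr_def)
    show "Ar E \<subseteq> far F ` Ar D"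
    proof
      fix \<psi> assume *: "\<psi> \<in> Ar E"
      obtain x x' where x: "x \<in> Ob D" "fob F x = Dm E \<psi>" "x' \<in> Ob D" "fob F x' = Cd E \<psi>"
        using assms(2)[of "Dm E \<psi>"] assms(2)[of "Cd E \<psi>"] * by auto
      then obtain \<phi> where "arr D \<phi> x x'" "far F \<phi> = \<psi>"
        using assms(4)[of x x' \<psi>] * by (auto simp: arr_def)
      then show "\<psi> \<in> far F ` Ar D" by (auto simp: arr_def)
    qed
  qed
  ultimately show ?thesis using assms(1) by (auto simp: cat_isomorphism_def bij_betw_def)
qed

lemma cat_isomorphism_ob_ex:
  "cat_isomorphism D E F \<Longrightarrow> y \<in> Ob E \<Longrightarrow> \<exists>x \<in> Ob D. fob F x = y"
  by (force simp: cat_isomorphism_def bij_betw_def)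

lemma cat_isomorphism_ob_inj:
  "cat_isomorphism D E F \<Longrightarrow> x \<in> Ob D \<Longrightarrow> x' \<in> Ob D \<Longrightarrow> fob F x = fob F x' \<Longrightarrow> x = x'"
  by (auto simp: cat_isomorphism_def bij_betw_def inj_on_def)

lemma cat_isomorphism_ar_inj:
  "cat_isomorphism D E F \<Longrightarrow> \<phi> \<in> Ar D \<Longrightarrow> \<phi>' \<in> Ar D \<Longrightarrow> far F \<phi> = far F \<phi>' \<Longrightarrow> \<phi> = \<phi>'"
  by (auto simp: cat_isomorphism_def bij_betw_def inj_on_def)

text \<open>Surjectivity on arrows gives a preimage with unknown endpoints. Their images are the
  prescribed ones, so injectivity on objects identifies them.\<close>

lemma cat_isomorphism_ar_ex:
  assumes "cat_isomorphism D E F" "x \<in> Ob D" "x' \<in> Ob D" "arr E \<psi> (fob F x) (fob F x')"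
  shows "\<exists>\<phi>. arr D \<phi> x x' \<and> far F \<phi> = \<psi>"
proof -
  interpret D: category D using assms(1) by (simp add: is_functor_def cat_isomorphism_def)
  obtain \<phi> where p: "\<phi> \<in> Ar D" "far F \<phi> = \<psi>" using assms
    by (force simp: cat_isomorphism_def bij_betw_def arr_def)
  then have "fob F (Dm D \<phi>) = fob F x" "fob F (Cd D \<phi>) = fob F x'"
    using assms(1,4) by (auto simp: cat_isomorphism_def is_functor_def arr_def)
  then show ?thesis using p assms cat_isomorphism_ob_inj[OF assms(1)] by (auto simp: arr_def)
qed

lemma prod_cat_simps [simp]:
  "Ob (prod_cat D E) = Ob D \<times> Ob E" "Ar (prod_cat D E) = Ar D \<times> Ar E"
  "Dm (prod_cat D E) fg = (Dm D (fst fg), Dm E (snd fg))"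
  "Cd (prod_cat D E) fg = (Cd D (fst fg), Cd E (snd fg))"
  "Idn (prod_cat D E) xy = (Idn D (fst xy), Idn E (snd xy))"
  "Cmp (prod_cat D E) fg fg' = (Cmp D (fst fg) (fst fg'), Cmp E (snd fg) (snd fg'))"
  by (auto simp: prod_cat_def split: prod.splits)

lemma pullback_cat_simps [simp]:
  "Ob (pullback_cat D E F G) = {(x, y). x \<in> Ob D \<and> y \<in> Ob E \<and> fob F x = fob G y}"
  "Ar (pullback_cat D E F G) = {(f, g). f \<in> Ar D \<and> g \<in> Ar E \<and> far F f = far G g}"
  "Dm (pullback_cat D E F G) fg = (Dm D (fst fg), Dm E (snd fg))"
  "Cd (pullback_cat D E F G) fg = (Cd D (fst fg), Cd E (snd fg))"
  "Idn (pullback_cat D E F G) xy = (Idn D (fst xy), Idn E (snd xy))"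
  "Cmp (pullback_cat D E F G) fg fg' = (Cmp D (fst fg) (fst fg'), Cmp E (snd fg) (snd fg'))"
  by (simp_all add: pullback_cat_def del: prod_cat_simps) (auto simp: prod_cat_def split:
    prod.splits)

text \<open>\<open>is_functor\<close> contains the claim that its codomain is a category, so this is
  owed before the comparison functor of a strict pullback can be called a functor.\<close>

lemma category_pullback:
  assumes F: "is_functor D H F" and G: "is_functor E H G"
  shows "category (pullback_cat D E F G)"
proof -
  interpret D: category D using F by (simp add: is_functor_def)
  interpret E: category E using G by (simp add: is_functor_def)
  interpret H: category H using G by (simp add: is_functor_def)
  have F': "\<And>f. f \<in> Ar D \<Longrightarrow> Dm H (far F f) = fob F (Dm D f)"
    "\<And>f. f \<in> Ar D \<Longrightarrow> Cd H (far F f) = fob F (Cd D f)"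
    "\<And>x. x \<in> Ob D \<Longrightarrow> far F (Idn D x) = Idn H (fob F x)"
    "\<And>f g. f \<in> Ar D \<Longrightarrow> g \<in> Ar D \<Longrightarrow> Cd D f = Dm D g \<Longrightarrow> far F (Cmp D f g) = Cmp H (far F f) (far F g)"
    using F by (auto simp: is_functor_def arr_def)
  have G': "\<And>f. f \<in> Ar E \<Longrightarrow> Dm H (far G f) = fob G (Dm E f)"
    "\<And>f. f \<in> Ar E \<Longrightarrow> Cd H (far G f) = fob G (Cd E f)"
    "\<And>x. x \<in> Ob E \<Longrightarrow> far G (Idn E x) = Idn H (fob G x)"
    "\<And>f g. f \<in> Ar E \<Longrightarrow> g \<in> Ar E \<Longrightarrow> Cd E f = Dm E g \<Longrightarrow> far G (Cmp E f g) = Cmp H (far G f) (far G g)"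
    using G by (auto simp: is_functor_def arr_def)
  \<comment> \<open>The endpoint equations are used backwards: \<open>fob F (Dm D f)\<close> is read
    as the domain of \<open>far F f\<close>, so that equal images of two arrows yield equal images
    of their endpoints.\<close>
  show ?thesis
    by unfold_locales (auto simp: arr_def F' G' simp flip: F'(1,2) G'(1,2))
qed

section \<open>Calculus in a strict 2-category\<close>

lemma under_simps [simp]:
  "Ob (under C) = Cell0 C" "Ar (under C) = Cell1 C" "Dm (under C) = dom1 C" "Cd (under C) = cod1 C"
  "Idn (under C) = id1 C" "Cmp (under C) = comp1 C"
  by (simp_all add: under_def)

lemma vert_simps [simp]:
  "Ob (vert C) = Cell1 C" "Ar (vert C) = Cell2 C" "Dm (vert C) = dom2 C" "Cd (vert C) = cod2 C"
  "Idn (vert C) = id2 C" "Cmp (vert C) = vcomp C"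
  by (simp_all add: vert_def)

lemma mor_iff [simp]: "mor C f X Y \<longleftrightarrow> f \<in> Cell1 C \<and> dom1 C f = X \<and> cod1 C f = Y"
  by (simp add: arr_def)

lemma cell_iff [simp]: "cell C \<alpha> f g \<longleftrightarrow> \<alpha> \<in> Cell2 C \<and> dom2 C \<alpha> = f \<and> cod2 C \<alpha> = g"
  by (simp add: arr_def)

abbreviation isoc :: "('o, 'm, 'c) two_cat \<Rightarrow> 'c \<Rightarrow> bool" where
  "isoc C \<alpha> \<equiv> iso_arrow (vert C) \<alpha>"

context two_category
begin

sublocale U: category "under C" by (rule under_category)
sublocale V: category "vert C" by (rule vert_category)

lemma cell1_closed [simp]:
  "f \<in> Cell1 C \<Longrightarrow> dom1 C f \<in> Cell0 C" "f \<in> Cell1 C \<Longrightarrow> cod1 C f \<in> Cell0 C"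
  "x \<in> Cell0 C \<Longrightarrow> id1 C x \<in> Cell1 C" "x \<in> Cell0 C \<Longrightarrow> dom1 C (id1 C x) = x"
  "x \<in> Cell0 C \<Longrightarrow> cod1 C (id1 C x) = x"
  using U.ar_closed by simp_all

lemma comp1_closed [simp]:
  assumes "f \<in> Cell1 C" "g \<in> Cell1 C" "cod1 C f = dom1 C g"
  shows "f \<cdot> g \<in> Cell1 C" "dom1 C (f \<cdot> g) = dom1 C f" "cod1 C (f \<cdot> g) = cod1 C g"
  using U.cmp_closed[of f g] assms by simp_all

lemma comp1_id [simp]: "f \<in> Cell1 C \<Longrightarrow> dom1 C f = x \<Longrightarrow> id1 C x \<cdot> f = f"
  "f \<in> Cell1 C \<Longrightarrow> cod1 C f = x \<Longrightarrow> f \<cdot> id1 C x = f"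
  using U.cmp_id_left U.cmp_id_right by simp_all

lemma comp1_assoc [simp]:
  "f \<in> Cell1 C \<Longrightarrow> g \<in> Cell1 C \<Longrightarrow> h \<in> Cell1 C \<Longrightarrow> cod1 C f = dom1 C g \<Longrightarrow> cod1 C g = dom1 C h \<Longrightarrow>
    (f \<cdot> g) \<cdot> h = f \<cdot> (g \<cdot> h)"
  using U.cmp_assoc by simp

lemma cell2_closed [simp]:
  "\<alpha> \<in> Cell2 C \<Longrightarrow> dom2 C \<alpha> \<in> Cell1 C" "\<alpha> \<in> Cell2 C \<Longrightarrow> cod2 C \<alpha> \<in> Cell1 C"
  "f \<in> Cell1 C \<Longrightarrow> id2 C f \<in> Cell2 C" "f \<in> Cell1 C \<Longrightarrow> dom2 C (id2 C f) = f"
  "f \<in> Cell1 C \<Longrightarrow> cod2 C (id2 C f) = f"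
  "\<alpha> \<in> Cell2 C \<Longrightarrow> dom1 C (cod2 C \<alpha>) = dom1 C (dom2 C \<alpha>)"
  "\<alpha> \<in> Cell2 C \<Longrightarrow> cod1 C (cod2 C \<alpha>) = cod1 C (dom2 C \<alpha>)"
  using V.ar_closed globular_dom globular_cod by simp_all

lemma vcomp_closed [simp]:
  assumes "\<alpha> \<in> Cell2 C" "\<beta> \<in> Cell2 C" "cod2 C \<alpha> = dom2 C \<beta>"
  shows "\<alpha> \<bullet> \<beta> \<in> Cell2 C" "dom2 C (\<alpha> \<bullet> \<beta>) = dom2 C \<alpha>" "cod2 C (\<alpha> \<bullet> \<beta>) = cod2 C \<beta>"
  using V.cmp_closed[of \<alpha> \<beta>] assms by simp_all

lemma vcomp_id [simp]: "\<alpha> \<in> Cell2 C \<Longrightarrow> dom2 C \<alpha> = f \<Longrightarrow> id2 C f \<bullet> \<alpha> = \<alpha>"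
  "\<alpha> \<in> Cell2 C \<Longrightarrow> cod2 C \<alpha> = f \<Longrightarrow> \<alpha> \<bullet> id2 C f = \<alpha>"
  using V.cmp_id_left V.cmp_id_right by simp_all

lemma vcomp_assoc [simp]:
  "\<alpha> \<in> Cell2 C \<Longrightarrow> \<beta> \<in> Cell2 C \<Longrightarrow> \<gamma> \<in> Cell2 C \<Longrightarrow> cod2 C \<alpha> = dom2 C \<beta> \<Longrightarrow> cod2 C \<beta> = dom2 C \<gamma> \<Longrightarrow>
    (\<alpha> \<bullet> \<beta>) \<bullet> \<gamma> = \<alpha> \<bullet> (\<beta> \<bullet> \<gamma>)"
  using V.cmp_assoc by simp

lemma hcomp_closed:
  assumes "\<alpha> \<in> Cell2 C" "\<beta> \<in> Cell2 C" "cod1 C (dom2 C \<alpha>) = dom1 C (dom2 C \<beta>)"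
  shows "\<alpha> \<star> \<beta> \<in> Cell2 C" "dom2 C (\<alpha> \<star> \<beta>) = dom2 C \<alpha> \<cdot> dom2 C \<beta>"
    "cod2 C (\<alpha> \<star> \<beta>) = cod2 C \<alpha> \<cdot> cod2 C \<beta>"
  using hcomp_cell[of \<alpha> \<beta>] assms by (simp_all add: hcomposable_def)

lemma lwhisk_closed [simp]:
  assumes "x \<in> Cell1 C" "\<alpha> \<in> Cell2 C" "cod1 C x = dom1 C (dom2 C \<alpha>)"
  shows "x \<rhd> \<alpha> \<in> Cell2 C" "dom2 C (x \<rhd> \<alpha>) = x \<cdot> dom2 C \<alpha>" "cod2 C (x \<rhd> \<alpha>) = x \<cdot> cod2 C \<alpha>"
  using hcomp_closed[of "id2 C x" \<alpha>] assms by (simp_all add: lwhisk_def)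

lemma rwhisk_closed [simp]:
  assumes "f \<in> Cell1 C" "\<alpha> \<in> Cell2 C" "cod1 C (dom2 C \<alpha>) = dom1 C f"
  shows "\<alpha> \<lhd> f \<in> Cell2 C" "dom2 C (\<alpha> \<lhd> f) = dom2 C \<alpha> \<cdot> f" "cod2 C (\<alpha> \<lhd> f) = cod2 C \<alpha> \<cdot> f"
  using hcomp_closed[of \<alpha> "id2 C f"] assms by (simp_all add: rwhisk_def)

lemma whisker_id1 [simp]:
  "\<alpha> \<in> Cell2 C \<Longrightarrow> dom1 C (dom2 C \<alpha>) = x \<Longrightarrow> id1 C x \<rhd> \<alpha> = \<alpha>"
  "\<alpha> \<in> Cell2 C \<Longrightarrow> cod1 C (dom2 C \<alpha>) = x \<Longrightarrow> \<alpha> \<lhd> id1 C x = \<alpha>"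
  using hcomp_id_left hcomp_id_right by (auto simp: lwhisk_def rwhisk_def)

lemma whisker_id2 [simp]:
  assumes "x \<in> Cell1 C" "f \<in> Cell1 C" "cod1 C x = dom1 C f"
  shows "x \<rhd> id2 C f = id2 C (x \<cdot> f)" "id2 C x \<lhd> f = id2 C (x \<cdot> f)"
  using hcomp_id2[of x _ _ f] assms by (auto simp: lwhisk_def rwhisk_def)

lemma whisker_comp1 [simp]:
  "x \<in> Cell1 C \<Longrightarrow> y \<in> Cell1 C \<Longrightarrow> \<alpha> \<in> Cell2 C \<Longrightarrow> cod1 C x = dom1 C y \<Longrightarrow> cod1 C y = dom1 C (dom2 C \<alpha>) \<Longrightarrow>
    (x \<cdot> y) \<rhd> \<alpha> = x \<rhd> (y \<rhd> \<alpha>)"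
  "f \<in> Cell1 C \<Longrightarrow> g \<in> Cell1 C \<Longrightarrow> \<alpha> \<in> Cell2 C \<Longrightarrow> cod1 C (dom2 C \<alpha>) = dom1 C f \<Longrightarrow> cod1 C f = dom1 C g \<Longrightarrow>
    \<alpha> \<lhd> (f \<cdot> g) = (\<alpha> \<lhd> f) \<lhd> g"
  "x \<in> Cell1 C \<Longrightarrow> f \<in> Cell1 C \<Longrightarrow> \<alpha> \<in> Cell2 C \<Longrightarrow> cod1 C x = dom1 C (dom2 C \<alpha>) \<Longrightarrow>
    cod1 C (dom2 C \<alpha>) = dom1 C f \<Longrightarrow> (x \<rhd> \<alpha>) \<lhd> f = x \<rhd> (\<alpha> \<lhd> f)"
  by (simp_all add: lwhisk_def rwhisk_def hcomp_assoc hcomposable_def flip: hcomp_id2)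

lemma whisker_vcomp [simp]:
  "x \<in> Cell1 C \<Longrightarrow> \<alpha> \<in> Cell2 C \<Longrightarrow> \<beta> \<in> Cell2 C \<Longrightarrow> cod2 C \<alpha> = dom2 C \<beta> \<Longrightarrow> cod1 C x = dom1 C (dom2 C \<alpha>) \<Longrightarrow>
    x \<rhd> (\<alpha> \<bullet> \<beta>) = (x \<rhd> \<alpha>) \<bullet> (x \<rhd> \<beta>)"
  "f \<in> Cell1 C \<Longrightarrow> \<alpha> \<in> Cell2 C \<Longrightarrow> \<beta> \<in> Cell2 C \<Longrightarrow> cod2 C \<alpha> = dom2 C \<beta> \<Longrightarrow> cod1 C (dom2 C \<alpha>) = dom1 C f \<Longrightarrow>
    (\<alpha> \<bullet> \<beta>) \<lhd> f = (\<alpha> \<lhd> f) \<bullet> (\<beta> \<lhd> f)"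
  using interchange[of "id2 C x" x x "id2 C x" x \<alpha> "dom2 C \<alpha>" "dom2 C \<beta>" \<beta> "cod2 C \<beta>"]
    interchange[of \<alpha> "dom2 C \<alpha>" "dom2 C \<beta>" \<beta> "cod2 C \<beta>" "id2 C f" f f "id2 C f" f]
  by (simp_all add: lwhisk_def rwhisk_def)

lemma hcomp_eq:
  assumes "\<alpha> \<in> Cell2 C" "\<beta> \<in> Cell2 C" "cod1 C (dom2 C \<alpha>) = dom1 C (dom2 C \<beta>)"
  shows "\<alpha> \<star> \<beta> = (\<alpha> \<lhd> dom2 C \<beta>) \<bullet> (cod2 C \<alpha> \<rhd> \<beta>)"
    and "\<alpha> \<star> \<beta> = (dom2 C \<alpha> \<rhd> \<beta>) \<bullet> (\<alpha> \<lhd> cod2 C \<beta>)"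
  using assms interchange[of \<alpha> "dom2 C \<alpha>" "cod2 C \<alpha>" "id2 C (cod2 C \<alpha>)" "cod2 C \<alpha>"
    "id2 C (dom2 C \<beta>)" "dom2 C \<beta>" "dom2 C \<beta>" \<beta> "cod2 C \<beta>"]
    interchange[of "id2 C (dom2 C \<alpha>)" "dom2 C \<alpha>" "dom2 C \<alpha>" \<alpha> "cod2 C \<alpha>" \<beta> "dom2 C \<beta>" "cod2 C \<beta>"
      "id2 C (cod2 C \<beta>)" "cod2 C \<beta>"]
  by (simp_all add: lwhisk_def rwhisk_def)

text \<open>The interchange law in whiskered form. With \<beta> a universal 2-cell or the 2-cell of
  a cocone it becomes the naturality square of \<alpha>, and this is how it is applied
  throughout.\<close>

lemma whisker_exchange:
  assumes "\<alpha> \<in> Cell2 C" "\<beta> \<in> Cell2 C" "cod1 C (dom2 C \<alpha>) = dom1 C (dom2 C \<beta>)"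
  shows "(\<alpha> \<lhd> dom2 C \<beta>) \<bullet> (cod2 C \<alpha> \<rhd> \<beta>) = (dom2 C \<alpha> \<rhd> \<beta>) \<bullet> (\<alpha> \<lhd> cod2 C \<beta>)"
  using hcomp_eq assms by metis

section \<open>Invertible 2-cells\<close>

lemma isoc_iff: "isoc C \<alpha> \<longleftrightarrow> \<alpha> \<in> Cell2 C \<and>
    (\<exists>\<beta>. \<beta> \<in> Cell2 C \<and> dom2 C \<beta> = cod2 C \<alpha> \<and> cod2 C \<beta> = dom2 C \<alpha> \<and>
      \<alpha> \<bullet> \<beta> = id2 C (dom2 C \<alpha>) \<and> \<beta> \<bullet> \<alpha> = id2 C (cod2 C \<alpha>))"
  by (auto simp: iso_arrow_def inverse_arrows_def)

lemma isocE:
  assumes "isoc C \<alpha>"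
  obtains \<beta> where "\<beta> \<in> Cell2 C" "dom2 C \<beta> = cod2 C \<alpha>" "cod2 C \<beta> = dom2 C \<alpha>"
    "\<alpha> \<bullet> \<beta> = id2 C (dom2 C \<alpha>)" "\<beta> \<bullet> \<alpha> = id2 C (cod2 C \<alpha>)" "isoc C \<beta>"
proof -
  obtain \<beta> where "\<beta> \<in> Cell2 C" "dom2 C \<beta> = cod2 C \<alpha>" "cod2 C \<beta> = dom2 C \<alpha>"
    "\<alpha> \<bullet> \<beta> = id2 C (dom2 C \<alpha>)" "\<beta> \<bullet> \<alpha> = id2 C (cod2 C \<alpha>)" "\<alpha> \<in> Cell2 C"
    using assms by (auto simp: isoc_iff)
  moreover from this have "isoc C \<beta>" by (auto simp: isoc_iff)
  ultimately show ?thesis using that by blast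
qed

lemma isoc_cell: "isoc C \<alpha> \<Longrightarrow> \<alpha> \<in> Cell2 C"
  by (simp add: isoc_iff)

lemma isoc_id [simp]: "f \<in> Cell1 C \<Longrightarrow> isoc C (id2 C f)"
  unfolding isoc_iff by (auto intro!: exI[of _ "id2 C f"])

text \<open>Simplification associates to the right, which hides an adjacent pair such as a 2-cell
  and its inverse; this rule brings the pair together again.\<close>

lemma vcomp_cancel_assoc:
  assumes "\<alpha> \<in> Cell2 C" "\<beta> \<in> Cell2 C" "\<gamma> \<in> Cell2 C" "cod2 C \<alpha> = dom2 C \<beta>" "cod2 C \<beta> = dom2 C \<gamma>"
    "\<alpha> \<bullet> \<beta> = \<delta>"
  shows "\<alpha> \<bullet> (\<beta> \<bullet> \<gamma>) = \<delta> \<bullet> \<gamma>"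
  using assms vcomp_assoc by metis

lemma isoc_vcomp [simp]:
  assumes "isoc C \<alpha>" "isoc C \<beta>" "cod2 C \<alpha> = dom2 C \<beta>"
  shows "isoc C (\<alpha> \<bullet> \<beta>)"
proof -
  obtain \<alpha>' where a: "\<alpha>' \<in> Cell2 C" "dom2 C \<alpha>' = cod2 C \<alpha>" "cod2 C \<alpha>' = dom2 C \<alpha>"
    "\<alpha> \<bullet> \<alpha>' = id2 C (dom2 C \<alpha>)" "\<alpha>' \<bullet> \<alpha> = id2 C (cod2 C \<alpha>)" using assms(1) by (rule isocE)
  obtain \<beta>' where b: "\<beta>' \<in> Cell2 C" "dom2 C \<beta>' = cod2 C \<beta>" "cod2 C \<beta>' = dom2 C \<beta>"
    "\<beta> \<bullet> \<beta>' = id2 C (dom2 C \<beta>)" "\<beta>' \<bullet> \<beta> = id2 C (cod2 C \<beta>)" using assms(2) by (rule isocE)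
  have "\<alpha> \<bullet> (\<beta> \<bullet> (\<beta>' \<bullet> \<alpha>')) = id2 C (dom2 C \<alpha>)"
    using assms a b isoc_cell[OF assms(1)] isoc_cell[OF assms(2)]
      by (subst vcomp_cancel_assoc[of \<beta> \<beta>' \<alpha>']) auto
  moreover have "\<beta>' \<bullet> (\<alpha>' \<bullet> (\<alpha> \<bullet> \<beta>)) = id2 C (cod2 C \<beta>)"
    using assms a b isoc_cell[OF assms(1)] isoc_cell[OF assms(2)]
      by (subst vcomp_cancel_assoc[of \<alpha>' \<alpha> \<beta>]) auto
  ultimately show ?thesis
    using assms a b isoc_cell[OF assms(1)] isoc_cell[OF assms(2)] unfolding isoc_iff
      by (auto intro!: exI[of _ "\<beta>' \<bullet> \<alpha>'"])
qed

lemma isoc_lwhisk [simp]: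
  assumes "isoc C \<alpha>" "x \<in> Cell1 C" "cod1 C x = dom1 C (dom2 C \<alpha>)" shows "isoc C (x \<rhd> \<alpha>)"
  using assms(1)
proof (rule isocE)
  fix \<beta> assume b: "\<beta> \<in> Cell2 C" "dom2 C \<beta> = cod2 C \<alpha>" "cod2 C \<beta> = dom2 C \<alpha>"
    "\<alpha> \<bullet> \<beta> = id2 C (dom2 C \<alpha>)" "\<beta> \<bullet> \<alpha> = id2 C (cod2 C \<alpha>)"
  show ?thesis using assms isoc_cell[OF assms(1)] b unfolding isoc_iff
    by (auto intro!: exI[of _ "x \<rhd> \<beta>"] simp flip: whisker_vcomp)
qed

lemma isoc_rwhisk [simp]:
  assumes "isoc C \<alpha>" "x \<in> Cell1 C" "cod1 C (dom2 C \<alpha>) = dom1 C x" shows "isoc C (\<alpha> \<lhd> x)"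
  using assms(1)
proof (rule isocE)
  fix \<beta> assume b: "\<beta> \<in> Cell2 C" "dom2 C \<beta> = cod2 C \<alpha>" "cod2 C \<beta> = dom2 C \<alpha>"
    "\<alpha> \<bullet> \<beta> = id2 C (dom2 C \<alpha>)" "\<beta> \<bullet> \<alpha> = id2 C (cod2 C \<alpha>)"
  show ?thesis using assms isoc_cell[OF assms(1)] b unfolding isoc_iff
    by (auto intro!: exI[of _ "\<beta> \<lhd> x"] simp flip: whisker_vcomp)
qed

lemma isoc_cancel_left:
  assumes "isoc C \<alpha>" "\<beta> \<in> Cell2 C" "\<gamma> \<in> Cell2 C" "dom2 C \<beta> = cod2 C \<alpha>" "dom2 C \<gamma> = cod2 C \<alpha>"
    "\<alpha> \<bullet> \<beta> = \<alpha> \<bullet> \<gamma>"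
  shows "\<beta> = \<gamma>"
proof -
  obtain \<alpha>' where a: "\<alpha>' \<in> Cell2 C" "dom2 C \<alpha>' = cod2 C \<alpha>" "cod2 C \<alpha>' = dom2 C \<alpha>"
    "\<alpha> \<bullet> \<alpha>' = id2 C (dom2 C \<alpha>)" "\<alpha>' \<bullet> \<alpha> = id2 C (cod2 C \<alpha>)" using assms(1) by (rule isocE)
  have "\<alpha>' \<bullet> (\<alpha> \<bullet> \<beta>) = \<alpha>' \<bullet> (\<alpha> \<bullet> \<gamma>)" using assms(6) by simp
  then show ?thesis using a isoc_cell[OF assms(1)] assms(1-5) vcomp_cancel_assoc[of \<alpha>' \<alpha> \<beta>]
    vcomp_cancel_assoc[of \<alpha>' \<alpha> \<gamma>] by simp
qed

text \<open>Cancel \<sigma> on the left and \<tau> on the right of the given square. It supplies the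
  naturality of a family of inverses.\<close>

lemma inverse_square:
  assumes "inverse_arrows (vert C) \<sigma> \<sigma>'" "inverse_arrows (vert C) \<tau> \<tau>'" "\<phi> \<in> Cell2 C" "\<psi> \<in> Cell2 C"
    "dom2 C \<phi> = dom2 C \<sigma>" "cod2 C \<phi> = dom2 C \<tau>" "dom2 C \<psi> = cod2 C \<sigma>" "cod2 C \<psi> = cod2 C \<tau>"
    "\<phi> \<bullet> \<tau> = \<sigma> \<bullet> \<psi>"
  shows "\<psi> \<bullet> \<tau>' = \<sigma>' \<bullet> \<phi>"
proof -
  have c: "\<sigma> \<in> Cell2 C" "\<tau> \<in> Cell2 C" "\<sigma>' \<in> Cell2 C" "\<tau>' \<in> Cell2 C"
    "dom2 C \<sigma>' = cod2 C \<sigma>" "cod2 C \<sigma>' = dom2 C \<sigma>" "dom2 C \<tau>' = cod2 C \<tau>" "cod2 C \<tau>' = dom2 C \<tau>"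
    "\<tau> \<bullet> \<tau>' = id2 C (dom2 C \<tau>)" "\<sigma>' \<bullet> \<sigma> = id2 C (cod2 C \<sigma>)"
    using assms by (auto simp: inverse_arrows_def)
  have "\<sigma>' \<bullet> \<phi> = \<sigma>' \<bullet> (\<phi> \<bullet> (\<tau> \<bullet> \<tau>'))" using c assms by simp
  also have "\<dots> = \<sigma>' \<bullet> ((\<phi> \<bullet> \<tau>) \<bullet> \<tau>')" using c assms(3-8) by simp
  also have "\<dots> = (\<sigma>' \<bullet> \<sigma>) \<bullet> (\<psi> \<bullet> \<tau>')" unfolding assms(9) using c(1-8) assms(3-8) by simp
  also have "\<dots> = \<psi> \<bullet> \<tau>'" unfolding c using c assms(3-8) by simp
  finally show ?thesis by simp
qed

section \<open>Hom-categories, groupoid objects and arrow-wise isos\<close>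

lemma Hom_simps [simp]:
  "Ob (Hom C A B) = {f. mor C f A B}"
  "\<alpha> \<in> Ar (Hom C A B) \<longleftrightarrow> \<alpha> \<in> Cell2 C \<and> dom1 C (dom2 C \<alpha>) = A \<and> cod1 C (dom2 C \<alpha>) = B"
  "Dm (Hom C A B) = dom2 C" "Cd (Hom C A B) = cod2 C" "Idn (Hom C A B) = id2 C"
    "Cmp (Hom C A B) = vcomp C"
  by (auto simp: Hom_def)

lemma category_Hom [simp]: "category (Hom C A B)"
  by unfold_locales (auto simp: arr_def)

text \<open>An inverse of \<alpha> has the endpoints of \<alpha> exchanged and so lies in the same
  hom-category; invertibility does not depend on where it is tested.\<close>

lemma iso_Hom: "iso_arrow (Hom C A B) \<alpha> \<longleftrightarrow> isoc C \<alpha> \<and> dom1 C (dom2 C \<alpha>) = A \<and> cod1 C (dom2 C \<alpha>) = B"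
  unfolding isoc_iff iso_arrow_def inverse_arrows_def by (auto simp: arr_def)

lemma post_simps [simp]: "fob (post C f) g = g \<cdot> f" "far (post C f) \<alpha> = \<alpha> \<lhd> f"
  by (simp_all add: post_def)

lemma post_functor: "f \<in> Cell1 C \<Longrightarrow> is_functor (Hom C A (dom1 C f)) (Hom C A (cod1 C f)) (post C f)"
  by (auto simp: is_functor_def arr_def)

lemma groupoid_objectI:
  assumes "X \<in> Cell0 C" "\<And>\<alpha>. \<alpha> \<in> Cell2 C \<Longrightarrow> cod1 C (dom2 C \<alpha>) = X \<Longrightarrow> isoc C \<alpha>"
  shows "groupoid_object C X"
  using assms by (auto simp: groupoid_object_def groupoid_cat_def iso_Hom)

lemma groupoid_objectD:
  assumes "groupoid_object C X" "\<alpha> \<in> Cell2 C" "cod1 C (dom2 C \<alpha>) = X"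
  shows "isoc C \<alpha>"
proof -
  have "groupoid_cat (Hom C (dom1 C (dom2 C \<alpha>)) X)" "\<alpha> \<in> Ar (Hom C (dom1 C (dom2 C \<alpha>)) X)"
    using assms by (auto simp: groupoid_object_def)
  then show ?thesis unfolding groupoid_cat_def using iso_Hom by blast
qed

lemma awi_isoc: "arrow_wise_iso C f \<Longrightarrow> \<alpha> \<in> Cell2 C \<Longrightarrow> cod1 C (dom2 C \<alpha>) = dom1 C f \<Longrightarrow> isoc C (\<alpha> \<lhd> f)"
  by (simp add: arrow_wise_iso_def)

lemma awi_pre [simp]:
  assumes "arrow_wise_iso C f" "x \<in> Cell1 C" "cod1 C x = dom1 C f" shows "arrow_wise_iso C (x \<cdot> f)"
  using assms by (auto simp: arrow_wise_iso_def)

lemma awi_post [simp]: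
  assumes "arrow_wise_iso C f" "x \<in> Cell1 C" "cod1 C f = dom1 C x" shows "arrow_wise_iso C (f \<cdot> x)"
  using assms by (auto simp: arrow_wise_iso_def)

lemma awi_groupoid: "groupoid_object C X \<Longrightarrow> f \<in> Cell1 C \<Longrightarrow> dom1 C f = X \<Longrightarrow> arrow_wise_iso C f"
  by (simp add: arrow_wise_iso_def groupoid_objectD)

text \<open>The isomorphism of hom-categories is split into four clauses: existence and uniqueness,
  once for morphisms and once for 2-cells. All universal objects below are handled through these
  four clauses.\<close>

lemma strict_pullbackI:
  assumes pq: "p \<in> Cell1 C" "q \<in> Cell1 C" "u \<in> Cell1 C" "v \<in> Cell1 C"
    "dom1 C q = dom1 C p" "cod1 C p = dom1 C u" "cod1 C q = dom1 C v" "cod1 C v = cod1 C u"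
      "p \<cdot> u = q \<cdot> v"
    and "\<And>B a b. mor C a B (dom1 C u) \<Longrightarrow> mor C b B (dom1 C v) \<Longrightarrow> a \<cdot> u = b \<cdot> v \<Longrightarrow>
      \<exists>m. mor C m B (dom1 C p) \<and> m \<cdot> p = a \<and> m \<cdot> q = b"
    and "\<And>B m n. mor C m B (dom1 C p) \<Longrightarrow> mor C n B (dom1 C p) \<Longrightarrow> m \<cdot> p = n \<cdot> p \<Longrightarrow> m \<cdot> q = n \<cdot> q \<Longrightarrow> m
        = n"
    and "\<And>B m n \<sigma> \<tau>. mor C m B (dom1 C p) \<Longrightarrow> mor C n B (dom1 C p) \<Longrightarrow> cell C \<sigma> (m \<cdot> p) (n \<cdot> p) \<Longrightarrow>
      cell C \<tau> (m \<cdot> q) (n \<cdot> q) \<Longrightarrow> \<sigma> \<lhd> u = \<tau> \<lhd> v \<Longrightarrow> \<exists>\<kappa>. cell C \<kappa> m n \<and> \<kappa> \<lhd> p = \<sigma> \<and> \<kappa> \<lhd> q = \<tau>"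
    and "\<And>B m n \<kappa> \<kappa>'. mor C m B (dom1 C p) \<Longrightarrow> mor C n B (dom1 C p) \<Longrightarrow> cell C \<kappa> m n \<Longrightarrow> cell C \<kappa>' m n \<Longrightarrow>
      \<kappa> \<lhd> p = \<kappa>' \<lhd> p \<Longrightarrow> \<kappa> \<lhd> q = \<kappa>' \<lhd> q \<Longrightarrow> \<kappa> = \<kappa>'"
  shows "strict_pullback C p q u v"
proof -
  have "cat_isomorphism (Hom C B (dom1 C p))
        (pullback_cat (Hom C B (dom1 C u)) (Hom C B (dom1 C v)) (post C u) (post C v))
        (pairing_functor C p q)" for B
  proof -
    let ?E = "pullback_cat (Hom C B (dom1 C u)) (Hom C B (dom1 C v)) (post C u) (post C v)"
      and ?H = "Hom C B (dom1 C p)" and ?F = "pairing_functor C p q"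
    have F: "category ?E"
      by (rule category_pullback[where H="Hom C B (cod1 C u)"])
        (use pq post_functor[of u] post_functor[of v] in auto)
    have e: "\<alpha> \<lhd> p \<lhd> u = \<alpha> \<lhd> q \<lhd> v" if "\<alpha> \<in> Cell2 C" "cod1 C (dom2 C \<alpha>) = dom1 C p" for \<alpha>
    proof -
      have "\<alpha> \<lhd> p \<lhd> u = \<alpha> \<lhd> (p \<cdot> u)" using that pq(1-8) by simp
      also have "\<dots> = \<alpha> \<lhd> q \<lhd> v" unfolding pq(9) using that pq(1-8) by simp
      finally show ?thesis .
    qed
    show ?thesis
    proof (rule cat_isomorphismI)
      show "is_functor ?H ?E ?F"
        using F pq e by (auto simp: is_functor_def pairing_functor_def arr_def)
    next
      fix y assume "y \<in> Ob ?E"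
      then show "\<exists>x\<in>Ob ?H. fob ?F x = y"
        using assms(10) by (fastforce simp: pairing_functor_def)
    next
      fix x x' assume "x \<in> Ob ?H" "x' \<in> Ob ?H" "fob ?F x = fob ?F x'"
      then show "x = x'" using assms(11)[of x B x'] by (auto simp: pairing_functor_def)
    next
      fix m n \<psi> assume *: "m \<in> Ob ?H" "n \<in> Ob ?H"
         "arr ?E \<psi>
             (fob ?F m) (fob ?F n)"
      obtain \<sigma> \<tau> where st: "\<psi> = (\<sigma>, \<tau>)" by fastforce
      have mn: "mor C m B (dom1 C p)" "mor C n B (dom1 C p)" using *(1,2) by simp_all
      have "cell C \<sigma> (m \<cdot> p) (n \<cdot> p)" "cell C \<tau> (m \<cdot> q) (n \<cdot> q)" "\<sigma> \<lhd> u = \<tau> \<lhd> v"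
        using *(3) by (simp_all add: pairing_functor_def arr_def st)
      then obtain \<kappa> where "cell C \<kappa> m n \<and> \<kappa> \<lhd> p = \<sigma> \<and> \<kappa> \<lhd> q = \<tau>"
        using assms(12)[OF mn] by blast
      then show "\<exists>\<phi>. arr ?H \<phi> m n \<and> far ?F \<phi> = \<psi>"
        using mn by (intro exI[of _ \<kappa>]) (simp add: pairing_functor_def arr_def st)
    next
      fix m n \<phi> \<phi>' assume "m \<in> Ob ?H" "n \<in> Ob ?H" "arr ?H \<phi> m n" "arr ?H \<phi>' m n"
         "far ?F \<phi> = far ?F \<phi>'"
      then show "\<phi> = \<phi>'" using assms(13)[of m B n \<phi> \<phi>'] by (simp add: pairing_functor_def arr_def)
    qed
  qed
  then show ?thesis using pq by (simp add: strict_pullback_def)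
qed

lemma strict_pullback_legs:
  assumes "strict_pullback C p q u v"
  shows "p \<in> Cell1 C" "q \<in> Cell1 C" "u \<in> Cell1 C" "v \<in> Cell1 C"
    "dom1 C q = dom1 C p" "cod1 C p = dom1 C u" "cod1 C q = dom1 C v" "cod1 C v = cod1 C u"
      "p \<cdot> u = q \<cdot> v"
  using assms by (auto simp: strict_pullback_def)

lemma strict_pullback_iso:
  assumes "strict_pullback C p q u v" "B \<in> Cell0 C"
  shows "cat_isomorphism (Hom C B (dom1 C p))
        (pullback_cat (Hom C B (dom1 C u)) (Hom C B (dom1 C v)) (post C u) (post C v))
        (pairing_functor C p q)"
  using assms by (auto simp: strict_pullback_def)

lemma strict_pullback_ex:
  assumes "strict_pullback C p q u v" "mor C a B (dom1 C u)" "mor C b B (dom1 C v)" "a \<cdot> u = b \<cdot> v"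
  shows "\<exists>m. mor C m B (dom1 C p) \<and> m \<cdot> p = a \<and> m \<cdot> q = b"
proof -
  have "B \<in> Cell0 C" using assms(2) cell1_closed(1)[of a] by simp
  note iso = strict_pullback_iso[OF assms(1) this]
  obtain m where "m \<in> Ob (Hom C B (dom1 C p))" "fob (pairing_functor C p q) m = (a, b)"
    by (rule bexE[OF cat_isomorphism_ob_ex[OF iso, of "(a, b)"]]) (use assms in simp_all)
  then show ?thesis by (intro exI[of _ m]) (simp add: pairing_functor_def)
qed

lemma strict_pullback_uniq:
  assumes "strict_pullback C p q u v" "mor C m B (dom1 C p)" "mor C n B (dom1 C p)" "m \<cdot> p = n \<cdot> p"
    "m \<cdot> q = n \<cdot> q"
  shows "m = n"
proof -
  have "B \<in> Cell0 C" using assms(2) cell1_closed(1)[of m] by simp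
  note iso = strict_pullback_iso[OF assms(1) this]
  show ?thesis
    by (rule cat_isomorphism_ob_inj[OF iso]) (use assms(2-5) in \<open>simp_all add: pairing_functor_def\<close>)
qed

lemma strict_pullback_ex2:
  assumes "strict_pullback C p q u v" "mor C m B (dom1 C p)" "mor C n B (dom1 C p)"
    "cell C \<sigma> (m \<cdot> p) (n \<cdot> p)"
    "cell C \<tau> (m \<cdot> q) (n \<cdot> q)" "\<sigma> \<lhd> u = \<tau> \<lhd> v"
  shows "\<exists>\<kappa>. cell C \<kappa> m n \<and> \<kappa> \<lhd> p = \<sigma> \<and> \<kappa> \<lhd> q = \<tau>"
proof -
  have "B \<in> Cell0 C" using assms(2) cell1_closed(1)[of m] by simp
  note iso = strict_pullback_iso[OF assms(1) this]
  have p: "p \<in> Cell1 C" "q \<in> Cell1 C" "dom1 C q = dom1 C p" "cod1 C p = dom1 C u"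
    "cod1 C q = dom1 C v"
    by (rule strict_pullback_legs[OF assms(1)])+
  have "\<exists>\<phi>. arr (Hom C B (dom1 C p)) \<phi> m n \<and> far (pairing_functor C p q) \<phi> = (\<sigma>, \<tau>)"
    by (rule cat_isomorphism_ar_ex[OF iso]) (use assms(2-) p in \<open>simp_all add: pairing_functor_def
      arr_def\<close>)
  then show ?thesis by (simp add: pairing_functor_def arr_def) blast
qed

lemma strict_pullback_uniq2:
  assumes "strict_pullback C p q u v" "mor C m B (dom1 C p)" "mor C n B (dom1 C p)" "cell C \<kappa> m n"
    "cell C \<kappa>' m n"
      "\<kappa> \<lhd> p = \<kappa>' \<lhd> p" "\<kappa> \<lhd> q = \<kappa>' \<lhd> q"
  shows "\<kappa> = \<kappa>'"
proof -
  have "B \<in> Cell0 C" using assms(2) cell1_closed(1)[of m] by simp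
  note iso = strict_pullback_iso[OF assms(1) this]
  show ?thesis
    by (rule cat_isomorphism_ar_inj[OF iso]) (use assms(2-) in \<open>simp_all add: pairing_functor_def\<close>)
qed

text \<open>Internal categories live in the underlying 1-category, whereas the pullbacks at hand are
  strict 2-categorical ones; only the two clauses on morphisms are kept.\<close>

lemma strict_pullback_is_pullback:
  assumes "strict_pullback C p q u v"
  shows "is_pullback (under C) p q u v"
  unfolding is_pullback_def
proof (intro conjI allI impI)
  fix A a b
  assume "mor C a A (Dm (under C) u) \<and> mor C b A (Dm (under C) v) \<and> Cmp (under C) a u
      = Cmp (under C) b v"
  then have "mor C a A (dom1 C u)" "mor C b A (dom1 C v)" "a \<cdot> u = b \<cdot> v" by simp_all
  then obtain m where m: "mor C m A (dom1 C p)" "m \<cdot> p = a" "m \<cdot> q = b"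
    using strict_pullback_ex[OF assms] by blast
  show "\<exists>!m. mor C m A (Dm (under C) p) \<and> Cmp (under C) m p = a \<and> Cmp (under C) m q = b"
  proof (rule ex1I[of _ m])
    fix n assume "mor C n A (Dm (under C) p) \<and> Cmp (under C) n p = a \<and> Cmp (under C) n q = b"
    then have n: "mor C n A (dom1 C p)" "n \<cdot> p = m \<cdot> p" "n \<cdot> q = m \<cdot> q" using m(2,3) by simp_all
    show "n = m" by (rule strict_pullback_uniq[OF assms n(1) m(1) n(2,3)])
  qed (use m in simp)
qed (use strict_pullback_legs[OF assms] in simp_all)

lemma strict_product_iso:
  assumes "strict_product C p q" "B \<in> Cell0 C"
  shows "cat_isomorphism (Hom C B (dom1 C p)) (prod_cat (Hom C B (cod1 C p)) (Hom C B (cod1 C q)))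
      (pairing_functor C p q)"
  using assms by (auto simp: strict_product_def)

lemma strict_product_ex:
  assumes "strict_product C p q" "mor C a B (cod1 C p)" "mor C b B (cod1 C q)"
  shows "\<exists>m. mor C m B (dom1 C p) \<and> m \<cdot> p = a \<and> m \<cdot> q = b"
proof -
  have "B \<in> Cell0 C" using assms(2) cell1_closed(1)[of a] by simp
  note iso = strict_product_iso[OF assms(1) this]
  obtain m where "m \<in> Ob (Hom C B (dom1 C p))" "fob (pairing_functor C p q) m = (a, b)"
    by (rule bexE[OF cat_isomorphism_ob_ex[OF iso, of "(a, b)"]]) (use assms in simp_all)
  then show ?thesis by (intro exI[of _ m]) (simp add: pairing_functor_def)
qed

lemma strict_product_uniq:
  assumes "strict_product C p q" "mor C m B (dom1 C p)" "mor C n B (dom1 C p)" "m \<cdot> p = n \<cdot> p"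
    "m \<cdot> q = n \<cdot> q"
  shows "m = n"
proof -
  have "B \<in> Cell0 C" using assms(2) cell1_closed(1)[of m] by simp
  note iso = strict_product_iso[OF assms(1) this]
  show ?thesis
    by (rule cat_isomorphism_ob_inj[OF iso]) (use assms(2-5) in \<open>simp_all add: pairing_functor_def\<close>)
qed

lemma strict_product_uniq2:
  assumes "strict_product C p q" "mor C m B (dom1 C p)" "mor C n B (dom1 C p)" "cell C \<kappa> m n"
    "cell C \<kappa>' m n"
      "\<kappa> \<lhd> p = \<kappa>' \<lhd> p" "\<kappa> \<lhd> q = \<kappa>' \<lhd> q"
  shows "\<kappa> = \<kappa>'"
proof -
  have "B \<in> Cell0 C" using assms(2) cell1_closed(1)[of m] by simp
  note iso = strict_product_iso[OF assms(1) this]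
  show ?thesis
    by (rule cat_isomorphism_ar_inj[OF iso]) (use assms(2-) in \<open>simp_all add: pairing_functor_def\<close>)
qed

end

section \<open>Internal categories\<close>

context category
begin

lemma internal_category_closed [simp]:
  assumes "internal_category D K"
  shows "C0 K \<in> Ob D" "C1 K \<in> Ob D" "C2 K \<in> Ob D"
    "pi0 K \<in> Ar D" "Dm D (pi0 K) = C1 K" "Cd D (pi0 K) = C0 K"
    "pi1 K \<in> Ar D" "Dm D (pi1 K) = C1 K" "Cd D (pi1 K) = C0 K"
    "ie K \<in> Ar D" "Dm D (ie K) = C0 K" "Cd D (ie K) = C1 K"
    "pi01 K \<in> Ar D" "Dm D (pi01 K) = C2 K" "Cd D (pi01 K) = C1 K"
    "pi12 K \<in> Ar D" "Dm D (pi12 K) = C2 K" "Cd D (pi12 K) = C1 K"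
    "pi02 K \<in> Ar D" "Dm D (pi02 K) = C2 K" "Cd D (pi02 K) = C1 K"
  using assms unfolding internal_category_def arr_def by blast+

lemma internal_category_eqs:
  assumes "internal_category D K"
  shows "ie K \<odot> pi0 K = Idn D (C0 K)" "ie K \<odot> pi1 K = Idn D (C0 K)"
    "pi02 K \<odot> pi0 K = pi01 K \<odot> pi0 K" "pi02 K \<odot> pi1 K = pi12 K \<odot> pi1 K"
    "pi01 K \<odot> pi1 K = pi12 K \<odot> pi0 K"
  using assms unfolding internal_category_def is_pullback_def by blast+

text \<open>Removes the description operator from \<open>icomp\<close>: by the pullback property any
  mediator with the right projections is the one it denotes.\<close>

lemma icomp_char:
  assumes K: "internal_category D K"
    and m: "m \<in> Ar D" "Cd D m = C2 K" "m \<odot> pi01 K = a" "m \<odot> pi12 K = b"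
  shows "icomp D K a b = m \<odot> pi02 K"
proof -
  have pb: "is_pullback D (pi01 K) (pi12 K) (pi1 K) (pi0 K)"
    using K unfolding internal_category_def by blast
  have d: "Dm D a = Dm D m" "arr D a (Dm D m) (C1 K)" "arr D b (Dm D m) (C1 K)"
    using K m(1,2) by (simp_all flip: m(3,4) add: arr_def)
  have e: "a \<odot> pi1 K = b \<odot> pi0 K"
    using K m(1,2) internal_category_eqs(5)[OF K] by (simp flip: m(3,4))
  have "\<exists>!n. arr D n (Dm D m) (C2 K) \<and> n \<odot> pi01 K = a \<and> n \<odot> pi12 K = b"
    using pb d(2,3) e K by (simp add: is_pullback_def)
  then have "(THE n. arr D n (Dm D a) (C2 K) \<and> n \<odot> pi01 K = a \<and> n \<odot> pi12 K = b) = m"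
    unfolding d(1) by (rule the1_equality) (use m in \<open>simp add: arr_def\<close>)
  then show ?thesis by (simp add: icomp_def)
qed

lemma composable_mediator:
  assumes K: "internal_category D K"
    and "a \<in> Ar D" "b \<in> Ar D" "Cd D a = C1 K" "Cd D b = C1 K" "a \<odot> pi1 K = b \<odot> pi0 K"
  obtains m where "m \<in> Ar D" "Dm D m = Dm D a" "Cd D m = C2 K" "m \<odot> pi01 K = a" "m \<odot> pi12 K = b"
    "icomp D K a b = m \<odot> pi02 K"
proof -
  have pb: "is_pullback D (pi01 K) (pi12 K) (pi1 K) (pi0 K)"
    using K unfolding internal_category_def by blast
  \<comment> \<open>Composability alone forces a common domain, because equal composites have equal
    domains.\<close>
  have "Dm D (a \<odot> pi1 K) = Dm D (b \<odot> pi0 K)" using assms(6) by simp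
  then have "Dm D b = Dm D a" using assms(1-5) by simp
  then have "\<exists>!n. arr D n (Dm D a) (C2 K) \<and> n \<odot> pi01 K = a \<and> n \<odot> pi12 K = b"
    using pb assms by (simp add: is_pullback_def arr_def)
  then obtain m where m: "arr D m (Dm D a) (C2 K)" "m \<odot> pi01 K = a" "m \<odot> pi12 K = b" by blast
  show ?thesis by (rule that[of m]) (use m icomp_char[OF K _ _ m(2,3)] in \<open>simp_all add: arr_def\<close>)
qed

lemma icomp_closed [simp]:
  assumes K: "internal_category D K"
    and ab: "a \<in> Ar D" "b \<in> Ar D" "Cd D a = C1 K" "Cd D b = C1 K" "a \<odot> pi1 K = b \<odot> pi0 K"
  shows "icomp D K a b \<in> Ar D" "Dm D (icomp D K a b) = Dm D a" "Cd D (icomp D K a b) = C1 K"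
    "icomp D K a b \<odot> pi0 K = a \<odot> pi0 K" "icomp D K a b \<odot> pi1 K = b \<odot> pi1 K"
proof -
  obtain m where m: "m \<in> Ar D" "Dm D m = Dm D a" "Cd D m = C2 K" "m \<odot> pi01 K = a" "m \<odot> pi12 K = b"
    "icomp D K a b = m \<odot> pi02 K" using composable_mediator[OF K ab] by metis
  then show "icomp D K a b \<in> Ar D" "Dm D (icomp D K a b) = Dm D a" "Cd D (icomp D K a b) = C1 K"
    using K by simp_all
  have "icomp D K a b \<odot> pi0 K = (m \<odot> pi01 K) \<odot> pi0 K" "icomp D K a b \<odot> pi1 K = (m \<odot> pi12 K) \<odot> pi1 K"
    using K m(1-3,6) internal_category_eqs[OF K] by simp_all
  then show "icomp D K a b \<odot> pi0 K = a \<odot> pi0 K" "icomp D K a b \<odot> pi1 K = b \<odot> pi1 K"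
    using m(4,5) by simp_all
qed

text \<open>Precomposing the mediator of \<open>a\<close> and \<open>b\<close> with \<open>x\<close>
  gives the mediator of the precomposed arrows. This stability is what permits reasoning with
  generalized elements.\<close>

lemma icomp_pre:
  assumes K: "internal_category D K"
    and ab: "a \<in> Ar D" "b \<in> Ar D" "Cd D a = C1 K" "Cd D b = C1 K" "a \<odot> pi1 K = b \<odot> pi0 K"
    and x: "x \<in> Ar D" "Cd D x = Dm D a"
  shows "x \<odot> icomp D K a b = icomp D K (x \<odot> a) (x \<odot> b)"
proof -
  obtain m where m: "m \<in> Ar D" "Dm D m = Dm D a" "Cd D m = C2 K" "m \<odot> pi01 K = a" "m \<odot> pi12 K = b"
    "icomp D K a b = m \<odot> pi02 K" using composable_mediator[OF K ab] by metis
  have "icomp D K (x \<odot> a) (x \<odot> b) = (x \<odot> m) \<odot> pi02 K"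
    by (rule icomp_char[OF K]) (use K x m in simp_all)
  then show ?thesis using K x m(1-3,6) by simp
qed

text \<open>The unit axiom is given only for the generic arrow \<open>Idn D (C1 K)\<close>;
  precomposing it with \<open>a\<close> yields the law for every generalized arrow.\<close>

lemma icomp_id_left:
  assumes K: "internal_category D K" and a: "a \<in> Ar D" "Cd D a = C1 K" "a \<odot> pi0 K = x"
  shows "icomp D K (x \<odot> ie K) a = a"
proof -
  have "a \<odot> icomp D K (pi0 K \<odot> ie K) (Idn D (C1 K)) = icomp D K (a \<odot> (pi0 K \<odot> ie K)) (a \<odot> Idn D (C1
      K))"
    by (rule icomp_pre[OF K]) (use K a internal_category_eqs[OF K] in simp_all)
  moreover have "icomp D K (pi0 K \<odot> ie K) (Idn D (C1 K)) = Idn D (C1 K)"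
    using K unfolding internal_category_def by blast
  moreover have "a \<odot> (pi0 K \<odot> ie K) = x \<odot> ie K" using K a(1,2) by (simp flip: a(3))
  ultimately show ?thesis using K a(1,2) by simp
qed

lemma icomp_id_right:
  assumes K: "internal_category D K" and a: "a \<in> Ar D" "Cd D a = C1 K" "a \<odot> pi1 K = x"
  shows "icomp D K a (x \<odot> ie K) = a"
proof -
  have "a \<odot> icomp D K (Idn D (C1 K)) (pi1 K \<odot> ie K) = icomp D K (a \<odot> Idn D (C1 K)) (a \<odot> (pi1 K \<odot> ie
      K))"
    by (rule icomp_pre[OF K]) (use K a internal_category_eqs[OF K] in simp_all)
  moreover have "icomp D K (Idn D (C1 K)) (pi1 K \<odot> ie K) = Idn D (C1 K)"
    using K unfolding internal_category_def by blast
  moreover have "a \<odot> (pi1 K \<odot> ie K) = x \<odot> ie K" using K a(1,2) by (simp flip: a(3))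
  ultimately show ?thesis using K a(1,2) by simp
qed

lemma icomp_assoc:
  assumes K: "internal_category D K"
    and "a \<in> Ar D" "b \<in> Ar D" "c \<in> Ar D" "Cd D a = C1 K" "Cd D b = C1 K" "Cd D c = C1 K"
    "a \<odot> pi1 K = b \<odot> pi0 K" "b \<odot> pi1 K = c \<odot> pi0 K"
  shows "icomp D K (icomp D K a b) c = icomp D K a (icomp D K b c)"
proof -
  have "Dm D (a \<odot> pi1 K) = Dm D (b \<odot> pi0 K)" "Dm D (b \<odot> pi1 K) = Dm D (c \<odot> pi0 K)" using assms
    by simp_all
  then have "Dm D b = Dm D a" "Dm D c = Dm D a" using assms(1-7) by simp_all
  moreover have "\<forall>A a b c. arr D a A (C1 K) \<and> arr D b A (C1 K) \<and> arr D c A (C1 K) \<and>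
        a \<odot> pi1 K = b \<odot> pi0 K \<and> b \<odot> pi1 K = c \<odot> pi0 K \<longrightarrow>
        icomp D K (icomp D K a b) c = icomp D K a (icomp D K b c)"
    using K unfolding internal_category_def by blast
  ultimately show ?thesis using assms(2-) by (simp add: arr_def)
qed

section \<open>Internal functors and transformations on generalized elements\<close>

lemma internal_functor_cats:
  assumes "internal_functor D F"
  shows "internal_category D (fsrc F)" "internal_category D (ftrg F)"
  using assms by (simp_all add: internal_functor_def Let_def)

lemma internal_functor_closed [simp]:
  assumes "internal_functor D F"
  shows "F0 F \<in> Ar D" "Dm D (F0 F) = C0 (fsrc F)" "Cd D (F0 F) = C0 (ftrg F)"
    "F1 F \<in> Ar D" "Dm D (F1 F) = C1 (fsrc F)" "Cd D (F1 F) = C1 (ftrg F)"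
    "F2 F \<in> Ar D" "Dm D (F2 F) = C2 (fsrc F)" "Cd D (F2 F) = C2 (ftrg F)"
  using assms by (simp_all add: internal_functor_def arr_def Let_def)

lemma internal_functor_eqs:
  assumes "internal_functor D F" "fsrc F = K" "ftrg F = L"
  shows "F1 F \<odot> pi0 L = pi0 K \<odot> F0 F" "F1 F \<odot> pi1 L = pi1 K \<odot> F0 F" "ie K \<odot> F1 F = F0 F \<odot> ie L"
    "F2 F \<odot> pi01 L = pi01 K \<odot> F1 F" "F2 F \<odot> pi12 L = pi12 K \<odot> F1 F" "F2 F \<odot> pi02 L = pi02 K \<odot> F1 F"
  using assms by (simp_all add: internal_functor_def Let_def)

text \<open>\<open>F2\<close> carries the mediator of a composable pair to the mediator of its image
  and commutes with \<open>pi02\<close>.\<close>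

lemma internal_functor_icomp:
  assumes F: "internal_functor D F" "fsrc F = K" "ftrg F = L"
    and ab: "a \<in> Ar D" "b \<in> Ar D" "Cd D a = C1 K" "Cd D b = C1 K" "a \<odot> pi1 K = b \<odot> pi0 K"
  shows "icomp D K a b \<odot> F1 F = icomp D L (a \<odot> F1 F) (b \<odot> F1 F)"
proof -
  have K: "internal_category D K" and L: "internal_category D L"
    using internal_functor_cats F by auto
  obtain m where m: "m \<in> Ar D" "Dm D m = Dm D a" "Cd D m = C2 K" "m \<odot> pi01 K = a" "m \<odot> pi12 K = b"
    "icomp D K a b = m \<odot> pi02 K" using composable_mediator[OF K ab] by metis
  have "icomp D L (a \<odot> F1 F) (b \<odot> F1 F) = (m \<odot> F2 F) \<odot> pi02 L"
  proof (rule icomp_char[OF L])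
    have "(m \<odot> F2 F) \<odot> pi01 L = (m \<odot> pi01 K) \<odot> F1 F" "(m \<odot> F2 F) \<odot> pi12 L = (m \<odot> pi12 K) \<odot> F1 F"
      using K L F m(1-3) internal_functor_eqs[OF F] by simp_all
    then show "(m \<odot> F2 F) \<odot> pi01 L = a \<odot> F1 F" "(m \<odot> F2 F) \<odot> pi12 L = b \<odot> F1 F"
      using m(4,5) by simp_all
  qed (use m F in simp_all)
  also have "\<dots> = (m \<odot> pi02 K) \<odot> F1 F"
    using K L F m(1-3) internal_functor_eqs[OF F] by simp
  finally show ?thesis using m(6) by simp
qed

lemma internal_nat_functors:
  assumes "internal_nat D \<alpha>"
  shows "internal_functor D (nsrc \<alpha>)" "internal_functor D (ntrg \<alpha>)"
    "fsrc (ntrg \<alpha>) = fsrc (nsrc \<alpha>)" "ftrg (ntrg \<alpha>) = ftrg (nsrc \<alpha>)"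
  using assms by (simp_all add: internal_nat_def Let_def)

lemma internal_nat_closed [simp]:
  assumes "internal_nat D \<alpha>"
  shows "ncomp \<alpha> \<in> Ar D" "Dm D (ncomp \<alpha>) = C0 (fsrc (nsrc \<alpha>))" "Cd D (ncomp \<alpha>) = C1 (ftrg (nsrc \<alpha>))"
  using assms by (simp_all add: internal_nat_def arr_def Let_def)

lemma internal_nat_eqs:
  assumes "internal_nat D \<alpha>" "ftrg (nsrc \<alpha>) = L"
  shows "ncomp \<alpha> \<odot> pi0 L = F0 (nsrc \<alpha>)" "ncomp \<alpha> \<odot> pi1 L = F0 (ntrg \<alpha>)"
  using assms by (simp_all add: internal_nat_def Let_def)

lemma internal_natI:
  assumes "internal_functor D F" "internal_functor D G" "fsrc F = K" "fsrc G = K" "ftrg F = L"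
    "ftrg G = L"
    "n \<in> Ar D" "Dm D n = C0 K" "Cd D n = C1 L" "n \<odot> pi0 L = F0 F" "n \<odot> pi1 L = F0 G"
    "icomp D L (F1 F) (pi1 K \<odot> n) = icomp D L (pi0 K \<odot> n) (F1 G)"
  shows "internal_nat D \<lparr>nsrc = F, ntrg = G, ncomp = n\<rparr>"
  using assms by (simp add: internal_nat_def arr_def Let_def)

text \<open>The naturality axiom speaks of the generic arrow of \<open>K\<close>; precomposition
  with \<open>a\<close> specialises it to an arbitrary one.\<close>

lemma internal_nat_natural:
  assumes \<alpha>: "internal_nat D \<alpha>" and K: "fsrc (nsrc \<alpha>) = K" and L: "ftrg (nsrc \<alpha>) = L"
    and a: "a \<in> Ar D" "Cd D a = C1 K" "a \<odot> pi0 K = x" "a \<odot> pi1 K = y"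
  shows "icomp D L (a \<odot> F1 (nsrc \<alpha>)) (y \<odot> ncomp \<alpha>) = icomp D L (x \<odot> ncomp \<alpha>) (a \<odot> F1 (ntrg \<alpha>))"
proof -
  note f = internal_nat_functors[OF \<alpha>]
  have KL: "internal_category D K" "internal_category D L"
    using internal_functor_cats[OF f(1)] K L by auto
  note e1 = internal_functor_eqs[OF f(1) K L] and e2 = internal_functor_eqs[OF f(2), of K L]
  have "a \<odot> icomp D L (F1 (nsrc \<alpha>)) (pi1 K \<odot> ncomp \<alpha>) = icomp D L (a \<odot> F1 (nsrc \<alpha>)) (a \<odot> (pi1 K \<odot>
      ncomp \<alpha>))"
    by (rule icomp_pre) (use f KL K L a \<alpha> e1 internal_nat_eqs[OF \<alpha> L] in simp_all)
  moreover have "a \<odot> icomp D L (pi0 K \<odot> ncomp \<alpha>) (F1 (ntrg \<alpha>))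
      = icomp D L (a \<odot> (pi0 K \<odot> ncomp \<alpha>)) (a \<odot> F1 (ntrg \<alpha>))"
    by (rule icomp_pre) (use f KL K L a \<alpha> e2 internal_nat_eqs[OF \<alpha> L] in simp_all)
  moreover have "icomp D L (F1 (nsrc \<alpha>)) (pi1 K \<odot> ncomp \<alpha>)
      = icomp D L (pi0 K \<odot> ncomp \<alpha>) (F1 (ntrg \<alpha>))"
    using \<alpha> K L by (simp add: internal_nat_def Let_def)
  moreover have "a \<odot> (pi1 K \<odot> ncomp \<alpha>) = y \<odot> ncomp \<alpha>" "a \<odot> (pi0 K \<odot> ncomp \<alpha>) = x \<odot> ncomp \<alpha>"
    using KL K a(1,2) \<alpha> by (simp_all flip: a(3,4))
  ultimately show ?thesis by simp
qed

section \<open>The 2-category of internal categories\<close>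

lemma IntCat_simps [simp]:
  "Cell0 (IntCat D) = {K. internal_category D K}"
  "Cell1 (IntCat D) = {F. internal_functor D F}"
  "Cell2 (IntCat D) = {\<alpha>. internal_nat D \<alpha>}"
  "dom1 (IntCat D) = fsrc" "cod1 (IntCat D) = ftrg" "dom2 (IntCat D) = nsrc"
    "cod2 (IntCat D) = ntrg"
  "id1 (IntCat D) K = \<lparr>fsrc = K, ftrg = K, F0 = Idn D (C0 K), F1 = Idn D (C1 K), F2 = Idn D (C2 K)\<rparr>"
  "comp1 (IntCat D) F G = \<lparr>fsrc = fsrc F, ftrg = ftrg G,
        F0 = F0 F \<odot> F0 G, F1 = F1 F \<odot> F1 G, F2 = F2 F \<odot> F2 G\<rparr>"
  "id2 (IntCat D) F = \<lparr>nsrc = F, ntrg = F, ncomp = F0 F \<odot> ie (ftrg F)\<rparr>"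
  "vcomp (IntCat D) \<alpha> \<beta> = \<lparr>nsrc = nsrc \<alpha>, ntrg = ntrg \<beta>,
        ncomp = icomp D (ftrg (nsrc \<alpha>)) (ncomp \<alpha>) (ncomp \<beta>)\<rparr>"
  by (simp_all add: IntCat_def)

lemma internal_functor_id:
  assumes "internal_category D K"
  shows "internal_functor D (id1 (IntCat D) K)"
  using assms by (simp add: internal_functor_def arr_def)

lemma internal_functor_comp:
  assumes F: "internal_functor D F" and G: "internal_functor D G" and "ftrg F = fsrc G"
  shows "internal_functor D (comp1 (IntCat D) F G)"
proof -
  define K L M where "K = fsrc F" "L = fsrc G" "M = ftrg G"
  note k = this[symmetric]
  have K: "internal_category D K" "internal_category D L" "internal_category D M"
    using internal_functor_cats[OF F] internal_functor_cats[OF G] k by auto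
  have l: "ftrg F = L" using assms(3) k by simp
  note eF = internal_functor_eqs[OF F k(1) l] and eG = internal_functor_eqs[OF G k(2,3)]
  \<comment> \<open>Composites are right-associated, so an equation between two-fold composites has
    to be made applicable in front of a further factor \<open>z\<close>.\<close>
  have r: "x \<odot> (y \<odot> z) = x' \<odot> (y' \<odot> z)" if "x \<odot> y = x' \<odot> y'" "x \<in> Ar D" "y \<in> Ar D" "x' \<in> Ar D"
    "y' \<in> Ar D" "z \<in> Ar D"
    "Cd D x = Dm D y" "Cd D x' = Dm D y'" "Cd D y = Dm D z" "Cd D y' = Dm D z" for x y z x' y'
    using that cmp_assoc by metis
  show ?thesis
    unfolding internal_functor_def Let_def
    using F G K k l
    by (simp add: arr_def eG) (simp add: r[OF eF(1)] r[OF eF(2)] r[OF eF(3)] r[OF eF(4)] r[OF eF(5)]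
      r[OF eF(6)] eG)
qed

lemma internal_nat_id:
  assumes F: "internal_functor D F"
  shows "internal_nat D (id2 (IntCat D) F)"
proof -
  define K L where "K = fsrc F" "L = ftrg F"
  note k = this[symmetric]
  have K: "internal_category D K" "internal_category D L"
    using internal_functor_cats[OF F] k by auto
  note eF = internal_functor_eqs[OF F k]
  have "icomp D L (F1 F) ((pi1 K \<odot> F0 F) \<odot> ie L) = F1 F"
    "icomp D L ((pi0 K \<odot> F0 F) \<odot> ie L) (F1 F) = F1 F"
    by (rule icomp_id_right icomp_id_left; use K F k eF in simp)+
  then show ?thesis unfolding IntCat_simps k
    by (intro internal_natI[of _ _ K L]) (use F K k eF internal_category_eqs in simp_all)
qed

lemma internal_nat_vcomp:
  assumes \<alpha>: "internal_nat D \<alpha>" and \<beta>: "internal_nat D \<beta>" and "ntrg \<alpha> = nsrc \<beta>"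
  shows "internal_nat D (vcomp (IntCat D) \<alpha> \<beta>)"
proof -
  define F G H where "F = nsrc \<alpha>" "G = nsrc \<beta>" "H = ntrg \<beta>"
  note f = this[symmetric]
  define K L where "K = fsrc F" "L = ftrg F"
  note k = this[symmetric]
  have g: "ntrg \<alpha> = G" using assms f by simp
  have kl: "fsrc G = K" "ftrg G = L" "fsrc H = K" "ftrg H = L"
    using internal_nat_functors(3,4)[OF \<alpha>] internal_nat_functors(3,4)[OF \<beta>] k f g by simp_all
  have F: "internal_functor D F" "internal_functor D G" "internal_functor D H"
    using internal_nat_functors[OF \<alpha>] internal_nat_functors[OF \<beta>] f by simp_all
  have K: "internal_category D K" "internal_category D L"
    using internal_functor_cats[OF F(1)] k by auto
  note eF = internal_functor_eqs[OF F(1) k] and eG = internal_functor_eqs[OF F(2) kl(1,2)]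
    and eH = internal_functor_eqs[OF F(3) kl(3,4)]
  note na = internal_nat_eqs[OF \<alpha>, of L] and nb = internal_nat_eqs[OF \<beta>, of L]
  note s = F K k kl f g eF eG eH na nb \<alpha> \<beta>
  have nat: "icomp D L (F1 F) (pi1 K \<odot> ncomp \<alpha>) = icomp D L (pi0 K \<odot> ncomp \<alpha>) (F1 G)"
    "icomp D L (F1 G) (pi1 K \<odot> ncomp \<beta>) = icomp D L (pi0 K \<odot> ncomp \<beta>) (F1 H)"
    using \<alpha> \<beta> f g k kl by (simp_all add: internal_nat_def Let_def)
  have "icomp D L (F1 F) (pi1 K \<odot> icomp D L (ncomp \<alpha>) (ncomp \<beta>))
     = icomp D L (F1 F) (icomp D L (pi1 K \<odot> ncomp \<alpha>) (pi1 K \<odot> ncomp \<beta>))"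
    by (subst icomp_pre) (use s in simp_all)
  also have "\<dots> = icomp D L (icomp D L (F1 F) (pi1 K \<odot> ncomp \<alpha>)) (pi1 K \<odot> ncomp \<beta>)"
    by (subst icomp_assoc) (use s in simp_all)
  also have "\<dots> = icomp D L (pi0 K \<odot> ncomp \<alpha>) (icomp D L (F1 G) (pi1 K \<odot> ncomp \<beta>))"
    unfolding nat(1) by (subst icomp_assoc) (use s in simp_all)
  also have "\<dots> = icomp D L (icomp D L (pi0 K \<odot> ncomp \<alpha>) (pi0 K \<odot> ncomp \<beta>)) (F1 H)"
    unfolding nat(2) by (subst icomp_assoc) (use s in simp_all)
  also have "\<dots> = icomp D L (pi0 K \<odot> icomp D L (ncomp \<alpha>) (ncomp \<beta>)) (F1 H)"
    by (subst icomp_pre) (use s in simp_all)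
  finally show ?thesis unfolding IntCat_simps f k
    by (intro internal_natI[of _ _ K L]) (use s in simp_all)
qed

text \<open>Apply \<open>H\<close> to the naturality square of \<alpha>;
  \<open>internal_functor_icomp\<close> distributes it over both composites.\<close>

lemma internal_nat_post:
  assumes \<alpha>: "internal_nat D \<alpha>" and H: "internal_functor D H" "ftrg (nsrc \<alpha>) = fsrc H"
  shows "internal_nat D \<lparr>nsrc = comp1 (IntCat D) (nsrc \<alpha>) H, ntrg = comp1 (IntCat D) (ntrg \<alpha>) H,
      ncomp = ncomp \<alpha> \<odot> F1 H\<rparr>"
proof -
  define F G where "F = nsrc \<alpha>" "G = ntrg \<alpha>"
  note f = this[symmetric]
  define K L M where "K = fsrc F" "L = ftrg F" "M = ftrg H"
  note k = this[symmetric]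
  have kl: "fsrc G = K" "ftrg G = L" "fsrc H = L"
    using internal_nat_functors(3,4)[OF \<alpha>] H k f by simp_all
  have F: "internal_functor D F" "internal_functor D G"
    using internal_nat_functors[OF \<alpha>] f by simp_all
  have K: "internal_category D K" "internal_category D L" "internal_category D M"
    using internal_functor_cats[OF F(1)] internal_functor_cats[OF H(1)] k by auto
  note eF = internal_functor_eqs[OF F(1) k(1,2)] and eG = internal_functor_eqs[OF F(2) kl(1,2)]
    and eH = internal_functor_eqs[OF H(1) kl(3) k(3)]
  note na = internal_nat_eqs[OF \<alpha>, of L]
  have r: "x \<odot> (y \<odot> z) = w \<odot> z" if "x \<odot> y = w" "x \<in> Ar D" "y \<in> Ar D" "z \<in> Ar D"
    "Cd D x = Dm D y" "Cd D y = Dm D z" for x y z w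
    using that cmp_assoc by metis
  have nat: "icomp D L (F1 F) (pi1 K \<odot> ncomp \<alpha>) = icomp D L (pi0 K \<odot> ncomp \<alpha>) (F1 G)"
    using \<alpha> f k kl by (simp_all add: internal_nat_def Let_def)
  have "icomp D L (F1 F) (pi1 K \<odot> ncomp \<alpha>) \<odot> F1 H = icomp D M (F1 F \<odot> F1 H) ((pi1 K \<odot> ncomp \<alpha>) \<odot> F1
      H)"
    by (rule internal_functor_icomp[OF H(1) kl(3) k(3)]) (use F K k kl f eF eG na \<alpha> in simp_all)
  moreover have "icomp D L (pi0 K \<odot> ncomp \<alpha>) (F1 G) \<odot> F1 H
      = icomp D M ((pi0 K \<odot> ncomp \<alpha>) \<odot> F1 H) (F1 G \<odot> F1 H)"
    by (rule internal_functor_icomp[OF H(1) kl(3) k(3)]) (use F K k kl f eF eG na \<alpha> in simp_all)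
  ultimately have n: "icomp D M (F1 F \<odot> F1 H) (pi1 K \<odot> (ncomp \<alpha> \<odot> F1 H))
      = icomp D M (pi0 K \<odot> (ncomp \<alpha> \<odot> F1 H)) (F1 G \<odot> F1 H)"
    using nat F K k kl f \<alpha> H by simp
  have c: "internal_functor D (comp1 (IntCat D) F H)" "internal_functor D (comp1 (IntCat D) G H)"
    by (rule internal_functor_comp; use F H k kl in simp)+
  have "(ncomp \<alpha> \<odot> F1 H) \<odot> pi0 M = F0 F \<odot> F0 H" "(ncomp \<alpha> \<odot> F1 H) \<odot> pi1 M = F0 G \<odot> F0 H"
    using F K k kl f \<alpha> H eH r[OF na(1)] r[OF na(2)] by simp_all
  then show ?thesis unfolding f
    by (intro internal_natI[of _ _ K M]) (use c n F K k kl f \<alpha> H in simp_all)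
qed

text \<open>The required square is the naturality of \<beta> at the generalized arrow
  \<open>F1 H\<close>.\<close>

lemma internal_nat_pre:
  assumes \<beta>: "internal_nat D \<beta>" and H: "internal_functor D H" "ftrg H = fsrc (nsrc \<beta>)"
  shows "internal_nat D \<lparr>nsrc = comp1 (IntCat D) H (nsrc \<beta>), ntrg = comp1 (IntCat D) H (ntrg \<beta>),
      ncomp = F0 H \<odot> ncomp \<beta>\<rparr>"
proof -
  define F G where "F = nsrc \<beta>" "G = ntrg \<beta>"
  note f = this[symmetric]
  define K L M where "K = fsrc H" "L = fsrc F" "M = ftrg F"
  note k = this[symmetric]
  have kl: "fsrc G = L" "ftrg G = M" "ftrg H = L"
    using internal_nat_functors(3,4)[OF \<beta>] H k f by simp_all
  have F: "internal_functor D F" "internal_functor D G"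
    using internal_nat_functors[OF \<beta>] f by simp_all
  have K: "internal_category D K" "internal_category D L" "internal_category D M"
    using internal_functor_cats[OF F(1)] internal_functor_cats[OF H(1)] k by auto
  note eH = internal_functor_eqs[OF H(1) k(1) kl(3)]
  note na = internal_nat_eqs[OF \<beta>, of M]
  have "icomp D M (F1 H \<odot> F1 F) ((pi1 K \<odot> F0 H) \<odot> ncomp \<beta>)
      = icomp D M ((pi0 K \<odot> F0 H) \<odot> ncomp \<beta>) (F1 H \<odot> F1 G)"
    unfolding f[symmetric]
    by (rule internal_nat_natural[OF \<beta>]) (use F H K k kl f eH in simp_all)
  then have n: "icomp D M (F1 H \<odot> F1 F) (pi1 K \<odot> (F0 H \<odot> ncomp \<beta>))
      = icomp D M (pi0 K \<odot> (F0 H \<odot> ncomp \<beta>)) (F1 H \<odot> F1 G)"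
    using F K k kl f \<beta> H by simp
  have c: "internal_functor D (comp1 (IntCat D) H F)" "internal_functor D (comp1 (IntCat D) H G)"
    by (rule internal_functor_comp; use F H k kl in simp)+
  show ?thesis unfolding f
    by (intro internal_natI[of _ _ K M]) (use c n F K k kl f \<beta> H na in simp_all)
qed

text \<open>With the horizontal composite written as a vertical composite of two whiskerings, its
  being a transformation follows from the three closure lemmas above.\<close>

lemma IntCat_hcomp:
  "hcomp (IntCat D) \<alpha> \<beta> = vcomp (IntCat D)
      \<lparr>nsrc = comp1 (IntCat D) (nsrc \<alpha>) (nsrc \<beta>), ntrg = comp1 (IntCat D) (ntrg \<alpha>) (nsrc \<beta>),
          ncomp = ncomp \<alpha> \<odot> F1 (nsrc \<beta>)\<rparr>
      \<lparr>nsrc = comp1 (IntCat D) (ntrg \<alpha>) (nsrc \<beta>), ntrg = comp1 (IntCat D) (ntrg \<alpha>) (ntrg \<beta>),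
          ncomp = F0 (ntrg \<alpha>) \<odot> ncomp \<beta>\<rparr>"
  by (simp add: IntCat_def Let_def)

text \<open>All typing and endpoint facts of a transformation, phrased with fixed names
  \<open>K\<close> and \<open>L\<close>, so that the computations below can use them as one set of
  rewrite rules.\<close>

lemma internal_nat_data:
  assumes \<alpha>: "internal_nat D \<alpha>" and k: "fsrc (nsrc \<alpha>) = K" "ftrg (nsrc \<alpha>) = L"
  shows "internal_nat D \<alpha>" "internal_functor D (nsrc \<alpha>)" "internal_functor D (ntrg \<alpha>)"
    "fsrc (nsrc \<alpha>) = K" "ftrg (nsrc \<alpha>) = L"
    "fsrc (ntrg \<alpha>) = K" "ftrg (ntrg \<alpha>) = L" "internal_category D K" "internal_category D L"
    "F1 (nsrc \<alpha>) \<odot> pi0 L = pi0 K \<odot> F0 (nsrc \<alpha>)" "F1 (nsrc \<alpha>) \<odot> pi1 L = pi1 K \<odot> F0 (nsrc \<alpha>)"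
    "ie K \<odot> F1 (nsrc \<alpha>) = F0 (nsrc \<alpha>) \<odot> ie L"
    "F1 (ntrg \<alpha>) \<odot> pi0 L = pi0 K \<odot> F0 (ntrg \<alpha>)" "F1 (ntrg \<alpha>) \<odot> pi1 L = pi1 K \<odot> F0 (ntrg \<alpha>)"
    "ie K \<odot> F1 (ntrg \<alpha>) = F0 (ntrg \<alpha>) \<odot> ie L"
    "ncomp \<alpha> \<odot> pi0 L = F0 (nsrc \<alpha>)" "ncomp \<alpha> \<odot> pi1 L = F0 (ntrg \<alpha>)"
  using \<alpha> internal_nat_functors[OF \<alpha>] k internal_functor_cats[OF internal_nat_functors(1)[OF \<alpha>]]
    internal_functor_eqs[OF internal_nat_functors(1)[OF \<alpha>] k]
    internal_functor_eqs[OF internal_nat_functors(2)[OF \<alpha>], of K L] internal_nat_eqs[OF \<alpha> k(2)]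
  by auto

lemma cmp_reassoc:
  "x \<odot> y = w \<Longrightarrow> x \<in> Ar D \<Longrightarrow> y \<in> Ar D \<Longrightarrow> z \<in> Ar D \<Longrightarrow> Cd D x = Dm D y \<Longrightarrow> Cd D y = Dm D z \<Longrightarrow>
    x \<odot> (y \<odot> z) = w \<odot> z"
  using cmp_assoc by metis

lemma internal_nat_hcomp:
  assumes \<alpha>: "internal_nat D \<alpha>" and \<beta>: "internal_nat D \<beta>" and "ftrg (nsrc \<alpha>) = fsrc (nsrc \<beta>)"
  shows "internal_nat D (hcomp (IntCat D) \<alpha> \<beta>)"
  unfolding IntCat_hcomp
  by (intro internal_nat_vcomp internal_nat_pre internal_nat_post)
    (use assms internal_nat_functors[OF \<alpha>] internal_nat_functors[OF \<beta>] in simp_all)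

text \<open>Both sides are triple composites in the last category. On the left the functor
  \<open>nsrc \<gamma>\<close> is distributed over a composite, on the right a precomposition is;
  what remains is associativity of \<open>icomp\<close>.\<close>

lemma internal_nat_hcomp_assoc:
  assumes \<alpha>: "internal_nat D \<alpha>" and \<beta>: "internal_nat D \<beta>" and \<gamma>: "internal_nat D \<gamma>"
    and c: "ftrg (nsrc \<alpha>) = fsrc (nsrc \<beta>)" "ftrg (nsrc \<beta>) = fsrc (nsrc \<gamma>)"
  shows "hcomp (IntCat D) (hcomp (IntCat D) \<alpha> \<beta>) \<gamma> = hcomp (IntCat D) \<alpha> (hcomp (IntCat D) \<beta> \<gamma>)"
proof -
  define K L M N where "K = fsrc (nsrc \<alpha>)" "L = fsrc (nsrc \<beta>)" "M = fsrc (nsrc \<gamma>)"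
    "N = ftrg (nsrc \<gamma>)"
  note k = this[symmetric]
  note A = internal_nat_data[OF \<alpha>, of K L] and B = internal_nat_data[OF \<beta>, of L M]
    and E = internal_nat_data[OF \<gamma>, of M N]
  note s = A B E k c
  have "icomp D N (icomp D M (ncomp \<alpha> \<odot> F1 (nsrc \<beta>)) (F0 (ntrg \<alpha>) \<odot> ncomp \<beta>) \<odot> F1 (nsrc \<gamma>)) ((F0
      (ntrg \<alpha>) \<odot> F0 (ntrg \<beta>)) \<odot> ncomp \<gamma>)
    = icomp D N (icomp D N (ncomp \<alpha> \<odot> (F1 (nsrc \<beta>) \<odot> F1 (nsrc \<gamma>))) (F0 (ntrg \<alpha>) \<odot> (ncomp \<beta> \<odot> F1
        (nsrc \<gamma>)))) (F0 (ntrg \<alpha>) \<odot> (F0 (ntrg \<beta>) \<odot> ncomp \<gamma>))"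
    by (subst internal_functor_icomp[of _ M N]) (use s in \<open>simp_all add: cmp_reassoc[OF A(17)]\<close>)
  also have "\<dots> = icomp D N (ncomp \<alpha> \<odot> (F1 (nsrc \<beta>) \<odot> F1 (nsrc \<gamma>))) (icomp D N (F0 (ntrg \<alpha>) \<odot> (ncomp
      \<beta> \<odot> F1 (nsrc \<gamma>))) (F0 (ntrg \<alpha>) \<odot> (F0 (ntrg \<beta>) \<odot> ncomp \<gamma>)))"
    by (rule icomp_assoc) (use s in \<open>simp_all add: cmp_reassoc[OF A(17)] cmp_reassoc[OF B(16)]
      cmp_reassoc[OF B(17)] cmp_reassoc[OF B(11)]\<close>)
  also have "\<dots> = icomp D N (ncomp \<alpha> \<odot> (F1 (nsrc \<beta>) \<odot> F1 (nsrc \<gamma>))) (F0 (ntrg \<alpha>) \<odot> icomp D N (ncomp \<beta>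
      \<odot> F1 (nsrc \<gamma>)) (F0 (ntrg \<beta>) \<odot> ncomp \<gamma>))"
    by (subst icomp_pre) (use s in \<open>simp_all add: cmp_reassoc[OF B(17)]\<close>)
  finally show ?thesis using s by (simp add: IntCat_hcomp)
qed

text \<open>Each side is a composite of four arrows, and the two sides differ only in the middle
  two. These are exchanged by naturality of \<alpha>' at the arrow
  \<open>ncomp \<beta>\<close>.\<close>

lemma internal_nat_interchange:
  assumes a: "internal_nat D \<alpha>" "internal_nat D \<beta>" "ntrg \<alpha> = nsrc \<beta>"
    and a': "internal_nat D \<alpha>'" "internal_nat D \<beta>'" "ntrg \<alpha>' = nsrc \<beta>'"
    and c: "ftrg (nsrc \<alpha>) = fsrc (nsrc \<alpha>')"
  shows "hcomp (IntCat D) (vcomp (IntCat D) \<alpha> \<beta>) (vcomp (IntCat D) \<alpha>' \<beta>') =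
    vcomp (IntCat D) (hcomp (IntCat D) \<alpha> \<alpha>') (hcomp (IntCat D) \<beta> \<beta>')"
proof -
  define K L M where "K = fsrc (nsrc \<alpha>)" "L = fsrc (nsrc \<alpha>')" "M = ftrg (nsrc \<alpha>')"
  note k = this[symmetric]
  have k': "fsrc (nsrc \<beta>) = K" "ftrg (nsrc \<beta>) = L" "fsrc (nsrc \<beta>') = L" "ftrg (nsrc \<beta>') = M"
    using internal_nat_functors[OF a(1)] internal_nat_functors[OF a'(1)] a(3) a'(3) c k by simp_all
  note A = internal_nat_data[OF a(1), of K L] and B = internal_nat_data[OF a(2), of K L]
    and A' = internal_nat_data[OF a'(1), of L M] and B' = internal_nat_data[OF a'(2), of L M]
  note s = A B A' B' k c k' a(3) a'(3)
  let ?a = "ncomp \<alpha> \<odot> F1 (nsrc \<alpha>')" and ?b = "ncomp \<beta> \<odot> F1 (nsrc \<alpha>')"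
    and ?b' = "ncomp \<beta> \<odot> F1 (nsrc \<beta>')"
  let ?c = "F0 (ntrg \<beta>) \<odot> ncomp \<alpha>'" and ?d = "F0 (ntrg \<beta>) \<odot> ncomp \<beta>'"
    and ?c' = "F0 (nsrc \<beta>) \<odot> ncomp \<alpha>'"
  have nat: "icomp D M ?b ?c = icomp D M ?c' ?b'"
    using internal_nat_natural[OF a'(1), of L M "ncomp \<beta>"] s by simp
  note r = cmp_reassoc[OF A(17)] cmp_reassoc[OF B(17)] cmp_reassoc[OF B(16)] cmp_reassoc[OF A(16)]
    cmp_reassoc[OF A'(10)] cmp_reassoc[OF A'(11)] cmp_reassoc[OF B'(10)] cmp_reassoc[OF B'(11)]
  have "icomp D M (icomp D L (ncomp \<alpha>) (ncomp \<beta>) \<odot> F1 (nsrc \<alpha>')) (F0 (ntrg \<beta>) \<odot> icomp D M (ncomp \<alpha>')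
      (ncomp \<beta>'))
    = icomp D M (icomp D M ?a ?b) (icomp D M ?c ?d)"
  proof -
    have "icomp D L (ncomp \<alpha>) (ncomp \<beta>) \<odot> F1 (nsrc \<alpha>') = icomp D M ?a ?b"
      by (rule internal_functor_icomp) (use s in simp_all)
    moreover have "F0 (ntrg \<beta>) \<odot> icomp D M (ncomp \<alpha>') (ncomp \<beta>') = icomp D M ?c ?d"
      by (rule icomp_pre) (use s in simp_all)
    ultimately show ?thesis by simp
  qed
  also have "\<dots> = icomp D M ?a (icomp D M ?b (icomp D M ?c ?d))"
    by (rule icomp_assoc) (use s in \<open>simp_all add: r\<close>)
  also have "icomp D M ?b (icomp D M ?c ?d) = icomp D M (icomp D M ?b ?c) ?d"
    by (rule icomp_assoc[symmetric]) (use s in \<open>simp_all add: r\<close>)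
  also have "\<dots> = icomp D M ?c' (icomp D M ?b' ?d)"
    unfolding nat by (rule icomp_assoc) (use s in \<open>simp_all add: r\<close>)
  also have "icomp D M ?a (icomp D M ?c' (icomp D M ?b' ?d))
      = icomp D M (icomp D M ?a ?c') (icomp D M ?b' ?d)"
    by (rule icomp_assoc[symmetric]) (use s in \<open>simp_all add: r\<close>)
  finally show ?thesis using s by (simp add: IntCat_hcomp)
qed

text \<open>\<open>two_functor\<close> requires its codomain to be a 2-category; for
  \<open>Cong C\<close> this will be inherited from here.\<close>

theorem two_category_IntCat: "two_category (IntCat D)"
  (is "two_category ?I")
proof
  fix f assume "f \<in> Ar (under ?I)"
  then show "Dm (under ?I) f \<in> Ob (under ?I)" "Cd (under ?I) f \<in> Ob (under ?I)"
    using internal_functor_cats by simp_all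
next
  fix x assume "x \<in> Ob (under ?I)"
  then show "mor ?I (Idn (under ?I) x) x x" using internal_functor_id[of x] by simp
next
  fix f x y g z assume "mor ?I f x y" "mor ?I g y z"
  then show "mor ?I (Cmp (under ?I) f g) x z" using internal_functor_comp[of f g] by simp
next
  fix f x y assume "mor ?I f x y"
  then show "Cmp (under ?I) (Idn (under ?I) x) f = f" "Cmp (under ?I) f (Idn (under ?I) y) = f"
    by (auto intro: ifun.equality)
next
  fix f g h w x y z assume "mor ?I f w x" "mor ?I g x y" "mor ?I h y z"
  then show "Cmp (under ?I) (Cmp (under ?I) f g) h = Cmp (under ?I) f (Cmp (under ?I) g h)"
    by auto
next
  fix f assume "f \<in> Ar (vert ?I)"
  then show "Dm (vert ?I) f \<in> Ob (vert ?I)" "Cd (vert ?I) f \<in> Ob (vert ?I)"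
    using internal_nat_functors by simp_all
next
  fix x assume "x \<in> Ob (vert ?I)"
  then show "cell ?I (Idn (vert ?I) x) x x" using internal_nat_id[of x] by simp
next
  fix f x y g z assume "cell ?I f x y" "cell ?I g y z"
  then show "cell ?I (Cmp (vert ?I) f g) x z" using internal_nat_vcomp[of f g] by simp
next
  fix f x y assume f: "cell ?I f x y"
  then have nat: "internal_nat D f" by simp
  note A = internal_nat_data[OF nat refl refl]
  have "icomp D (ftrg (nsrc f)) (F0 (nsrc f) \<odot> ie (ftrg (nsrc f))) (ncomp f) = ncomp f"
    "icomp D (ftrg (nsrc f)) (ncomp f) (F0 (ntrg f) \<odot> ie (ftrg (ntrg f))) = ncomp f"
    using A by (simp_all add: icomp_id_left icomp_id_right)
  then show "Cmp (vert ?I) (Idn (vert ?I) x) f = f" "Cmp (vert ?I) f (Idn (vert ?I) y) = f"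
    using f by (auto intro: inat.equality)
next
  fix f g h w x y z assume s: "cell ?I f w x" "cell ?I g x y" "cell ?I h y z"
  then have nat: "internal_nat D f" "internal_nat D g" "internal_nat D h" by simp_all
  define K L where "K = fsrc (nsrc f)" "L = ftrg (nsrc f)"
  note k = this[symmetric]
  have k': "fsrc (nsrc g) = K" "ftrg (nsrc g) = L" "fsrc (nsrc h) = K" "ftrg (nsrc h) = L"
    using internal_nat_functors[OF nat(1)] internal_nat_functors[OF nat(2)] s k by auto
  have "icomp D L (icomp D L (ncomp f) (ncomp g)) (ncomp h)
      = icomp D L (ncomp f) (icomp D L (ncomp g) (ncomp h))"
    using internal_nat_data[OF nat(1) k] internal_nat_data[OF nat(2) k'(1,2)] internal_nat_data[OF
      nat(3) k'(3,4)] s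
    by (intro icomp_assoc) auto
  then show "Cmp (vert ?I) (Cmp (vert ?I) f g) h = Cmp (vert ?I) f (Cmp (vert ?I) g h)"
    using s k k' by simp
next
  fix \<alpha> assume a: "\<alpha> \<in> Cell2 ?I"
  then show "dom1 ?I (dom2 ?I \<alpha>) = dom1 ?I (cod2 ?I \<alpha>)"
    "cod1 ?I (dom2 ?I \<alpha>) = cod1 ?I (cod2 ?I \<alpha>)"
    using internal_nat_functors by simp_all
  from a have nat: "internal_nat D \<alpha>" by simp
  define K L where "K = fsrc (nsrc \<alpha>)" "L = ftrg (nsrc \<alpha>)"
  note k = this[symmetric]
  note A = internal_nat_data[OF nat k]
  \<comment> \<open>Whiskering an identity transformation with the source of \<alpha> produces
    \<open>ie K\<close> followed by \<open>F1\<close>, which is an identity arrow of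
    \<open>L\<close> because functors preserve identities.\<close>
  have "icomp D L (ie K \<odot> F1 (nsrc \<alpha>)) (ncomp \<alpha>) = ncomp \<alpha>"
    "icomp D L (ncomp \<alpha>) (F0 (ntrg \<alpha>) \<odot> ie L) = ncomp \<alpha>"
    unfolding A(12) by (rule icomp_id_left icomp_id_right; use A in simp)+
  then show "hcomp ?I (id2 ?I (id1 ?I (dom1 ?I (dom2 ?I \<alpha>)))) \<alpha> = \<alpha>"
    "hcomp ?I \<alpha> (id2 ?I (id1 ?I (cod1 ?I (dom2 ?I \<alpha>)))) = \<alpha>"
    using A by (auto simp: IntCat_hcomp intro!: inat.equality ifun.equality)
next
  fix \<alpha> \<beta> assume "hcomposable ?I \<alpha> \<beta>"
  then show "cell ?I (hcomp ?I \<alpha> \<beta>) (comp1 ?I (dom2 ?I \<alpha>) (dom2 ?I \<beta>))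
      (comp1 ?I (cod2 ?I \<alpha>) (cod2 ?I \<beta>))"
    using internal_nat_hcomp[of \<alpha> \<beta>] by (simp add: hcomposable_def) (simp add: IntCat_hcomp)
next
  fix \<alpha> \<beta> \<gamma> assume "hcomposable ?I \<alpha> \<beta>" "hcomposable ?I \<beta> \<gamma>"
  then show "hcomp ?I (hcomp ?I \<alpha> \<beta>) \<gamma> = hcomp ?I \<alpha> (hcomp ?I \<beta> \<gamma>)"
    using internal_nat_hcomp_assoc[of \<alpha> \<beta> \<gamma>] by (simp add: hcomposable_def)
next
  fix f X Y g Z assume s: "mor ?I f X Y" "mor ?I g Y Z"
  then have f: "internal_functor D f" "internal_functor D g" by simp_all
  note e = internal_functor_eqs[OF f(1) refl refl] internal_functor_eqs[OF f(2) refl refl]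
    internal_functor_cats[OF f(1)] internal_functor_cats[OF f(2)]
  have "icomp D Z ((F0 f \<odot> F0 g) \<odot> ie Z) ((F0 f \<odot> F0 g) \<odot> ie Z) = (F0 f \<odot> F0 g) \<odot> ie Z"
    by (rule icomp_id_left) (use s f e internal_category_eqs in auto)
  then show "hcomp ?I (id2 ?I f) (id2 ?I g) = id2 ?I (comp1 ?I f g)"
    using s e f by (auto simp: IntCat_hcomp)
next
  fix \<alpha> f g \<beta> h \<alpha>' f' g' \<beta>' h'
  assume "cell ?I \<alpha> f g" "cell ?I \<beta> g h" "cell ?I \<alpha>' f' g'" "cell ?I \<beta>' g' h'"
      "cod1 ?I f = dom1 ?I f'"
  then show "hcomp ?I (vcomp ?I \<alpha> \<beta>) (vcomp ?I \<alpha>' \<beta>') =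
       vcomp ?I (hcomp ?I \<alpha> \<alpha>') (hcomp ?I \<beta> \<beta>')"
    by (intro internal_nat_interchange) simp_all
qed

end

lemma full_sub_simps [simp]:
  "Cell0 (full_sub C S) = {X \<in> Cell0 C. S X}"
  "Cell1 (full_sub C S) = {f \<in> Cell1 C. S (dom1 C f) \<and> S (cod1 C f)}"
  "Cell2 (full_sub C S) = {\<alpha> \<in> Cell2 C. S (dom1 C (dom2 C \<alpha>)) \<and> S (cod1 C (dom2 C \<alpha>))}"
  "dom1 (full_sub C S) = dom1 C" "cod1 (full_sub C S) = cod1 C" "id1 (full_sub C S) = id1 C"
  "comp1 (full_sub C S) = comp1 C" "dom2 (full_sub C S) = dom2 C" "cod2 (full_sub C S) = cod2 C"
  "id2 (full_sub C S) = id2 C" "vcomp (full_sub C S) = vcomp C" "hcomp (full_sub C S) = hcomp C"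
  by (simp_all add: full_sub_def)

lemma (in two_category) two_category_full_sub: "two_category (full_sub C S)"
proof
  fix \<alpha> f g \<beta> h \<alpha>' f' g' \<beta>' h'
  assume "cell (full_sub C S) \<alpha> f g" "cell (full_sub C S) \<beta> g h" "cell (full_sub C S) \<alpha>' f' g'"
    "cell (full_sub C S) \<beta>' g' h'"
      "cod1 (full_sub C S) f = dom1 (full_sub C S) f'"
  then show "hcomp (full_sub C S) (vcomp (full_sub C S) \<alpha> \<beta>) (vcomp (full_sub C S) \<alpha>' \<beta>') =
       vcomp (full_sub C S) (hcomp (full_sub C S) \<alpha> \<alpha>') (hcomp (full_sub C S) \<beta> \<beta>')"
    using interchange[of \<alpha> f g \<beta> h \<alpha>' f' g' \<beta>' h'] by simp
qed (auto simp: hcomposable_def hcomp_closed hcomp_assoc hcomp_id_left hcomp_id_right hcomp_id2)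

section \<open>Cotensors with finite ordinals\<close>

lemma ord_cat_simps [simp]:
  "Ob (ord_cat k) = {0..k}" "Ar (ord_cat k) = {(i, j). i \<le> j \<and> j \<le> k}" "Dm (ord_cat k) = fst"
  "Cd (ord_cat k) = snd" "Idn (ord_cat k) i = (i, i)" "Cmp (ord_cat k) f g = (fst f, snd g)"
  by (simp_all add: ord_cat_def)

lemma category_ord: "category (ord_cat k)"
  by unfold_locales (auto simp: arr_def)

lemma fun_cat_simps [simp]:
  "Ob (fun_cat J D) = {F. is_functor J D F \<and> fob F \<in> extensional (Ob J)
      \<and> far F \<in> extensional (Ar J)}"
  "(F, G, \<eta>) \<in> Ar (fun_cat J D) \<longleftrightarrow>
     is_functor J D F \<and> fob F \<in> extensional (Ob J) \<and> far F \<in> extensional (Ar J) \<and>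
     is_functor J D G \<and> fob G \<in> extensional (Ob J) \<and> far G \<in> extensional (Ar J) \<and>
     \<eta> \<in> extensional (Ob J) \<and> (\<forall>j \<in> Ob J. arr D (\<eta> j) (fob F j) (fob G j)) \<and>
     (\<forall>\<phi> \<in> Ar J. Cmp D (far F \<phi>) (\<eta> (Cd J \<phi>)) = Cmp D (\<eta> (Dm J \<phi>)) (far G \<phi>))"
  "Dm (fun_cat J D) (F, G, \<eta>) = F" "Cd (fun_cat J D) (F, G, \<eta>) = G"
  "Idn (fun_cat J D) F = (F, F, \<lambda>j \<in> Ob J. Idn D (fob F j))"
  "Cmp (fun_cat J D) (F, G, \<eta>) (F', G', \<eta>') = (F, G', \<lambda>j \<in> Ob J. Cmp D (\<eta> j) (\<eta>' j))"
  by (simp_all add: fun_cat_def)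

lemma category_fun:
  assumes "category J" "category D"
  shows "category (fun_cat J D)"
proof -
  interpret J: category J by fact
  interpret D: category D by fact
  have ar: "far F f \<in> Ar D" "Dm D (far F f) = fob F (Dm J f)" "Cd D (far F f) = fob F (Cd J f)"
    if "is_functor J D F" "f \<in> Ar J" for F f
    using that by (auto simp: is_functor_def arr_def)
  have ob: "fob F j \<in> Ob D" if "is_functor J D F" "j \<in> Ob J" for F j
    using that by (auto simp: is_functor_def arr_def)
  show ?thesis
  proof
    fix f assume "f \<in> Ar (fun_cat J D)"
    then show "Dm (fun_cat J D) f \<in> Ob (fun_cat J D)" "Cd (fun_cat J D) f \<in> Ob (fun_cat J D)"
      by (cases f; simp)+
  next
    fix x assume "x \<in> Ob (fun_cat J D)"
    then show "arr (fun_cat J D) (Idn (fun_cat J D) x) x x"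
      by (simp add: arr_def ob ar)
  next
    fix f x y g z assume *: "arr (fun_cat J D) f x y" "arr (fun_cat J D) g y z"
    obtain \<eta> where f: "f = (x, y, \<eta>)" using *(1) by (cases f) (simp add: arr_def)
    obtain \<eta>' where g: "g = (y, z, \<eta>')" using *(2) by (cases g) (simp add: arr_def)
    have e: "\<And>j. j \<in> Ob J \<Longrightarrow> arr D (\<eta> j) (fob x j) (fob y j)"
      "\<And>j. j \<in> Ob J \<Longrightarrow> arr D (\<eta>' j) (fob y j) (fob z j)"
      "\<And>\<phi>. \<phi> \<in> Ar J \<Longrightarrow> Cmp D (far x \<phi>) (\<eta> (Cd J \<phi>)) = Cmp D (\<eta> (Dm J \<phi>)) (far y \<phi>)"
      "\<And>\<phi>. \<phi> \<in> Ar J \<Longrightarrow> Cmp D (far y \<phi>) (\<eta>' (Cd J \<phi>)) = Cmp D (\<eta>' (Dm J \<phi>)) (far z \<phi>)"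
      "is_functor J D x" "is_functor J D y" "is_functor J D z"
      using * by (simp_all add: f g arr_def)
    have n: "Cmp D (far x \<phi>) (Cmp D (\<eta> (Cd J \<phi>)) (\<eta>' (Cd J \<phi>)))
        = Cmp D (Cmp D (\<eta> (Dm J \<phi>)) (\<eta>' (Dm J \<phi>))) (far z \<phi>)"
      if "\<phi> \<in> Ar J" for \<phi>
    proof -
      have c: "arr D (\<eta> (Cd J \<phi>)) (fob x (Cd J \<phi>)) (fob y (Cd J \<phi>))"
        "arr D (\<eta>' (Cd J \<phi>)) (fob y (Cd J \<phi>)) (fob z (Cd J \<phi>))"
        "arr D (\<eta> (Dm J \<phi>)) (fob x (Dm J \<phi>)) (fob y (Dm J \<phi>))"
          "arr D (\<eta>' (Dm J \<phi>)) (fob y (Dm J \<phi>)) (fob z (Dm J \<phi>))"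
        using e(1,2) that by simp_all
      have "Cmp D (far x \<phi>) (Cmp D (\<eta> (Cd J \<phi>)) (\<eta>' (Cd J \<phi>)))
          = Cmp D (Cmp D (far x \<phi>) (\<eta> (Cd J \<phi>))) (\<eta>' (Cd J \<phi>))"
        using c ar[OF e(5) that] by (simp add: arr_def)
      also have "\<dots> = Cmp D (\<eta> (Dm J \<phi>)) (Cmp D (far y \<phi>) (\<eta>' (Cd J \<phi>)))"
        unfolding e(3)[OF that] using c ar[OF e(6) that] by (simp add: arr_def)
      also have "\<dots> = Cmp D (Cmp D (\<eta> (Dm J \<phi>)) (\<eta>' (Dm J \<phi>))) (far z \<phi>)"
        unfolding e(4)[OF that] using c ar[OF e(7) that] by (simp add: arr_def)
      finally show ?thesis .
    qed
    have "arr D (Cmp D (\<eta> j) (\<eta>' j)) (fob x j) (fob z j)" if "j \<in> Ob J" for j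
      using e(1,2)[OF that] by (simp add: arr_def)
    then show "arr (fun_cat J D) (Cmp (fun_cat J D) f g) x z"
      using * n by (simp add: f g arr_def)
  next
    fix f x y assume *: "arr (fun_cat J D) f x y"
    obtain F G \<eta> where f: "f = (F, G, \<eta>)" by (cases f)
    show "Cmp (fun_cat J D) (Idn (fun_cat J D) x) f = f"
      "Cmp (fun_cat J D) f (Idn (fun_cat J D) y) = f"
      using * by (auto simp: f arr_def extensional_def)
  next
    fix f g h w x y z assume *: "arr (fun_cat J D) f w x" "arr (fun_cat J D) g x y"
      "arr (fun_cat J D) h y z"
    obtain F G \<eta> where f: "f = (F, G, \<eta>)" by (cases f)
    obtain F' G' \<eta>' where g: "g = (F', G', \<eta>')" by (cases g)
    obtain F'' G'' \<eta>'' where h: "h = (F'', G'', \<eta>'')" by (cases h)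
    have "Cmp D (Cmp D (\<eta> j) (\<eta>' j)) (\<eta>'' j) = Cmp D (\<eta> j) (Cmp D (\<eta>' j) (\<eta>'' j))" if "j \<in> Ob J"
      for j
    proof -
      have "arr D (\<eta> j) (fob F j) (fob G j)" "arr D (\<eta>' j) (fob G j) (fob G' j)"
        "arr D (\<eta>'' j) (fob G' j) (fob G'' j)"
        using * that by (simp_all add: f g h arr_def)
      then show ?thesis by (simp add: arr_def)
    qed
    then show "Cmp (fun_cat J D) (Cmp (fun_cat J D) f g) h
        = Cmp (fun_cat J D) f (Cmp (fun_cat J D) g h)"
      using * by (auto simp: f g h arr_def)
  qed
qed

lemma cotensor_functor_simps [simp]:
  "fob (cotensor_functor C J ev) m =
     \<lparr>fob = (\<lambda>j \<in> Ob J. m \<cdot>\<^bsub>C\<^esub> fob ev j), far = (\<lambda>\<phi> \<in> Ar J. m \<rhd>\<^bsub>C\<^esub> far ev \<phi>)\<rparr>"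
  "far (cotensor_functor C J ev) \<alpha> = (fob (cotensor_functor C J ev) (dom2 C \<alpha>),
      fob (cotensor_functor C J ev) (cod2 C \<alpha>),
     \<lambda>j \<in> Ob J. \<alpha> \<lhd>\<^bsub>C\<^esub> fob ev j)"
  by (simp_all add: cotensor_functor_def Let_def)

text \<open>A functor from \<open>[k]\<close> into a hom-category as a pair of plain functions.
  Values outside \<open>[k]\<close> are arbitrary, so diagrams can be built freely and are made
  extensional only on entering \<open>fun_cat\<close>.\<close>

definition ord_diagram :: "('o, 'm, 'c) two_cat \<Rightarrow> 'o \<Rightarrow> 'o \<Rightarrow> nat \<Rightarrow> (nat \<Rightarrow> 'm) \<Rightarrow> (nat \<Rightarrow> nat \<Rightarrow> 'c) \<Rightarrow>
    bool" where
  "ord_diagram C A X k a \<phi> \<longleftrightarrow> (\<forall>i\<le>k. mor C (a i) A X) \<and>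
     (\<forall>i j. i \<le> j \<longrightarrow> j \<le> k \<longrightarrow> cell C (\<phi> i j) (a i) (a j)) \<and>
     (\<forall>i\<le>k. \<phi> i i = id2 C (a i)) \<and>
     (\<forall>i j l. i \<le> j \<longrightarrow> j \<le> l \<longrightarrow> l \<le> k \<longrightarrow> \<phi> i l = \<phi> i j \<bullet>\<^bsub>C\<^esub> \<phi> j l)"

lemma is_functorD:
  assumes "is_functor D E F"
  shows "category D" "category E" "x \<in> Ob D \<Longrightarrow> fob F x \<in> Ob E"
    "f \<in> Ar D \<Longrightarrow> arr E (far F f) (fob F (Dm D f)) (fob F (Cd D f))"
    "x \<in> Ob D \<Longrightarrow> far F (Idn D x) = Idn E (fob F x)"
    "f \<in> Ar D \<Longrightarrow> g \<in> Ar D \<Longrightarrow> Cd D f = Dm D g \<Longrightarrow> far F (Cmp D f g) = Cmp E (far F f) (far F g)"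
  using assms unfolding is_functor_def by blast+

lemma ord_diagramD:
  assumes "ord_diagram C A X k a \<phi>"
  shows "i \<le> k \<Longrightarrow> mor C (a i) A X" "i \<le> j \<Longrightarrow> j \<le> k \<Longrightarrow> cell C (\<phi> i j) (a i) (a j)"
    "i \<le> k \<Longrightarrow> \<phi> i i = id2 C (a i)"
    "i \<le> j \<Longrightarrow> j \<le> l \<Longrightarrow> l \<le> k \<Longrightarrow> \<phi> i l = \<phi> i j \<bullet>\<^bsub>C\<^esub> \<phi> j l"
proof -
  note d = assms[unfolded ord_diagram_def]
  show "i \<le> k \<Longrightarrow> mor C (a i) A X" using d[THEN conjunct1] by blast
  show "i \<le> j \<Longrightarrow> j \<le> k \<Longrightarrow> cell C (\<phi> i j) (a i) (a j)" using d[THEN conjunct2, THEN conjunct1] by blast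
  show "i \<le> k \<Longrightarrow> \<phi> i i = id2 C (a i)" using d[THEN conjunct2, THEN conjunct2, THEN conjunct1]
    by blast
  show "i \<le> j \<Longrightarrow> j \<le> l \<Longrightarrow> l \<le> k \<Longrightarrow> \<phi> i l = \<phi> i j \<bullet>\<^bsub>C\<^esub> \<phi> j l"
    by (rule d[THEN conjunct2, THEN conjunct2, THEN conjunct2, rule_format])
qed

lemma ord_diagramI:
  assumes "\<And>i. i \<le> k \<Longrightarrow> mor C (a i) A X" "\<And>i j. i \<le> j \<Longrightarrow> j \<le> k \<Longrightarrow> cell C (\<phi> i j) (a i) (a j)"
    "\<And>i. i \<le> k \<Longrightarrow> \<phi> i i = id2 C (a i)"
    "\<And>i j l. i \<le> j \<Longrightarrow> j \<le> l \<Longrightarrow> l \<le> k \<Longrightarrow> \<phi> i l = \<phi> i j \<bullet>\<^bsub>C\<^esub> \<phi> j l"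
  shows "ord_diagram C A X k a \<phi>"
  unfolding ord_diagram_def using assms by (intro conjI allI impI)

text \<open>Only values inside \<open>[k]\<close> are constrained, which allows passing between a
  diagram and its restriction to the carriers.\<close>

lemma ord_diagram_cong:
  assumes "ord_diagram C A X k a \<phi>" "\<And>i. i \<le> k \<Longrightarrow> a' i = a i" "\<And>i j. i \<le> j \<Longrightarrow> j \<le> k \<Longrightarrow> \<phi>' i j = \<phi> i j"
  shows "ord_diagram C A X k a' \<phi>'"
proof (rule ord_diagramI)
  show "\<phi>' i l = \<phi>' i j \<bullet>\<^bsub>C\<^esub> \<phi>' j l" if "i \<le> j" "j \<le> l" "l \<le> k" for i j l
    using ord_diagramD(4)[OF assms(1) that] that assms(3)[of i j] assms(3)[of j l] assms(3)[of i l]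
      by simp
qed (use ord_diagramD(1-3)[OF assms(1)] assms(2,3) in simp_all)

context two_category
begin

lemma arr_Hom: "arr (Hom C A B) \<alpha> f g \<longleftrightarrow> cell C \<alpha> f g \<and> dom1 C f = A \<and> cod1 C f = B"
  by (auto simp: arr_def)

lemma is_functor_ord:
  "is_functor (ord_cat k) (Hom C A X) F \<longleftrightarrow> ord_diagram C A X k (fob F) (\<lambda>i j. far F (i, j))"
proof
  assume F: "is_functor (ord_cat k) (Hom C A X) F"
  have 1: "mor C (fob F i) A X" "far F (i, i) = id2 C (fob F i)" if "i \<le> k" for i
    using is_functorD(3,5)[OF F, of i] that by simp_all
  have 2: "cell C (far F (i, j)) (fob F i) (fob F j)" if "i \<le> j" "j \<le> k" for i j
    using is_functorD(4)[OF F, of "(i, j)"] that by (simp add: arr_Hom)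
  have 3: "far F (i, l) = far F (i, j) \<bullet> far F (j, l)" if "i \<le> j" "j \<le> l" "l \<le> k" for i j l
  proof -
    have "far F (Cmp (ord_cat k) (i, j) (j, l)) = Cmp (Hom C A X) (far F (i, j)) (far F (j, l))"
      by (rule is_functorD(6)[OF F]) (use that in simp_all)
    then show ?thesis by simp
  qed
  show "ord_diagram C A X k (fob F) (\<lambda>i j. far F (i, j))"
    by (intro ord_diagramI 1 2 3)
next
  assume F: "ord_diagram C A X k (fob F) (\<lambda>i j. far F (i, j))"
  note 1 = ord_diagramD(1,3)[OF F] and 2 = ord_diagramD(2)[OF F] and 3 = ord_diagramD(4)[OF F]
  have 4: "far F f \<in> Cell2 C \<and> dom2 C (far F f) = fob F (fst f) \<and> cod2 C (far F f) = fob F (snd f) \<and>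
     dom1 C (dom2 C (far F f)) = A \<and> cod1 C (dom2 C (far F f)) = X" if "fst f \<le> snd f" "snd f \<le> k"
       for f
    using 2[of "fst f" "snd f"] 1(1)[of "fst f"] that by simp
  show "is_functor (ord_cat k) (Hom C A X) F"
    unfolding is_functor_def
  proof (intro conjI ballI impI category_ord category_Hom)
    fix f g assume "f \<in> Ar (ord_cat k)" "g \<in> Ar (ord_cat k)" "Cd (ord_cat k) f = Dm (ord_cat k) g"
    then show "far F (Cmp (ord_cat k) f g) = Cmp (Hom C A X) (far F f) (far F g)"
      using 3[of "fst f" "snd f" "snd g"] by (auto split: prod.splits)
  qed (use 1 4 in \<open>auto simp: arr_def\<close>)
qed

lemma ord_diagram_pre:
  assumes "ord_diagram C P X k a \<phi>" "mor C m A P"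
  shows "ord_diagram C A X k (\<lambda>i. m \<cdot> a i) (\<lambda>i j. m \<rhd> \<phi> i j)"
proof -
  note 1 = ord_diagramD(1,3)[OF assms(1)] and 2 = ord_diagramD(2)[OF assms(1)]
    and 3 = ord_diagramD(4)[OF assms(1)]
  have "m \<rhd> \<phi> i l = (m \<rhd> \<phi> i j) \<bullet> (m \<rhd> \<phi> j l)" if "i \<le> j" "j \<le> l" "l \<le> k" for i j l
    unfolding 3[OF that] using 1[of i] 2[of i j] 2[of j l] assms(2) that by simp
  moreover have "cell C (m \<rhd> \<phi> i j) (m \<cdot> a i) (m \<cdot> a j)" if "i \<le> j" "j \<le> k" for i j
    using 2[OF that] 1[of i] assms(2) that by simp
  moreover have "mor C (m \<cdot> a i) A X" "m \<rhd> \<phi> i i = id2 C (m \<cdot> a i)" if "i \<le> k" for i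
    using 1[OF that] assms(2) by simp_all
  ultimately show ?thesis by (intro ord_diagramI)
qed

lemma cotensor_ord_diagram:
  assumes "strict_cotensor C (ord_cat k) X P ev"
  shows "ord_diagram C P X k (fob ev) (\<lambda>i j. far ev (i, j))" "X \<in> Cell0 C" "P \<in> Cell0 C"
  using assms is_functor_ord by (auto simp: strict_cotensor_def)

lemma cotensor_iso:
  assumes "strict_cotensor C J X P ev" "A \<in> Cell0 C"
  shows "cat_isomorphism (Hom C A P) (fun_cat J (Hom C A X)) (cotensor_functor C J ev)"
  using assms by (simp add: strict_cotensor_def)

lemma cotensor_ex:
  assumes P: "strict_cotensor C (ord_cat k) X P ev" and A: "A \<in> Cell0 C"
    and a: "ord_diagram C A X k a \<phi>"
  shows "\<exists>m. mor C m A P \<and> (\<forall>i\<le>k. m \<cdot> fob ev i = a i) \<and> (\<forall>i j. i \<le> j \<longrightarrow> j \<le> k \<longrightarrow> m \<rhd> far ev (i, j)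
      = \<phi> i j)"
proof -
  \<comment> \<open>Objects of \<open>fun_cat\<close> are extensional, hence the restriction to the
    carriers of \<open>[k]\<close>.\<close>
  define F where "F = \<lparr>fob = (\<lambda>i \<in> Ob (ord_cat k). a i), far = (\<lambda>f \<in> Ar (ord_cat k). \<phi> (fst f) (snd
      f))\<rparr>"
  have "ord_diagram C A X k (fob F) (\<lambda>i j. far F (i, j))"
    by (rule ord_diagram_cong[OF a]) (simp_all add: F_def)
  then have "F \<in> Ob (fun_cat (ord_cat k) (Hom C A X))"
    unfolding fun_cat_simps mem_Collect_eq is_functor_ord by (simp add: F_def)
  then obtain m where m: "m \<in> Ob (Hom C A P)" "fob (cotensor_functor C (ord_cat k) ev) m = F"
    using cat_isomorphism_ob_ex[OF cotensor_iso[OF P A]] by blast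
  have "m \<cdot> fob ev i = a i" if "i \<le> k" for i
    using fun_cong[OF arg_cong[OF m(2), of fob], of i] that by (simp add: F_def)
  moreover have "m \<rhd> far ev (i, j) = \<phi> i j" if "i \<le> j" "j \<le> k" for i j
    using fun_cong[OF arg_cong[OF m(2), of far], of "(i, j)"] that by (simp add: F_def)
  ultimately show ?thesis using m(1) by (intro exI[of _ m]) simp
qed

lemma cotensor_uniq:
  assumes P: "strict_cotensor C (ord_cat k) X P ev" and m: "mor C m A P" "mor C n A P"
    and "\<And>i. i \<le> k \<Longrightarrow> m \<cdot> fob ev i = n \<cdot> fob ev i"
    and "\<And>i j. i \<le> j \<Longrightarrow> j \<le> k \<Longrightarrow> m \<rhd> far ev (i, j) = n \<rhd> far ev (i, j)"
  shows "m = n"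
proof -
  have A: "A \<in> Cell0 C" using m(1) cell1_closed(1)[of m] by simp
  have "fob (cotensor_functor C (ord_cat k) ev) m = fob (cotensor_functor C (ord_cat k) ev) n"
    using assms(4,5) by (auto intro!: restrict_ext)
  then show ?thesis using cat_isomorphism_ob_inj[OF cotensor_iso[OF P A]] m by simp
qed

lemma cotensor_ex2:
  assumes P: "strict_cotensor C (ord_cat k) X P ev" and m: "mor C m A P" "mor C n A P"
    and s: "\<And>i. i \<le> k \<Longrightarrow> cell C (\<sigma> i) (m \<cdot> fob ev i) (n \<cdot> fob ev i)"
    and nat: "\<And>i j. i \<le> j \<Longrightarrow> j \<le> k \<Longrightarrow> (m \<rhd> far ev (i, j)) \<bullet> \<sigma> j = \<sigma> i \<bullet> (n \<rhd> far ev (i, j))"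
  shows "\<exists>\<kappa>. cell C \<kappa> m n \<and> (\<forall>i\<le>k. \<kappa> \<lhd> fob ev i = \<sigma> i)"
proof -
  have A: "A \<in> Cell0 C" using m(1) cell1_closed(1)[of m] by simp
  note iso = cotensor_iso[OF P A]
  let ?F = "cotensor_functor C (ord_cat k) ev"
  have F: "is_functor (Hom C A P) (fun_cat (ord_cat k) (Hom C A X)) ?F"
    using iso by (simp add: cat_isomorphism_def)
  have mn: "m \<in> Ob (Hom C A P)" "n \<in> Ob (Hom C A P)" using m by simp_all
  then have ob: "fob ?F m \<in> Ob (fun_cat (ord_cat k) (Hom C A X))"
    "fob ?F n \<in> Ob (fun_cat (ord_cat k) (Hom C A X))"
    using F unfolding is_functor_def by blast+
  have d: "mor C (fob ev i) P X" if "i \<le> k" for i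
    using ord_diagramD(1)[OF cotensor_ord_diagram(1)[OF P]] that .
  have "arr (Hom C A X) (\<sigma> i) (m \<cdot> fob ev i) (n \<cdot> fob ev i)" if "i \<le> k" for i
    using s[OF that] d[OF that] m by (simp add: arr_Hom)
  then have "arr (fun_cat (ord_cat k) (Hom C A X)) (fob ?F m, fob ?F n,
      \<lambda>i \<in> Ob (ord_cat k). \<sigma> i) (fob ?F m) (fob ?F n)"
    using ob nat by (auto simp: arr_def[of "fun_cat _ _"])
  then obtain \<kappa> where k: "arr (Hom C A P) \<kappa> m n"
    "far ?F \<kappa> = (fob ?F m, fob ?F n, \<lambda>i \<in> Ob (ord_cat k). \<sigma> i)"
    using cat_isomorphism_ar_ex[OF iso mn] by blast
  have e: "(\<lambda>j \<in> Ob (ord_cat k). \<kappa> \<lhd> fob ev j) = (\<lambda>i \<in> Ob (ord_cat k). \<sigma> i)" using k(2) by simp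
  have "\<kappa> \<lhd> fob ev i = \<sigma> i" if "i \<le> k" for i
    using fun_cong[OF e, of i] that by simp
  then show ?thesis using k(1) by (intro exI[of _ \<kappa>]) (simp add: arr_Hom)
qed

lemma cotensor_uniq2:
  assumes P: "strict_cotensor C (ord_cat k) X P ev" and m: "mor C m A P" "mor C n A P"
    and k: "cell C \<kappa> m n" "cell C \<kappa>' m n" "\<And>i. i \<le> k \<Longrightarrow> \<kappa> \<lhd> fob ev i = \<kappa>' \<lhd> fob ev i"
  shows "\<kappa> = \<kappa>'"
proof -
  have A: "A \<in> Cell0 C" using m(1) cell1_closed(1)[of m] by simp
  note iso = cotensor_iso[OF P A]
  have "far (cotensor_functor C (ord_cat k) ev) \<kappa> = far (cotensor_functor C (ord_cat k) ev) \<kappa>'"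
    using k by (auto intro!: restrict_ext)
  then show ?thesis using cat_isomorphism_ar_inj[OF iso, of \<kappa> \<kappa>'] k m by simp
qed

text \<open>Converse to the four preceding lemmas; it serves to recognise a pullback of arrow
  objects as \<open>X^[2]\<close>.\<close>

lemma strict_cotensorI:
  assumes XP: "X \<in> Cell0 C" "P \<in> Cell0 C" and ev: "ord_diagram C P X k (fob ev) (\<lambda>i j. far ev (i,
      j))"
    and ex: "\<And>A a \<phi>. A \<in> Cell0 C \<Longrightarrow> ord_diagram C A X k a \<phi> \<Longrightarrow>
       \<exists>m. mor C m A P \<and> (\<forall>i\<le>k. m \<cdot> fob ev i = a i) \<and> (\<forall>i j. i \<le> j \<longrightarrow> j \<le> k \<longrightarrow> m \<rhd> far ev (i, j)
           = \<phi> i j)"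
    and uniq: "\<And>A m n. mor C m A P \<Longrightarrow> mor C n A P \<Longrightarrow> (\<And>i. i \<le> k \<Longrightarrow> m \<cdot> fob ev i = n \<cdot> fob ev i) \<Longrightarrow>
       (\<And>i j. i \<le> j \<Longrightarrow> j \<le> k \<Longrightarrow> m \<rhd> far ev (i, j) = n \<rhd> far ev (i, j)) \<Longrightarrow> m = n"
    and ex2: "\<And>A m n \<sigma>. mor C m A P \<Longrightarrow> mor C n A P \<Longrightarrow>
      (\<And>i. i \<le> k \<Longrightarrow> cell C (\<sigma> i) (m \<cdot> fob ev i) (n \<cdot> fob ev i)) \<Longrightarrow>
      (\<And>i j. i \<le> j \<Longrightarrow> j \<le> k \<Longrightarrow> (m \<rhd> far ev (i, j)) \<bullet> \<sigma> j = \<sigma> i \<bullet> (n \<rhd> far ev (i, j))) \<Longrightarrow>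
      \<exists>\<kappa>. cell C \<kappa> m n \<and> (\<forall>i\<le>k. \<kappa> \<lhd> fob ev i = \<sigma> i)"
    and uniq2: "\<And>A m n \<kappa> \<kappa>'. mor C m A P \<Longrightarrow> mor C n A P \<Longrightarrow> cell C \<kappa> m n \<Longrightarrow> cell C \<kappa>' m n \<Longrightarrow>
      (\<And>i. i \<le> k \<Longrightarrow> \<kappa> \<lhd> fob ev i = \<kappa>' \<lhd> fob ev i) \<Longrightarrow> \<kappa> = \<kappa>'"
  shows "strict_cotensor C (ord_cat k) X P ev"
proof -
  let ?F = "cotensor_functor C (ord_cat k) ev"
  note e1 = ord_diagramD(1,3)[OF ev] and e2 = ord_diagramD(2)[OF ev]
  have "cat_isomorphism (Hom C A P) (fun_cat (ord_cat k) (Hom C A X)) ?F" if A: "A \<in> Cell0 C" for A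
  proof (rule cat_isomorphismI)
    have ob: "fob ?F m \<in> Ob (fun_cat (ord_cat k) (Hom C A X))" if "mor C m A P" for m
      unfolding fun_cat_simps mem_Collect_eq is_functor_ord
      by (intro conjI ord_diagram_cong[OF ord_diagram_pre[OF ev that]]) simp_all
    \<comment> \<open>Whiskering a 2-cell into \<open>P\<close> with the evaluation functor gives a
      natural family by the exchange law, so the comparison is well defined on 2-cells.\<close>
    have nat: "(dom2 C \<alpha> \<rhd> far ev (i, j)) \<bullet> (\<alpha> \<lhd> fob ev j) = (\<alpha> \<lhd> fob ev i) \<bullet> (cod2 C \<alpha> \<rhd> far ev (i,
        j))"
      if "\<alpha> \<in> Ar (Hom C A P)" "i \<le> j" "j \<le> k" for \<alpha> i j
      using whisker_exchange[of \<alpha> "far ev (i, j)"] e1[of i] e2[of i j] that by simp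
    have ar: "arr (fun_cat (ord_cat k) (Hom C A X)) (far ?F \<alpha>) (fob ?F (dom2 C \<alpha>)) (fob ?F (cod2 C
        \<alpha>))" if "\<alpha> \<in> Ar (Hom C A P)" for \<alpha>
    proof -
      have "\<forall>i\<in>Ob (ord_cat k). arr (Hom C A X) (\<alpha> \<lhd> fob ev i) (dom2 C \<alpha> \<cdot> fob ev i) (cod2 C \<alpha> \<cdot> fob
          ev i)"
        using e1 that by (simp add: arr_Hom)
      moreover have "mor C (dom2 C \<alpha>) A P" "mor C (cod2 C \<alpha>) A P" using that by simp_all
      ultimately show ?thesis
        using ob[of "dom2 C \<alpha>"] ob[of "cod2 C \<alpha>"] nat[OF that]
          by (auto simp: arr_def[of "fun_cat _ _"])
    qed
    show "is_functor (Hom C A P) (fun_cat (ord_cat k) (Hom C A X)) ?F"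
      unfolding is_functor_def
    proof (intro conjI ballI impI category_fun category_ord category_Hom)
      show "fob ?F x \<in> Ob (fun_cat (ord_cat k) (Hom C A X))" if "x \<in> Ob (Hom C A P)" for x
        using ob that by simp
      show "arr (fun_cat (ord_cat k) (Hom C A X)) (far ?F f) (fob ?F (Dm (Hom C A P) f)) (fob ?F (Cd
          (Hom C A P) f))"
        if "f \<in> Ar (Hom C A P)" for f
        using ar[OF that] unfolding Hom_simps .
    qed (use e1 in \<open>auto intro!: restrict_ext\<close>)
    show "\<exists>m \<in> Ob (Hom C A P). fob ?F m = F" if "F \<in> Ob (fun_cat (ord_cat k) (Hom C A X))" for F
    proof -
      have F: "ord_diagram C A X k (fob F) (\<lambda>i j. far F (i, j))" "fob F \<in> extensional {0..k}"
        "far F \<in> extensional {(i, j). i \<le> j \<and> j \<le> k}"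
        using that is_functor_ord by simp_all
      obtain m where m: "mor C m A P" "\<And>i. i\<le>k \<Longrightarrow> m \<cdot> fob ev i = fob F i"
        "\<And>i j. i \<le> j \<Longrightarrow> j \<le> k \<Longrightarrow> m \<rhd> far ev (i, j) = far F (i, j)"
        using ex[OF A F(1)] by blast
      have "fob ?F m = F"
        by (rule fctr.equality) (use F m in \<open>auto simp: fun_eq_iff extensional_def\<close>)
      then show ?thesis using m(1) by auto
    qed
    show "m = n" if "m \<in> Ob (Hom C A P)" "n \<in> Ob (Hom C A P)" "fob ?F m = fob ?F n" for m n
    proof (rule uniq[of m A n])
      have f: "(\<lambda>j\<in>{0..k}. m \<cdot> fob ev j) = (\<lambda>j\<in>{0..k}. n \<cdot> fob ev j)"
        "(\<lambda>f\<in>Ar (ord_cat k). m \<rhd> far ev f) = (\<lambda>f\<in>Ar (ord_cat k). n \<rhd> far ev f)"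
        using that(3) by simp_all
      show "m \<cdot> fob ev i = n \<cdot> fob ev i" if "i \<le> k" for i
        using fun_cong[OF f(1), of i] that by simp
      show "m \<rhd> far ev (i, j) = n \<rhd> far ev (i, j)" if "i \<le> j" "j \<le> k" for i j
        using fun_cong[OF f(2), of "(i, j)"] that by simp
    qed (use that in simp_all)
    show "\<exists>\<kappa>. arr (Hom C A P) \<kappa> m n \<and> far ?F \<kappa> = \<psi>"
      if mn: "m \<in> Ob (Hom C A P)" "n \<in> Ob (Hom C A P)"
        and a: "arr (fun_cat (ord_cat k) (Hom C A X)) \<psi> (fob ?F m) (fob ?F n)" for m n \<psi>
    proof -
      obtain F G \<eta> where "\<psi> = (F, G, \<eta>)" by (cases \<psi>)
      then have psi: "\<psi> = (fob ?F m, fob ?F n, \<eta>)" using a by (simp add: arr_def)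
      have "\<forall>i\<in>Ob (ord_cat k). arr (Hom C A X) (\<eta> i) (m \<cdot> fob ev i) (n \<cdot> fob ev i)"
        "\<forall>f\<in>Ar (ord_cat k). (m \<rhd> far ev f) \<bullet> \<eta> (snd f) = \<eta> (fst f) \<bullet> (n \<rhd> far ev f)"
          and ext: "\<eta> \<in> extensional {0..k}"
        using a by (auto simp: arr_def[of "fun_cat _ _"] psi)
      then have "\<And>i. i \<le> k \<Longrightarrow> cell C (\<eta> i) (m \<cdot> fob ev i) (n \<cdot> fob ev i)"
        "\<And>i j. i \<le> j \<Longrightarrow> j \<le> k \<Longrightarrow> (m \<rhd> far ev (i, j)) \<bullet> \<eta> j = \<eta> i \<bullet> (n \<rhd> far ev (i, j))"
        by (simp_all add: arr_Hom)
      then obtain \<kappa> where k: "cell C \<kappa> m n" "\<And>i. i\<le>k \<Longrightarrow> \<kappa> \<lhd> fob ev i = \<eta> i"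
        using ex2[of m A n \<eta>] mn by auto
      have "(\<lambda>j\<in>{0..k}. \<kappa> \<lhd> fob ev j) = \<eta>"
        using ext k(2) by (auto simp: fun_eq_iff extensional_def)
      then show ?thesis using k(1) mn by (intro exI[of _ \<kappa>]) (simp add: psi arr_Hom)
    qed
    show "\<kappa> = \<kappa>'" if "m \<in> Ob (Hom C A P)" "n \<in> Ob (Hom C A P)" "arr (Hom C A P) \<kappa> m n"
      "arr (Hom C A P) \<kappa>' m n" "far ?F \<kappa> = far ?F \<kappa>'" for m n \<kappa> \<kappa>'
    proof (rule uniq2[of m A n])
      have f: "(\<lambda>j\<in>{0..k}. \<kappa> \<lhd> fob ev j) = (\<lambda>j\<in>{0..k}. \<kappa>' \<lhd> fob ev j)" using that(5) by simp
      show "\<kappa> \<lhd> fob ev i = \<kappa>' \<lhd> fob ev i" if "i \<le> k" for i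
        using fun_cong[OF f, of i] that by simp
    qed (use that in \<open>simp_all add: arr_Hom\<close>)
  qed
  then show ?thesis using XP ev is_functor_ord by (simp add: strict_cotensor_def)
qed

text \<open>The inverses of the components form a natural family again, by
  \<open>inverse_square\<close>, and so come from a 2-cell into the cotensor; uniqueness of such
  2-cells makes it an inverse.\<close>

lemma cotensor_isoc:
  assumes P: "strict_cotensor C (ord_cat k) X P ev" and k: "\<kappa> \<in> Cell2 C" "cod1 C (dom2 C \<kappa>) = P"
    and iso: "\<And>i. i \<le> k \<Longrightarrow> isoc C (\<kappa> \<lhd> fob ev i)"
  shows "isoc C \<kappa>"
proof -
  define m n A where "m = dom2 C \<kappa>" "n = cod2 C \<kappa>" "A = dom1 C m"
  have m: "mor C m A P" and n: "mor C n A P" and K: "cell C \<kappa> m n"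
    using k by (simp_all add: m_n_A_def)
  note ev = cotensor_ord_diagram[OF P]
  note e1 = ord_diagramD(1)[OF ev(1)] and e2 = ord_diagramD(2)[OF ev(1)]
  have "\<forall>i. \<exists>\<beta>. i \<le> k \<longrightarrow> inverse_arrows (vert C) (\<kappa> \<lhd> fob ev i) \<beta>"
    using iso by (auto simp: iso_arrow_def)
  then obtain \<sigma> where s: "\<And>i. i \<le> k \<Longrightarrow> inverse_arrows (vert C) (\<kappa> \<lhd> fob ev i) (\<sigma> i)" by metis
  have s': "\<sigma> i \<in> Cell2 C" "dom2 C (\<sigma> i) = n \<cdot> fob ev i" "cod2 C (\<sigma> i) = m \<cdot> fob ev i"
    "(\<kappa> \<lhd> fob ev i) \<bullet> \<sigma> i = id2 C (m \<cdot> fob ev i)" "\<sigma> i \<bullet> (\<kappa> \<lhd> fob ev i) = id2 C (n \<cdot> fob ev i)"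
      if "i \<le> k" for i
    using s[OF that] e1[OF that] K m unfolding inverse_arrows_def by simp_all
  have "\<exists>\<kappa>'. cell C \<kappa>' n m \<and> (\<forall>i\<le>k. \<kappa>' \<lhd> fob ev i = \<sigma> i)"
  proof (rule cotensor_ex2[OF P n m])
    show "cell C (\<sigma> i) (n \<cdot> fob ev i) (m \<cdot> fob ev i)" if "i \<le> k" for i using s'[OF that] by simp
    show "(n \<rhd> far ev (i, j)) \<bullet> \<sigma> j = \<sigma> i \<bullet> (m \<rhd> far ev (i, j))" if "i \<le> j" "j \<le> k" for i j
    proof -
      have i: "i \<le> k" using that by simp
      have "(m \<rhd> far ev (i, j)) \<bullet> (\<kappa> \<lhd> fob ev j) = (\<kappa> \<lhd> fob ev i) \<bullet> (n \<rhd> far ev (i, j))"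
        using whisker_exchange[of \<kappa> "far ev (i, j)"] e1[OF i] e2[OF that] K k by simp
      then show ?thesis
        by (intro inverse_square[OF s[OF i] s[OF that(2)]])
          (use e1[OF i] e1[OF that(2)] e2[OF that] K m n in simp_all)
    qed
  qed
  then obtain \<kappa>' where k': "cell C \<kappa>' n m" "\<And>i. i \<le> k \<Longrightarrow> \<kappa>' \<lhd> fob ev i = \<sigma> i" by blast
  have "\<kappa> \<bullet> \<kappa>' = id2 C m"
    by (rule cotensor_uniq2[OF P m m]) (use k' K m n s' e1 in simp_all)
  moreover have "\<kappa>' \<bullet> \<kappa> = id2 C n"
    by (rule cotensor_uniq2[OF P n n]) (use k' K m n s' e1 in simp_all)
  ultimately show ?thesis using k'(1) K unfolding isoc_iff by (intro conjI exI[of _ \<kappa>']) simp_all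
qed

end

text \<open>The values of a functor out of \<open>[2]\<close> with consecutive arrows \<open>\<phi>, \<psi>\<close>.\<close>

definition pair_ob :: "('o, 'm, 'c) two_cat \<Rightarrow> 'c \<Rightarrow> 'c \<Rightarrow> nat \<Rightarrow> 'm" where
  "pair_ob C \<phi> \<psi> i = (if i = 0 then dom2 C \<phi> else if i = 1 then cod2 C \<phi> else cod2 C \<psi>)"

definition pair_ar :: "('o, 'm, 'c) two_cat \<Rightarrow> 'c \<Rightarrow> 'c \<Rightarrow> nat \<Rightarrow> nat \<Rightarrow> 'c" where
  "pair_ar C \<phi> \<psi> i j = (if i = j then id2 C (pair_ob C \<phi> \<psi> i) else if j = 1 then \<phi>
     else if i = 1 then \<psi> else \<phi> \<bullet>\<^bsub>C\<^esub> \<psi>)"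

lemma ord_2_cases:
  "(i::nat) \<le> j \<and> j \<le> 2 \<longleftrightarrow> (i = j \<and> j \<le> 2) \<or> (i = 0 \<and> j = 1) \<or> (i = 1 \<and> j = 2) \<or> (i = 0 \<and> j = 2)"
  by auto

text \<open>A functor out of \<open>[1]\<close> amounts to one 2-cell, and a transformation between
  two such functors to one commutative square. The universal property is recorded in this form,
  together with the fact that invertibility is detected at the two ends.\<close>

locale universal_arrow = two_category C for C :: "('o, 'm, 'c) two_cat" (structure) +
  fixes X P d0 d1 d
  assumes objs [simp]: "X \<in> Cell0 C" "P \<in> Cell0 C"
    and ends [simp]: "d0 \<in> Cell1 C" "dom1 C d0 = P" "cod1 C d0 = X" "d1 \<in> Cell1 C" "dom1 C d1 = P"
      "cod1 C d1 = X"
    and univ [simp]: "d \<in> Cell2 C" "dom2 C d = d0" "cod2 C d = d1"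
    and ex: "\<phi> \<in> Cell2 C \<Longrightarrow> dom1 C (dom2 C \<phi>) = A \<Longrightarrow> cod1 C (dom2 C \<phi>) = X \<Longrightarrow> \<exists>m. mor C m A P \<and> m \<rhd> d
        = \<phi>"
    and uniq: "mor C m A P \<Longrightarrow> mor C n A P \<Longrightarrow> m \<rhd> d = n \<rhd> d \<Longrightarrow> m = n"
    and ex2: "mor C m A P \<Longrightarrow> mor C n A P \<Longrightarrow> cell C \<sigma> (m \<cdot> d0) (n \<cdot> d0) \<Longrightarrow> cell C \<tau> (m \<cdot> d1) (n \<cdot> d1) \<Longrightarrow>
      (m \<rhd> d) \<bullet> \<tau> = \<sigma> \<bullet> (n \<rhd> d) \<Longrightarrow> \<exists>\<kappa>. cell C \<kappa> m n \<and> \<kappa> \<lhd> d0 = \<sigma> \<and> \<kappa> \<lhd> d1 = \<tau>"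
    and uniq2: "mor C m A P \<Longrightarrow> mor C n A P \<Longrightarrow> cell C \<kappa> m n \<Longrightarrow> cell C \<kappa>' m n \<Longrightarrow>
      \<kappa> \<lhd> d0 = \<kappa>' \<lhd> d0 \<Longrightarrow> \<kappa> \<lhd> d1 = \<kappa>' \<lhd> d1 \<Longrightarrow> \<kappa> = \<kappa>'"
    and isoc_lift: "\<kappa> \<in> Cell2 C \<Longrightarrow> cod1 C (dom2 C \<kappa>) = P \<Longrightarrow> isoc C (\<kappa> \<lhd> d0) \<Longrightarrow> isoc C (\<kappa> \<lhd> d1)
        \<Longrightarrow> isoc C \<kappa>"
begin

lemma awi_lift:
  assumes m: "mor C m A P" and "arrow_wise_iso C (m \<cdot> d0)" "arrow_wise_iso C (m \<cdot> d1)"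
  shows "arrow_wise_iso C m"
proof -
  have "isoc C (\<alpha> \<lhd> m)" if a: "\<alpha> \<in> Cell2 C" "cod1 C (dom2 C \<alpha>) = dom1 C m" for \<alpha>
  proof (rule isoc_lift)
    show "isoc C (\<alpha> \<lhd> m \<lhd> d0)" using awi_isoc[OF assms(2), of \<alpha>] a m by simp
    show "isoc C (\<alpha> \<lhd> m \<lhd> d1)" using awi_isoc[OF assms(3), of \<alpha>] a m by simp
  qed (use a m in simp_all)
  then show ?thesis using m by (simp add: arrow_wise_iso_def)
qed

text \<open>To lift \<phi> at \<open>x\<close>, compose the 2-cell named by \<open>x\<close> with
  \<phi>: the source stays fixed and the target moves along \<phi>. This licenses the pullback of
  \<open>d1\<close> along \<open>d0\<close> from which \<open>X^[2]\<close> is made.\<close>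

lemma isofibration_d1: "isofibration C d1"
  unfolding isofibration_def
proof (intro conjI ballI)
  fix A assume A: "A \<in> Cell0 C"
  have "\<exists>\<psi>. iso_arrow (Hom C A P) \<psi> \<and> Dm (Hom C A P) \<psi> = x \<and> far (post C d1) \<psi> = \<phi>"
    if x: "mor C x A P" and p: "isoc C \<phi>" "dom2 C \<phi> = x \<cdot> d1" for x \<phi>
  proof -
    note c = isoc_cell[OF p(1)]
    obtain y where y: "mor C y A P" "y \<rhd> d = (x \<rhd> d) \<bullet> \<phi>"
      using ex[of "(x \<rhd> d) \<bullet> \<phi>" A] x p c by auto
    have y0: "y \<cdot> d0 = x \<cdot> d0" using arg_cong[OF y(2), of "dom2 C"] x y(1) c p(2) by simp
    have y1: "y \<cdot> d1 = cod2 C \<phi>" using arg_cong[OF y(2), of "cod2 C"] x y(1) c p(2) by simp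
    obtain \<kappa> where k: "cell C \<kappa> x y" "\<kappa> \<lhd> d0 = id2 C (x \<cdot> d0)" "\<kappa> \<lhd> d1 = \<phi>"
      using ex2[OF x y(1), of "id2 C (x \<cdot> d0)" \<phi>] x y c p(2) y0 y1 by auto
    have "isoc C \<kappa>"
      by (rule isoc_lift) (use k p x in simp_all)
    then show ?thesis using k x by (intro exI[of _ \<kappa>]) (simp add: iso_Hom)
  qed
  then show "isofibration_functor (Hom C A (dom1 C d1)) (Hom C A (cod1 C d1)) (post C d1)"
    unfolding isofibration_functor_def using post_functor[of d1 A] by (auto simp: iso_Hom)
qed simp

end

text \<open>The same reduction for \<open>[2]\<close>: a functor is a composable pair of 2-cells,
  and a transformation is a pair of adjacent squares sharing the side at vertex 1.\<close>

locale universal_pair = two_category C for C :: "('o, 'm, 'c) two_cat" (structure) +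
  fixes X P o0 o1 o2 e01 e12 e02
  assumes objs [simp]: "X \<in> Cell0 C" "P \<in> Cell0 C"
    and ends [simp]: "o0 \<in> Cell1 C" "dom1 C o0 = P" "cod1 C o0 = X" "o1 \<in> Cell1 C" "dom1 C o1 = P"
      "cod1 C o1 = X"
      "o2 \<in> Cell1 C" "dom1 C o2 = P" "cod1 C o2 = X"
    and univ [simp]: "e01 \<in> Cell2 C" "dom2 C e01 = o0" "cod2 C e01 = o1" "e12 \<in> Cell2 C"
      "dom2 C e12 = o1" "cod2 C e12 = o2"
    and e02: "e02 = e01 \<bullet> e12"
    and ex: "\<phi> \<in> Cell2 C \<Longrightarrow> \<psi> \<in> Cell2 C \<Longrightarrow> cod2 C \<phi> = dom2 C \<psi> \<Longrightarrow> dom1 C (dom2 C \<phi>) = A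
        \<Longrightarrow> cod1 C (dom2 C \<phi>) = X \<Longrightarrow>
      \<exists>m. mor C m A P \<and> m \<rhd> e01 = \<phi> \<and> m \<rhd> e12 = \<psi>"
    and uniq: "mor C m A P \<Longrightarrow> mor C n A P \<Longrightarrow> m \<rhd> e01 = n \<rhd> e01 \<Longrightarrow> m \<rhd> e12 = n \<rhd> e12 \<Longrightarrow> m = n"
    and ex2: "mor C m A P \<Longrightarrow> mor C n A P \<Longrightarrow> cell C \<sigma>0 (m \<cdot> o0) (n \<cdot> o0) \<Longrightarrow> cell C \<sigma>1 (m \<cdot> o1) (n \<cdot> o1)
        \<Longrightarrow>
       cell C \<sigma>2 (m \<cdot> o2) (n \<cdot> o2) \<Longrightarrow>
      (m \<rhd> e01) \<bullet> \<sigma>1 = \<sigma>0 \<bullet> (n \<rhd> e01) \<Longrightarrow> (m \<rhd> e12) \<bullet> \<sigma>2 = \<sigma>1 \<bullet> (n \<rhd> e12) \<Longrightarrow>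
      \<exists>\<kappa>. cell C \<kappa> m n \<and> \<kappa> \<lhd> o0 = \<sigma>0 \<and> \<kappa> \<lhd> o1 = \<sigma>1 \<and> \<kappa> \<lhd> o2 = \<sigma>2"
    and uniq2: "mor C m A P \<Longrightarrow> mor C n A P \<Longrightarrow> cell C \<kappa> m n \<Longrightarrow> cell C \<kappa>' m n \<Longrightarrow>
      \<kappa> \<lhd> o0 = \<kappa>' \<lhd> o0 \<Longrightarrow> \<kappa> \<lhd> o1 = \<kappa>' \<lhd> o1 \<Longrightarrow> \<kappa> \<lhd> o2 = \<kappa>' \<lhd> o2 \<Longrightarrow> \<kappa> = \<kappa>'"
    and isoc_lift: "\<kappa> \<in> Cell2 C \<Longrightarrow> cod1 C (dom2 C \<kappa>) = P \<Longrightarrow> isoc C (\<kappa> \<lhd> o0) \<Longrightarrow> isoc C (\<kappa> \<lhd> o1) \<Longrightarrow>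
      isoc C (\<kappa> \<lhd> o2) \<Longrightarrow> isoc C \<kappa>"
begin

lemma awi_lift:
  assumes m: "mor C m A P" and "arrow_wise_iso C (m \<cdot> o0)" "arrow_wise_iso C (m \<cdot> o1)"
    "arrow_wise_iso C (m \<cdot> o2)"
  shows "arrow_wise_iso C m"
proof -
  have "isoc C (\<alpha> \<lhd> m)" if a: "\<alpha> \<in> Cell2 C" "cod1 C (dom2 C \<alpha>) = dom1 C m" for \<alpha>
  proof (rule isoc_lift)
    show "isoc C (\<alpha> \<lhd> m \<lhd> o0)" using awi_isoc[OF assms(2), of \<alpha>] a m by simp
    show "isoc C (\<alpha> \<lhd> m \<lhd> o1)" using awi_isoc[OF assms(3), of \<alpha>] a m by simp
    show "isoc C (\<alpha> \<lhd> m \<lhd> o2)" using awi_isoc[OF assms(4), of \<alpha>] a m by simp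
  qed (use a m in simp_all)
  then show ?thesis using m by (simp add: arrow_wise_iso_def)
qed

end

section \<open>Arrow objects, \<open>X^[2]\<close> and products from the pita axioms\<close>

context two_category
begin

lemma ord_diagram_1:
  assumes "\<phi> \<in> Cell2 C" "dom1 C (dom2 C \<phi>) = A" "cod1 C (dom2 C \<phi>) = X"
  shows "ord_diagram C A X 1 (\<lambda>i. if i = 0 then dom2 C \<phi> else cod2 C \<phi>)
    (\<lambda>i j. if i = j then id2 C (if i = 0 then dom2 C \<phi> else cod2 C \<phi>) else \<phi>)"
  by (rule ord_diagramI) (use assms in auto)

lemma ord_diagram_2:
  assumes "\<phi> \<in> Cell2 C" "\<psi> \<in> Cell2 C" "cod2 C \<phi> = dom2 C \<psi>" "dom1 C (dom2 C \<phi>) = A"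
    "cod1 C (dom2 C \<phi>) = X"
  shows "ord_diagram C A X 2 (pair_ob C \<phi> \<psi>) (pair_ar C \<phi> \<psi>)"
proof -
  have x: "dom1 C (dom2 C \<psi>) = A" "cod1 C (dom2 C \<psi>) = X"
    using assms cell2_closed(6,7)[OF assms(1)] by simp_all
  have m: "mor C (pair_ob C \<phi> \<psi> i) A X" for i
    using assms x by (simp add: pair_ob_def)
  have id: "pair_ar C \<phi> \<psi> i i = id2 C (pair_ob C \<phi> \<psi> i)" for i by (simp add: pair_ar_def)
  have c: "cell C (pair_ar C \<phi> \<psi> i j) (pair_ob C \<phi> \<psi> i) (pair_ob C \<phi> \<psi> j)" if "i \<le> j" "j \<le> 2"
    for i j
    using ord_2_cases[of i j] that m[of i] assms by (auto simp: pair_ob_def pair_ar_def)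
  show ?thesis
  proof (rule ord_diagramI)
    show "pair_ar C \<phi> \<psi> i l = pair_ar C \<phi> \<psi> i j \<bullet> pair_ar C \<phi> \<psi> j l" if "i \<le> j" "j \<le> l" "l \<le> 2"
      for i j l
    proof (cases "i = j \<or> j = l")
      case True
      then show ?thesis using c[of i l] that m id by auto
    next
      case False
      then have "i = 0" "j = 1" "l = 2" using that by auto
      then show ?thesis by (simp add: pair_ar_def)
    qed
  qed (rule m c id; assumption?)+
qed

text \<open>The conditions at the identities of \<open>[1]\<close> hold automatically because
  diagrams send them to identity 2-cells; what remains is the condition at
  \<open>0 < 1\<close>.\<close>

lemma arrow_object_universal:
  assumes P: "arrow_object C X P ev"
  shows "universal_arrow C X P (fob ev 0) (fob ev 1) (bdry ev)"
proof -
  note ev = cotensor_ord_diagram[OF P]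
  have o: "mor C (fob ev 0) P X" "mor C (fob ev 1) P X" using ord_diagramD(1)[OF ev(1)] by blast+
  have d: "cell C (bdry ev) (fob ev 0) (fob ev 1)" using ord_diagramD(2)[OF ev(1), of 0 1] by simp
  have id: "far ev (i, i) = id2 C (fob ev i)" if "i \<le> 1" for i
    using ord_diagramD(3)[OF ev(1) that] .
  have le: "i = 0 \<or> i = 1" if "i \<le> 1" for i :: nat using that by auto
  show ?thesis
  proof
    show "\<exists>m. mor C m A P \<and> m \<rhd> bdry ev = \<phi>"
      if "\<phi> \<in> Cell2 C" "dom1 C (dom2 C \<phi>) = A" "cod1 C (dom2 C \<phi>) = X" for \<phi> A
      using cotensor_ex[OF P _ ord_diagram_1[OF that]] cell1_closed(1)[of "dom2 C \<phi>"] that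
        by fastforce
    show "m = n" if m: "mor C m A P" "mor C n A P" and e: "m \<rhd> bdry ev = n \<rhd> bdry ev" for m n A
    proof -
      have 0: "m \<cdot> fob ev 0 = n \<cdot> fob ev 0" using arg_cong[OF e, of "dom2 C"] d m o by simp
      have 1: "m \<cdot> fob ev 1 = n \<cdot> fob ev 1" using arg_cong[OF e, of "cod2 C"] d m o by simp
      have i: "m \<cdot> fob ev i = n \<cdot> fob ev i" if "i \<le> 1" for i using le[OF that] 0 1 by metis
      show ?thesis
      proof (rule cotensor_uniq[OF P m i])
        show "m \<rhd> far ev (i, j) = n \<rhd> far ev (i, j)" if ij: "i \<le> j" "j \<le> 1" for i j
        proof (cases "i = j")
          case True
          then show ?thesis using id[OF ij(2)] i[OF ij(2)] ord_diagramD(1)[OF ev(1) ij(2)] m by simp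
        next
          case False
          then have "i = 0" "j = 1" using ij by auto
          then show ?thesis using e by simp
        qed
      qed
    qed
    show "\<exists>\<kappa>. cell C \<kappa> m n \<and> \<kappa> \<lhd> fob ev 0 = \<sigma> \<and> \<kappa> \<lhd> fob ev 1 = \<tau>"
      if m: "mor C m A P" "mor C n A P" and s: "cell C \<sigma> (m \<cdot> fob ev 0) (n \<cdot> fob ev 0)"
        "cell C \<tau> (m \<cdot> fob ev 1) (n \<cdot> fob ev 1)"
        and sq: "(m \<rhd> bdry ev) \<bullet> \<tau> = \<sigma> \<bullet> (n \<rhd> bdry ev)" for m n A \<sigma> \<tau>
    proof -
      define r where "r = (\<lambda>i::nat. if i = 0 then \<sigma> else \<tau>)"
      have c: "cell C (r i) (m \<cdot> fob ev i) (n \<cdot> fob ev i)" if "i \<le> 1" for i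
        using le[OF that] s by (auto simp: r_def)
      have "\<exists>\<kappa>. cell C \<kappa> m n \<and> (\<forall>i\<le>1. \<kappa> \<lhd> fob ev i = r i)"
      proof (rule cotensor_ex2[OF P m c])
        show "(m \<rhd> far ev (i, j)) \<bullet> r j = r i \<bullet> (n \<rhd> far ev (i, j))" if ij: "i \<le> j" "j \<le> 1" for i j
        proof (cases "i = j")
          case True
          then show ?thesis using id[OF ij(2)] c[OF ij(2)] ord_diagramD(1)[OF ev(1) ij(2)] m by simp
        next
          case False
          then have "i = 0" "j = 1" using ij by auto
          then show ?thesis using sq by (simp add: r_def)
        qed
      qed
      then obtain \<kappa> where k: "cell C \<kappa> m n" "\<And>i. i \<le> 1 \<Longrightarrow> \<kappa> \<lhd> fob ev i = r i" by blast
      show ?thesis using k(1) k(2)[of 0] k(2)[of 1] by (intro exI[of _ \<kappa>]) (simp add: r_def)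
    qed
    show "\<kappa> = \<kappa>'" if m: "mor C m A P" "mor C n A P" and k: "cell C \<kappa> m n" "cell C \<kappa>' m n"
      and e: "\<kappa> \<lhd> fob ev 0 = \<kappa>' \<lhd> fob ev 0" "\<kappa> \<lhd> fob ev 1 = \<kappa>' \<lhd> fob ev 1" for m n A \<kappa> \<kappa>'
    proof (rule cotensor_uniq2[OF P m k])
      show "\<kappa> \<lhd> fob ev i = \<kappa>' \<lhd> fob ev i" if "i \<le> 1" for i using le[OF that] e by metis
    qed
    show "isoc C \<kappa>" if "\<kappa> \<in> Cell2 C" "cod1 C (dom2 C \<kappa>) = P" "isoc C (\<kappa> \<lhd> fob ev 0)"
      "isoc C (\<kappa> \<lhd> fob ev 1)" for \<kappa>
    proof (rule cotensor_isoc[OF P that(1,2)])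
      show "isoc C (\<kappa> \<lhd> fob ev i)" if "i \<le> 1" for i
        using le[OF that] \<open>isoc C (\<kappa> \<lhd> fob ev 0)\<close> \<open>isoc C (\<kappa> \<lhd> fob ev 1)\<close> by metis
    qed
  qed (use ev o d in simp_all)
qed

lemma cotensor_2_universal:
  assumes P: "strict_cotensor C (ord_cat 2) X P ev"
  shows "universal_pair C X P (fob ev 0) (fob ev 1) (fob ev 2) (far ev (0, 1)) (far ev (1,
      2)) (far ev (0, 2))"
proof -
  note ev = cotensor_ord_diagram[OF P]
  have o: "mor C (fob ev 0) P X" "mor C (fob ev 1) P X" "mor C (fob ev 2) P X"
    by (rule ord_diagramD(1)[OF ev(1)]; simp)+
  have d: "cell C (far ev (0, 1)) (fob ev 0) (fob ev 1)"
    "cell C (far ev (1, 2)) (fob ev 1) (fob ev 2)"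
    by (rule ord_diagramD(2)[OF ev(1)]; simp)+
  have id: "far ev (i, i) = id2 C (fob ev i)" if "i \<le> 2" for i
    using ord_diagramD(3)[OF ev(1) that] .
  have c: "far ev (0, 2) = far ev (0, 1) \<bullet> far ev (1, 2)"
    by (rule ord_diagramD(4)[OF ev(1)]) simp_all
  have le: "i = 0 \<or> i = 1 \<or> i = 2" if "i \<le> 2" for i :: nat using that by auto
  have le2: "i = j \<or> (i = 0 \<and> j = 1) \<or> (i = 1 \<and> j = 2) \<or> (i = 0 \<and> j = 2)" if "i \<le> j" "j \<le> 2"
    for i j :: nat using that by auto
  show ?thesis
  proof
    show "\<exists>m. mor C m A P \<and> m \<rhd> far ev (0, 1) = \<phi> \<and> m \<rhd> far ev (1, 2) = \<psi>"
      if p: "\<phi> \<in> Cell2 C" "\<psi> \<in> Cell2 C" "cod2 C \<phi> = dom2 C \<psi>" "dom1 C (dom2 C \<phi>) = A"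
        "cod1 C (dom2 C \<phi>) = X" for \<phi> \<psi> A
    proof -
      have "A \<in> Cell0 C" using cell1_closed(1)[of "dom2 C \<phi>"] p by simp
      then obtain m where m: "mor C m A P" "\<And>i j. i \<le> j \<Longrightarrow> j \<le> 2 \<Longrightarrow> m \<rhd> far ev (i, j)
          = pair_ar C \<phi> \<psi> i j"
        using cotensor_ex[OF P _ ord_diagram_2[OF p]] by blast
      show ?thesis using m(1) m(2)[of 0 1] m(2)[of 1 2]
        by (intro exI[of _ m]) (simp add: pair_ar_def)
    qed
    show "m = n" if m: "mor C m A P" "mor C n A P" and e: "m \<rhd> far ev (0, 1) = n \<rhd> far ev (0, 1)"
      "m \<rhd> far ev (1, 2) = n \<rhd> far ev (1, 2)" for m n A
    proof -
      have 0: "m \<cdot> fob ev 0 = n \<cdot> fob ev 0" using arg_cong[OF e(1), of "dom2 C"] d m o by simp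
      have 1: "m \<cdot> fob ev 1 = n \<cdot> fob ev 1" using arg_cong[OF e(1), of "cod2 C"] d m o by simp
      have 2: "m \<cdot> fob ev 2 = n \<cdot> fob ev 2" using arg_cong[OF e(2), of "cod2 C"] d m o by simp
      have i: "m \<cdot> fob ev i = n \<cdot> fob ev i" if "i \<le> 2" for i using le[OF that] 0 1 2 by metis
      show ?thesis
      proof (rule cotensor_uniq[OF P m i])
        show "m \<rhd> far ev (i, j) = n \<rhd> far ev (i, j)" if ij: "i \<le> j" "j \<le> 2" for i j
        proof (cases "i = j")
          case True
          then show ?thesis using id[OF ij(2)] i[OF ij(2)] ord_diagramD(1)[OF ev(1) ij(2)] m by simp
        next
          case False
          have "m \<rhd> far ev (0, 2) = n \<rhd> far ev (0, 2)" using c d o m e by simp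
          then show ?thesis using le2[OF ij] e False by metis
        qed
      qed
    qed
    show "\<exists>\<kappa>. cell C \<kappa> m n \<and> \<kappa> \<lhd> fob ev 0 = \<sigma>0 \<and> \<kappa> \<lhd> fob ev 1 = \<sigma>1 \<and> \<kappa> \<lhd> fob ev 2 = \<sigma>2"
      if m: "mor C m A P" "mor C n A P" and s: "cell C \<sigma>0 (m \<cdot> fob ev 0) (n \<cdot> fob ev 0)"
        "cell C \<sigma>1 (m \<cdot> fob ev 1) (n \<cdot> fob ev 1)"
         "cell C \<sigma>2 (m \<cdot> fob ev 2) (n \<cdot> fob ev 2)"
        and sq: "(m \<rhd> far ev (0, 1)) \<bullet> \<sigma>1 = \<sigma>0 \<bullet> (n \<rhd> far ev (0, 1))"
          "(m \<rhd> far ev (1, 2)) \<bullet> \<sigma>2 = \<sigma>1 \<bullet> (n \<rhd> far ev (1, 2))" for m n A \<sigma>0 \<sigma>1 \<sigma>2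
    proof -
      define r where "r = (\<lambda>i::nat. if i = 0 then \<sigma>0 else if i = 1 then \<sigma>1 else \<sigma>2)"
      have c': "cell C (r i) (m \<cdot> fob ev i) (n \<cdot> fob ev i)" if "i \<le> 2" for i
        using le[OF that] s by (auto simp: r_def)
      have "\<exists>\<kappa>. cell C \<kappa> m n \<and> (\<forall>i\<le>2. \<kappa> \<lhd> fob ev i = r i)"
      proof (rule cotensor_ex2[OF P m c'])
        \<comment> \<open>Naturality at \<open>0 < 2\<close> is obtained by pasting the squares at
          \<open>0 < 1\<close> and \<open>1 < 2\<close>.\<close>
        have "(m \<rhd> far ev (0, 2)) \<bullet> \<sigma>2 = (m \<rhd> far ev (0, 1)) \<bullet> ((m \<rhd> far ev (1, 2)) \<bullet> \<sigma>2)"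
          using c d o m s by simp
        also have "\<dots> = ((m \<rhd> far ev (0, 1)) \<bullet> \<sigma>1) \<bullet> (n \<rhd> far ev (1, 2))"
          unfolding sq(2) using d o m s by simp
        also have "\<dots> = \<sigma>0 \<bullet> (n \<rhd> far ev (0, 2))"
          unfolding sq(1) using c d o m s by simp
        finally have 02: "(m \<rhd> far ev (0, 2)) \<bullet> \<sigma>2 = \<sigma>0 \<bullet> (n \<rhd> far ev (0, 2))" .
        show "(m \<rhd> far ev (i, j)) \<bullet> r j = r i \<bullet> (n \<rhd> far ev (i, j))" if ij: "i \<le> j" "j \<le> 2" for i j
        proof (cases "i = j")
          case True
          then show ?thesis using id[OF ij(2)] c'[OF ij(2)] ord_diagramD(1)[OF ev(1) ij(2)] m
            by simp
        next
          case False
          then show ?thesis using le2[OF ij] sq 02 by (auto simp: r_def)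
        qed
      qed
      then obtain \<kappa> where k: "cell C \<kappa> m n" "\<And>i. i \<le> 2 \<Longrightarrow> \<kappa> \<lhd> fob ev i = r i" by blast
      show ?thesis using k(1) k(2)[of 0] k(2)[of 1] k(2)[of 2]
        by (intro exI[of _ \<kappa>]) (simp add: r_def)
    qed
    show "\<kappa> = \<kappa>'" if m: "mor C m A P" "mor C n A P" and k: "cell C \<kappa> m n" "cell C \<kappa>' m n"
      and e: "\<kappa> \<lhd> fob ev 0 = \<kappa>' \<lhd> fob ev 0" "\<kappa> \<lhd> fob ev 1 = \<kappa>' \<lhd> fob ev 1"
        "\<kappa> \<lhd> fob ev 2 = \<kappa>' \<lhd> fob ev 2" for m n A \<kappa> \<kappa>'
    proof (rule cotensor_uniq2[OF P m k])
      show "\<kappa> \<lhd> fob ev i = \<kappa>' \<lhd> fob ev i" if "i \<le> 2" for i using le[OF that] e by metis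
    qed
    show "isoc C \<kappa>" if k: "\<kappa> \<in> Cell2 C" "cod1 C (dom2 C \<kappa>) = P" "isoc C (\<kappa> \<lhd> fob ev 0)"
      "isoc C (\<kappa> \<lhd> fob ev 1)" "isoc C (\<kappa> \<lhd> fob ev 2)" for \<kappa>
    proof (rule cotensor_isoc[OF P k(1,2)])
      show "isoc C (\<kappa> \<lhd> fob ev i)" if "i \<le> 2" for i using le[OF that] k(3-5) by metis
    qed
  qed (use ev o d c in simp_all)
qed

text \<open>A composable pair is two arrows sharing an object, so \<open>X^[2]\<close> is the
  pullback of the target \<open>d1\<close> and the source \<open>d0\<close> of the arrow object;
  \<open>p\<close> is the first arrow and \<open>q\<close> the second.\<close>

lemma cotensor_2_exists:
  assumes C: "pita C" and X: "X \<in> Cell0 C"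
  shows "\<exists>P ev. strict_cotensor C (ord_cat 2) X P ev"
proof -
  obtain P ev' where P: "arrow_object C X P ev'" using C X unfolding pita_def by blast
  define d0 d1 d where "d0 = fob ev' 0" "d1 = fob ev' 1" "d = bdry ev'"
  interpret A: universal_arrow C X P d0 d1 d
    unfolding d0_d1_d_def by (rule arrow_object_universal[OF P])
  obtain p q where pq: "strict_pullback C p q d1 d0"
    using C A.isofibration_d1 unfolding pita_def by fastforce
  note l = strict_pullback_legs[OF pq]
  define Q where "Q = dom1 C p"
  have p: "p \<in> Cell1 C" "dom1 C p = Q" "cod1 C p = P" "q \<in> Cell1 C" "dom1 C q = Q" "cod1 C q = P"
    and e: "q \<cdot> d0 = p \<cdot> d1"
    using l by (simp_all add: Q_def)
  have Q: "Q \<in> Cell0 C" using cell1_closed(1)[OF p(1)] p(2) by simp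
  define \<phi> \<psi> where "\<phi> = p \<rhd> d" "\<psi> = q \<rhd> d"
  have f: "\<phi> \<in> Cell2 C" "dom2 C \<phi> = p \<cdot> d0" "cod2 C \<phi> = p \<cdot> d1" "\<psi> \<in> Cell2 C" "dom2 C \<psi> = p \<cdot> d1"
    "cod2 C \<psi> = q \<cdot> d1"
    using p e by (simp_all add: \<phi>_\<psi>_def)
  define ev where "ev = \<lparr>fob = pair_ob C \<phi> \<psi>, far = (\<lambda>(i, j). pair_ar C \<phi> \<psi> i j)\<rparr>"
  have ob: "fob ev 0 = p \<cdot> d0" "fob ev 1 = p \<cdot> d1" "fob ev 2 = q \<cdot> d1"
    by (simp_all add: ev_def pair_ob_def f)
  have ar: "far ev (0, 1) = \<phi>" "far ev (1, 2) = \<psi>" by (simp_all add: ev_def pair_ar_def)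
  have le: "i = 0 \<or> i = 1 \<or> i = 2" if "i \<le> 2" for i :: nat using that by auto
  have le2: "i = j \<or> (i = 0 \<and> j = 1) \<or> (i = 1 \<and> j = 2) \<or> (i = 0 \<and> j = 2)" if "i \<le> j" "j \<le> 2"
    for i j :: nat using that by auto
  have dg: "ord_diagram C Q X 2 (fob ev) (\<lambda>i j. far ev (i, j))"
    unfolding ev_def using ord_diagram_2[of \<phi> \<psi> Q X] f p by simp
  note id = ord_diagramD(3)[OF dg]
  have c: "far ev (0, 2) = \<phi> \<bullet> \<psi>" using ord_diagramD(4)[OF dg, of 0 1 2] ar by simp
  have "strict_cotensor C (ord_cat 2) X Q ev"
  proof (rule strict_cotensorI[OF X Q dg])
    fix A a f assume A: "A \<in> Cell0 C" and a: "ord_diagram C A X 2 a f"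
    have ao: "mor C (a 0) A X" "mor C (a 1) A X" "mor C (a 2) A X"
      by (rule ord_diagramD(1)[OF a]; simp)+
    have af: "cell C (f 0 1) (a 0) (a 1)" "cell C (f 1 2) (a 1) (a 2)"
      by (rule ord_diagramD(2)[OF a]; simp)+
    obtain m1 where m1: "mor C m1 A P" "m1 \<rhd> d = f 0 1" using A.ex[of "f 0 1" A] ao af by auto
    obtain m2 where m2: "mor C m2 A P" "m2 \<rhd> d = f 1 2" using A.ex[of "f 1 2" A] ao af by auto
    have m10: "m1 \<cdot> d0 = a 0" using arg_cong[OF m1(2), of "dom2 C"] m1(1) af by simp
    have m11: "m1 \<cdot> d1 = a 1" using arg_cong[OF m1(2), of "cod2 C"] m1(1) af by simp
    have m20: "m2 \<cdot> d0 = a 1" using arg_cong[OF m2(2), of "dom2 C"] m2(1) af by simp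
    have m21: "m2 \<cdot> d1 = a 2" using arg_cong[OF m2(2), of "cod2 C"] m2(1) af by simp
    have "\<exists>m. mor C m A (dom1 C p) \<and> m \<cdot> p = m1 \<and> m \<cdot> q = m2"
      by (rule strict_pullback_ex[OF pq]) (use m1 m2 m11 m20 in simp_all)
    then obtain m where m: "mor C m A Q" "m \<cdot> p = m1" "m \<cdot> q = m2" using p(2) by blast
    have "m \<cdot> (p \<cdot> d0) = (m \<cdot> p) \<cdot> d0" "m \<cdot> (p \<cdot> d1) = (m \<cdot> p) \<cdot> d1" "m \<cdot> (q \<cdot> d1) = (m \<cdot> q) \<cdot> d1"
      "m \<rhd> \<phi> = (m \<cdot> p) \<rhd> d" "m \<rhd> \<psi> = (m \<cdot> q) \<rhd> d"
      using m(1) p by (simp_all add: \<phi>_\<psi>_def)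
    then have mo: "m \<cdot> fob ev 0 = a 0" "m \<cdot> fob ev 1 = a 1" "m \<cdot> fob ev 2 = a 2"
      and ma: "m \<rhd> \<phi> = f 0 1" "m \<rhd> \<psi> = f 1 2"
      unfolding m(2,3) ob m10 m11 m20 m21 m1(2) m2(2) by simp_all
    have mi: "m \<cdot> fob ev i = a i" if "i \<le> 2" for i using le[OF that] mo by metis
    have "m \<rhd> far ev (0, 2) = f 0 1 \<bullet> f 1 2" unfolding c using m(1) p f ma by simp
    then have m02: "m \<rhd> far ev (0, 2) = f 0 2" using ord_diagramD(4)[OF a, of 0 1 2] by simp
    have "m \<rhd> far ev (i, j) = f i j" if ij: "i \<le> j" "j \<le> 2" for i j
    proof (cases "i = j")
      case True
      then show ?thesis using id[OF ij(2)] mi[OF ij(2)] ord_diagramD(1)[OF dg ij(2)]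
        ord_diagramD(3)[OF a ij(2)] m(1) by simp
    next
      case False
      then show ?thesis using le2[OF ij] m02 ma ar by auto
    qed
    then show "\<exists>m. mor C m A Q \<and> (\<forall>i\<le>2. m \<cdot> fob ev i = a i) \<and> (\<forall>i j. i \<le> j \<longrightarrow> j \<le> 2 \<longrightarrow> m \<rhd> far ev (i,
        j) = f i j)"
      using m(1) mi by (intro exI[of _ m]) simp
  next
    fix A m n assume m: "mor C m A Q" "mor C n A Q"
      and e: "\<And>i j. i \<le> j \<Longrightarrow> j \<le> 2 \<Longrightarrow> m \<rhd> far ev (i, j) = n \<rhd> far ev (i, j)"
    have "m \<rhd> \<phi> = n \<rhd> \<phi>" "m \<rhd> \<psi> = n \<rhd> \<psi>" using e[of 0 1] e[of 1 2] ar by simp_all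
    then have "(m \<cdot> p) \<rhd> d = (n \<cdot> p) \<rhd> d" "(m \<cdot> q) \<rhd> d = (n \<cdot> q) \<rhd> d" using m p
      by (simp_all add: \<phi>_\<psi>_def)
    then have "m \<cdot> p = n \<cdot> p" "m \<cdot> q = n \<cdot> q"
      using A.uniq[of "m \<cdot> p" A "n \<cdot> p"] A.uniq[of "m \<cdot> q" A "n \<cdot> q"] m p by simp_all
    then show "m = n" by (intro strict_pullback_uniq[OF pq, of m A n]) (use m p in simp_all)
  next
    fix A m n \<sigma> assume m: "mor C m A Q" "mor C n A Q"
      and s: "\<And>i. i \<le> 2 \<Longrightarrow> cell C (\<sigma> i) (m \<cdot> fob ev i) (n \<cdot> fob ev i)"
      and nat: "\<And>i j. i \<le> j \<Longrightarrow> j \<le> 2 \<Longrightarrow> (m \<rhd> far ev (i, j)) \<bullet> \<sigma> j = \<sigma> i \<bullet> (n \<rhd> far ev (i, j))"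
    have "\<exists>\<kappa>. cell C \<kappa> (m \<cdot> p) (n \<cdot> p) \<and> \<kappa> \<lhd> d0 = \<sigma> 0 \<and> \<kappa> \<lhd> d1 = \<sigma> 1"
      by (rule A.ex2) (use m p s[of 0] s[of 1] nat[of 0 1] ob ar in \<open>simp_all add: \<phi>_\<psi>_def\<close>)
    then obtain \<kappa>1 where k1: "cell C \<kappa>1 (m \<cdot> p) (n \<cdot> p)" "\<kappa>1 \<lhd> d0 = \<sigma> 0" "\<kappa>1 \<lhd> d1 = \<sigma> 1" by blast
    have "\<exists>\<kappa>. cell C \<kappa> (m \<cdot> q) (n \<cdot> q) \<and> \<kappa> \<lhd> d0 = \<sigma> 1 \<and> \<kappa> \<lhd> d1 = \<sigma> 2"
      by (rule A.ex2) (use m p s[of 1] s[of 2] nat[of 1 2] ob ar e in \<open>simp_all add: \<phi>_\<psi>_def\<close>)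
    then obtain \<kappa>2 where k2: "cell C \<kappa>2 (m \<cdot> q) (n \<cdot> q)" "\<kappa>2 \<lhd> d0 = \<sigma> 1" "\<kappa>2 \<lhd> d1 = \<sigma> 2" by blast
    have "\<exists>\<kappa>. cell C \<kappa> m n \<and> \<kappa> \<lhd> p = \<kappa>1 \<and> \<kappa> \<lhd> q = \<kappa>2"
      by (rule strict_pullback_ex2[OF pq]) (use m p k1 k2 in simp_all)
    then obtain \<kappa> where k: "cell C \<kappa> m n" "\<kappa> \<lhd> p = \<kappa>1" "\<kappa> \<lhd> q = \<kappa>2" by blast
    have "\<kappa> \<lhd> fob ev 0 = \<sigma> 0" "\<kappa> \<lhd> fob ev 1 = \<sigma> 1" "\<kappa> \<lhd> fob ev 2 = \<sigma> 2"
      unfolding ob using k k1 k2 p m by simp_all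
    then have "\<kappa> \<lhd> fob ev i = \<sigma> i" if "i \<le> 2" for i using le[OF that] by metis
    then show "\<exists>\<kappa>. cell C \<kappa> m n \<and> (\<forall>i\<le>2. \<kappa> \<lhd> fob ev i = \<sigma> i)" using k(1) by blast
  next
    fix A m n \<kappa> \<kappa>' assume m: "mor C m A Q" "mor C n A Q" and k: "cell C \<kappa> m n" "cell C \<kappa>' m n"
      and e: "\<And>i. i \<le> 2 \<Longrightarrow> \<kappa> \<lhd> fob ev i = \<kappa>' \<lhd> fob ev i"
    have o: "\<kappa> \<lhd> p \<lhd> d0 = \<kappa>' \<lhd> p \<lhd> d0" "\<kappa> \<lhd> p \<lhd> d1 = \<kappa>' \<lhd> p \<lhd> d1" "\<kappa> \<lhd> q \<lhd> d1 = \<kappa>' \<lhd> q \<lhd> d1"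
      using e[of 0] e[of 1] e[of 2] k p m unfolding ob by simp_all
    \<comment> \<open>Vertex 1 is both the target of \<open>p\<close> and the source of
      \<open>q\<close>, so agreement there controls one end of each arrow.\<close>
    have "\<kappa> \<lhd> q \<lhd> d0 = \<kappa> \<lhd> (q \<cdot> d0)" "\<kappa>' \<lhd> q \<lhd> d0 = \<kappa>' \<lhd> (q \<cdot> d0)" using k p m by simp_all
    then have o2: "\<kappa> \<lhd> q \<lhd> d0 = \<kappa>' \<lhd> q \<lhd> d0" unfolding \<open>q \<cdot> d0 = p \<cdot> d1\<close> using o(2) k p m by simp
    have kp: "\<kappa> \<lhd> p = \<kappa>' \<lhd> p" by (rule A.uniq2[of "m \<cdot> p" A "n \<cdot> p"]) (use o k p m in simp_all)
    have kq: "\<kappa> \<lhd> q = \<kappa>' \<lhd> q" by (rule A.uniq2[of "m \<cdot> q" A "n \<cdot> q"]) (use o o2 k p m in simp_all)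
    show "\<kappa> = \<kappa>'" by (rule strict_pullback_uniq2[OF pq, of m A n]) (use m p k kp kq in simp_all)
  qed
  then show ?thesis by blast
qed

text \<open>A product is a pullback over the terminal object, where the compatibility condition on
  pairs is always satisfied. The pita axiom applies because every morphism to the terminal object is
  an isofibration.\<close>

lemma strict_product_exists:
  assumes C: "pita C" and X: "X \<in> Cell0 C" "Y \<in> Cell0 C"
  shows "\<exists>p q. strict_product C p q \<and> cod1 C p = X \<and> cod1 C q = Y"
proof -
  obtain I where I: "strict_terminal C I" using C unfolding pita_def by blast
  have t: "\<exists>!f. mor C f A I" if "A \<in> Cell0 C" for A
    using I that by (simp add: strict_terminal_def)
  have t2: "\<alpha> = \<beta>" if "A \<in> Cell0 C" "\<alpha> \<in> Ar (Hom C A I)" "\<beta> \<in> Ar (Hom C A I)" for A \<alpha> \<beta>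
    using I that unfolding strict_terminal_def by blast
  obtain u v where u: "mor C u X I" and v: "mor C v Y I" using t X by metis
  have "isofibration C u"
    unfolding isofibration_def isofibration_functor_def
  proof (intro conjI ballI allI impI)
    fix A x \<phi> assume A: "A \<in> Cell0 C" and x: "x \<in> Ob (Hom C A (dom1 C u))"
      and p: "iso_arrow (Hom C A (cod1 C u)) \<phi> \<and> Dm (Hom C A (cod1 C u)) \<phi> = fob (post C u) x"
    \<comment> \<open>Any two parallel tests in the hom-category of the terminal object coincide, so
      the identity of \<open>x\<close> already lifts \<phi>.\<close>
    have "id2 C x \<lhd> u = \<phi>"
      by (rule t2[OF A]) (use x p u isoc_cell[of \<phi>] in \<open>simp_all add: iso_Hom\<close>)
    then show "\<exists>\<psi>. iso_arrow (Hom C A (dom1 C u)) \<psi> \<and> Dm (Hom C A (dom1 C u)) \<psi> = x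
        \<and> far (post C u) \<psi> = \<phi>"
      using x by (intro exI[of _ "id2 C x"]) (simp add: iso_Hom)
  qed (use u post_functor[of u] in simp_all)
  then obtain p q where pq: "strict_pullback C p q u v"
    using C u v unfolding pita_def by fastforce
  note l = strict_pullback_legs[OF pq]
  have "pullback_cat (Hom C B X) (Hom C B Y) (post C u) (post C v)
      = prod_cat (Hom C B X) (Hom C B Y)" if B: "B \<in> Cell0 C" for B
  proof -
    have "x \<cdot> u = y \<cdot> v" if "mor C x B X" "mor C y B Y" for x y
      using ex1_implies_ex[OF t[OF B]] t[OF B] that u v by (metis U.Cmp_arr under_simps(6))
    moreover have "\<alpha> \<lhd> u = \<beta> \<lhd> v" if "\<alpha> \<in> Ar (Hom C B X)" "\<beta> \<in> Ar (Hom C B Y)" for \<alpha> \<beta>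
      by (rule t2[OF B]) (use that u v in simp_all)
    ultimately have "Ob (pullback_cat (Hom C B X) (Hom C B Y) (post C u) (post C v))
        = Ob (prod_cat (Hom C B X) (Hom C B Y))"
      "Ar (pullback_cat (Hom C B X) (Hom C B Y) (post C u) (post C v))
          = Ar (prod_cat (Hom C B X) (Hom C B Y))"
      unfolding pullback_cat_simps prod_cat_simps by (auto simp del: Hom_simps(2))
    then show ?thesis by (intro cat.equality) (simp_all add: pullback_cat_def)
  qed
  then have "strict_product C p q"
    using strict_pullback_iso[OF pq] l u v by (simp add: strict_product_def)
  then show ?thesis using l u v by auto
qed

section \<open>Cores\<close>

lemma core_legs:
  assumes "is_core C X i"
  shows "i \<in> Cell1 C" "cod1 C i = X" "arrow_wise_iso C i"
  using assms by (simp_all add: is_core_def)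

lemma core_cat_simps [simp]:
  "Ob (core_cat C A X) = {f. mor C f A X \<and> arrow_wise_iso C f}"
  "\<alpha> \<in> Ar (core_cat C A X) \<longleftrightarrow> \<alpha> \<in> Ar (Hom C A X) \<and> isoc C \<alpha> \<and> arrow_wise_iso C (dom2 C \<alpha>)
      \<and> arrow_wise_iso C (cod2 C \<alpha>)"
  "Dm (core_cat C A X) = dom2 C" "Cd (core_cat C A X) = cod2 C"
  by (auto simp: core_cat_def)

lemma core_iso:
  "is_core C X i \<Longrightarrow> A \<in> Cell0 C \<Longrightarrow> cat_isomorphism (Hom C A (dom1 C i)) (core_cat C A X) (post C i)"
  by (simp add: is_core_def)

lemma core_ex:
  assumes i: "is_core C X i" and f: "mor C f A X" "arrow_wise_iso C f"
  shows "\<exists>x. mor C x A (dom1 C i) \<and> x \<cdot> i = f"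
proof -
  have A: "A \<in> Cell0 C" using cell1_closed(1)[of f] f by auto
  have "f \<in> Ob (core_cat C A X)" using f by simp
  then show ?thesis using cat_isomorphism_ob_ex[OF core_iso[OF i A]] by fastforce
qed

lemma core_uniq:
  assumes i: "is_core C X i" and x: "mor C x A (dom1 C i)" "mor C y A (dom1 C i)" "x \<cdot> i = y \<cdot> i"
  shows "x = y"
proof -
  have A: "A \<in> Cell0 C" using cell1_closed(1)[of x] x by auto
  show ?thesis by (rule cat_isomorphism_ob_inj[OF core_iso[OF i A]]) (use x in simp_all)
qed

lemma core_ex2:
  assumes i: "is_core C X i" and x: "mor C x A (dom1 C i)" "mor C y A (dom1 C i)"
    and s: "cell C \<sigma> (x \<cdot> i) (y \<cdot> i)" "isoc C \<sigma>"
  shows "\<exists>\<kappa>. cell C \<kappa> x y \<and> \<kappa> \<lhd> i = \<sigma>"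
proof -
  have A: "A \<in> Cell0 C" using cell1_closed(1)[of x] x by auto
  have "\<exists>\<phi>. arr (Hom C A (dom1 C i)) \<phi> x y \<and> far (post C i) \<phi> = \<sigma>"
  proof (rule cat_isomorphism_ar_ex[OF core_iso[OF i A]])
    have a: "\<sigma> \<in> Ar (core_cat C A X)" using s x core_legs[OF i] by simp
    show "arr (core_cat C A X) \<sigma> (fob (post C i) x) (fob (post C i) y)"
      unfolding arr_def using a s by simp
  qed (use x in simp_all)
  then show ?thesis by (auto simp: arr_Hom)
qed

lemma core_uniq2:
  assumes i: "is_core C X i" and x: "mor C x A (dom1 C i)" "mor C y A (dom1 C i)"
    and s: "cell C \<kappa> x y" "cell C \<kappa>' x y" "\<kappa> \<lhd> i = \<kappa>' \<lhd> i"
  shows "\<kappa> = \<kappa>'"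
proof -
  have A: "A \<in> Cell0 C" using cell1_closed(1)[of x] x by auto
  show ?thesis by (rule cat_isomorphism_ar_inj[OF core_iso[OF i A]]) (use x s in simp_all)
qed

text \<open>Whiskering \<alpha> with the arrow-wise iso \<open>i\<close> gives an invertible 2-cell.
  Its inverse is an invertible 2-cell between arrow-wise isos, so it lifts through the core, and the
  lift inverts \<alpha>.\<close>

lemma core_groupoid:
  assumes i: "is_core C X i"
  shows "groupoid_object C (dom1 C i)"
proof (rule groupoid_objectI)
  note l = core_legs[OF i]
  show "dom1 C i \<in> Cell0 C" using l by simp
  fix \<alpha> assume a: "\<alpha> \<in> Cell2 C" "cod1 C (dom2 C \<alpha>) = dom1 C i"
  define x y where "x = dom2 C \<alpha>" "y = cod2 C \<alpha>"
  have x: "mor C x (dom1 C x) (dom1 C i)" "mor C y (dom1 C x) (dom1 C i)" "cell C \<alpha> x y"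
    using a by (simp_all add: x_y_def)
  obtain \<beta> where b: "\<beta> \<in> Cell2 C" "dom2 C \<beta> = y \<cdot> i" "cod2 C \<beta> = x \<cdot> i"
    "(\<alpha> \<lhd> i) \<bullet> \<beta> = id2 C (x \<cdot> i)" "\<beta> \<bullet> (\<alpha> \<lhd> i) = id2 C (y \<cdot> i)" "isoc C \<beta>"
    using isocE[OF awi_isoc[OF l(3) a]] l x by simp (metis (no_types, lifting))
  obtain \<kappa> where k: "cell C \<kappa> y x" "\<kappa> \<lhd> i = \<beta>" using core_ex2[OF i x(2,1) _ b(6)] b by auto
  have "\<alpha> \<bullet> \<kappa> = id2 C x" by (rule core_uniq2[OF i x(1,1)]) (use k x b l in simp_all)
  moreover have "\<kappa> \<bullet> \<alpha> = id2 C y" by (rule core_uniq2[OF i x(2,2)]) (use k x b l in simp_all)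
  ultimately show "isoc C \<alpha>" unfolding isoc_iff using k(1) x(3)
    by (intro conjI exI[of _ \<kappa>]) simp_all
qed

text \<open>Arrow-wise isos stay such after composition with \<open>f\<close>, so \<open>i\<close>
  followed by \<open>f\<close> factors uniquely through the core \<open>j\<close>; this justifies
  the description operator.\<close>

lemma core_map_spec:
  assumes i: "is_core C X i" and j: "is_core C Y j" and f: "mor C f X Y"
  shows "mor C (core_map C i j f) (dom1 C i) (dom1 C j)" "core_map C i j f \<cdot> j = i \<cdot> f"
proof -
  note l = core_legs[OF i]
  have "mor C (i \<cdot> f) (dom1 C i) Y" "arrow_wise_iso C (i \<cdot> f)" using l f by simp_all
  then obtain x where x: "mor C x (dom1 C i) (dom1 C j)" "x \<cdot> j = i \<cdot> f" using core_ex[OF j]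
    by blast
  have "\<exists>!m. mor C m (dom1 C i) (dom1 C j) \<and> m \<cdot> j = i \<cdot> f"
  proof (rule ex1I)
    show "mor C x (dom1 C i) (dom1 C j) \<and> x \<cdot> j = i \<cdot> f" using x by simp
    fix y assume y: "mor C y (dom1 C i) (dom1 C j) \<and> y \<cdot> j = i \<cdot> f"
    show "y = x" by (rule core_uniq[OF j, of _ "dom1 C i"]) (use x y in simp_all)
  qed
  from theI'[OF this] show "mor C (core_map C i j f) (dom1 C i) (dom1 C j)"
    "core_map C i j f \<cdot> j = i \<cdot> f"
    unfolding core_map_def by blast+
qed

section \<open>Induced morphisms between cotensors\<close>

lemma ord_diagram_reindex:
  assumes a: "ord_diagram C A X l a \<phi>" and u: "\<And>i. i \<le> k \<Longrightarrow> u i \<le> l"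
    "\<And>i j. i \<le> j \<Longrightarrow> j \<le> k \<Longrightarrow> u i \<le> u j"
  shows "ord_diagram C A X k (\<lambda>i. a (u i)) (\<lambda>i j. \<phi> (u i) (u j))"
proof (rule ord_diagramI)
  show "\<phi> (u i) (u m) = \<phi> (u i) (u j) \<bullet> \<phi> (u j) (u m)" if "i \<le> j" "j \<le> m" "m \<le> k" for i j m
    by (rule ord_diagramD(4)[OF a]) (use u that in simp_all)
qed (use u in \<open>simp_all add: ord_diagramD(1-3)[OF a] del: mor_iff cell_iff\<close>)

lemma ord_diagram_post:
  assumes a: "ord_diagram C A X k a \<phi>" and f: "mor C f X Y"
  shows "ord_diagram C A Y k (\<lambda>i. a i \<cdot> f) (\<lambda>i j. \<phi> i j \<lhd> f)"
proof (rule ord_diagramI)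
  show "mor C (a i \<cdot> f) A Y" if "i \<le> k" for i using ord_diagramD(1)[OF a that] f by simp
  show "cell C (\<phi> i j \<lhd> f) (a i \<cdot> f) (a j \<cdot> f)" if "i \<le> j" "j \<le> k" for i j
    using ord_diagramD(1)[OF a, of i] ord_diagramD(2)[OF a that] f that by simp
  show "\<phi> i i \<lhd> f = id2 C (a i \<cdot> f)" if "i \<le> k" for i
    using ord_diagramD(1,3)[OF a that] f by simp
  show "\<phi> i l \<lhd> f = (\<phi> i j \<lhd> f) \<bullet> (\<phi> j l \<lhd> f)" if "i \<le> j" "j \<le> l" "l \<le> k" for i j l
    unfolding ord_diagramD(4)[OF a that]
    using ord_diagramD(1)[OF a, of i] ord_diagramD(2)[OF a, of i j] ord_diagramD(2)[OF a, of j l] f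
      that by simp
qed

text \<open>Phrased over \<open>Ob\<close> and \<open>Ar\<close> to match the description operators
  in \<open>cotensor_reindex\<close> and \<open>cotensor_map\<close>, both of which are resolved
  with it.\<close>

lemma cotensor_ex1:
  assumes P: "strict_cotensor C (ord_cat k) X P ev" and A: "A \<in> Cell0 C"
    and a: "ord_diagram C A X k a \<phi>"
  shows "\<exists>!m. mor C m A P \<and> (\<forall>j\<in>Ob (ord_cat k). m \<cdot> fob ev j = a j) \<and>
    (\<forall>f\<in>Ar (ord_cat k). m \<rhd> far ev f = \<phi> (fst f) (snd f))"
proof -
  obtain m where m: "mor C m A P" "\<And>i. i \<le> k \<Longrightarrow> m \<cdot> fob ev i = a i"
    "\<And>i j. i \<le> j \<Longrightarrow> j \<le> k \<Longrightarrow> m \<rhd> far ev (i, j) = \<phi> i j"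
    using cotensor_ex[OF P A a] by blast
  show ?thesis
  proof (rule ex1I)
    show "mor C m A P \<and> (\<forall>j\<in>Ob (ord_cat k). m \<cdot> fob ev j = a j) \<and> (\<forall>f\<in>Ar (ord_cat k). m \<rhd> far ev f
        = \<phi> (fst f) (snd f))"
      using m by auto
    fix n assume n: "mor C n A P \<and> (\<forall>j\<in>Ob (ord_cat k). n \<cdot> fob ev j = a j)
        \<and> (\<forall>f\<in>Ar (ord_cat k). n \<rhd> far ev f = \<phi> (fst f) (snd f))"
    show "n = m"
      by (rule cotensor_uniq[OF P]) (use m n in simp_all)
  qed
qed

text \<open>Only the target has to be a cotensor; a diagram suffices as source. This covers
  \<open>X\<close> with \<open>ev_point\<close>, which is the source for the identity map of a
  nerve.\<close>

lemma cotensor_reindex_spec: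
  assumes P: "strict_cotensor C (ord_cat k) X P ev"
    and P': "ord_diagram C P' X l (fob ev') (\<lambda>i j. far ev' (i, j))" "P' \<in> Cell0 C"
    and u: "\<And>i. i \<le> k \<Longrightarrow> fob u i \<le> l" "\<And>i j. i \<le> j \<Longrightarrow> j \<le> k \<Longrightarrow> fob u i \<le> fob u j"
      "\<And>i j. i \<le> j \<Longrightarrow> j \<le> k \<Longrightarrow> far u (i, j) = (fob u i, fob u j)"
  shows "mor C (cotensor_reindex C (ord_cat k) u P' ev' P ev) P' P"
    "i \<le> k \<Longrightarrow> cotensor_reindex C (ord_cat k) u P' ev' P ev \<cdot> fob ev i = fob ev' (fob u i)"
    "i \<le> j \<Longrightarrow> j \<le> k \<Longrightarrow> cotensor_reindex C (ord_cat k) u P' ev' P ev \<rhd> far ev (i, j)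
        = far ev' (fob u i, fob u j)"
proof -
  have "ord_diagram C P' X k (\<lambda>i. fob ev' (fob u i)) (\<lambda>i j. far ev' (fob u i, fob u j))"
    by (rule ord_diagram_reindex[OF P'(1)]) (use u in simp_all)
  then have "ord_diagram C P' X k (\<lambda>i. fob ev' (fob u i)) (\<lambda>i j. far ev' (far u (i, j)))"
    by (rule ord_diagram_cong) (use u in simp_all)
  note ex1 = cotensor_ex1[OF P P'(2) this, unfolded prod.collapse]
  note t = theI'[OF ex1, folded cotensor_reindex_def]
  show "mor C (cotensor_reindex C (ord_cat k) u P' ev' P ev) P' P" using t by blast
  show "cotensor_reindex C (ord_cat k) u P' ev' P ev \<cdot> fob ev i = fob ev' (fob u i)" if "i \<le> k"
    using t that by simp
  show "cotensor_reindex C (ord_cat k) u P' ev' P ev \<rhd> far ev (i, j) = far ev' (fob u i, fob u j)"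
    if "i \<le> j" "j \<le> k"
    using t that u(3) by simp
qed

lemma cotensor_map_spec:
  assumes P: "strict_cotensor C (ord_cat k) X P ev" and Q: "strict_cotensor C (ord_cat k) Y Q ew"
    and f: "mor C f X Y"
  shows "mor C (cotensor_map C (ord_cat k) f P ev Q ew) P Q"
    "i \<le> k \<Longrightarrow> cotensor_map C (ord_cat k) f P ev Q ew \<cdot> fob ew i = fob ev i \<cdot> f"
    "i \<le> j \<Longrightarrow> j \<le> k \<Longrightarrow> cotensor_map C (ord_cat k) f P ev Q ew \<rhd> far ew (i, j) = far ev (i, j) \<lhd> f"
proof -
  note ev = cotensor_ord_diagram[OF P]
  note ex1 = cotensor_ex1[OF Q ev(3) ord_diagram_post[OF ev(1) f], unfolded prod.collapse]
  note t = theI'[OF ex1, folded cotensor_map_def]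
  show "mor C (cotensor_map C (ord_cat k) f P ev Q ew) P Q" using t by blast
  show "cotensor_map C (ord_cat k) f P ev Q ew \<cdot> fob ew i = fob ev i \<cdot> f" if "i \<le> k"
    using t that by simp
  show "cotensor_map C (ord_cat k) f P ev Q ew \<rhd> far ew (i, j) = far ev (i, j) \<lhd> f"
    if "i \<le> j" "j \<le> k"
    using t that by simp
qed

lemma ord_diagram_point: "X \<in> Cell0 C \<Longrightarrow> ord_diagram C X X k (fob (ev_point C X)) (\<lambda>i j. far
    (ev_point C X) (i, j))"
  by (rule ord_diagramI) (simp_all add: ev_point_def)

text \<open>Evaluation at the point is the identity of \<open>X\<close>, so the defining property
  names the morphism outright. Hence source and target of a nerve are induced by the two ends of the
  arrow object.\<close>

lemma cotensor_reindex_point: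
  assumes P: "arrow_object C X P ev" and j: "j \<le> 1"
  shows "cotensor_reindex C (ord_cat 0) (delta [j]) P ev X (ev_point C X) = fob ev j"
proof -
  note ev = cotensor_ord_diagram[OF P]
  note o = ord_diagramD(1,3)[OF ev(1) j]
  show ?thesis unfolding cotensor_reindex_def
  proof (rule the_equality)
    show "mor C (fob ev j) P X \<and> (\<forall>j'\<in>Ob (ord_cat 0). fob ev j \<cdot> fob (ev_point C X) j'
        = fob ev (fob (delta [j]) j')) \<and>
      (\<forall>f\<in>Ar (ord_cat 0). fob ev j \<rhd> far (ev_point C X) f = far ev (far (delta [j]) f))"
      using o ev by (auto simp: ev_point_def delta_def)
    fix m assume "mor C m P X \<and> (\<forall>j'\<in>Ob (ord_cat 0). m \<cdot> fob (ev_point C X) j'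
        = fob ev (fob (delta [j]) j')) \<and>
      (\<forall>f\<in>Ar (ord_cat 0). m \<rhd> far (ev_point C X) f = far ev (far (delta [j]) f))"
    then have "mor C m P X" "m \<cdot> id1 C X = fob ev j" by (simp_all add: ev_point_def delta_def)
    then show "m = fob ev j" by simp
  qed
qed

end

section \<open>Nerves by their universal property\<close>

text \<open>A cocone \<open>(i, \<theta>)\<close> with vertex \<open>X\<close> under \<open>K\<close> that exhibits morphisms into \<open>C0 K\<close> and \<open>C1 K\<close> as
  arrow-wise isos into \<open>X\<close> and 2-cells between them; \<open>|C|(A, K)\<close> is then the full subcategory of
  \<open>C(A, X)\<close> on the arrow-wise isos.\<close>

locale nerve_like = two_category C for C :: "('o, 'm, 'c) two_cat" (structure) +
  fixes K :: "('o, 'm) icat" and X i \<theta>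
  assumes i_mor [simp]: "i \<in> Cell1 C" "dom1 C i = C0 K" "cod1 C i = X"
    and awi_i [simp]: "arrow_wise_iso C i"
    and str [simp]: "pi0 K \<in> Cell1 C" "dom1 C (pi0 K) = C1 K" "cod1 C (pi0 K) = C0 K"
      "pi1 K \<in> Cell1 C" "dom1 C (pi1 K) = C1 K" "cod1 C (pi1 K) = C0 K"
      "ie K \<in> Cell1 C" "dom1 C (ie K) = C0 K" "cod1 C (ie K) = C1 K"
      "pi01 K \<in> Cell1 C" "dom1 C (pi01 K) = C2 K" "cod1 C (pi01 K) = C1 K"
      "pi12 K \<in> Cell1 C" "dom1 C (pi12 K) = C2 K" "cod1 C (pi12 K) = C1 K"
      "pi02 K \<in> Cell1 C" "dom1 C (pi02 K) = C2 K" "cod1 C (pi02 K) = C1 K"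
    and th [simp]: "\<theta> \<in> Cell2 C" "dom2 C \<theta> = pi0 K \<cdot> i" "cod2 C \<theta> = pi1 K \<cdot> i"
    and ie_th: "ie K \<rhd> \<theta> = id2 C i"
    and comp_th: "pi02 K \<rhd> \<theta> = (pi01 K \<rhd> \<theta>) \<bullet> (pi12 K \<rhd> \<theta>)"
    and gpd: "groupoid_object C (C0 K)" "groupoid_object C (C1 K)" "groupoid_object C (C2 K)"
    and ob_ex: "mor C f A X \<Longrightarrow> arrow_wise_iso C f \<Longrightarrow> \<exists>x. mor C x A (C0 K) \<and> x \<cdot> i = f"
    and ob_uniq: "mor C x A (C0 K) \<Longrightarrow> mor C y A (C0 K) \<Longrightarrow> x \<cdot> i = y \<cdot> i \<Longrightarrow> x = y"
    and ob_ex2: "mor C x A (C0 K) \<Longrightarrow> mor C y A (C0 K) \<Longrightarrow> cell C \<sigma> (x \<cdot> i) (y \<cdot> i) \<Longrightarrow> isoc C \<sigma> \<Longrightarrow>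
      \<exists>\<kappa>. cell C \<kappa> x y \<and> \<kappa> \<lhd> i = \<sigma>"
    and ob_uniq2: "mor C x A (C0 K) \<Longrightarrow> mor C y A (C0 K) \<Longrightarrow> cell C \<kappa> x y \<Longrightarrow> cell C \<kappa>' x y \<Longrightarrow> \<kappa> \<lhd> i
        = \<kappa>' \<lhd> i \<Longrightarrow> \<kappa> = \<kappa>'"
    and ar_ex: "\<phi> \<in> Cell2 C \<Longrightarrow> dom1 C (dom2 C \<phi>) = A \<Longrightarrow> cod1 C (dom2 C \<phi>) = X
        \<Longrightarrow> arrow_wise_iso C (dom2 C \<phi>) \<Longrightarrow>
      arrow_wise_iso C (cod2 C \<phi>) \<Longrightarrow> \<exists>a. mor C a A (C1 K) \<and> a \<rhd> \<theta> = \<phi>"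
    and ar_uniq: "mor C a A (C1 K) \<Longrightarrow> mor C b A (C1 K) \<Longrightarrow> a \<rhd> \<theta> = b \<rhd> \<theta> \<Longrightarrow> a = b"
    and ar_ex2: "mor C a A (C1 K) \<Longrightarrow> mor C b A (C1 K) \<Longrightarrow> cell C \<sigma> (a \<cdot> pi0 K) (b \<cdot> pi0 K) \<Longrightarrow>
      cell C \<tau> (a \<cdot> pi1 K) (b \<cdot> pi1 K) \<Longrightarrow> (a \<rhd> \<theta>) \<bullet> (\<tau> \<lhd> i) = (\<sigma> \<lhd> i) \<bullet> (b \<rhd> \<theta>) \<Longrightarrow>
      \<exists>\<kappa>. cell C \<kappa> a b \<and> \<kappa> \<lhd> pi0 K = \<sigma> \<and> \<kappa> \<lhd> pi1 K = \<tau>"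
    and ar_uniq2: "mor C a A (C1 K) \<Longrightarrow> mor C b A (C1 K) \<Longrightarrow> cell C \<kappa> a b \<Longrightarrow> cell C \<kappa>' a b \<Longrightarrow>
      \<kappa> \<lhd> pi0 K = \<kappa>' \<lhd> pi0 K \<Longrightarrow> \<kappa> \<lhd> pi1 K = \<kappa>' \<lhd> pi1 K \<Longrightarrow> \<kappa> = \<kappa>'"
    and pb: "strict_pullback C (pi01 K) (pi12 K) (pi1 K) (pi0 K)"
begin

lemma obj_closed [simp]: "C0 K \<in> Cell0 C" "C1 K \<in> Cell0 C" "C2 K \<in> Cell0 C" "X \<in> Cell0 C"
  using gpd cell1_closed(2)[OF i_mor(1)] unfolding i_mor(3) by (auto simp: groupoid_object_def)

lemma pb_eq: "pi12 K \<cdot> pi0 K = pi01 K \<cdot> pi1 K"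
  using strict_pullback_legs(9)[OF pb] by simp

lemma pb_eq_i: "pi01 K \<cdot> (pi1 K \<cdot> i) = pi12 K \<cdot> (pi0 K \<cdot> i)"
  using pb_eq comp1_assoc[of "pi01 K" "pi1 K" i] comp1_assoc[of "pi12 K" "pi0 K" i] by simp

text \<open>The cocone equation \<open>comp_th\<close> at a generalized element: composition in
  \<open>K\<close> is vertical composition of the named 2-cells.\<close>

lemma pi02_th:
  assumes "mor C m A (C2 K)"
  shows "(m \<cdot> pi02 K) \<rhd> \<theta> = ((m \<cdot> pi01 K) \<rhd> \<theta>) \<bullet> ((m \<cdot> pi12 K) \<rhd> \<theta>)"
  using assms comp_th pb_eq_i by simp

lemma src_th: "mor C a A (C1 K) \<Longrightarrow> dom2 C (a \<rhd> \<theta>) = (a \<cdot> pi0 K) \<cdot> i"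
  and trg_th: "mor C a A (C1 K) \<Longrightarrow> cod2 C (a \<rhd> \<theta>) = (a \<cdot> pi1 K) \<cdot> i"
  by simp_all

text \<open>Since \<open>i\<close> is injective on morphisms into \<open>C0 K\<close>, the endpoints
  of an arrow of \<open>K\<close> can be read off from the 2-cell that it names.\<close>

lemma src_eqI: "mor C a A (C1 K) \<Longrightarrow> mor C x A (C0 K) \<Longrightarrow> dom2 C (a \<rhd> \<theta>) = x \<cdot> i \<Longrightarrow> a \<cdot> pi0 K = x"
  by (rule ob_uniq[of _ A]) simp_all

lemma trg_eqI: "mor C a A (C1 K) \<Longrightarrow> mor C x A (C0 K) \<Longrightarrow> cod2 C (a \<rhd> \<theta>) = x \<cdot> i \<Longrightarrow> a \<cdot> pi1 K = x"
  by (rule ob_uniq[of _ A]) simp_all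

text \<open>By \<open>ie_th\<close> the 2-cell named by \<open>ie K\<close> is an identity, which
  has both ends \<open>i\<close>. The general rule for ends of whiskerings is removed so that they
  are computed from this identity.\<close>

lemma ie_ends: "ie K \<cdot> pi0 K = id1 C (C0 K)" "ie K \<cdot> pi1 K = id1 C (C0 K)"
  by (rule src_eqI[of _ "C0 K"] trg_eqI[of _ "C0 K"]; simp add: ie_th del: lwhisk_closed)+

lemma comp_ends: "pi02 K \<cdot> pi0 K = pi01 K \<cdot> pi0 K" "pi02 K \<cdot> pi1 K = pi12 K \<cdot> pi1 K"
proof -
  have c: "cod2 C (pi01 K \<rhd> \<theta>) = dom2 C (pi12 K \<rhd> \<theta>)"
    unfolding src_th[of "pi12 K" "C2 K", simplified] using pb_eq by (simp flip: comp1_assoc)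
  have "dom2 C (pi02 K \<rhd> \<theta>) = dom2 C (pi01 K \<rhd> \<theta>)" "cod2 C (pi02 K \<rhd> \<theta>) = cod2 C (pi12 K \<rhd> \<theta>)"
    unfolding comp_th using c by (simp_all del: lwhisk_closed(2,3))
  then show "pi02 K \<cdot> pi0 K = pi01 K \<cdot> pi0 K" "pi02 K \<cdot> pi1 K = pi12 K \<cdot> pi1 K"
    by (intro src_eqI[of _ "C2 K"] trg_eqI[of _ "C2 K"]; simp)+
qed

lemma mediator:
  assumes a: "mor C a A (C1 K)" "mor C b A (C1 K)" "a \<cdot> pi1 K = b \<cdot> pi0 K"
  obtains m where "mor C m A (C2 K)" "m \<cdot> pi01 K = a" "m \<cdot> pi12 K = b"
    "icomp (under C) K a b = m \<cdot> pi02 K"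
proof -
  have "\<exists>m. mor C m A (dom1 C (pi01 K)) \<and> m \<cdot> pi01 K = a \<and> m \<cdot> pi12 K = b"
    by (rule strict_pullback_ex[OF pb]) (use a in simp_all)
  then obtain m where m: "mor C m A (C2 K)" "m \<cdot> pi01 K = a" "m \<cdot> pi12 K = b" by auto
  have "(THE n. mor C n A (C2 K) \<and> n \<cdot> pi01 K = a \<and> n \<cdot> pi12 K = b) = m"
  proof (rule the_equality)
    fix n assume n: "mor C n A (C2 K) \<and> n \<cdot> pi01 K = a \<and> n \<cdot> pi12 K = b"
    show "n = m" by (rule strict_pullback_uniq[OF pb, of _ A]) (use m n in simp_all)
  qed (use m in simp)
  then have "icomp (under C) K a b = m \<cdot> pi02 K" using a by (simp add: icomp_def)
  then show ?thesis using that m by blast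
qed

text \<open>Read through the mediator, \<open>pi02_th\<close> says that whiskering \<theta> turns
  \<open>icomp\<close> into vertical composition.\<close>

lemma icomp_mor:
  assumes a: "mor C a A (C1 K)" "mor C b A (C1 K)" "a \<cdot> pi1 K = b \<cdot> pi0 K"
  shows "mor C (icomp (under C) K a b) A (C1 K)" "icomp (under C) K a b \<rhd> \<theta> = (a \<rhd> \<theta>) \<bullet> (b \<rhd> \<theta>)"
    "icomp (under C) K a b \<cdot> pi0 K = a \<cdot> pi0 K" "icomp (under C) K a b \<cdot> pi1 K = b \<cdot> pi1 K"
proof -
  obtain m where m: "mor C m A (C2 K)" "m \<cdot> pi01 K = a" "m \<cdot> pi12 K = b"
    and e: "icomp (under C) K a b = m \<cdot> pi02 K"
    using mediator[OF a] by blast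
  show "mor C (icomp (under C) K a b) A (C1 K)" unfolding e using m(1) by simp
  show "icomp (under C) K a b \<rhd> \<theta> = (a \<rhd> \<theta>) \<bullet> (b \<rhd> \<theta>)"
    unfolding e pi02_th[OF m(1)] m(2,3) ..
  have "(m \<cdot> pi02 K) \<cdot> pi0 K = (m \<cdot> pi01 K) \<cdot> pi0 K" "(m \<cdot> pi02 K) \<cdot> pi1 K = (m \<cdot> pi12 K) \<cdot> pi1 K"
    using m(1) comp_ends by simp_all
  then show "icomp (under C) K a b \<cdot> pi0 K = a \<cdot> pi0 K" "icomp (under C) K a b \<cdot> pi1 K = b \<cdot> pi1 K"
    unfolding e m(2,3) by simp_all
qed

lemma ie_pre_th: "mor C x A (C0 K) \<Longrightarrow> (x \<cdot> ie K) \<rhd> \<theta> = id2 C (x \<cdot> i)"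
  by (simp add: ie_th)

lemma composable_th:
  assumes "mor C a A (C1 K)" "mor C b A (C1 K)" "a \<cdot> pi1 K = b \<cdot> pi0 K"
  shows "cod2 C (a \<rhd> \<theta>) = dom2 C (b \<rhd> \<theta>)"
  unfolding src_th[OF assms(2)] trg_th[OF assms(1)] assms(3) ..

text \<open>Whiskering \<theta> is injective on morphisms into \<open>C1 K\<close> and turns
  internal composites and identities into vertical ones, so the axioms are inherited from the
  hom-categories into \<open>X\<close>.\<close>

lemma nerve_internal_category: "internal_category (under C) K"
proof -
  have l: "icomp (under C) K (pi0 K \<cdot> ie K) (id1 C (C1 K)) = id1 C (C1 K)"
  proof -
    have c: "mor C (pi0 K \<cdot> ie K) (C1 K) (C1 K)" "mor C (id1 C (C1 K)) (C1 K) (C1 K)"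
      "(pi0 K \<cdot> ie K) \<cdot> pi1 K = id1 C (C1 K) \<cdot> pi0 K" using ie_ends by simp_all
    show ?thesis
      by (rule ar_uniq[of _ "C1 K"]) (use icomp_mor[OF c] c ie_pre_th[of "pi0 K"
        "C1 K"] in simp_all)
  qed
  have r: "icomp (under C) K (id1 C (C1 K)) (pi1 K \<cdot> ie K) = id1 C (C1 K)"
  proof -
    have c: "mor C (id1 C (C1 K)) (C1 K) (C1 K)" "mor C (pi1 K \<cdot> ie K) (C1 K) (C1 K)"
      "id1 C (C1 K) \<cdot> pi1 K = (pi1 K \<cdot> ie K) \<cdot> pi0 K" using ie_ends by simp_all
    show ?thesis
      by (rule ar_uniq[of _ "C1 K"]) (use icomp_mor[OF c] c ie_pre_th[of "pi1 K"
        "C1 K"] in simp_all)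
  qed
  have as: "icomp (under C) K (icomp (under C) K a b) c = icomp (under C) K a (icomp (under C) K b
      c)"
    if a: "mor C a A (C1 K)" and b: "mor C b A (C1 K)" and c: "mor C c A (C1 K)"
      and ab: "a \<cdot> pi1 K = b \<cdot> pi0 K" and bc: "b \<cdot> pi1 K = c \<cdot> pi0 K" for A a b c
  proof -
    note iab = icomp_mor[OF a b ab] and ibc = icomp_mor[OF b c bc]
    have abc: "icomp (under C) K a b \<cdot> pi1 K = c \<cdot> pi0 K"
      "a \<cdot> pi1 K = icomp (under C) K b c \<cdot> pi0 K"
      using iab ibc ab bc by simp_all
    note j1 = icomp_mor[OF iab(1) c abc(1)] and j2 = icomp_mor[OF a ibc(1) abc(2)]
    show ?thesis
    proof (rule ar_uniq[OF j1(1) j2(1)])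
      have "a \<rhd> \<theta> \<in> Cell2 C" "b \<rhd> \<theta> \<in> Cell2 C" "c \<rhd> \<theta> \<in> Cell2 C" using a b c by simp_all
      then show "icomp (under C) K (icomp (under C) K a b) c \<rhd> \<theta>
          = icomp (under C) K a (icomp (under C) K b c) \<rhd> \<theta>"
        unfolding j1(2) j2(2) iab(2) ibc(2) by (rule vcomp_assoc) (rule composable_th[OF a b ab]
          composable_th[OF b c bc])+
    qed
  qed
  show ?thesis
    unfolding internal_category_def
    by (intro conjI allI impI) (use l r as ie_ends comp_ends strict_pullback_is_pullback[OF pb] in
      \<open>simp_all del: mor_iff\<close>, simp_all)
qed

section \<open>Lifting properties of the structure maps of a nerve\<close>

lemma square_th:
  assumes "\<psi> \<in> Cell2 C" "cod1 C (dom2 C \<psi>) = C1 K"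
  shows "(dom2 C \<psi> \<rhd> \<theta>) \<bullet> (\<psi> \<lhd> pi1 K \<lhd> i) = (\<psi> \<lhd> pi0 K \<lhd> i) \<bullet> (cod2 C \<psi> \<rhd> \<theta>)"
  using whisker_exchange[of \<psi> \<theta>] assms by simp

text \<open>Moving the ends of an arrow along 2-cells is conjugation. It is possible because 2-cells
  into \<open>C0 K\<close> become invertible after \<open>i\<close>, an arrow-wise iso.\<close>

lemma transport:
  assumes x: "mor C x A (C1 K)" and s: "cell C \<sigma> (x \<cdot> pi0 K) y0" "cell C \<tau> (x \<cdot> pi1 K) y1"
  obtains b \<kappa> where "mor C b A (C1 K)" "b \<cdot> pi0 K = y0" "b \<cdot> pi1 K = y1" "cell C \<kappa> x b"
    "\<kappa> \<lhd> pi0 K = \<sigma>" "\<kappa> \<lhd> pi1 K = \<tau>"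
proof -
  have y: "mor C y0 A (C0 K)" "mor C y1 A (C0 K)"
    using s x cell2_closed(2,6,7)[of \<sigma>] cell2_closed(2,6,7)[of \<tau>] by auto
  have iso: "isoc C (\<sigma> \<lhd> i)" using awi_isoc[OF awi_i, of \<sigma>] s x by simp
  obtain \<beta> where b: "\<beta> \<in> Cell2 C" "dom2 C \<beta> = y0 \<cdot> i" "cod2 C \<beta> = (x \<cdot> pi0 K) \<cdot> i"
    "(\<sigma> \<lhd> i) \<bullet> \<beta> = id2 C ((x \<cdot> pi0 K) \<cdot> i)"
    by (rule isocE[OF iso]) (use s x y in simp)
  \<comment> \<open>The arrow \<open>x\<close> conjugated by the two given 2-cells: \<beta> inverts
    the whiskering of \<sigma> with \<open>i\<close>.\<close>
  define \<phi> where "\<phi> = \<beta> \<bullet> ((x \<rhd> \<theta>) \<bullet> (\<tau> \<lhd> i))"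
  have p: "\<phi> \<in> Cell2 C" "dom2 C \<phi> = y0 \<cdot> i" "cod2 C \<phi> = y1 \<cdot> i"
    using b s x y by (simp_all add: \<phi>_def)
  obtain c where c: "mor C c A (C1 K)" "c \<rhd> \<theta> = \<phi>"
    using ar_ex[of \<phi> A] p y by auto
  have c0: "c \<cdot> pi0 K = y0" by (rule src_eqI[OF c(1) y(1)]) (simp only: c(2) p(2))
  have c1: "c \<cdot> pi1 K = y1" by (rule trg_eqI[OF c(1) y(2)]) (simp only: c(2) p(3))
  have "(\<sigma> \<lhd> i) \<bullet> \<phi> = (x \<rhd> \<theta>) \<bullet> (\<tau> \<lhd> i)"
    unfolding \<phi>_def using b s x y by (subst vcomp_cancel_assoc[OF _ _ _ _ _ b(4)]) simp_all
  then have "\<exists>\<kappa>. cell C \<kappa> x c \<and> \<kappa> \<lhd> pi0 K = \<sigma> \<and> \<kappa> \<lhd> pi1 K = \<tau>"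
    by (intro ar_ex2[OF x c(1)]) (use s c0 c1 c(2) in simp_all)
  then show ?thesis using that c c0 c1 by blast
qed

text \<open>In the square \<open>square_th\<close> the side coming from the sources is invertible.
  Cancelling it shows that the 2-cells named by the two targets agree, hence so do the targets, and
  then \<open>ar_uniq2\<close> applies.\<close>

lemma target_unique:
  assumes "\<psi> \<in> Cell2 C" "cod1 C (dom2 C \<psi>) = C1 K" "\<psi>' \<in> Cell2 C" "dom2 C \<psi>' = dom2 C \<psi>"
    and e: "\<psi> \<lhd> pi0 K = \<psi>' \<lhd> pi0 K" "\<psi> \<lhd> pi1 K = \<psi>' \<lhd> pi1 K"
  shows "\<psi> = \<psi>'"
proof -
  define x b b' where "x = dom2 C \<psi>" "b = cod2 C \<psi>" "b' = cod2 C \<psi>'"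
  define A where "A = dom1 C x"
  have m: "mor C x A (C1 K)" "mor C b A (C1 K)" "mor C b' A (C1 K)" "cell C \<psi> x b" "cell C \<psi>' x b'"
    using assms(1-4) cell2_closed(6,7)[OF assms(3)] by (simp_all add: x_b_b'_def A_def)
  have iso: "isoc C (\<psi> \<lhd> pi0 K \<lhd> i)" using awi_isoc[OF awi_i, of "\<psi> \<lhd> pi0 K"] m by simp
  have sq: "(\<psi> \<lhd> pi0 K \<lhd> i) \<bullet> (b \<rhd> \<theta>) = (\<psi> \<lhd> pi0 K \<lhd> i) \<bullet> (b' \<rhd> \<theta>)"
    using square_th[of \<psi>] square_th[of \<psi>'] m e by simp
  have b: "b \<cdot> pi0 K = b' \<cdot> pi0 K" using arg_cong[OF e(1), of "cod2 C"] m by simp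
  then have b': "b \<cdot> (pi0 K \<cdot> i) = b' \<cdot> (pi0 K \<cdot> i)"
    using comp1_assoc[of b "pi0 K" i] comp1_assoc[of b' "pi0 K" i] m by simp
  have "b \<rhd> \<theta> = b' \<rhd> \<theta>"
    by (rule isoc_cancel_left[OF iso _ _ _ _ sq]) (use m b' in simp_all)
  then have "b = b'" by (rule ar_uniq[OF m(2,3)])
  then show ?thesis using ar_uniq2[OF m(1,2), of \<psi> \<psi>'] m e by simp
qed

text \<open>Needed to form composable triples as a pullback of \<open>pi12 K\<close> and
  \<open>pi01 K\<close>. When the second arrow moves along \<phi>, the first is carried along so
  that the pair stays composable.\<close>

lemma isofibration_pi12: "isofibration C (pi12 K)"
  unfolding isofibration_def
proof (intro conjI ballI)
  fix A assume A: "A \<in> Cell0 C"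
  have "\<exists>\<psi>. iso_arrow (Hom C A (C2 K)) \<psi> \<and> Dm (Hom C A (C2 K)) \<psi> = m \<and> far (post C (pi12 K)) \<psi> = \<phi>"
    if m: "mor C m A (C2 K)" and p: "isoc C \<phi>" "dom2 C \<phi> = m \<cdot> pi12 K" for m \<phi>
  proof -
    define y where "y = cod2 C \<phi>"
    have y: "cell C \<phi> (m \<cdot> pi12 K) y" "mor C y A (C1 K)"
      using isoc_cell[OF p(1)] p(2) m cell2_closed(2,6,7)[of \<phi>] by (simp_all add: y_def)
    have e: "(m \<cdot> pi01 K) \<cdot> pi1 K = (m \<cdot> pi12 K) \<cdot> pi0 K" using m pb_eq by simp
    \<comment> \<open>The first arrow keeps its source, by an identity 2-cell, and its target
      follows the source of the second arrow.\<close>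
    obtain b \<kappa> where b: "mor C b A (C1 K)" "b \<cdot> pi1 K = y \<cdot> pi0 K"
      "cell C \<kappa> (m \<cdot> pi01 K) b" "\<kappa> \<lhd> pi1 K = \<phi> \<lhd> pi0 K"
      by (rule transport[of "m \<cdot> pi01 K" A "id2 C ((m \<cdot> pi01 K) \<cdot> pi0 K)" "(m \<cdot> pi01 K) \<cdot> pi0 K"
        "\<phi> \<lhd> pi0 K" "y \<cdot> pi0 K"])
        (use m y e in simp_all)
    have "\<exists>n. mor C n A (dom1 C (pi01 K)) \<and> n \<cdot> pi01 K = b \<and> n \<cdot> pi12 K = y"
      by (rule strict_pullback_ex[OF pb]) (use b y in simp_all)
    then obtain n where n: "mor C n A (C2 K)" "n \<cdot> pi01 K = b" "n \<cdot> pi12 K = y" by auto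
    have "\<exists>\<kappa>'. cell C \<kappa>' m n \<and> \<kappa>' \<lhd> pi01 K = \<kappa> \<and> \<kappa>' \<lhd> pi12 K = \<phi>"
      by (rule strict_pullback_ex2[OF pb]) (use b y m n in simp_all)
    then obtain \<kappa>' where k: "cell C \<kappa>' m n" "\<kappa>' \<lhd> pi12 K = \<phi>" by blast
    have "isoc C \<kappa>'" by (rule groupoid_objectD[OF gpd(3)]) (use k m in simp_all)
    then show ?thesis using k m by (intro exI[of _ \<kappa>']) (simp add: iso_Hom)
  qed
  then show "isofibration_functor (Hom C A (dom1 C (pi12 K))) (Hom C A (cod1 C (pi12 K))) (post C
      (pi12 K))"
    unfolding isofibration_functor_def using post_functor[of "pi12 K" A] by (auto simp: iso_Hom)
qed simp

text \<open>A 2-cell into the product is a pair of 2-cells to be imposed on the two ends of an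
  arrow: \<open>transport\<close> supplies the lift and \<open>target_unique\<close> its
  uniqueness.\<close>

lemma pairing_DOF:
  assumes "is_pairing C p q (pi0 K) (pi1 K) m" "cod1 C p = C0 K" "cod1 C q = C0 K"
  shows "DOF C m"
proof -
  have pr: "strict_product C p q" using assms(1) by (simp add: is_pairing_def)
  define Q where "Q = dom1 C p"
  have m: "m \<in> Cell1 C" "dom1 C m = C1 K" "cod1 C m = Q" and mp: "m \<cdot> p = pi0 K" "m \<cdot> q = pi1 K"
    using assms(1) by (simp_all add: is_pairing_def Q_def)
  have p: "p \<in> Cell1 C" "q \<in> Cell1 C" "dom1 C p = Q" "dom1 C q = Q" "cod1 C p = C0 K"
    "cod1 C q = C0 K"
    using pr assms(2,3) by (simp_all add: strict_product_def Q_def)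
  have mm: "\<psi> \<lhd> m \<lhd> p = \<psi> \<lhd> pi0 K" "\<psi> \<lhd> m \<lhd> q = \<psi> \<lhd> pi1 K"
    if "\<psi> \<in> Cell2 C" "cod1 C (dom2 C \<psi>) = C1 K" for \<psi>
    using that m p mp whisker_comp1(2)[of m p \<psi>] whisker_comp1(2)[of m q \<psi>] by simp_all
  have xm: "(x \<cdot> m) \<cdot> p = x \<cdot> pi0 K" "(x \<cdot> m) \<cdot> q = x \<cdot> pi1 K" if "x \<in> Cell1 C" "cod1 C x = C1 K"
    for x
    using that m p mp by simp_all
  have main: "\<exists>!\<psi>. \<psi> \<in> Ar (Hom C A (C1 K)) \<and> Dm (Hom C A (C1 K)) \<psi> = x \<and> far (post C m) \<psi> = \<phi>"
    if x: "mor C x A (C1 K)" and f: "\<phi> \<in> Cell2 C" "dom2 C \<phi> = x \<cdot> m" for A x \<phi>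
  proof -
    define z where "z = cod2 C \<phi>"
    have z: "cell C \<phi> (x \<cdot> m) z" "mor C z A Q"
      using f x m cell2_closed(2,6,7)[of \<phi>] by (simp_all add: z_def)
    have s: "cell C (\<phi> \<lhd> p) (x \<cdot> pi0 K) (z \<cdot> p)" "cell C (\<phi> \<lhd> q) (x \<cdot> pi1 K) (z \<cdot> q)"
      using z x m p xm[of x] by simp_all
    obtain b \<kappa> where b: "mor C b A (C1 K)" "b \<cdot> pi0 K = z \<cdot> p" "b \<cdot> pi1 K = z \<cdot> q" "cell C \<kappa> x b"
      "\<kappa> \<lhd> pi0 K = \<phi> \<lhd> p" "\<kappa> \<lhd> pi1 K = \<phi> \<lhd> q"
      by (rule transport[OF x s])
    have bz: "b \<cdot> m = z" by (rule strict_product_uniq[OF pr, of _ A]) (use b z m p mp in simp_all)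
    have km: "\<kappa> \<lhd> m = \<phi>"
      by (rule strict_product_uniq2[OF pr, of "x \<cdot> m" A z]) (use b z m p x bz mm[of \<kappa>] in simp_all)
    show ?thesis
    proof (rule ex1I)
      show "\<kappa> \<in> Ar (Hom C A (C1 K)) \<and> Dm (Hom C A (C1 K)) \<kappa> = x \<and> far (post C m) \<kappa> = \<phi>"
        using b x km by simp
      fix \<psi> assume ps: "\<psi> \<in> Ar (Hom C A (C1 K)) \<and> Dm (Hom C A (C1 K)) \<psi> = x \<and> far (post C m) \<psi> = \<phi>"
      then have c: "\<psi> \<in> Cell2 C" "dom2 C \<psi> = x" "\<psi> \<lhd> m = \<phi>" by simp_all
      show "\<psi> = \<kappa>"
        by (rule target_unique) (use c b x mm[of \<psi>] in simp_all)
    qed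
  qed
  show ?thesis
    unfolding DOF_def DOF_functor_def m(2)
  proof (intro conjI ballI impI)
    fix A x \<phi> assume "x \<in> Ob (Hom C A (C1 K))" "\<phi> \<in> Ar (Hom C A (cod1 C m))"
      "Dm (Hom C A (cod1 C m)) \<phi> = fob (post C m) x"
    then show "\<exists>!\<psi>. \<psi> \<in> Ar (Hom C A (C1 K)) \<and> Dm (Hom C A (C1 K)) \<psi> = x \<and> far (post C m) \<psi> = \<phi>"
      by (intro main) simp_all
  next
    show "is_functor (Hom C A (C1 K)) (Hom C A (cod1 C m)) (post C m)" for A
      using post_functor[OF m(1), of A] m(2) by simp
  qed (rule m)
qed

lemma nerve_gbo_congruence:
  assumes C: "pita C"
  shows "gbo_congruence C K"
proof -
  obtain p q where pq: "strict_product C p q" "cod1 C p = C0 K" "cod1 C q = C0 K"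
    using strict_product_exists[OF C obj_closed(1,1)] by blast
  obtain m where m: "mor C m (C1 K) (dom1 C p)" "m \<cdot> p = pi0 K" "m \<cdot> q = pi1 K"
    using strict_product_ex[OF pq(1), of "pi0 K" "C1 K" "pi1 K"] pq(2,3) by auto
  have pm: "is_pairing C p q (pi0 K) (pi1 K) m" using pq m by (simp add: is_pairing_def)
  note D = pairing_DOF[OF pm pq(2,3)]
  \<comment> \<open>Lifts along the discrete opfibration are invertible because \<open>C1 K\<close>
    is a groupoid.\<close>
  have "isofibration C m"
    unfolding isofibration_def isofibration_functor_def
  proof (intro conjI ballI allI impI)
    fix A x \<phi> assume A: "A \<in> Cell0 C" and x: "x \<in> Ob (Hom C A (dom1 C m))"
      and f: "iso_arrow (Hom C A (cod1 C m)) \<phi> \<and> Dm (Hom C A (cod1 C m)) \<phi> = fob (post C m) x"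
    have f': "\<phi> \<in> Ar (Hom C A (cod1 C m))" using f x m isoc_cell[of \<phi>] by (simp add: iso_Hom)
    obtain \<psi> where ps: "\<psi> \<in> Ar (Hom C A (dom1 C m))" "Dm (Hom C A (dom1 C m)) \<psi> = x"
      "far (post C m) \<psi> = \<phi>"
      using D A x f f' unfolding DOF_def DOF_functor_def by blast
    have "isoc C \<psi>" by (rule groupoid_objectD[OF gpd(2)]) (use ps m in simp_all)
    then show "\<exists>\<psi>. iso_arrow (Hom C A (dom1 C m)) \<psi> \<and> Dm (Hom C A (dom1 C m)) \<psi> = x
        \<and> far (post C m) \<psi> = \<phi>"
      using ps by (intro exI[of _ \<psi>]) (simp add: iso_Hom)
  qed (use m post_functor[of m] in simp_all)
  then show ?thesis
    unfolding gbo_congruence_def internal_double_category_def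
    using nerve_internal_category pq pm D gpd by blast
qed

end

text \<open>A 2-cell into \<open>C3\<close> is determined by its four whiskerings with the vertices
  \<open>v0, \<dots>, v3 : C3 \<rightarrow> C0\<close>; the square forces \<open>v0\<close> to agree with \<open>v2\<close> and \<open>v1\<close> with \<open>v3\<close>.\<close>

locale completeness_square = nerve_like C K X i \<theta> + U: universal_arrow C "C0 K" P d0 d1 d
  for C :: "('o, 'm, 'c) two_cat" (structure) and K X i \<theta> P d0 d1 d +
  fixes r \<tau> \<beta> s t C3 p0 p1 PP q0 q1 QQ lt rt bt tp
  assumes r [simp]: "r \<in> Cell1 C" "dom1 C r = P" "cod1 C r = C1 K" and r_th: "r \<rhd> \<theta> = d \<lhd> i"
    and \<tau> [simp]: "\<tau> \<in> Cell1 C" "dom1 C \<tau> = P" "cod1 C \<tau> = P" and \<tau>_d: "\<tau> \<rhd> d = \<beta>"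
    and \<beta> [simp]: "\<beta> \<in> Cell2 C" "dom2 C \<beta> = d1" "cod2 C \<beta> = d0" and \<beta>_inv: "d \<bullet> \<beta> = id2 C d0"
      "\<beta> \<bullet> d = id2 C d1"
    and st: "strict_pullback C s t (pi12 K) (pi01 K)" and C3: "dom1 C s = C3"
    and pp: "strict_product C p0 p1" and p_mor [simp]: "p0 \<in> Cell1 C" "p1 \<in> Cell1 C"
      "dom1 C p0 = PP" "dom1 C p1 = PP" "cod1 C p0 = C0 K" "cod1 C p1 = C0 K"
    and qq: "strict_product C q0 q1" and q_mor [simp]: "q0 \<in> Cell1 C" "q1 \<in> Cell1 C"
      "dom1 C q0 = QQ" "dom1 C q1 = QQ" "cod1 C q0 = C1 K" "cod1 C q1 = C1 K"
    and lt [simp]: "lt \<in> Cell1 C" "dom1 C lt = P" "cod1 C lt = PP" "lt \<cdot> p0 = d0" "lt \<cdot> p1 = d1"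
    and rt [simp]: "rt \<in> Cell1 C" "dom1 C rt = C3" "cod1 C rt = QQ" "rt \<cdot> q0 = s \<cdot> pi02 K"
      "rt \<cdot> q1 = t \<cdot> pi02 K"
    and bt [simp]: "bt \<in> Cell1 C" "dom1 C bt = PP" "cod1 C bt = QQ" "bt \<cdot> q0 = p0 \<cdot> ie K"
      "bt \<cdot> q1 = p1 \<cdot> ie K"
    and tp [simp]: "tp \<in> Cell1 C" "dom1 C tp = P" "cod1 C tp = C3"
    and tp_eq: "(tp \<cdot> s) \<cdot> pi01 K = r" "(tp \<cdot> s) \<cdot> pi12 K = \<tau> \<cdot> r" "(tp \<cdot> t) \<cdot> pi12 K = r"
begin

lemma st_mor [simp]: "s \<in> Cell1 C" "t \<in> Cell1 C" "dom1 C s = C3" "dom1 C t = C3" "cod1 C s = C2 K"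
  "cod1 C t = C2 K"
  using strict_pullback_legs[OF st] C3 by simp_all

lemma st_eq: "s \<cdot> pi12 K = t \<cdot> pi01 K"
  using strict_pullback_legs(9)[OF st] .

lemma r_ends: "r \<cdot> pi0 K = d0" "r \<cdot> pi1 K = d1"
  by (rule src_eqI[of _ P] trg_eqI[of _ P]; simp add: r_th del: lwhisk_closed)+

lemma \<tau>_ends: "\<tau> \<cdot> d0 = d1" "\<tau> \<cdot> d1 = d0"
  using arg_cong[OF \<tau>_d, of "dom2 C"] arg_cong[OF \<tau>_d, of "cod2 C"] by simp_all

lemma \<tau>r_th: "(\<tau> \<cdot> r) \<rhd> \<theta> = \<beta> \<lhd> i"
proof -
  have "(\<tau> \<cdot> r) \<rhd> \<theta> = \<tau> \<rhd> (r \<rhd> \<theta>)" by simp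
  also have "\<dots> = (\<tau> \<rhd> d) \<lhd> i" unfolding r_th by simp
  finally show ?thesis unfolding \<tau>_d .
qed

definition "v0 = s \<cdot> (pi01 K \<cdot> pi0 K)"
definition "v1 = s \<cdot> (pi01 K \<cdot> pi1 K)"
definition "v2 = s \<cdot> (pi12 K \<cdot> pi1 K)"
definition "v3 = t \<cdot> (pi12 K \<cdot> pi1 K)"

lemma v_mor [simp]: "v0 \<in> Cell1 C" "dom1 C v0 = C3" "cod1 C v0 = C0 K" "v1 \<in> Cell1 C"
  "dom1 C v1 = C3" "cod1 C v1 = C0 K"
  "v2 \<in> Cell1 C" "dom1 C v2 = C3" "cod1 C v2 = C0 K" "v3 \<in> Cell1 C" "dom1 C v3 = C3"
    "cod1 C v3 = C0 K"
  by (simp_all add: v0_def v1_def v2_def v3_def)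

lemma v_eqs:
  "(s \<cdot> pi01 K) \<cdot> pi0 K = v0" "(s \<cdot> pi01 K) \<cdot> pi1 K = v1" "(s \<cdot> pi12 K) \<cdot> pi0 K = v1"
    "(s \<cdot> pi12 K) \<cdot> pi1 K = v2"
  "(t \<cdot> pi01 K) \<cdot> pi0 K = v1" "(t \<cdot> pi01 K) \<cdot> pi1 K = v2" "(t \<cdot> pi12 K) \<cdot> pi0 K = v2"
    "(t \<cdot> pi12 K) \<cdot> pi1 K = v3"
  "(s \<cdot> pi02 K) \<cdot> pi0 K = v0" "(s \<cdot> pi02 K) \<cdot> pi1 K = v2" "(t \<cdot> pi02 K) \<cdot> pi0 K = v1"
    "(t \<cdot> pi02 K) \<cdot> pi1 K = v3"
proof -
  show 1: "(s \<cdot> pi01 K) \<cdot> pi0 K = v0" "(s \<cdot> pi01 K) \<cdot> pi1 K = v1" "(s \<cdot> pi12 K) \<cdot> pi1 K = v2"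
    "(t \<cdot> pi12 K) \<cdot> pi1 K = v3"
    "(s \<cdot> pi12 K) \<cdot> pi0 K = v1"
    using pb_eq by (simp_all add: v0_def v1_def v2_def v3_def)
  then show 2: "(t \<cdot> pi01 K) \<cdot> pi0 K = v1" "(t \<cdot> pi01 K) \<cdot> pi1 K = v2" unfolding st_eq by simp_all
  show 3: "(t \<cdot> pi12 K) \<cdot> pi0 K = v2" using 2 pb_eq by simp
  show "(s \<cdot> pi02 K) \<cdot> pi0 K = v0" "(s \<cdot> pi02 K) \<cdot> pi1 K = v2" "(t \<cdot> pi02 K) \<cdot> pi0 K = v1"
    "(t \<cdot> pi02 K) \<cdot> pi1 K = v3"
    using 1 2 comp_ends by simp_all
qed

lemma rt_v: "(rt \<cdot> q0) \<cdot> pi0 K = v0" "(rt \<cdot> q0) \<cdot> pi1 K = v2" "(rt \<cdot> q1) \<cdot> pi0 K = v1"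
  "(rt \<cdot> q1) \<cdot> pi1 K = v3"
  unfolding rt(4,5) by (rule v_eqs)+

lemma bt_v: "(bt \<cdot> q0) \<cdot> pi0 K = p0" "(bt \<cdot> q0) \<cdot> pi1 K = p0" "(bt \<cdot> q1) \<cdot> pi0 K = p1"
  "(bt \<cdot> q1) \<cdot> pi1 K = p1"
  unfolding bt(4,5) using ie_ends by simp_all

lemma tp_v: "tp \<cdot> v0 = d0" "tp \<cdot> v1 = d1" "tp \<cdot> v2 = d0" "tp \<cdot> v3 = d1"
proof -
  have "tp \<cdot> v0 = ((tp \<cdot> s) \<cdot> pi01 K) \<cdot> pi0 K" "tp \<cdot> v1 = ((tp \<cdot> s) \<cdot> pi01 K) \<cdot> pi1 K"
    "tp \<cdot> v2 = ((tp \<cdot> s) \<cdot> pi12 K) \<cdot> pi1 K" "tp \<cdot> v3 = ((tp \<cdot> t) \<cdot> pi12 K) \<cdot> pi1 K"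
    by (simp_all add: v0_def v1_def v2_def v3_def)
  then show "tp \<cdot> v0 = d0" "tp \<cdot> v1 = d1" "tp \<cdot> v2 = d0" "tp \<cdot> v3 = d1"
    unfolding tp_eq using r_ends \<tau>_ends by simp_all
qed

lemma rwhisk_comp: "\<alpha> \<in> Cell2 C \<Longrightarrow> f \<in> Cell1 C \<Longrightarrow> g \<in> Cell1 C \<Longrightarrow> cod1 C (dom2 C \<alpha>) = dom1 C f
    \<Longrightarrow> cod1 C f = dom1 C g \<Longrightarrow>
    f \<cdot> g = h \<Longrightarrow> \<alpha> \<lhd> f \<lhd> g = \<alpha> \<lhd> h"
  using whisker_comp1(2) by metis

text \<open>The middle arrow is seen by both \<open>s\<close> and \<open>t\<close>, so three
  consecutive arrows determine both projections of a triple.\<close>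

lemma C3_uniq:
  assumes "mor C m B C3" "mor C n B C3" "m \<cdot> (s \<cdot> pi01 K) = n \<cdot> (s \<cdot> pi01 K)"
    "m \<cdot> (s \<cdot> pi12 K) = n \<cdot> (s \<cdot> pi12 K)" "m \<cdot> (t \<cdot> pi12 K) = n \<cdot> (t \<cdot> pi12 K)"
  shows "m = n"
proof (rule strict_pullback_uniq[OF st, of _ B])
  show "m \<cdot> s = n \<cdot> s"
    by (rule strict_pullback_uniq[OF pb, of _ B]) (use assms in simp_all)
  have "m \<cdot> (t \<cdot> pi01 K) = n \<cdot> (t \<cdot> pi01 K)" using assms(4) unfolding st_eq .
  then show "m \<cdot> t = n \<cdot> t"
    by (intro strict_pullback_uniq[OF pb, of "m \<cdot> t" B "n \<cdot> t"]) (use assms in simp_all)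
qed (use assms in simp_all)

lemma C3_uniq2:
  assumes m: "mor C m B C3" "mor C n B C3" and k: "cell C \<kappa> m n" "cell C \<kappa>' m n"
    and v: "\<kappa> \<lhd> v0 = \<kappa>' \<lhd> v0" "\<kappa> \<lhd> v1 = \<kappa>' \<lhd> v1" "\<kappa> \<lhd> v2 = \<kappa>' \<lhd> v2" "\<kappa> \<lhd> v3 = \<kappa>' \<lhd> v3"
  shows "\<kappa> = \<kappa>'"
proof -
  have e: "\<kappa> \<lhd> f = \<kappa>' \<lhd> f" if "f \<in> Cell1 C" "dom1 C f = C3" "cod1 C f = C1 K"
    "\<kappa> \<lhd> (f \<cdot> pi0 K) = \<kappa>' \<lhd> (f \<cdot> pi0 K)" "\<kappa> \<lhd> (f \<cdot> pi1 K) = \<kappa>' \<lhd> (f \<cdot> pi1 K)" for f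
    by (rule ar_uniq2[of "m \<cdot> f" B "n \<cdot> f"]) (use that m k in simp_all)
  have e1: "\<kappa> \<lhd> (s \<cdot> pi01 K) = \<kappa>' \<lhd> (s \<cdot> pi01 K)" by (rule e) (simp_all only: v_eqs v, simp_all)
  have e2: "\<kappa> \<lhd> (s \<cdot> pi12 K) = \<kappa>' \<lhd> (s \<cdot> pi12 K)" by (rule e) (simp_all only: v_eqs v, simp_all)
  have e3: "\<kappa> \<lhd> (t \<cdot> pi12 K) = \<kappa>' \<lhd> (t \<cdot> pi12 K)" by (rule e) (simp_all only: v_eqs v, simp_all)
  have e4: "\<kappa> \<lhd> (t \<cdot> pi01 K) = \<kappa>' \<lhd> (t \<cdot> pi01 K)" using e2 unfolding st_eq .
  have "\<kappa> \<lhd> s = \<kappa>' \<lhd> s"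
    by (rule strict_pullback_uniq2[OF pb, of "m \<cdot> s" B "n \<cdot> s"]) (use m k e1 e2 in simp_all)
  moreover have "\<kappa> \<lhd> t = \<kappa>' \<lhd> t"
    by (rule strict_pullback_uniq2[OF pb, of "m \<cdot> t" B "n \<cdot> t"]) (use m k e3 e4 in simp_all)
  ultimately show ?thesis
    using strict_pullback_uniq2[OF st, of m B n \<kappa> \<kappa>'] m k by simp
qed

text \<open>The triple at the top names \<open>d\<close>, its inverse \<beta>, and \<open>d\<close>
  again, all followed by \<open>i\<close>; its two binary composites are therefore
  identities.\<close>

lemma square_commutes: "tp \<cdot> rt = lt \<cdot> bt"
proof (rule strict_product_uniq[OF qq, of _ P])
  have c: "(tp \<cdot> s) \<cdot> pi02 K = d0 \<cdot> ie K" "(tp \<cdot> t) \<cdot> pi02 K = d1 \<cdot> ie K"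
  proof -
    have t01: "(tp \<cdot> t) \<cdot> pi01 K = \<tau> \<cdot> r"
      using tp_eq(2) st_eq by simp
    have "((tp \<cdot> s) \<cdot> pi02 K) \<rhd> \<theta> = (((tp \<cdot> s) \<cdot> pi01 K) \<rhd> \<theta>) \<bullet> (((tp \<cdot> s) \<cdot> pi12 K) \<rhd> \<theta>)"
      by (rule pi02_th) simp
    also have "\<dots> = (d \<lhd> i) \<bullet> (\<beta> \<lhd> i)" unfolding tp_eq r_th \<tau>r_th ..
    also have "\<dots> = (d \<bullet> \<beta>) \<lhd> i" by simp
    finally have 1: "((tp \<cdot> s) \<cdot> pi02 K) \<rhd> \<theta> = (d0 \<cdot> ie K) \<rhd> \<theta>" unfolding \<beta>_inv using ie_th by simp
    have "((tp \<cdot> t) \<cdot> pi02 K) \<rhd> \<theta> = (((tp \<cdot> t) \<cdot> pi01 K) \<rhd> \<theta>) \<bullet> (((tp \<cdot> t) \<cdot> pi12 K) \<rhd> \<theta>)"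
      by (rule pi02_th) simp
    also have "\<dots> = (\<beta> \<lhd> i) \<bullet> (d \<lhd> i)" unfolding tp_eq t01 r_th \<tau>r_th ..
    also have "\<dots> = (\<beta> \<bullet> d) \<lhd> i" by simp
    finally have 2: "((tp \<cdot> t) \<cdot> pi02 K) \<rhd> \<theta> = (d1 \<cdot> ie K) \<rhd> \<theta>" unfolding \<beta>_inv using ie_th by simp
    show "(tp \<cdot> s) \<cdot> pi02 K = d0 \<cdot> ie K" by (rule ar_uniq[OF _ _ 1, of P]) simp_all
    show "(tp \<cdot> t) \<cdot> pi02 K = d1 \<cdot> ie K" by (rule ar_uniq[OF _ _ 2, of P]) simp_all
  qed
  have "(lt \<cdot> bt) \<cdot> q0 = (lt \<cdot> p0) \<cdot> ie K" "(lt \<cdot> bt) \<cdot> q1 = (lt \<cdot> p1) \<cdot> ie K"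
    by (simp_all del: lt(4,5))
  then show "(tp \<cdot> rt) \<cdot> q0 = (lt \<cdot> bt) \<cdot> q0" "(tp \<cdot> rt) \<cdot> q1 = (lt \<cdot> bt) \<cdot> q1" using c by simp_all
qed simp_all

text \<open>The hypothesis says that the 2-cell named by the middle arrow has the first one as left
  inverse and the third as right inverse. So the outer two agree and are invertible, and an
  invertible 2-cell lifts through \<open>i\<close> to one into \<open>C0 K\<close>, which is the
  sought morphism into the arrow object.\<close>

lemma square_ex:
  assumes a: "mor C a B C3" and b: "mor C b B PP" and ab: "a \<cdot> rt = b \<cdot> bt"
  shows "\<exists>m. mor C m B P \<and> m \<cdot> tp = a \<and> m \<cdot> lt = b"
proof -
  define x1 x2 x3 where "x1 = a \<cdot> (s \<cdot> pi01 K)" "x2 = a \<cdot> (s \<cdot> pi12 K)" "x3 = a \<cdot> (t \<cdot> pi12 K)"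
  have x: "mor C x1 B (C1 K)" "mor C x2 B (C1 K)" "mor C x3 B (C1 K)" using a
    by (simp_all add: x1_x2_x3_def)
  have x2: "a \<cdot> (t \<cdot> pi01 K) = x2" unfolding st_eq[symmetric] x1_x2_x3_def ..
  have c12: "x1 \<cdot> pi1 K = x2 \<cdot> pi0 K" and c23: "x2 \<cdot> pi1 K = x3 \<cdot> pi0 K"
    using a arg_cong[OF v_eqs(3), of "(\<cdot>) a"] arg_cong[OF v_eqs(2), of "(\<cdot>) a"] arg_cong[OF
      v_eqs(4), of "(\<cdot>) a"] arg_cong[OF v_eqs(7), of "(\<cdot>) a"]
    by (simp_all add: x1_x2_x3_def)
  have q: "(a \<cdot> s) \<cdot> pi02 K = (b \<cdot> p0) \<cdot> ie K" "(a \<cdot> t) \<cdot> pi02 K = (b \<cdot> p1) \<cdot> ie K"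
  proof -
    have "(a \<cdot> rt) \<cdot> q0 = (b \<cdot> bt) \<cdot> q0" "(a \<cdot> rt) \<cdot> q1 = (b \<cdot> bt) \<cdot> q1" unfolding ab by simp_all
    then show "(a \<cdot> s) \<cdot> pi02 K = (b \<cdot> p0) \<cdot> ie K" "(a \<cdot> t) \<cdot> pi02 K = (b \<cdot> p1) \<cdot> ie K"
      using a b by simp_all
  qed
  define f1 f2 f3 where "f1 = x1 \<rhd> \<theta>" "f2 = x2 \<rhd> \<theta>" "f3 = x3 \<rhd> \<theta>"
  define y0 y1 where "y0 = b \<cdot> p0" "y1 = b \<cdot> p1"
  have y: "mor C y0 B (C0 K)" "mor C y1 B (C0 K)" using b by (simp_all add: y0_y1_def)
  have "((a \<cdot> s) \<cdot> pi02 K) \<rhd> \<theta> = f1 \<bullet> f2" 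
    unfolding f1_f2_f3_def x1_x2_x3_def using pi02_th[of "a \<cdot> s" B] a by simp
  then have 12: "f1 \<bullet> f2 = id2 C (y0 \<cdot> i)" unfolding q using ie_pre_th[OF y(1)]
    by (simp add: y0_y1_def)
  have "((a \<cdot> t) \<cdot> pi02 K) \<rhd> \<theta> = (((a \<cdot> t) \<cdot> pi01 K) \<rhd> \<theta>) \<bullet> (((a \<cdot> t) \<cdot> pi12 K) \<rhd> \<theta>)"
    using pi02_th[of "a \<cdot> t" B] a by simp
  moreover have "(a \<cdot> t) \<cdot> pi01 K = x2" "(a \<cdot> t) \<cdot> pi12 K = x3" using x2 a
    by (simp_all add: x1_x2_x3_def)
  ultimately have 23: "f2 \<bullet> f3 = id2 C (y1 \<cdot> i)" unfolding q f1_f2_f3_def using ie_pre_th[OF y(2)]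
    by (simp add: y0_y1_def)
  have f: "f1 \<in> Cell2 C" "f2 \<in> Cell2 C" "f3 \<in> Cell2 C" "cod2 C f1 = dom2 C f2"
    "cod2 C f2 = dom2 C f3"
    using x composable_th[OF x(1,2) c12] composable_th[OF x(2,3) c23]
      by (simp_all add: f1_f2_f3_def)
  have d1: "dom2 C f1 = y0 \<cdot> i" using arg_cong[OF 12, of "dom2 C"] f y by simp
  have d2: "cod2 C f2 = y0 \<cdot> i" using arg_cong[OF 12, of "cod2 C"] f y by simp
  have d3: "dom2 C f2 = y1 \<cdot> i" using arg_cong[OF 23, of "dom2 C"] f y by simp
  \<comment> \<open>A left inverse and a right inverse of \<open>f2\<close> coincide.\<close>
  have "f1 = f1 \<bullet> (f2 \<bullet> f3)" unfolding 23 using f d3 by simp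
  also have "\<dots> = f3" using f 12 d2 by (simp add: vcomp_cancel_assoc[OF _ _ _ _ _ 12])
  finally have f13: "f1 = f3" .
  have inv: "inverse_arrows (vert C) f1 f2"
    using f 12 23 d1 d2 d3 unfolding inverse_arrows_def f13 by simp
  have iso: "isoc C f1" using inv by (auto simp: iso_arrow_def)
  \<comment> \<open>Fullness of \<open>i\<close> is available for invertible 2-cells only, which is
    why invertibility had to be established first.\<close>
  obtain \<kappa> where k: "cell C \<kappa> y0 y1" "\<kappa> \<lhd> i = f1"
    using ob_ex2[OF y _ iso] d1 d3 f by auto
  obtain m where m: "mor C m B P" "m \<rhd> d = \<kappa>" using U.ex[of \<kappa> B] k y by auto
  have m0: "m \<cdot> d0 = y0" using arg_cong[OF m(2), of "dom2 C"] m(1) k by simp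
  have m1: "m \<cdot> d1 = y1" using arg_cong[OF m(2), of "cod2 C"] m(1) k by simp
  have mr_th: "(m \<cdot> r) \<rhd> \<theta> = f1"
  proof -
    have "(m \<cdot> r) \<rhd> \<theta> = m \<rhd> (d \<lhd> i)" using m r_th by simp
    also have "\<dots> = (m \<rhd> d) \<lhd> i" using m(1) by simp
    finally show ?thesis unfolding m(2) k(2) .
  qed
  have mr: "m \<cdot> r = x1" by (rule ar_uniq[of _ B]) (use m(1) x mr_th in \<open>simp_all add: f1_f2_f3_def\<close>)
  \<comment> \<open>Both the middle arrow and the one obtained through \<tau> name an inverse of
    \<open>f1\<close>, and inverses are unique.\<close>
  have mtr: "m \<cdot> (\<tau> \<cdot> r) = x2"
  proof (rule ar_uniq[of _ B])
    have e: "(m \<cdot> (\<tau> \<cdot> r)) \<rhd> \<theta> = m \<rhd> (\<beta> \<lhd> i)"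
    proof -
      have "(m \<cdot> (\<tau> \<cdot> r)) \<rhd> \<theta> = m \<rhd> ((\<tau> \<cdot> r) \<rhd> \<theta>)" using m(1) by simp
      then show ?thesis unfolding \<tau>r_th .
    qed
    have "m \<rhd> ((d \<bullet> \<beta>) \<lhd> i) = id2 C (y0 \<cdot> i)" "m \<rhd> ((\<beta> \<bullet> d) \<lhd> i) = id2 C (y1 \<cdot> i)"
      unfolding \<beta>_inv using m(1) m0 m1 comp1_assoc[of m d0 i] comp1_assoc[of m d1 i] by simp_all
    moreover have "m \<rhd> ((d \<bullet> \<beta>) \<lhd> i) = f1 \<bullet> (m \<rhd> (\<beta> \<lhd> i))" "m \<rhd> ((\<beta> \<bullet> d) \<lhd> i) = (m \<rhd> (\<beta> \<lhd> i)) \<bullet> f1"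
      unfolding k(2)[symmetric] m(2)[symmetric] using m(1) by simp_all
    ultimately have "inverse_arrows (vert C) f1 (m \<rhd> (\<beta> \<lhd> i))"
      using f(1) m(1) m0 m1 d1 f(4) d3 comp1_assoc[of m d0 i] comp1_assoc[of m d1 i]
      unfolding inverse_arrows_def by simp
    from V.inverse_arrows_unique[OF this inv] show "(m \<cdot> (\<tau> \<cdot> r)) \<rhd> \<theta> = x2 \<rhd> \<theta>"
      unfolding e f1_f2_f3_def .
  qed (use m(1) x in simp_all)
  have x3: "x3 = x1" by (rule ar_uniq[OF x(3,1)]) (use f13 in \<open>simp add: f1_f2_f3_def\<close>)
  have "m \<cdot> tp = a"
  proof (rule C3_uniq[of _ B])
    have "(m \<cdot> tp) \<cdot> (s \<cdot> pi01 K) = m \<cdot> ((tp \<cdot> s) \<cdot> pi01 K)" using m(1) by simp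
    then show "(m \<cdot> tp) \<cdot> (s \<cdot> pi01 K) = a \<cdot> (s \<cdot> pi01 K)" unfolding tp_eq mr x1_x2_x3_def .
    have "(m \<cdot> tp) \<cdot> (s \<cdot> pi12 K) = m \<cdot> ((tp \<cdot> s) \<cdot> pi12 K)" using m(1) by simp
    then show "(m \<cdot> tp) \<cdot> (s \<cdot> pi12 K) = a \<cdot> (s \<cdot> pi12 K)" unfolding tp_eq mtr x1_x2_x3_def .
    have "(m \<cdot> tp) \<cdot> (t \<cdot> pi12 K) = m \<cdot> ((tp \<cdot> t) \<cdot> pi12 K)" using m(1) by simp
    then show "(m \<cdot> tp) \<cdot> (t \<cdot> pi12 K) = a \<cdot> (t \<cdot> pi12 K)"
      unfolding tp_eq mr x3[symmetric] x1_x2_x3_def .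
  qed (use m(1) a in simp_all)
  moreover have "m \<cdot> lt = b"
    by (rule strict_product_uniq[OF pp, of _ B]) (use m(1) b m0 m1 in \<open>simp_all add: y0_y1_def\<close>)
  ultimately show ?thesis using m(1) by blast
qed

text \<open>\<zeta> prescribes the two components \<xi> and \<eta> of \<kappa>, and commutation with
  the degenerate bottom side gives \<sigma> these values alternately at the four vertices. The
  naturality condition for \<kappa> is what \<sigma> says about the first arrow.\<close>

lemma square_ex2:
  assumes m: "mor C m B P" "mor C n B P" and s: "cell C \<sigma> (m \<cdot> tp) (n \<cdot> tp)"
    and t: "cell C \<zeta> (m \<cdot> lt) (n \<cdot> lt)"
    and st': "\<sigma> \<lhd> rt = \<zeta> \<lhd> bt"
  shows "\<exists>\<kappa>. cell C \<kappa> m n \<and> \<kappa> \<lhd> tp = \<sigma> \<and> \<kappa> \<lhd> lt = \<zeta>"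
proof -
  define \<xi> \<eta> where "\<xi> = \<zeta> \<lhd> p0" "\<eta> = \<zeta> \<lhd> p1"
  have x: "cell C \<xi> (m \<cdot> d0) (n \<cdot> d0)" "cell C \<eta> (m \<cdot> d1) (n \<cdot> d1)"
    using t m by (simp_all add: \<xi>_\<eta>_def)
  have e: "\<sigma> \<lhd> rt \<lhd> q0 \<lhd> pi0 K = \<sigma> \<lhd> ((rt \<cdot> q0) \<cdot> pi0 K)"
    "\<sigma> \<lhd> rt \<lhd> q0 \<lhd> pi1 K = \<sigma> \<lhd> ((rt \<cdot> q0) \<cdot> pi1 K)"
    "\<sigma> \<lhd> rt \<lhd> q1 \<lhd> pi0 K = \<sigma> \<lhd> ((rt \<cdot> q1) \<cdot> pi0 K)" "\<sigma> \<lhd> rt \<lhd> q1 \<lhd> pi1 K = \<sigma> \<lhd> ((rt \<cdot> q1) \<cdot> pi1 K)"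
    using s m by (simp_all del: rt(4,5))
  have e': "\<zeta> \<lhd> bt \<lhd> q0 \<lhd> pi0 K = \<zeta> \<lhd> ((bt \<cdot> q0) \<cdot> pi0 K)"
    "\<zeta> \<lhd> bt \<lhd> q0 \<lhd> pi1 K = \<zeta> \<lhd> ((bt \<cdot> q0) \<cdot> pi1 K)"
    "\<zeta> \<lhd> bt \<lhd> q1 \<lhd> pi0 K = \<zeta> \<lhd> ((bt \<cdot> q1) \<cdot> pi0 K)" "\<zeta> \<lhd> bt \<lhd> q1 \<lhd> pi1 K = \<zeta> \<lhd> ((bt \<cdot> q1) \<cdot> pi1 K)"
    using t m by (simp_all del: bt(4,5))
  have sv: "\<sigma> \<lhd> v0 = \<xi>" "\<sigma> \<lhd> v2 = \<xi>" "\<sigma> \<lhd> v1 = \<eta>" "\<sigma> \<lhd> v3 = \<eta>"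
    using e e' unfolding st' rt_v bt_v \<xi>_\<eta>_def by simp_all
  have sr: "cell C (\<sigma> \<lhd> (s \<cdot> pi01 K)) (m \<cdot> r) (n \<cdot> r)"
  proof -
    have "(m \<cdot> tp) \<cdot> (s \<cdot> pi01 K) = m \<cdot> ((tp \<cdot> s) \<cdot> pi01 K)"
      "(n \<cdot> tp) \<cdot> (s \<cdot> pi01 K) = n \<cdot> ((tp \<cdot> s) \<cdot> pi01 K)"
      using m by simp_all
    then show ?thesis using s m rwhisk_closed[of "s \<cdot> pi01 K" \<sigma>] unfolding tp_eq
      by (simp del: whisker_comp1 rwhisk_closed)
  qed
  have r0: "\<sigma> \<lhd> (s \<cdot> pi01 K) \<lhd> pi0 K = \<xi>" "\<sigma> \<lhd> (s \<cdot> pi01 K) \<lhd> pi1 K = \<eta>"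
    unfolding sv(1,3)[symmetric] by (rule rwhisk_comp; use s m v_eqs in simp)+
  have th: "(x \<cdot> r) \<rhd> \<theta> = x \<rhd> (d \<lhd> i)" if "mor C x B P" for x using that r_th by simp
  \<comment> \<open>The square holds after whiskering with \<open>i\<close>, by
    \<open>square_th\<close> at the first arrow, and \<open>i\<close> is faithful on 2-cells into
    \<open>C0 K\<close>.\<close>
  have nat: "(m \<rhd> d) \<bullet> \<eta> = \<xi> \<bullet> (n \<rhd> d)"
  proof (rule ob_uniq2[of "m \<cdot> d0" B "n \<cdot> d1"])
    have "((m \<cdot> r) \<rhd> \<theta>) \<bullet> (\<eta> \<lhd> i) = (\<xi> \<lhd> i) \<bullet> ((n \<cdot> r) \<rhd> \<theta>)"
      using square_th[of "\<sigma> \<lhd> (s \<cdot> pi01 K)"] sr m unfolding r0 by (simp del: whisker_comp1)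
    then show "((m \<rhd> d) \<bullet> \<eta>) \<lhd> i = (\<xi> \<bullet> (n \<rhd> d)) \<lhd> i"
      unfolding th[OF m(1)] th[OF m(2)] using m x by simp
  qed (use m x in simp_all)
  obtain \<kappa> where k: "cell C \<kappa> m n" "\<kappa> \<lhd> d0 = \<xi>" "\<kappa> \<lhd> d1 = \<eta>"
    using U.ex2[OF m x nat] by blast
  have "\<kappa> \<lhd> tp \<lhd> v0 = \<kappa> \<lhd> d0" "\<kappa> \<lhd> tp \<lhd> v1 = \<kappa> \<lhd> d1" "\<kappa> \<lhd> tp \<lhd> v2 = \<kappa> \<lhd> d0" "\<kappa> \<lhd> tp \<lhd> v3 = \<kappa> \<lhd> d1"
    by (rule rwhisk_comp; use k m tp_v in simp)+
  then have "\<kappa> \<lhd> tp = \<sigma>"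
    using C3_uniq2[of "m \<cdot> tp" B "n \<cdot> tp" "\<kappa> \<lhd> tp" \<sigma>] k m s sv by simp
  moreover have "\<kappa> \<lhd> lt \<lhd> p0 = \<kappa> \<lhd> d0" "\<kappa> \<lhd> lt \<lhd> p1 = \<kappa> \<lhd> d1"
    by (rule rwhisk_comp; use k m in simp)+
  then have "\<kappa> \<lhd> lt = \<zeta>"
    using strict_product_uniq2[OF pp, of "m \<cdot> lt" B "n \<cdot> lt" "\<kappa> \<lhd> lt" \<zeta>] k m t
      by (simp add: \<xi>_\<eta>_def)
  ultimately show ?thesis using k(1) by blast
qed

lemma square_pullback: "strict_pullback C tp lt rt bt"
proof (rule strict_pullbackI)
  fix B m n assume m: "mor C m B (dom1 C tp)" "mor C n B (dom1 C tp)"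
    and e: "m \<cdot> tp = n \<cdot> tp" "m \<cdot> lt = n \<cdot> lt"
  \<comment> \<open>A morphism into the arrow object is recovered from the first arrow of its
    triple: that arrow names the 2-cell whiskered with \<open>i\<close>, and \<open>i\<close> is
    faithful.\<close>
  have r: "m \<cdot> r = n \<cdot> r"
  proof -
    have "m \<cdot> r = (m \<cdot> tp) \<cdot> (s \<cdot> pi01 K)" "n \<cdot> r = (n \<cdot> tp) \<cdot> (s \<cdot> pi01 K)" using m
      by (simp_all flip: tp_eq(1))
    then show ?thesis using e by simp
  qed
  have d: "m \<cdot> d0 = n \<cdot> d0" "m \<cdot> d1 = n \<cdot> d1"
  proof -
    have "m \<cdot> d0 = (m \<cdot> lt) \<cdot> p0" "n \<cdot> d0 = (n \<cdot> lt) \<cdot> p0" "m \<cdot> d1 = (m \<cdot> lt) \<cdot> p1"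
      "n \<cdot> d1 = (n \<cdot> lt) \<cdot> p1" using m by simp_all
    then show "m \<cdot> d0 = n \<cdot> d0" "m \<cdot> d1 = n \<cdot> d1" using e by simp_all
  qed
  have "m \<rhd> (d \<lhd> i) = (m \<cdot> r) \<rhd> \<theta>" "n \<rhd> (d \<lhd> i) = (n \<cdot> r) \<rhd> \<theta>" using m r_th by simp_all
  then have di: "m \<rhd> (d \<lhd> i) = n \<rhd> (d \<lhd> i)" unfolding r by simp
  have "m \<rhd> d = n \<rhd> d"
    by (rule ob_uniq2[of "m \<cdot> d0" B "m \<cdot> d1"]) (use m d di in simp_all)
  then show "m = n" using U.uniq[of m B n] m by simp
next
  fix B m n \<kappa> \<kappa>' assume m: "mor C m B (dom1 C tp)" "mor C n B (dom1 C tp)"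
    and k: "cell C \<kappa> m n" "cell C \<kappa>' m n"
    and e: "\<kappa> \<lhd> lt = \<kappa>' \<lhd> lt"
  have "\<kappa> \<lhd> lt \<lhd> p0 = \<kappa> \<lhd> d0" "\<kappa> \<lhd> lt \<lhd> p1 = \<kappa> \<lhd> d1" "\<kappa>' \<lhd> lt \<lhd> p0 = \<kappa>' \<lhd> d0"
    "\<kappa>' \<lhd> lt \<lhd> p1 = \<kappa>' \<lhd> d1"
    by (rule rwhisk_comp; use k m in simp)+
  then show "\<kappa> = \<kappa>'" using U.uniq2[of m B n \<kappa> \<kappa>'] k m e by simp
next
  fix B a b assume "mor C a B (dom1 C rt)" "mor C b B (dom1 C bt)" "a \<cdot> rt = b \<cdot> bt"
  then show "\<exists>m. mor C m B (dom1 C tp) \<and> m \<cdot> tp = a \<and> m \<cdot> lt = b" using square_ex[of a B b] by simp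
next
  fix B m n \<sigma> \<tau>' assume "mor C m B (dom1 C tp)" "mor C n B (dom1 C tp)" "cell C \<sigma> (m \<cdot> tp) (n \<cdot> tp)"
      "cell C \<tau>' (m \<cdot> lt) (n \<cdot> lt)" "\<sigma> \<lhd> rt = \<tau>' \<lhd> bt"
  then show "\<exists>\<kappa>. cell C \<kappa> m n \<and> \<kappa> \<lhd> tp = \<sigma> \<and> \<kappa> \<lhd> lt = \<tau>'" using square_ex2[of m B n \<sigma> \<tau>'] by simp
qed (use square_commutes in simp_all)

end

text \<open>\<open>complete_congruence\<close> asks for witnesses of all the objects and maps in its
  square. They are assembled here from the pita axioms and the universal properties of
  \<open>K\<close>.\<close>

lemma (in nerve_like) nerve_complete_congruence:
  assumes C: "pita C"
  shows "complete_congruence C K"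
proof -
  obtain P ev where P: "arrow_object C (C0 K) P ev" using C unfolding pita_def by fastforce
  define d0 d1 d where dd: "d0 = fob ev 0" "d1 = fob ev 1" "d = bdry ev"
  interpret U: universal_arrow C "C0 K" P d0 d1 d
    unfolding dd by (rule arrow_object_universal[OF P])
  have "\<exists>a. mor C a P (C1 K) \<and> a \<rhd> \<theta> = d \<lhd> i" by (rule ar_ex) simp_all
  then obtain r where r: "mor C r P (C1 K)" "r \<rhd> \<theta> = d \<lhd> i" by blast
  have r0: "r \<cdot> pi0 K = d0" by (rule src_eqI[OF r(1)]) (simp_all add: r(2) del: lwhisk_closed)
  have r1: "r \<cdot> pi1 K = d1" by (rule trg_eqI[OF r(1)]) (simp_all add: r(2) del: lwhisk_closed)
  \<comment> \<open>\<open>C0 K\<close> is a groupoid, so its universal 2-cell has an inverse; this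
    inverse, as a morphism into the arrow object, is \<tau>.\<close>
  have "isoc C d" by (rule groupoid_objectD[OF gpd(1)]) simp_all
  then obtain \<beta> where b: "\<beta> \<in> Cell2 C" "dom2 C \<beta> = d1" "cod2 C \<beta> = d0" "d \<bullet> \<beta> = id2 C d0"
    "\<beta> \<bullet> d = id2 C d1"
    by (rule isocE) simp
  obtain \<tau> where t: "mor C \<tau> P P" "\<tau> \<rhd> d = \<beta>" using U.ex[of \<beta> P] b by auto
  have t0: "\<tau> \<cdot> d0 = d1" using arg_cong[OF t(2), of "dom2 C"] t(1) b by simp
  have t1: "\<tau> \<cdot> d1 = d0" using arg_cong[OF t(2), of "cod2 C"] t(1) b by simp
  have rfl: "is_reflection C K P ev r"
  proof -
    \<comment> \<open>A 2-cell into \<open>C1 K\<close> is a commutative square. Here the sides are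
      \<open>d\<close> and an identity, the target arrow is an identity, and commutation is the
      defining equation of \<open>r\<close>.\<close>
    have "\<exists>\<rho>. cell C \<rho> r (d1 \<cdot> ie K) \<and> \<rho> \<lhd> pi0 K = d \<and> \<rho> \<lhd> pi1 K = id2 C d1"
      by (rule ar_ex2[OF r(1)]) (use r r0 r1 ie_ends ie_th in simp_all)
    then show ?thesis unfolding is_reflection_def dd using r(1) by blast
  qed
  have inv: "inverse_arrows (vert C) (bdry ev) (\<tau> \<rhd> bdry ev)"
    unfolding dd(3)[symmetric] t(2) inverse_arrows_def using b by simp
  obtain s s' where st: "strict_pullback C s s' (pi12 K) (pi01 K)"
    using C isofibration_pi12 unfolding pita_def by fastforce
  define C3 where "C3 = dom1 C s"
  have sm: "mor C s C3 (C2 K)" "mor C s' C3 (C2 K)" using strict_pullback_legs[OF st]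
    by (simp_all add: C3_def)
  obtain p0 p1 where pp: "strict_product C p0 p1" "cod1 C p0 = C0 K" "cod1 C p1 = C0 K"
    using strict_product_exists[OF C obj_closed(1,1)] by blast
  obtain q0 q1 where qq: "strict_product C q0 q1" "cod1 C q0 = C1 K" "cod1 C q1 = C1 K"
    using strict_product_exists[OF C obj_closed(2,2)] by blast
  define PP QQ where "PP = dom1 C p0" "QQ = dom1 C q0"
  have pm: "mor C p0 PP (C0 K)" "mor C p1 PP (C0 K)"
    and qm: "mor C q0 QQ (C1 K)" "mor C q1 QQ (C1 K)"
    using pp qq by (simp_all add: strict_product_def PP_QQ_def)
  have "\<exists>m. mor C m P (dom1 C p0) \<and> m \<cdot> p0 = d0 \<and> m \<cdot> p1 = d1"
    by (rule strict_product_ex[OF pp(1)]) (use pp in simp_all)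
  then obtain lt where lt: "mor C lt P PP" "lt \<cdot> p0 = d0" "lt \<cdot> p1 = d1" using pm by auto
  have "\<exists>m. mor C m C3 (dom1 C q0) \<and> m \<cdot> q0 = s \<cdot> pi02 K \<and> m \<cdot> q1 = s' \<cdot> pi02 K"
    by (rule strict_product_ex[OF qq(1)]) (use qq sm in simp_all)
  then obtain rt where rt: "mor C rt C3 QQ" "rt \<cdot> q0 = s \<cdot> pi02 K" "rt \<cdot> q1 = s' \<cdot> pi02 K" using qm
    by auto
  have "\<exists>m. mor C m PP (dom1 C q0) \<and> m \<cdot> q0 = p0 \<cdot> ie K \<and> m \<cdot> q1 = p1 \<cdot> ie K"
    by (rule strict_product_ex[OF qq(1)]) (use qq pm in simp_all)
  then obtain bt where bt: "mor C bt PP QQ" "bt \<cdot> q0 = p0 \<cdot> ie K" "bt \<cdot> q1 = p1 \<cdot> ie K" using qm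
    by auto
  \<comment> \<open>The first two arrows of the triple: \<open>r\<close> ends where the reversed
    arrow begins. The last two are paired in the same way.\<close>
  have "\<exists>m. mor C m P (dom1 C (pi01 K)) \<and> m \<cdot> pi01 K = r \<and> m \<cdot> pi12 K = \<tau> \<cdot> r"
    by (rule strict_pullback_ex[OF pb]) (use r r0 r1 t t0 in simp_all)
  then obtain w1 where w1: "mor C w1 P (C2 K)" "w1 \<cdot> pi01 K = r" "w1 \<cdot> pi12 K = \<tau> \<cdot> r" by auto
  have "\<exists>m. mor C m P (dom1 C (pi01 K)) \<and> m \<cdot> pi01 K = \<tau> \<cdot> r \<and> m \<cdot> pi12 K = r"
    by (rule strict_pullback_ex[OF pb]) (use r r0 r1 t t1 in simp_all)
  then obtain w2 where w2: "mor C w2 P (C2 K)" "w2 \<cdot> pi01 K = \<tau> \<cdot> r" "w2 \<cdot> pi12 K = r" by auto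
  have "\<exists>m. mor C m P (dom1 C s) \<and> m \<cdot> s = w1 \<and> m \<cdot> s' = w2"
    by (rule strict_pullback_ex[OF st]) (use w1 w2 in simp_all)
  then obtain tp where tp: "mor C tp P C3" "tp \<cdot> s = w1" "tp \<cdot> s' = w2" by (auto simp: C3_def)
  have tpe: "(tp \<cdot> s) \<cdot> pi01 K = r" "(tp \<cdot> s) \<cdot> pi12 K = \<tau> \<cdot> r" "(tp \<cdot> s') \<cdot> pi12 K = r"
    unfolding tp w1 w2 by (rule refl)+
  have 1: "is_pairing C p0 p1 (fob ev 0) (fob ev 1) lt"
    "is_pairing C q0 q1 (s \<cdot> pi02 K) (s' \<cdot> pi02 K) rt"
    "is_pairing C q0 q1 (p0 \<cdot> ie K) (p1 \<cdot> ie K) bt"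
    unfolding is_pairing_def dd[symmetric] by (intro conjI pp(1) qq(1) lt(2,3) rt(2,3) bt(2,3); use
      pm qm sm lt(1) rt(1) bt(1) in simp)+
  have S: "completeness_square C K X i \<theta> P d0 d1 d r \<tau> \<beta> s s' C3 p0 p1 PP q0 q1 QQ lt rt bt tp"
    by unfold_locales (rule r(2) t(2) b st pp(1) qq(1) lt(2,3) rt(2,3) bt(2,3) tpe C3_def[symmetric]
      | use r(1) t(1) pm qm lt(1) rt(1) bt(1) tp(1) in simp)+
  have tp': "mor C tp P (dom1 C s)" "mor C \<tau> P P" using tp t by (simp_all add: C3_def)
  show ?thesis
    unfolding complete_congruence_def
    by (intro conjI nerve_gbo_congruence[OF C] exI)
      (rule P rfl inv strict_pullback_is_pullback[OF st] tpe pp qq 1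
        completeness_square.square_pullback[OF S] tp')+
qed

text \<open>Passes from the description operators in \<open>nerve\<close> to universal properties.
  The last two clauses name the two arrows of an element of \<open>C2\<close> by the universal
  2-cells of \<open>X^[2]\<close>; they serve to identify the component \<open>F2\<close> of
  \<open>Nv1\<close>.\<close>

lemma (in two_category) nerve_like_nerve:
  assumes N: "is_nerve_data C X N"
  shows "nerve_like C (nerve C X N) X (core0 N) (core1 N \<rhd> bdry (ev1 N))"
    "pi01 (nerve C X N) \<rhd> (core1 N \<rhd> bdry (ev1 N)) = core2 N \<rhd> far (ev2 N) (0, 1)"
    "pi12 (nerve C X N) \<rhd> (core1 N \<rhd> bdry (ev1 N)) = core2 N \<rhd> far (ev2 N) (1, 2)"
proof -
  define P1 P2 e1 e2 i0 i1 i2 where nn: "P1 = cot1 N" "P2 = cot2 N" "e1 = ev1 N" "e2 = ev2 N"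
    "i0 = core0 N" "i1 = core1 N" "i2 = core2 N"
  have P1: "strict_cotensor C (ord_cat 1) X P1 e1" and P2: "strict_cotensor C (ord_cat 2) X P2 e2"
    and c: "is_core C X i0" "is_core C P1 i1" "is_core C P2 i2"
    using N by (simp_all add: is_nerve_data_def nn)
  define d0 d1 d where dd: "d0 = fob e1 0" "d1 = fob e1 1" "d = bdry e1"
  interpret A: universal_arrow C X P1 d0 d1 d unfolding dd by (rule arrow_object_universal[OF P1])
  define o0 o1 o2 e01 e12 e02 where oo: "o0 = fob e2 0" "o1 = fob e2 1" "o2 = fob e2 2"
    "e01 = far e2 (0, 1)" "e12 = far e2 (1, 2)" "e02 = far e2 (0, 2)"
  interpret B: universal_pair C X P2 o0 o1 o2 e01 e12 e02 unfolding oo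
    by (rule cotensor_2_universal[OF P2])
  note l0 [simp] = core_legs[OF c(1)] and l1 [simp] = core_legs[OF c(2)]
    and l2 [simp] = core_legs[OF c(3)]
  define X0 X1 X2 where xx: "X0 = dom1 C i0" "X1 = dom1 C i1" "X2 = dom1 C i2"
  note [simp] = xx[symmetric]
  define z where "z = cotensor_reindex C (ord_cat 1) (delta [0, 0]) X (ev_point C X) P1 e1"
  define r where "r = (\<lambda>j k. cotensor_reindex C (ord_cat 1) (delta [j, k]) P2 e2 P1 e1)"
  \<comment> \<open>Reindexing along the constant map from \<open>[1]\<close> to \<open>[0]\<close>
    names the identity 2-cell.\<close>
  have z: "mor C z X P1" "z \<rhd> d = id2 C (id1 C X)"
  proof -
    have "fob (delta [0, 0]) i \<le> 1" "fob (delta [0, 0]) i = 0" if "i \<le> 1" for i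
      using that by (cases i; simp add: delta_def)+
    then have u: "\<And>i. i \<le> 1 \<Longrightarrow> fob (delta [0, 0]) i \<le> 1"
      "\<And>i j. i \<le> j \<Longrightarrow> j \<le> 1 \<Longrightarrow> fob (delta [0, 0]) i \<le> fob (delta [0, 0]) j"
       "\<And>i j. i \<le> j \<Longrightarrow> j \<le> 1 \<Longrightarrow> far (delta [0, 0]) (i, j) = (fob (delta [0, 0]) i, fob (delta [0,
           0]) j)"
      by (auto simp: delta_def)
    note sp = cotensor_reindex_spec[OF P1 ord_diagram_point[OF A.objs(1), of 1] A.objs(1) u, folded
      z_def]
    show "mor C z X P1" by (rule sp(1))
    show "z \<rhd> d = id2 C (id1 C X)" using sp(3)[of 0 1] by (simp add: dd ev_point_def)
  qed
  have r: "mor C (r j k) P2 P1" "r j k \<rhd> d = far e2 (j, k)" if jk: "j \<le> k" "k \<le> 2" for j k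
  proof -
    have "fob (delta [j, k]) i = (if i = 0 then j else k)" if "i \<le> 1" for i
      using that by (cases i) (simp_all add: delta_def)
    then have u: "\<And>i. i \<le> 1 \<Longrightarrow> fob (delta [j, k]) i \<le> 2"
      "\<And>i j'. i \<le> j' \<Longrightarrow> j' \<le> 1 \<Longrightarrow> fob (delta [j, k]) i \<le> fob (delta [j, k]) j'"
       "\<And>i j'. i \<le> j' \<Longrightarrow> j' \<le> 1 \<Longrightarrow> far (delta [j, k]) (i, j') = (fob (delta [j, k]) i, fob (delta [j,
           k]) j')"
      using jk by (auto simp: delta_def)
    note sp = cotensor_reindex_spec[OF P1 cotensor_ord_diagram(1)[OF P2] B.objs(2) u, folded r_def]
    show "mor C (r j k) P2 P1" using sp(1) unfolding r_def .
    show "r j k \<rhd> d = far e2 (j, k)" using sp(3)[of 0 1] unfolding r_def by (simp add: dd delta_def)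
  qed
  define K where "K = nerve C X N"
  have Kd: "C0 K = X0" "C1 K = X1" "C2 K = X2" "pi0 K = core_map C i1 i0 d0"
    "pi1 K = core_map C i1 i0 d1" "ie K = core_map C i0 i1 z"
    "pi01 K = core_map C i2 i1 (r 0 1)" "pi12 K = core_map C i2 i1 (r 1 2)"
      "pi02 K = core_map C i2 i1 (r 0 2)"
    unfolding K_def nerve_def Let_def nn[symmetric] z_def r_def
      using cotensor_reindex_point[OF P1, of 0] cotensor_reindex_point[OF P1, of 1]
    by (simp_all add: dd)
  have m [simp]: "mor C (pi0 K) X1 X0" "mor C (pi1 K) X1 X0" "mor C (ie K) X0 X1"
    "mor C (pi01 K) X2 X1" "mor C (pi12 K) X2 X1" "mor C (pi02 K) X2 X1"
    and e: "pi0 K \<cdot> i0 = i1 \<cdot> d0" "pi1 K \<cdot> i0 = i1 \<cdot> d1" "ie K \<cdot> i1 = i0 \<cdot> z"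
      "pi01 K \<cdot> i1 = i2 \<cdot> r 0 1" "pi12 K \<cdot> i1 = i2 \<cdot> r 1 2" "pi02 K \<cdot> i1 = i2 \<cdot> r 0 2"
    unfolding Kd xx
    by (rule core_map_spec[OF c(2) c(1)] core_map_spec[OF c(1) c(2)] core_map_spec[OF c(3) c(2)];
      use z r in simp)+
  have r_d: "r 0 1 \<cdot> d0 = o0" "r 0 1 \<cdot> d1 = o1" "r 1 2 \<cdot> d0 = o1" "r 1 2 \<cdot> d1 = o2"
    using arg_cong[OF r(2)[of 0 1], of "dom2 C"] arg_cong[OF r(2)[of 0 1], of "cod2 C"] r(1)[of 0 1]
      arg_cong[OF r(2)[of 1 2], of "dom2 C"] arg_cong[OF r(2)[of 1 2], of "cod2 C"] r(1)[of 1 2]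
        B.univ
    unfolding oo(4,5)[symmetric] by simp_all
  define \<theta> where "\<theta> = i1 \<rhd> d"
  have th [simp]: "\<theta> \<in> Cell2 C" "dom2 C \<theta> = pi0 K \<cdot> i0" "cod2 C \<theta> = pi1 K \<cdot> i0"
    by (simp_all add: \<theta>_def e)
  have ath: "a \<rhd> \<theta> = (a \<cdot> i1) \<rhd> d" if "mor C a A X1" for a A using that by (simp add: \<theta>_def)
  \<comment> \<open>On generalized elements of \<open>C2\<close> the three maps to \<open>C1\<close>
    read off the three arrows of a diagram of shape \<open>[2]\<close>.\<close>
  have wth: "(m \<cdot> pi01 K) \<rhd> \<theta> = (m \<cdot> i2) \<rhd> e01" "(m \<cdot> pi12 K) \<rhd> \<theta> = (m \<cdot> i2) \<rhd> e12"
    "(m \<cdot> pi02 K) \<rhd> \<theta> = (m \<cdot> i2) \<rhd> e02" if m': "mor C m A X2" for m A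
  proof -
    have "(m \<cdot> pi01 K) \<rhd> \<theta> = (m \<cdot> (pi01 K \<cdot> i1)) \<rhd> d" "(m \<cdot> pi12 K) \<rhd> \<theta> = (m \<cdot> (pi12 K \<cdot> i1)) \<rhd> d"
      "(m \<cdot> pi02 K) \<rhd> \<theta> = (m \<cdot> (pi02 K \<cdot> i1)) \<rhd> d"
      using ath[of "m \<cdot> pi01 K" A] ath[of "m \<cdot> pi12 K" A] ath[of "m \<cdot> pi02 K" A] m' m by simp_all
    moreover have "(m \<cdot> (i2 \<cdot> r j k)) \<rhd> d = (m \<cdot> i2) \<rhd> far e2 (j, k)" if "j \<le> k" "k \<le> 2" for j k
      using r[OF that] m' by (simp flip: r(2)[OF that])
    ultimately show "(m \<cdot> pi01 K) \<rhd> \<theta> = (m \<cdot> i2) \<rhd> e01" "(m \<cdot> pi12 K) \<rhd> \<theta> = (m \<cdot> i2) \<rhd> e12"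
      "(m \<cdot> pi02 K) \<rhd> \<theta> = (m \<cdot> i2) \<rhd> e02"
      unfolding e oo by simp_all
  qed
  have ob_uniq: "x = y" if "mor C x A X0" "mor C y A X0" "x \<cdot> i0 = y \<cdot> i0" for x y A
    using core_uniq[OF c(1)] that by simp
  have ob_uniq2: "\<kappa> = \<kappa>'" if "mor C x A X0" "mor C y A X0" "cell C \<kappa> x y" "cell C \<kappa>' x y"
    "\<kappa> \<lhd> i0 = \<kappa>' \<lhd> i0" for x y A \<kappa> \<kappa>'
    by (rule core_uniq2[OF c(1)]) (use that in simp_all)
  have ar_uniq: "a = b" if ab: "mor C a A X1" "mor C b A X1" "a \<rhd> \<theta> = b \<rhd> \<theta>" for a b A
  proof -
    have "a \<cdot> i1 = b \<cdot> i1" by (rule A.uniq[of _ A]) (use ab ath[OF ab(1)] ath[OF ab(2)] in simp_all)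
    then show ?thesis using core_uniq[OF c(2)] ab by simp
  qed
  have i1d: "\<kappa> \<lhd> i1 \<lhd> d0 = \<kappa> \<lhd> pi0 K \<lhd> i0" "\<kappa> \<lhd> i1 \<lhd> d1 = \<kappa> \<lhd> pi1 K \<lhd> i0"
    if k: "\<kappa> \<in> Cell2 C" "cod1 C (dom2 C \<kappa>) = X1" for \<kappa>
  proof -
    have "\<kappa> \<lhd> i1 \<lhd> d0 = \<kappa> \<lhd> (i1 \<cdot> d0)" "\<kappa> \<lhd> i1 \<lhd> d1 = \<kappa> \<lhd> (i1 \<cdot> d1)" using k by simp_all
    then show "\<kappa> \<lhd> i1 \<lhd> d0 = \<kappa> \<lhd> pi0 K \<lhd> i0" "\<kappa> \<lhd> i1 \<lhd> d1 = \<kappa> \<lhd> pi1 K \<lhd> i0"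
      unfolding e(1,2)[symmetric] using k m by simp_all
  qed
  have ar_uniq2: "\<kappa> = \<kappa>'" if a: "mor C a A X1" "mor C b A X1" and k: "cell C \<kappa> a b" "cell C \<kappa>' a b"
    and kk: "\<kappa> \<lhd> pi0 K = \<kappa>' \<lhd> pi0 K" "\<kappa> \<lhd> pi1 K = \<kappa>' \<lhd> pi1 K" for a b A \<kappa> \<kappa>'
  proof -
    have "\<kappa> \<lhd> i1 = \<kappa>' \<lhd> i1"
      by (rule A.uniq2[of "a \<cdot> i1" A "b \<cdot> i1"]) (use a k kk i1d[of \<kappa>] i1d[of \<kappa>'] in simp_all)
    then show ?thesis using core_uniq2[OF c(2), of a A b \<kappa> \<kappa>'] a k by simp
  qed
  have ei: "m \<cdot> (i1 \<cdot> d0) = m \<cdot> (pi0 K \<cdot> i0)" "m \<cdot> (i1 \<cdot> d1) = m \<cdot> (pi1 K \<cdot> i0)" for m unfolding e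
    by simp_all
  have i2o: "i2 \<cdot> o0 = pi01 K \<cdot> (pi0 K \<cdot> i0)" "i2 \<cdot> o1 = pi01 K \<cdot> (pi1 K \<cdot> i0)"
    "i2 \<cdot> o1 = pi12 K \<cdot> (pi0 K \<cdot> i0)" "i2 \<cdot> o2 = pi12 K \<cdot> (pi1 K \<cdot> i0)"
  proof -
    have "pi01 K \<cdot> (i1 \<cdot> d0) = (pi01 K \<cdot> i1) \<cdot> d0" "pi01 K \<cdot> (i1 \<cdot> d1) = (pi01 K \<cdot> i1) \<cdot> d1" 
      "pi12 K \<cdot> (i1 \<cdot> d0) = (pi12 K \<cdot> i1) \<cdot> d0" "pi12 K \<cdot> (i1 \<cdot> d1) = (pi12 K \<cdot> i1) \<cdot> d1" using m
        by simp_all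
    then show "i2 \<cdot> o0 = pi01 K \<cdot> (pi0 K \<cdot> i0)" "i2 \<cdot> o1 = pi01 K \<cdot> (pi1 K \<cdot> i0)"
      "i2 \<cdot> o1 = pi12 K \<cdot> (pi0 K \<cdot> i0)" "i2 \<cdot> o2 = pi12 K \<cdot> (pi1 K \<cdot> i0)"
      unfolding e using r(1)[of 0 1] r(1)[of 1 2] r_d by simp_all
  qed
  have rwo: "\<kappa> \<lhd> i2 \<lhd> o0 = \<kappa> \<lhd> pi01 K \<lhd> pi0 K \<lhd> i0" "\<kappa> \<lhd> i2 \<lhd> o1 = \<kappa> \<lhd> pi01 K \<lhd> pi1 K \<lhd> i0"
     "\<kappa> \<lhd> i2 \<lhd> o1 = \<kappa> \<lhd> pi12 K \<lhd> pi0 K \<lhd> i0" "\<kappa> \<lhd> i2 \<lhd> o2 = \<kappa> \<lhd> pi12 K \<lhd> pi1 K \<lhd> i0"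
    if k: "\<kappa> \<in> Cell2 C" "cod1 C (dom2 C \<kappa>) = X2" for \<kappa>
  proof -
    have "\<kappa> \<lhd> i2 \<lhd> o0 = \<kappa> \<lhd> (i2 \<cdot> o0)" "\<kappa> \<lhd> i2 \<lhd> o1 = \<kappa> \<lhd> (i2 \<cdot> o1)" "\<kappa> \<lhd> i2 \<lhd> o2 = \<kappa> \<lhd> (i2 \<cdot> o2)"
      using k by simp_all
    moreover have "\<kappa> \<lhd> (pi01 K \<cdot> (pi0 K \<cdot> i0)) = \<kappa> \<lhd> pi01 K \<lhd> pi0 K \<lhd> i0"
      "\<kappa> \<lhd> (pi01 K \<cdot> (pi1 K \<cdot> i0)) = \<kappa> \<lhd> pi01 K \<lhd> pi1 K \<lhd> i0"
      "\<kappa> \<lhd> (pi12 K \<cdot> (pi0 K \<cdot> i0)) = \<kappa> \<lhd> pi12 K \<lhd> pi0 K \<lhd> i0"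
        "\<kappa> \<lhd> (pi12 K \<cdot> (pi1 K \<cdot> i0)) = \<kappa> \<lhd> pi12 K \<lhd> pi1 K \<lhd> i0" using k m by simp_all
    ultimately show "\<kappa> \<lhd> i2 \<lhd> o0 = \<kappa> \<lhd> pi01 K \<lhd> pi0 K \<lhd> i0" "\<kappa> \<lhd> i2 \<lhd> o1 = \<kappa> \<lhd> pi01 K \<lhd> pi1 K \<lhd> i0"
     "\<kappa> \<lhd> i2 \<lhd> o1 = \<kappa> \<lhd> pi12 K \<lhd> pi0 K \<lhd> i0" "\<kappa> \<lhd> i2 \<lhd> o2 = \<kappa> \<lhd> pi12 K \<lhd> pi1 K \<lhd> i0"
      using i2o by metis+
  qed
  have C2_uniq2: "\<kappa> = \<kappa>'" if m': "mor C m A X2" "mor C n A X2" and k: "cell C \<kappa> m n" "cell C \<kappa>' m n"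
    and o: "\<kappa> \<lhd> i2 \<lhd> o0 = \<kappa>' \<lhd> i2 \<lhd> o0" "\<kappa> \<lhd> i2 \<lhd> o1 = \<kappa>' \<lhd> i2 \<lhd> o1" "\<kappa> \<lhd> i2 \<lhd> o2 = \<kappa>' \<lhd> i2 \<lhd> o2"
      for m n A \<kappa> \<kappa>'
  proof -
    have "\<kappa> \<lhd> i2 = \<kappa>' \<lhd> i2" by (rule B.uniq2[of "m \<cdot> i2" A "n \<cdot> i2"]) (use m' k o in simp_all)
    then show ?thesis using core_uniq2[OF c(3), of m A n \<kappa> \<kappa>'] m' k by simp
  qed
  have pb_comm: "pi01 K \<cdot> pi1 K = pi12 K \<cdot> pi0 K"
    by (rule ob_uniq[of _ X2]) (use m i2o in simp_all)
  have pb: "strict_pullback C (pi01 K) (pi12 K) (pi1 K) (pi0 K)"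
  proof (rule strict_pullbackI)
    fix B a b assume "mor C a B (dom1 C (pi1 K))" "mor C b B (dom1 C (pi0 K))"
      and ab: "a \<cdot> pi1 K = b \<cdot> pi0 K"
    then have a: "mor C a B X1" "mor C b B X1" using m by simp_all
    have abi: "a \<cdot> (pi1 K \<cdot> i0) = b \<cdot> (pi0 K \<cdot> i0)"
      using ab a m comp1_assoc[of a "pi1 K" i0] comp1_assoc[of b "pi0 K" i0] by simp
    obtain w where w: "mor C w B P2" "w \<rhd> e01 = a \<rhd> \<theta>" "w \<rhd> e12 = b \<rhd> \<theta>"
      using B.ex[of "a \<rhd> \<theta>" "b \<rhd> \<theta>" B] a abi m by auto
    have w0: "w \<cdot> o0 = (a \<cdot> pi0 K) \<cdot> i0" using arg_cong[OF w(2), of "dom2 C"] w(1) a m by simp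
    have w1: "w \<cdot> o1 = (a \<cdot> pi1 K) \<cdot> i0" using arg_cong[OF w(2), of "cod2 C"] w(1) a m by simp
    have w2: "w \<cdot> o2 = (b \<cdot> pi1 K) \<cdot> i0" using arg_cong[OF w(3), of "cod2 C"] w(1) a m by simp
    \<comment> \<open>A diagram with arrow-wise isos at all three vertices is itself an arrow-wise
      iso into \<open>X^[2]\<close>, so it factors through the core.\<close>
    have "arrow_wise_iso C w"
      by (rule B.awi_lift[OF w(1)]; unfold w0 w1 w2; rule awi_pre) (use a m in simp_all)
    then obtain n where n: "mor C n B X2" "n \<cdot> i2 = w" using core_ex[OF c(3) w(1)] by auto
    have "n \<cdot> pi01 K = a" "n \<cdot> pi12 K = b"
      by (rule ar_uniq[of _ B]; use wth[OF n(1)] n(1) a m in \<open>simp add: n(2) w del: whisker_comp1\<close>)+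
    then show "\<exists>m. mor C m B (dom1 C (pi01 K)) \<and> m \<cdot> pi01 K = a \<and> m \<cdot> pi12 K = b" using n(1) m
      by auto
  next
    fix B x n assume "mor C x B (dom1 C (pi01 K))" "mor C n B (dom1 C (pi01 K))"
      and xn: "x \<cdot> pi01 K = n \<cdot> pi01 K" "x \<cdot> pi12 K = n \<cdot> pi12 K"
    then have x: "mor C x B X2" "mor C n B X2" using m by simp_all
    have "(x \<cdot> i2) \<rhd> e01 = (n \<cdot> i2) \<rhd> e01" "(x \<cdot> i2) \<rhd> e12 = (n \<cdot> i2) \<rhd> e12"
      using wth[OF x(1)] wth[OF x(2)] xn by metis+
    then have "x \<cdot> i2 = n \<cdot> i2" by (intro B.uniq[of "x \<cdot> i2" B "n \<cdot> i2"]) (use x in simp_all)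
    then show "x = n" using core_uniq[OF c(3), of x B n] x by simp
  next
    fix B x n \<sigma> \<tau> assume "mor C x B (dom1 C (pi01 K))" "mor C n B (dom1 C (pi01 K))" 
      and s: "cell C \<sigma> (x \<cdot> pi01 K) (n \<cdot> pi01 K)" and t: "cell C \<tau> (x \<cdot> pi12 K) (n \<cdot> pi12 K)"
        and st: "\<sigma> \<lhd> pi1 K = \<tau> \<lhd> pi0 K"
    then have x: "mor C x B X2" "mor C n B X2" using m by simp_all
    have xo: "(y \<cdot> i2) \<cdot> o0 = ((y \<cdot> pi01 K) \<cdot> pi0 K) \<cdot> i0"
      "(y \<cdot> i2) \<cdot> o1 = ((y \<cdot> pi01 K) \<cdot> pi1 K) \<cdot> i0" "(y \<cdot> i2) \<cdot> o2 = ((y \<cdot> pi12 K) \<cdot> pi1 K) \<cdot> i0"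
      if "mor C y B X2" for y
      using that m i2o by simp_all
    have "\<exists>\<kappa>. cell C \<kappa> (x \<cdot> i2) (n \<cdot> i2) \<and> \<kappa> \<lhd> o0 = \<sigma> \<lhd> pi0 K \<lhd> i0 \<and> \<kappa> \<lhd> o1 = \<sigma> \<lhd> pi1 K \<lhd> i0
        \<and> \<kappa> \<lhd> o2 = \<tau> \<lhd> pi1 K \<lhd> i0"
    proof (rule B.ex2)
      show "cell C (\<sigma> \<lhd> pi0 K \<lhd> i0) ((x \<cdot> i2) \<cdot> o0) ((n \<cdot> i2) \<cdot> o0)"
        "cell C (\<sigma> \<lhd> pi1 K \<lhd> i0) ((x \<cdot> i2) \<cdot> o1) ((n \<cdot> i2) \<cdot> o1)"
        "cell C (\<tau> \<lhd> pi1 K \<lhd> i0) ((x \<cdot> i2) \<cdot> o2) ((n \<cdot> i2) \<cdot> o2)"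
        unfolding xo[OF x(1)] xo[OF x(2)] using s t x m by simp_all
      show "((x \<cdot> i2) \<rhd> e01) \<bullet> (\<sigma> \<lhd> pi1 K \<lhd> i0) = (\<sigma> \<lhd> pi0 K \<lhd> i0) \<bullet> ((n \<cdot> i2) \<rhd> e01)"
        unfolding wth(1)[OF x(1), symmetric] wth(1)[OF x(2), symmetric]
        using whisker_exchange[of \<sigma> \<theta>] s x m by (simp del: whisker_comp1(1))
      show "((x \<cdot> i2) \<rhd> e12) \<bullet> (\<tau> \<lhd> pi1 K \<lhd> i0) = (\<sigma> \<lhd> pi1 K \<lhd> i0) \<bullet> ((n \<cdot> i2) \<rhd> e12)"
        unfolding wth(2)[OF x(1), symmetric] wth(2)[OF x(2), symmetric] st
        using whisker_exchange[of \<tau> \<theta>] t x m by (simp del: whisker_comp1(1))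
    qed (use x in simp_all)
    then obtain \<kappa>' where k': "cell C \<kappa>' (x \<cdot> i2) (n \<cdot> i2)" "\<kappa>' \<lhd> o0 = \<sigma> \<lhd> pi0 K \<lhd> i0"
      "\<kappa>' \<lhd> o1 = \<sigma> \<lhd> pi1 K \<lhd> i0" "\<kappa>' \<lhd> o2 = \<tau> \<lhd> pi1 K \<lhd> i0" by blast
    \<comment> \<open>A core lifts invertible 2-cells only. Invertibility is detected at the
      vertices, where each component is whiskered with the arrow-wise iso \<open>i0\<close>.\<close>
    have "isoc C \<kappa>'"
    proof (rule B.isoc_lift)
      show "isoc C (\<kappa>' \<lhd> o0)" "isoc C (\<kappa>' \<lhd> o1)" "isoc C (\<kappa>' \<lhd> o2)"
        unfolding k' by (rule awi_isoc; use s t x m in simp)+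
    qed (use k' x in simp_all)
    then obtain \<kappa> where k: "cell C \<kappa> x n" "\<kappa> \<lhd> i2 = \<kappa>'" using core_ex2[OF c(3), of x B n \<kappa>'] k' x
      by auto
    have ko: "\<kappa> \<lhd> pi01 K \<lhd> pi0 K \<lhd> i0 = \<sigma> \<lhd> pi0 K \<lhd> i0" "\<kappa> \<lhd> pi01 K \<lhd> pi1 K \<lhd> i0 = \<sigma> \<lhd> pi1 K \<lhd> i0"
      "\<kappa> \<lhd> pi12 K \<lhd> pi0 K \<lhd> i0 = \<tau> \<lhd> pi0 K \<lhd> i0" "\<kappa> \<lhd> pi12 K \<lhd> pi1 K \<lhd> i0 = \<tau> \<lhd> pi1 K \<lhd> i0"
      using rwo[of \<kappa>] k k' x st by simp_all
    have k1: "\<kappa> \<lhd> pi01 K \<lhd> pi0 K = \<sigma> \<lhd> pi0 K"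
      by (rule ob_uniq2[of "(x \<cdot> pi01 K) \<cdot> pi0 K" B "(n \<cdot> pi01 K) \<cdot> pi0 K"])
        (use k s x m ko(1) in simp_all)
    have k2: "\<kappa> \<lhd> pi01 K \<lhd> pi1 K = \<sigma> \<lhd> pi1 K"
      by (rule ob_uniq2[of "(x \<cdot> pi01 K) \<cdot> pi1 K" B "(n \<cdot> pi01 K) \<cdot> pi1 K"])
        (use k s x m ko(2) in simp_all)
    have 1: "\<kappa> \<lhd> pi01 K = \<sigma>" by (rule ar_uniq2[of "x \<cdot> pi01 K" B "n \<cdot> pi01 K"])
      (use k s x m k1 k2 in simp_all)
    have k3: "\<kappa> \<lhd> pi12 K \<lhd> pi0 K = \<tau> \<lhd> pi0 K"
      by (rule ob_uniq2[of "(x \<cdot> pi12 K) \<cdot> pi0 K" B "(n \<cdot> pi12 K) \<cdot> pi0 K"])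
        (use k t x m ko(3) in simp_all)
    have k4: "\<kappa> \<lhd> pi12 K \<lhd> pi1 K = \<tau> \<lhd> pi1 K"
      by (rule ob_uniq2[of "(x \<cdot> pi12 K) \<cdot> pi1 K" B "(n \<cdot> pi12 K) \<cdot> pi1 K"])
        (use k t x m ko(4) in simp_all)
    have 2: "\<kappa> \<lhd> pi12 K = \<tau>" by (rule ar_uniq2[of "x \<cdot> pi12 K" B "n \<cdot> pi12 K"])
      (use k t x m k3 k4 in simp_all)
    show "\<exists>\<kappa>. cell C \<kappa> x n \<and> \<kappa> \<lhd> pi01 K = \<sigma> \<and> \<kappa> \<lhd> pi12 K = \<tau>" using k(1) 1 2 by blast
  next
    fix B x n \<kappa> \<kappa>' assume "mor C x B (dom1 C (pi01 K))" "mor C n B (dom1 C (pi01 K))" 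
      and k: "cell C \<kappa> x n" "cell C \<kappa>' x n" and kk: "\<kappa> \<lhd> pi01 K = \<kappa>' \<lhd> pi01 K"
        "\<kappa> \<lhd> pi12 K = \<kappa>' \<lhd> pi12 K"
    then have x: "mor C x B X2" "mor C n B X2" using m by simp_all
    show "\<kappa> = \<kappa>'" by (rule C2_uniq2[OF x k]) (use rwo[of \<kappa>] rwo[of \<kappa>'] k x kk in simp_all)
  qed (use m pb_comm in simp_all)
  have "nerve_like C K X i0 \<theta>"
  proof
    show "ie K \<rhd> \<theta> = id2 C i0"
    proof -
      have "ie K \<rhd> \<theta> = (i0 \<cdot> z) \<rhd> d" using ath[of "ie K" X0] e(3) m by simp
      also have "\<dots> = i0 \<rhd> (z \<rhd> d)" using z by simp
      finally show ?thesis unfolding z(2) by simp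
    qed
    show "pi02 K \<rhd> \<theta> = (pi01 K \<rhd> \<theta>) \<bullet> (pi12 K \<rhd> \<theta>)"
    proof -
      have X2: "X2 \<in> Cell0 C" using cell1_closed(1)[OF l2(1)] by simp
      have "pi02 K \<rhd> \<theta> = i2 \<rhd> (e01 \<bullet> e12)" using wth(3)[of "id1 C X2" X2] X2 m B.e02 by simp
      also have "\<dots> = (i2 \<rhd> e01) \<bullet> (i2 \<rhd> e12)" by simp
      finally show ?thesis using wth(1,2)[of "id1 C X2" X2] X2 m by simp
    qed
    show "groupoid_object C (C0 K)" "groupoid_object C (C1 K)" "groupoid_object C (C2 K)"
      unfolding Kd xx by (rule core_groupoid[OF c(1)] core_groupoid[OF c(2)] core_groupoid[OF
        c(3)])+
    show "\<exists>x. mor C x A (C0 K) \<and> x \<cdot> i0 = f" if "mor C f A X" "arrow_wise_iso C f" for f A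
      unfolding Kd xx by (rule core_ex[OF c(1) that])
    show "x = y" if "mor C x A (C0 K)" "mor C y A (C0 K)" "x \<cdot> i0 = y \<cdot> i0" for x y A
      using ob_uniq that unfolding Kd .
    show "\<exists>\<kappa>. cell C \<kappa> x y \<and> \<kappa> \<lhd> i0 = \<sigma>" if "mor C x A (C0 K)" "mor C y A (C0 K)"
      "cell C \<sigma> (x \<cdot> i0) (y \<cdot> i0)" "isoc C \<sigma>" for x y A \<sigma>
      using core_ex2[OF c(1)] that unfolding Kd xx by blast
    show "\<kappa> = \<kappa>'" if "mor C x A (C0 K)" "mor C y A (C0 K)" "cell C \<kappa> x y" "cell C \<kappa>' x y"
      "\<kappa> \<lhd> i0 = \<kappa>' \<lhd> i0" for x y A \<kappa> \<kappa>'
      using ob_uniq2 that unfolding Kd by blast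
    show "\<exists>a. mor C a A (C1 K) \<and> a \<rhd> \<theta> = \<phi>" if p: "\<phi> \<in> Cell2 C" "dom1 C (dom2 C \<phi>) = A"
      "cod1 C (dom2 C \<phi>) = X"
      "arrow_wise_iso C (dom2 C \<phi>)" "arrow_wise_iso C (cod2 C \<phi>)" for \<phi> A
    proof -
      obtain w where w: "mor C w A P1" "w \<rhd> d = \<phi>" using A.ex[OF p(1-3)] by blast
      have "w \<cdot> d0 = dom2 C \<phi>" "w \<cdot> d1 = cod2 C \<phi>" using w(1) by (simp_all flip: w(2))
      then have "arrow_wise_iso C w" by (intro A.awi_lift[OF w(1)]) (use p in simp_all)
      then obtain a where a: "mor C a A X1" "a \<cdot> i1 = w" using core_ex[OF c(2) w(1)] by auto
      then show ?thesis using ath[OF a(1)] w(2) unfolding Kd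
        by (intro exI[of _ a]) (simp del: whisker_comp1)
    qed
    show "a = b" if "mor C a A (C1 K)" "mor C b A (C1 K)" "a \<rhd> \<theta> = b \<rhd> \<theta>" for a b A
      using ar_uniq that unfolding Kd .
    show "\<exists>\<kappa>. cell C \<kappa> a b \<and> \<kappa> \<lhd> pi0 K = \<sigma> \<and> \<kappa> \<lhd> pi1 K = \<tau>"
      if "mor C a A (C1 K)" "mor C b A (C1 K)" and s: "cell C \<sigma> (a \<cdot> pi0 K) (b \<cdot> pi0 K)"
        "cell C \<tau> (a \<cdot> pi1 K) (b \<cdot> pi1 K)"
        and sq: "(a \<rhd> \<theta>) \<bullet> (\<tau> \<lhd> i0) = (\<sigma> \<lhd> i0) \<bullet> (b \<rhd> \<theta>)" for a b A \<sigma> \<tau>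
    proof -
      have a: "mor C a A X1" "mor C b A X1" using that unfolding Kd by simp_all
      \<comment> \<open>The 2-cell is first found in the arrow object, from the square whiskered
        with \<open>i0\<close>, then lifted to the core of the arrow object; faithfulness of
        \<open>i0\<close> removes the whiskering.\<close>
      have "\<exists>\<kappa>. cell C \<kappa> (a \<cdot> i1) (b \<cdot> i1) \<and> \<kappa> \<lhd> d0 = \<sigma> \<lhd> i0 \<and> \<kappa> \<lhd> d1 = \<tau> \<lhd> i0"
        by (rule A.ex2) (use a s m sq ath[OF a(1)] ath[OF a(2)] ei in simp_all)
      then obtain \<kappa>' where k': "cell C \<kappa>' (a \<cdot> i1) (b \<cdot> i1)" "\<kappa>' \<lhd> d0 = \<sigma> \<lhd> i0" "\<kappa>' \<lhd> d1 = \<tau> \<lhd> i0"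
        by blast
      have "isoc C \<kappa>'"
      proof (rule A.isoc_lift)
        show "isoc C (\<kappa>' \<lhd> d0)" "isoc C (\<kappa>' \<lhd> d1)"
          unfolding k' by (rule awi_isoc; use s a m in simp)+
      qed (use k' a in simp_all)
      then obtain \<kappa> where k: "cell C \<kappa> a b" "\<kappa> \<lhd> i1 = \<kappa>'" using core_ex2[OF c(2), of a A b \<kappa>'] k' a
        by auto
      have ki: "\<kappa> \<lhd> pi0 K \<lhd> i0 = \<sigma> \<lhd> i0" "\<kappa> \<lhd> pi1 K \<lhd> i0 = \<tau> \<lhd> i0" using i1d[of \<kappa>] k k' a
        by simp_all
      have "\<kappa> \<lhd> pi0 K = \<sigma>" by (rule ob_uniq2[of "a \<cdot> pi0 K" A "b \<cdot> pi0 K"])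
        (use k s a m ki in simp_all)
      moreover have "\<kappa> \<lhd> pi1 K = \<tau>" by (rule ob_uniq2[of "a \<cdot> pi1 K" A "b \<cdot> pi1 K"])
        (use k s a m ki in simp_all)
      ultimately show ?thesis using k(1) by blast
    qed
    show "\<kappa> = \<kappa>'" if "mor C a A (C1 K)" "mor C b A (C1 K)" "cell C \<kappa> a b" "cell C \<kappa>' a b"
      "\<kappa> \<lhd> pi0 K = \<kappa>' \<lhd> pi0 K" "\<kappa> \<lhd> pi1 K = \<kappa>' \<lhd> pi1 K" for a b A \<kappa> \<kappa>'
      using ar_uniq2 that unfolding Kd by blast
  qed (use m pb in \<open>simp_all add: Kd(1-3)\<close>)
  then show "nerve_like C (nerve C X N) X (core0 N) (core1 N \<rhd> bdry (ev1 N))"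
    unfolding K_def \<theta>_def nn dd .
  have "X2 \<in> Cell0 C" using cell1_closed(1)[OF l2(1)] by simp
  then have "pi01 K \<rhd> \<theta> = i2 \<rhd> e01" "pi12 K \<rhd> \<theta> = i2 \<rhd> e12"
    using wth(1,2)[of "id1 C X2" X2] m by simp_all
  then show "pi01 (nerve C X N) \<rhd> (core1 N \<rhd> bdry (ev1 N)) = core2 N \<rhd> far (ev2 N) (0, 1)"
    "pi12 (nerve C X N) \<rhd> (core1 N \<rhd> bdry (ev1 N)) = core2 N \<rhd> far (ev2 N) (1, 2)"
    unfolding K_def \<theta>_def nn dd oo .
qed

section \<open>Internal functors into nerves and cocones\<close>

context two_category
begin

lemmas under_icat_closed [simp] = U.internal_category_closed[simplified]
lemmas under_ifun_closed [simp] = U.internal_functor_closed[simplified]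
lemmas under_inat_closed [simp] = U.internal_nat_closed[simplified]
lemmas under_icat_eqs = U.internal_category_eqs[simplified]
lemmas under_ifun_eqs = U.internal_functor_eqs[simplified]
lemmas under_inat_eqs = U.internal_nat_eqs[simplified]

lemma is_cocone_iff:
  "is_cocone C S Y (\<gamma>, \<gamma>') \<longleftrightarrow>
     mor C \<gamma> (C0 S) Y \<and> cell C \<gamma>' (pi0 S \<cdot> \<gamma>) (pi1 S \<cdot> \<gamma>) \<and> ie S \<rhd> \<gamma>' = id2 C \<gamma> \<and>
     pi02 S \<rhd> \<gamma>' = (pi01 S \<rhd> \<gamma>') \<bullet> (pi12 S \<rhd> \<gamma>')"
  by (simp add: is_cocone_def)

lemma cocone_post:
  assumes S: "internal_category (under C) S" and c: "is_cocone C S X (\<gamma>, \<gamma>')" and f: "mor C f X Y"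
  shows "is_cocone C S Y (\<gamma> \<cdot> f, \<gamma>' \<lhd> f)"
proof -
  have g: "mor C \<gamma> (C0 S) X" "cell C \<gamma>' (pi0 S \<cdot> \<gamma>) (pi1 S \<cdot> \<gamma>)" "ie S \<rhd> \<gamma>' = id2 C \<gamma>"
    "pi02 S \<rhd> \<gamma>' = (pi01 S \<rhd> \<gamma>') \<bullet> (pi12 S \<rhd> \<gamma>')"
    using c unfolding is_cocone_iff by blast+
  have e: "pi01 S \<cdot> (pi1 S \<cdot> \<gamma>) = pi12 S \<cdot> (pi0 S \<cdot> \<gamma>)"
    using under_icat_eqs(5)[OF S] S g(1) comp1_assoc[of "pi01 S" "pi1 S" \<gamma>] comp1_assoc[of "pi12 S"
      "pi0 S" \<gamma>] by simp
  have "ie S \<rhd> (\<gamma>' \<lhd> f) = (ie S \<rhd> \<gamma>') \<lhd> f" "pi02 S \<rhd> (\<gamma>' \<lhd> f) = (pi02 S \<rhd> \<gamma>') \<lhd> f"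
    using S g(1,2) f by simp_all
  then have "ie S \<rhd> (\<gamma>' \<lhd> f) = id2 C (\<gamma> \<cdot> f)"
    "pi02 S \<rhd> (\<gamma>' \<lhd> f) = (pi01 S \<rhd> (\<gamma>' \<lhd> f)) \<bullet> (pi12 S \<rhd> (\<gamma>' \<lhd> f))"
    unfolding g(3,4) using S g(1,2) f e by simp_all
  then show ?thesis unfolding is_cocone_iff using S g(1,2) f by simp
qed

end

context nerve_like
begin

lemma tautological: "is_cocone C K X (i, \<theta>)"
  unfolding is_cocone_iff using ie_th comp_th by simp

lemma functor_cocone:
  assumes F: "internal_functor (under C) F" "fsrc F = S" "ftrg F = K"
  shows "is_cocone C S X (F0 F \<cdot> i, F1 F \<rhd> \<theta>)"
proof -
  note S = U.internal_functor_cats(1)[OF F(1), unfolded F(2)]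
  note e = under_ifun_eqs[OF F]
  have p: "F1 F \<cdot> (pi0 K \<cdot> i) = pi0 S \<cdot> (F0 F \<cdot> i)" "F1 F \<cdot> (pi1 K \<cdot> i) = pi1 S \<cdot> (F0 F \<cdot> i)"
    using e(1,2) F S comp1_assoc[of "F1 F" "pi0 K" i] comp1_assoc[of "F1 F" "pi1 K" i] by simp_all
  have "ie S \<rhd> (F1 F \<rhd> \<theta>) = (ie S \<cdot> F1 F) \<rhd> \<theta>" using F S by simp
  also have "\<dots> = id2 C (F0 F \<cdot> i)" unfolding e(3) using ie_pre_th[of "F0 F" "C0 S"] F by simp
  finally have 1: "ie S \<rhd> (F1 F \<rhd> \<theta>) = id2 C (F0 F \<cdot> i)" .
  have "pi02 S \<rhd> (F1 F \<rhd> \<theta>) = (pi02 S \<cdot> F1 F) \<rhd> \<theta>" using F S by simp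
  also have "\<dots> = ((F2 F \<cdot> pi01 K) \<rhd> \<theta>) \<bullet> ((F2 F \<cdot> pi12 K) \<rhd> \<theta>)"
    unfolding e(6)[symmetric] by (rule pi02_th) (use F in simp)
  also have "\<dots> = (pi01 S \<rhd> (F1 F \<rhd> \<theta>)) \<bullet> (pi12 S \<rhd> (F1 F \<rhd> \<theta>))" unfolding e(4,5) using F S by simp
  finally have 2: "pi02 S \<rhd> (F1 F \<rhd> \<theta>) = (pi01 S \<rhd> (F1 F \<rhd> \<theta>)) \<bullet> (pi12 S \<rhd> (F1 F \<rhd> \<theta>))" .
  show ?thesis unfolding is_cocone_iff using 1 2 F p by simp
qed

text \<open>The remaining functor equations are the cocone equations seen through injectivity of
  \<open>i\<close> and of whiskering \<theta>; compatibility with \<open>pi02\<close> follows from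
  the two projections of \<open>f2\<close>.\<close>

lemma functorI:
  assumes S: "internal_category (under C) S"
    and f: "mor C f0 (C0 S) (C0 K)" "mor C f1 (C1 S) (C1 K)" "mor C f2 (C2 S) (C2 K)"
    and c: "is_cocone C S X (f0 \<cdot> i, f1 \<rhd> \<theta>)"
    and f2: "f2 \<cdot> pi01 K = pi01 S \<cdot> f1" "f2 \<cdot> pi12 K = pi12 S \<cdot> f1"
  shows "internal_functor (under C) \<lparr>fsrc = S, ftrg = K, F0 = f0, F1 = f1, F2 = f2\<rparr>"
proof -
  have g: "dom2 C (f1 \<rhd> \<theta>) = (pi0 S \<cdot> f0) \<cdot> i" "cod2 C (f1 \<rhd> \<theta>) = (pi1 S \<cdot> f0) \<cdot> i"
    "ie S \<rhd> (f1 \<rhd> \<theta>) = id2 C (f0 \<cdot> i)"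
    "pi02 S \<rhd> (f1 \<rhd> \<theta>) = (pi01 S \<rhd> (f1 \<rhd> \<theta>)) \<bullet> (pi12 S \<rhd> (f1 \<rhd> \<theta>))"
    using c S f unfolding is_cocone_iff by simp_all
  have 0: "f1 \<cdot> pi0 K = pi0 S \<cdot> f0" by (rule src_eqI[OF f(2) _ g(1)]) (use S f in simp)
  have 1: "f1 \<cdot> pi1 K = pi1 S \<cdot> f0" by (rule trg_eqI[OF f(2) _ g(2)]) (use S f in simp)
  have 2: "ie S \<cdot> f1 = f0 \<cdot> ie K"
  proof (rule ar_uniq[of _ "C0 S"])
    have "(ie S \<cdot> f1) \<rhd> \<theta> = ie S \<rhd> (f1 \<rhd> \<theta>)" using S f by simp
    then show "(ie S \<cdot> f1) \<rhd> \<theta> = (f0 \<cdot> ie K) \<rhd> \<theta>" unfolding g(3) ie_pre_th[OF f(1)] .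
  qed (use S f in simp_all)
  have 3: "f2 \<cdot> pi02 K = pi02 S \<cdot> f1"
  proof (rule ar_uniq[of _ "C2 S"])
    have "(f2 \<cdot> pi02 K) \<rhd> \<theta> = ((f2 \<cdot> pi01 K) \<rhd> \<theta>) \<bullet> ((f2 \<cdot> pi12 K) \<rhd> \<theta>)"
      by (rule pi02_th[OF f(3)])
    also have "\<dots> = pi02 S \<rhd> (f1 \<rhd> \<theta>)" unfolding f2 g(4) using f S by simp
    also have "\<dots> = (pi02 S \<cdot> f1) \<rhd> \<theta>" using f S by simp
    finally show "(f2 \<cdot> pi02 K) \<rhd> \<theta> = (pi02 S \<cdot> f1) \<rhd> \<theta>" .
  qed (use S f in simp_all)
  show ?thesis unfolding internal_functor_def Let_def
    using S nerve_internal_category f 0 1 2 3 f2 by simp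
qed

text \<open>The cocone determines \<open>F0\<close> and \<open>F1\<close>, and the pullback property
  of \<open>C2 K\<close> then determines \<open>F2\<close>.\<close>

lemma functor_eqI:
  assumes F: "internal_functor (under C) F" "ftrg F = K" and G: "internal_functor (under C) G"
    "ftrg G = K"
    and fs: "fsrc F = fsrc G" and e: "F0 F \<cdot> i = F0 G \<cdot> i" "F1 F \<rhd> \<theta> = F1 G \<rhd> \<theta>"
  shows "F = G"
proof -
  have 0: "F0 F = F0 G" by (rule ob_uniq[of _ "C0 (fsrc G)"]) (use F G fs e in simp_all)
  have 1: "F1 F = F1 G" by (rule ar_uniq[of _ "C1 (fsrc G)"]) (use F G fs e in simp_all)
  have 2: "F2 F = F2 G"
    by (rule strict_pullback_uniq[OF pb, of _ "C2 (fsrc G)"])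
      (use F G fs 1 under_ifun_eqs(4,5)[OF F(1) fs F(2)] under_ifun_eqs(4,5)[OF G(1) refl G(2)] in
        simp_all)
  show ?thesis by (rule ifun.equality) (use 0 1 2 fs F G in simp_all)
qed

text \<open>Since \<open>C0 S\<close> is a groupoid, \<gamma> is an arrow-wise iso, and so are the
  ends of \<gamma>', which are \<gamma> precomposed with source and target. Both therefore factor
  through \<open>K\<close>.\<close>

lemma functor_exists:
  assumes S: "internal_category (under C) S" "groupoid_object C (C0 S)"
    and c: "is_cocone C S X (\<gamma>, \<gamma>')"
  shows "\<exists>F. internal_functor (under C) F \<and> fsrc F = S \<and> ftrg F = K \<and> F0 F \<cdot> i = \<gamma> \<and> F1 F \<rhd> \<theta> = \<gamma>'"
proof -
  have g: "mor C \<gamma> (C0 S) X" "cell C \<gamma>' (pi0 S \<cdot> \<gamma>) (pi1 S \<cdot> \<gamma>)"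
    using c unfolding is_cocone_iff by blast+
  have awi: "arrow_wise_iso C \<gamma>" by (rule awi_groupoid[OF S(2)]) (use g in simp_all)
  obtain f0 where f0: "mor C f0 (C0 S) (C0 K)" "f0 \<cdot> i = \<gamma>" using ob_ex[OF g(1) awi] by blast
  have "\<exists>a. mor C a (C1 S) (C1 K) \<and> a \<rhd> \<theta> = \<gamma>'"
    by (rule ar_ex) (use g S(1) awi in simp_all)
  then obtain f1 where f1: "mor C f1 (C1 S) (C1 K)" "f1 \<rhd> \<theta> = \<gamma>'" by blast
  have c': "is_cocone C S X (f0 \<cdot> i, f1 \<rhd> \<theta>)" using c f0 f1 by simp
  have 0: "f1 \<cdot> pi0 K = pi0 S \<cdot> f0"
    by (rule src_eqI[OF f1(1)]) (use f0 g S(1) in \<open>simp_all add: f1(2) del: lwhisk_closed(2)\<close>)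
  have 1: "f1 \<cdot> pi1 K = pi1 S \<cdot> f0"
    by (rule trg_eqI[OF f1(1)]) (use f0 g S(1) in \<open>simp_all add: f1(2) del: lwhisk_closed(3)\<close>)
  have "\<exists>m. mor C m (C2 S) (dom1 C (pi01 K)) \<and> m \<cdot> pi01 K = pi01 S \<cdot> f1 \<and> m \<cdot> pi12 K = pi12 S \<cdot> f1"
  proof (rule strict_pullback_ex[OF pb])
    have "pi01 S \<cdot> (pi1 S \<cdot> f0) = pi12 S \<cdot> (pi0 S \<cdot> f0)"
      using under_icat_eqs(5)[OF S(1)] S(1) f0(1) comp1_assoc[of "pi01 S"
        "pi1 S" f0] comp1_assoc[of "pi12 S" "pi0 S" f0] by simp
    then show "(pi01 S \<cdot> f1) \<cdot> pi1 K = (pi12 S \<cdot> f1) \<cdot> pi0 K" using S(1) f1(1) 0 1 by simp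
  qed (use S(1) f1(1) in simp_all)
  then obtain f2 where f2: "mor C f2 (C2 S) (C2 K)" "f2 \<cdot> pi01 K = pi01 S \<cdot> f1"
    "f2 \<cdot> pi12 K = pi12 S \<cdot> f1" by auto
  show ?thesis
    using functorI[OF S(1) f0(1) f1(1) f2(1) c' f2(2,3)] f0(2) f1(2) by fastforce
qed

text \<open>Whiskering \<theta> turns the two internal composites in the naturality condition into
  vertical composites; the result is the condition on a morphism of cocones.\<close>

lemma nat_th:
  assumes n: "internal_nat (under C) \<alpha>" and k: "fsrc (nsrc \<alpha>) = S" "ftrg (nsrc \<alpha>) = K"
  shows "cell C (ncomp \<alpha> \<rhd> \<theta>) (F0 (nsrc \<alpha>) \<cdot> i) (F0 (ntrg \<alpha>) \<cdot> i)"
    "(pi0 S \<rhd> (ncomp \<alpha> \<rhd> \<theta>)) \<bullet> (F1 (ntrg \<alpha>) \<rhd> \<theta>) = (F1 (nsrc \<alpha>) \<rhd> \<theta>) \<bullet> (pi1 S \<rhd> (ncomp \<alpha> \<rhd> \<theta>))"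
proof -
  note f = U.internal_nat_functors[OF n]
  note S = U.internal_functor_cats(1)[OF f(1), unfolded k]
  note e = under_ifun_eqs[OF f(1) k] and e' = under_ifun_eqs[OF f(2), unfolded f(3,4), OF k]
    and ne = under_inat_eqs[OF n k(2)]
  have m: "mor C (ncomp \<alpha>) (C0 S) (C1 K)" "mor C (F1 (nsrc \<alpha>)) (C1 S) (C1 K)"
    "mor C (F1 (ntrg \<alpha>)) (C1 S) (C1 K)"
    using n f k by simp_all
  show "cell C (ncomp \<alpha> \<rhd> \<theta>) (F0 (nsrc \<alpha>) \<cdot> i) (F0 (ntrg \<alpha>) \<cdot> i)"
    using m(1) comp1_assoc[of "ncomp \<alpha>" "pi0 K" i] comp1_assoc[of "ncomp \<alpha>" "pi1 K" i] ne by simp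
  have mm: "mor C (pi0 S \<cdot> ncomp \<alpha>) (C1 S) (C1 K)" "mor C (pi1 S \<cdot> ncomp \<alpha>) (C1 S) (C1 K)" using m S
    by simp_all
  have c: "F1 (nsrc \<alpha>) \<cdot> pi1 K = (pi1 S \<cdot> ncomp \<alpha>) \<cdot> pi0 K"
    "(pi0 S \<cdot> ncomp \<alpha>) \<cdot> pi1 K = F1 (ntrg \<alpha>) \<cdot> pi0 K"
    using e e' ne m S by simp_all
  have "icomp (under C) K (F1 (nsrc \<alpha>)) (pi1 S \<cdot> ncomp \<alpha>) = icomp (under C) K (pi0 S \<cdot> ncomp \<alpha>) (F1
      (ntrg \<alpha>))"
    using n unfolding internal_nat_def Let_def k under_simps by blast
  then have "(F1 (nsrc \<alpha>) \<rhd> \<theta>) \<bullet> ((pi1 S \<cdot> ncomp \<alpha>) \<rhd> \<theta>) = ((pi0 S \<cdot> ncomp \<alpha>) \<rhd> \<theta>)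
      \<bullet> (F1 (ntrg \<alpha>) \<rhd> \<theta>)"
    using icomp_mor(2)[OF m(2) mm(2) c(1)] icomp_mor(2)[OF mm(1) m(3) c(2)] by simp
  then show "(pi0 S \<rhd> (ncomp \<alpha> \<rhd> \<theta>)) \<bullet> (F1 (ntrg \<alpha>) \<rhd> \<theta>) = (F1 (nsrc \<alpha>) \<rhd> \<theta>)
      \<bullet> (pi1 S \<rhd> (ncomp \<alpha> \<rhd> \<theta>))"
    using m S by simp
qed

text \<open>The preceding translation read backwards, which is possible because whiskering \<theta>
  is injective on morphisms into \<open>C1 K\<close>.\<close>

lemma natI:
  assumes F: "internal_functor (under C) F" "fsrc F = S" "ftrg F = K"
    and G: "internal_functor (under C) G" "fsrc G = S" "ftrg G = K"
    and n: "mor C n (C0 S) (C1 K)" "dom2 C (n \<rhd> \<theta>) = F0 F \<cdot> i" "cod2 C (n \<rhd> \<theta>) = F0 G \<cdot> i"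
    and sq: "(pi0 S \<rhd> (n \<rhd> \<theta>)) \<bullet> (F1 G \<rhd> \<theta>) = (F1 F \<rhd> \<theta>) \<bullet> (pi1 S \<rhd> (n \<rhd> \<theta>))"
  shows "internal_nat (under C) \<lparr>nsrc = F, ntrg = G, ncomp = n\<rparr>"
proof -
  note S = U.internal_functor_cats(1)[OF F(1), unfolded F(2)]
  note e = under_ifun_eqs[OF F] and e' = under_ifun_eqs[OF G]
  have m: "mor C (F1 F) (C1 S) (C1 K)" "mor C (F1 G) (C1 S) (C1 K)" "mor C (F0 F) (C0 S) (C0 K)"
    "mor C (F0 G) (C0 S) (C0 K)"
    using F G by simp_all
  have n0: "n \<cdot> pi0 K = F0 F" by (rule src_eqI[OF n(1) m(3) n(2)])
  have n1: "n \<cdot> pi1 K = F0 G" by (rule trg_eqI[OF n(1) m(4) n(3)])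
  have mm: "mor C (pi0 S \<cdot> n) (C1 S) (C1 K)" "mor C (pi1 S \<cdot> n) (C1 S) (C1 K)" using n(1) S
    by simp_all
  have c: "F1 F \<cdot> pi1 K = (pi1 S \<cdot> n) \<cdot> pi0 K" "(pi0 S \<cdot> n) \<cdot> pi1 K = F1 G \<cdot> pi0 K"
    using e e' n0 n1 n(1) S by simp_all
  note i1 = icomp_mor[OF m(1) mm(2) c(1)] and i2 = icomp_mor[OF mm(1) m(2) c(2)]
  have "icomp (under C) K (F1 F) (pi1 S \<cdot> n) = icomp (under C) K (pi0 S \<cdot> n) (F1 G)"
  proof (rule ar_uniq[OF i1(1) i2(1)])
    show "icomp (under C) K (F1 F) (pi1 S \<cdot> n) \<rhd> \<theta> = icomp (under C) K (pi0 S \<cdot> n) (F1 G) \<rhd> \<theta>"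
      unfolding i1(2) i2(2) using sq n(1) S by simp
  qed
  then show ?thesis
    by (intro U.internal_natI[OF F(1) G(1) F(2) G(2) F(3) G(3)]) (use n(1) n0 n1 in simp_all)
qed

lemma nat_eqI:
  assumes "internal_nat (under C) \<alpha>" "internal_nat (under C) \<beta>" "nsrc \<alpha> = nsrc \<beta>" "ntrg \<alpha> = ntrg \<beta>"
    "ftrg (nsrc \<beta>) = K" "ncomp \<alpha> \<rhd> \<theta> = ncomp \<beta> \<rhd> \<theta>"
  shows "\<alpha> = \<beta>"
proof -
  have "ncomp \<alpha> = ncomp \<beta>" by (rule ar_uniq[of _ "C0 (fsrc (nsrc \<beta>))"]) (use assms in simp_all)
  then show ?thesis using assms(3,4) by (intro inat.equality) simp_all
qed

end

section \<open>The nerve as a 2-functor\<close>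

lemma two_functor_Hom:
  assumes T: "two_functor C D T"
  shows "is_functor (Hom C X Y) (Hom D (T0 T X) (T0 T Y)) \<lparr>fob = T1 T, far = T2 T\<rparr>"
    (is "is_functor ?H ?K ?F")
proof -
  interpret C: two_category C using T by (simp add: two_functor_def)
  interpret D: two_category D using T by (simp add: two_functor_def)
  have h: "is_functor (under C) (under D) \<lparr>fob = T0 T, far = T1 T\<rparr>"
    and v: "is_functor (vert C) (vert D) ?F"
    using T by (simp_all add: two_functor_def)
  have 1: "f \<in> Cell1 C \<Longrightarrow> mor D (T1 T f) (T0 T (dom1 C f)) (T0 T (cod1 C f))" for f
    using is_functorD(4)[OF h, of f] by simp
  have 2: "\<alpha> \<in> Cell2 C \<Longrightarrow> cell D (T2 T \<alpha>) (T1 T (dom2 C \<alpha>)) (T1 T (cod2 C \<alpha>))" for \<alpha>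
    using is_functorD(4)[OF v, of \<alpha>] by simp
  show ?thesis
    unfolding is_functor_def
  proof (intro conjI ballI impI C.category_Hom D.category_Hom)
    fix f assume "f \<in> Ob ?H"
    then show "fob ?F f \<in> Ob ?K" using 1[of f] by auto
    show "far ?F (Idn ?H f) = Idn ?K (fob ?F f)"
      using is_functorD(5)[OF v, of f] \<open>f \<in> Ob ?H\<close> by simp
  next
    fix \<alpha> assume a: "\<alpha> \<in> Ar ?H"
    then show "arr ?K (far ?F \<alpha>) (fob ?F (Dm ?H \<alpha>))
            (fob ?F (Cd ?H \<alpha>))"
      using 1[of "dom2 C \<alpha>"] 2[of \<alpha>] by (auto simp: D.arr_Hom)
  next
    fix \<alpha> \<beta> assume "\<alpha> \<in> Ar ?H" "\<beta> \<in> Ar ?H" "Cd ?H \<alpha> = Dm ?H \<beta>"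
    then show "far ?F (Cmp ?H \<alpha> \<beta>) =
       Cmp ?K (far ?F \<alpha>) (far ?F \<beta>)"
      using is_functorD(6)[OF v, of \<alpha> \<beta>] by simp
  qed
qed

locale nerve_functor = two_category C for C :: "('o, 'm, 'c) two_cat" (structure) +
  fixes \<nu> :: "'o \<Rightarrow> ('o, 'm, 'c) nerve_data"
  assumes pita: "pita C" and choice: "nerve_choice C \<nu>"
begin

abbreviation "ICat \<equiv> IntCat (under C)"
abbreviation "Ner X \<equiv> nerve C X (\<nu> X)"
abbreviation "inc X \<equiv> core0 (\<nu> X)"
abbreviation "cel X \<equiv> core1 (\<nu> X) \<rhd> bdry (ev1 (\<nu> X))"

lemma Ner_data: "X \<in> Cell0 C \<Longrightarrow> is_nerve_data C X (\<nu> X)"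
  using choice by (simp add: nerve_choice_def)

lemma Ner_like: "X \<in> Cell0 C \<Longrightarrow> nerve_like C (Ner X) X (inc X) (cel X)"
  by (rule nerve_like_nerve(1)[OF Ner_data])

lemma Ner_objs: "C0 (Ner X) = dom1 C (core0 (\<nu> X))" "C1 (Ner X) = dom1 C (core1 (\<nu> X))"
  "C2 (Ner X) = dom1 C (core2 (\<nu> X))"
  by (simp_all add: nerve_def Let_def)

text \<open>The last two equations say that \<open>Nv1 C \<nu> f\<close> induces the tautological
  cocone followed by \<open>f\<close>. By \<open>functor_eqI\<close> they characterise it, so the
  choices and description operators in its definition do not appear again.\<close>

lemma Nv1_spec:
  assumes f: "mor C f X Y"
  shows "internal_functor (under C) (Nv1 C \<nu> f)" "fsrc (Nv1 C \<nu> f) = Ner X"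
    "ftrg (Nv1 C \<nu> f) = Ner Y"
    "F0 (Nv1 C \<nu> f) \<cdot> inc Y = inc X \<cdot> f" "F1 (Nv1 C \<nu> f) \<rhd> cel Y = cel X \<lhd> f"
proof -
  have X: "X \<in> Cell0 C" "Y \<in> Cell0 C" using f by auto
  interpret A: nerve_like C "Ner X" X "inc X" "cel X" by (rule Ner_like[OF X(1)])
  interpret B: nerve_like C "Ner Y" Y "inc Y" "cel Y" by (rule Ner_like[OF X(2)])
  define N M where "N = \<nu> X" "M = \<nu> Y"
  note nd = Ner_data[OF X(1), folded N_M_def, unfolded is_nerve_data_def]
    and md = Ner_data[OF X(2), folded N_M_def, unfolded is_nerve_data_def]
  have c: "strict_cotensor C (ord_cat 1) X (cot1 N) (ev1 N)"
    "strict_cotensor C (ord_cat 2) X (cot2 N) (ev2 N)"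
    "is_core C X (core0 N)" "is_core C (cot1 N) (core1 N)" "is_core C (cot2 N) (core2 N)"
    "strict_cotensor C (ord_cat 1) Y (cot1 M) (ev1 M)"
      "strict_cotensor C (ord_cat 2) Y (cot2 M) (ev2 M)"
    "is_core C Y (core0 M)" "is_core C (cot1 M) (core1 M)" "is_core C (cot2 M) (core2 M)"
    using nd md by blast+
  define g1 g2 where "g1 = cotensor_map C (ord_cat 1) f (cot1 N) (ev1 N) (cot1 M) (ev1 M)"
    "g2 = cotensor_map C (ord_cat 2) f (cot2 N) (ev2 N) (cot2 M) (ev2 M)"
  have g1: "mor C g1 (cot1 N) (cot1 M)" "g1 \<rhd> far (ev1 M) (0, 1) = far (ev1 N) (0, 1) \<lhd> f"
    using cotensor_map_spec(1)[OF c(1) c(6) f] cotensor_map_spec(3)[OF c(1) c(6) f, of 0 1]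
      unfolding g1_g2_def by simp_all
  have g2: "mor C g2 (cot2 N) (cot2 M)" "g2 \<rhd> far (ev2 M) (0, 1) = far (ev2 N) (0, 1) \<lhd> f"
    "g2 \<rhd> far (ev2 M) (1, 2) = far (ev2 N) (1, 2) \<lhd> f"
    using cotensor_map_spec(1)[OF c(2) c(7) f] cotensor_map_spec(3)[OF c(2) c(7) f, of 0 1]
      cotensor_map_spec(3)[OF c(2) c(7) f, of 1 2]
    unfolding g1_g2_def by simp_all
  define h0 h1 h2 where "h0 = core_map C (core0 N) (core0 M) f"
    "h1 = core_map C (core1 N) (core1 M) g1" "h2 = core_map C (core2 N) (core2 M) g2"
  have C1d: "C1 (Ner Y) = dom1 C (core1 M)" "C2 (Ner Y) = dom1 C (core2 M)"
    "C1 (Ner X) = dom1 C (core1 N)" "C2 (Ner X) = dom1 C (core2 N)"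
    unfolding Ner_objs N_M_def by simp_all
  have h0: "mor C h0 (C0 (Ner X)) (C0 (Ner Y))" "h0 \<cdot> inc Y = inc X \<cdot> f"
    unfolding Ner_objs h0_h1_h2_def using core_map_spec[OF c(3) c(8) f] unfolding N_M_def by blast+
  have h1: "mor C h1 (C1 (Ner X)) (C1 (Ner Y))" "h1 \<cdot> core1 M = core1 N \<cdot> g1"
    unfolding C1d h0_h1_h2_def using core_map_spec[OF c(4) c(9) g1(1)] by blast+
  have h2: "mor C h2 (C2 (Ner X)) (C2 (Ner Y))" "h2 \<cdot> core2 M = core2 N \<cdot> g2"
    unfolding C1d h0_h1_h2_def using core_map_spec[OF c(5) c(10) g2(1)] by blast+
  note l = core_legs[OF c(4)] core_legs[OF c(5)] core_legs[OF c(9)] core_legs[OF c(10)]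
  note dN1 = universal_arrow.univ[OF arrow_object_universal[OF c(1)]] universal_arrow.ends[OF
    arrow_object_universal[OF c(1)]]
  note dM1 = universal_arrow.univ[OF arrow_object_universal[OF c(6)]] universal_arrow.ends[OF
    arrow_object_universal[OF c(6)]]
  note dN2 = universal_pair.univ[OF cotensor_2_universal[OF c(2)]] universal_pair.ends[OF
    cotensor_2_universal[OF c(2)]]
  note dM2 = universal_pair.univ[OF cotensor_2_universal[OF c(7)]] universal_pair.ends[OF
    cotensor_2_universal[OF c(7)]]
  have h1t: "h1 \<rhd> cel Y = cel X \<lhd> f"
  proof -
    have "h1 \<rhd> (core1 M \<rhd> bdry (ev1 M)) = (h1 \<cdot> core1 M) \<rhd> bdry (ev1 M)" using h1(1) l dM1 C1d
      by simp
    also have "\<dots> = core1 N \<rhd> (g1 \<rhd> bdry (ev1 M))" unfolding h1(2) using g1(1) l dM1 by simp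
    also have "\<dots> = (core1 N \<rhd> bdry (ev1 N)) \<lhd> f" unfolding g1(2) using l dN1 f by simp
    finally show ?thesis unfolding N_M_def .
  qed
  have h2t: "(h2 \<cdot> core2 M) \<rhd> far (ev2 M) (0, 1) = core2 N \<rhd> (far (ev2 N) (0, 1) \<lhd> f)"
    "(h2 \<cdot> core2 M) \<rhd> far (ev2 M) (1, 2) = core2 N \<rhd> (far (ev2 N) (1, 2) \<lhd> f)"
    unfolding h2(2) using g2 l dM2 by simp_all
  note nt = nerve_like_nerve(2,3)[OF Ner_data[OF X(1)]]
    and mt = nerve_like_nerve(2,3)[OF Ner_data[OF X(2)]]
  \<comment> \<open>Both projections of a pair are handled by one argument, with \<open>e\<close>
    and \<open>e'\<close> the corresponding universal 2-cells of the two cotensors with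
    \<open>[2]\<close>.\<close>
  have f2: "h2 \<cdot> pi01 (Ner Y) = pi01 (Ner X) \<cdot> h1" "h2 \<cdot> pi12 (Ner Y) = pi12 (Ner X) \<cdot> h1"
  proof -
    have "(h2 \<cdot> p) \<rhd> cel Y = (q \<cdot> h1) \<rhd> cel Y"
      if p: "mor C p (C2 (Ner Y)) (C1 (Ner Y))" "mor C q (C2 (Ner X)) (C1 (Ner X))"
        "p \<rhd> cel Y = core2 (\<nu> Y) \<rhd> e" "q \<rhd> cel X = core2 (\<nu> X) \<rhd> e'"
        and e: "(h2 \<cdot> core2 (\<nu> Y)) \<rhd> e = core2 (\<nu> X) \<rhd> (e' \<lhd> f)" "e \<in> Cell2 C"
          "dom1 C (dom2 C e) = cot2 (\<nu> Y)" "e' \<in> Cell2 C" "dom1 C (dom2 C e') = cot2 (\<nu> X)"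
          "cod1 C (dom2 C e') = X"
      for p q e e'
    proof -
      have "(h2 \<cdot> p) \<rhd> cel Y = h2 \<rhd> (p \<rhd> cel Y)" using h2(1) p(1) B.th by simp
      also have "\<dots> = (h2 \<cdot> core2 (\<nu> Y)) \<rhd> e" unfolding p(3) using h2(1) l e C1d
        unfolding N_M_def[symmetric] by simp
      also have "\<dots> = (q \<rhd> cel X) \<lhd> f" unfolding e(1) p(4) using l e f unfolding N_M_def[symmetric]
        by simp
      also have "\<dots> = q \<rhd> (cel X \<lhd> f)" using p(2) f A.th by simp
      also have "\<dots> = (q \<cdot> h1) \<rhd> cel Y" unfolding h1t[symmetric] using p(2) h1(1) B.th by simp
      finally show ?thesis .
    qed
    note r = this
    have "(h2 \<cdot> pi01 (Ner Y)) \<rhd> cel Y = (pi01 (Ner X) \<cdot> h1) \<rhd> cel Y"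
      by (rule r[OF _ _ mt(1) nt(1) h2t(1)[unfolded N_M_def]])
        (use dM2[unfolded N_M_def] dN2[unfolded N_M_def] in simp_all)
    then show "h2 \<cdot> pi01 (Ner Y) = pi01 (Ner X) \<cdot> h1"
      by (rule B.ar_uniq[of _ "C2 (Ner X)", rotated 2]) (use h1(1) h2(1) in simp_all)
    have "(h2 \<cdot> pi12 (Ner Y)) \<rhd> cel Y = (pi12 (Ner X) \<cdot> h1) \<rhd> cel Y"
      by (rule r[OF _ _ mt(2) nt(2) h2t(2)[unfolded N_M_def]])
        (use dM2[unfolded N_M_def] dN2[unfolded N_M_def] in simp_all)
    then show "h2 \<cdot> pi12 (Ner Y) = pi12 (Ner X) \<cdot> h1"
      by (rule B.ar_uniq[of _ "C2 (Ner X)", rotated 2]) (use h1(1) h2(1) in simp_all)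
  qed
  have Nv1: "Nv1 C \<nu> f = \<lparr>fsrc = Ner X, ftrg = Ner Y, F0 = h0, F1 = h1, F2 = h2\<rparr>"
    using f by (simp add: Nv1_def Let_def h0_h1_h2_def g1_g2_def N_M_def)
  \<comment> \<open>By the two equations for \<open>h0\<close> and \<open>h1\<close> this is the
    image of the tautological cocone under \<open>f\<close>.\<close>
  have "is_cocone C (Ner X) Y (h0 \<cdot> inc Y, h1 \<rhd> cel Y)"
    unfolding h0(2) h1t by (rule cocone_post[OF A.nerve_internal_category A.tautological f])
  then show "internal_functor (under C) (Nv1 C \<nu> f)"
    unfolding Nv1 by (intro B.functorI[OF A.nerve_internal_category h0(1) h1(1) h2(1) _ f2])
  show "fsrc (Nv1 C \<nu> f) = Ner X" "ftrg (Nv1 C \<nu> f) = Ner Y" "F0 (Nv1 C \<nu> f) \<cdot> inc Y = inc X \<cdot> f"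
    "F1 (Nv1 C \<nu> f) \<rhd> cel Y = cel X \<lhd> f"
    unfolding Nv1 using h0(2) h1t by simp_all
qed

text \<open>Both ends of the 2-cell start with \<open>inc X\<close> and are arrow-wise isos, so it
  names an arrow of \<open>Ner Y\<close>. Its naturality is the exchange law for
  \<open>cel X\<close> and \<alpha>.\<close>

lemma Nv2_spec:
  assumes a: "cell C \<alpha> f g" and f: "mor C f X Y"
  shows "internal_nat (under C) (Nv2 C \<nu> \<alpha>)" "nsrc (Nv2 C \<nu> \<alpha>) = Nv1 C \<nu> f"
    "ntrg (Nv2 C \<nu> \<alpha>) = Nv1 C \<nu> g"
    "ncomp (Nv2 C \<nu> \<alpha>) \<rhd> cel Y = inc X \<rhd> \<alpha>"
proof -
  have X: "X \<in> Cell0 C" "Y \<in> Cell0 C" using f by auto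
  interpret A: nerve_like C "Ner X" X "inc X" "cel X" by (rule Ner_like[OF X(1)])
  interpret B: nerve_like C "Ner Y" Y "inc Y" "cel Y" by (rule Ner_like[OF X(2)])
  have g: "mor C g X Y" using a f cell2_closed(2,6,7)[of \<alpha>] by simp
  have "\<exists>n. mor C n (C0 (Ner X)) (C1 (Ner Y)) \<and> n \<rhd> cel Y = inc X \<rhd> \<alpha>"
    by (rule B.ar_ex) (use a f g in simp_all)
  then obtain n where n: "mor C n (C0 (Ner X)) (C1 (Ner Y))" "n \<rhd> cel Y = inc X \<rhd> \<alpha>" by blast
  have "is_core C (cot1 (\<nu> Y)) (core1 (\<nu> Y))" "arrow_object C Y (cot1 (\<nu> Y)) (ev1 (\<nu> Y))"
    using Ner_data[OF X(2)] by (simp_all add: is_nerve_data_def)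
  note l = core_legs[OF this(1)] universal_arrow.univ[OF arrow_object_universal[OF this(2)]]
    universal_arrow.ends[OF arrow_object_universal[OF this(2)]]
  have e: "(m \<cdot> core1 (\<nu> Y)) \<rhd> bdry (ev1 (\<nu> Y)) = m \<rhd> cel Y" if "mor C m (C0 (Ner X)) (C1 (Ner Y))"
    for m
    using that l by (simp add: Ner_objs(2))
  have "(THE m. mor C m (dom1 C (core0 (\<nu> X))) (dom1 C (core1 (\<nu> Y))) \<and>
                     (m \<cdot> core1 (\<nu> Y)) \<rhd> bdry (ev1 (\<nu> Y)) = core0 (\<nu> X) \<rhd> \<alpha>) = n"
    unfolding Ner_objs[symmetric]
  proof (rule the_equality)
    show "mor C n (C0 (Ner X)) (C1 (Ner Y)) \<and> (n \<cdot> core1 (\<nu> Y)) \<rhd> bdry (ev1 (\<nu> Y))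
        = core0 (\<nu> X) \<rhd> \<alpha>"
      using n e[OF n(1)] by metis
    fix m assume m: "mor C m (C0 (Ner X)) (C1 (Ner Y)) \<and> (m \<cdot> core1 (\<nu> Y)) \<rhd> bdry (ev1 (\<nu> Y))
        = core0 (\<nu> X) \<rhd> \<alpha>"
    then have "m \<rhd> cel Y = n \<rhd> cel Y" using e[of m] n(2) by metis
    then show "m = n" using B.ar_uniq n(1) m by blast
  qed
  then have Nv2: "Nv2 C \<nu> \<alpha> = \<lparr>nsrc = Nv1 C \<nu> f, ntrg = Nv1 C \<nu> g, ncomp = n\<rparr>"
    using a f by (simp add: Nv2_def Let_def)
  note F = Nv1_spec[OF f] and G = Nv1_spec[OF g]
  show "internal_nat (under C) (Nv2 C \<nu> \<alpha>)"
    unfolding Nv2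
  proof (rule B.natI[OF F(1-3) G(1-3) n(1)])
    show "dom2 C (n \<rhd> cel Y) = F0 (Nv1 C \<nu> f) \<cdot> inc Y" "cod2 C (n \<rhd> cel Y) = F0 (Nv1 C \<nu> g) \<cdot> inc Y"
      unfolding n(2) F(4) G(4) using a f g by simp_all
    show "(pi0 (Ner X) \<rhd> (n \<rhd> cel Y)) \<bullet> (F1 (Nv1 C \<nu> g) \<rhd> cel Y) = (F1 (Nv1 C \<nu> f) \<rhd> cel Y)
        \<bullet> (pi1 (Ner X) \<rhd> (n \<rhd> cel Y))"
      unfolding n(2) F(5) G(5) using whisker_exchange[of "cel X" \<alpha>] a f A.th by simp
  qed
  show "nsrc (Nv2 C \<nu> \<alpha>) = Nv1 C \<nu> f" "ntrg (Nv2 C \<nu> \<alpha>) = Nv1 C \<nu> g"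
    "ncomp (Nv2 C \<nu> \<alpha>) \<rhd> cel Y = inc X \<rhd> \<alpha>"
    unfolding Nv2 using n(2) by simp_all
qed

end

section \<open>The 2-category of complete congruences\<close>

context two_category
begin

lemma Cong_simps [simp]:
  "Cell0 (Cong C) = {K. internal_category (under C) K \<and> complete_congruence C K}"
  "Cell1 (Cong C) = {F. internal_functor (under C) F \<and> complete_congruence C (fsrc F)
      \<and> complete_congruence C (ftrg F)}"
  "Cell2 (Cong C) = {\<alpha>. internal_nat (under C) \<alpha> \<and> complete_congruence C (fsrc (nsrc \<alpha>))
      \<and> complete_congruence C (ftrg (nsrc \<alpha>))}"
  "dom1 (Cong C) = fsrc" "cod1 (Cong C) = ftrg" "dom2 (Cong C) = nsrc" "cod2 (Cong C) = ntrg"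
  "id1 (Cong C) = id1 (IntCat (under C))" "comp1 (Cong C) = comp1 (IntCat (under C))"
  "id2 (Cong C) = id2 (IntCat (under C))" "vcomp (Cong C) = vcomp (IntCat (under C))"
  "hcomp (Cong C) = hcomp (IntCat (under C))"
  by (auto simp: Cong_def)

lemma two_category_Cong: "two_category (Cong C)"
  unfolding Cong_def by (rule two_category.two_category_full_sub[OF U.two_category_IntCat])

end

section \<open>Functoriality of the nerve and its comparison with quotients\<close>

context nerve_functor
begin

lemma Nv_simps [simp]: "T0 (Nv C \<nu>) X = Ner X" "T1 (Nv C \<nu>) = Nv1 C \<nu>" "T2 (Nv C \<nu>) = Nv2 C \<nu>"
  by (simp_all add: Nv_def)

lemma Ner_complete: "X \<in> Cell0 C \<Longrightarrow> complete_congruence C (Ner X)"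
  by (rule nerve_like.nerve_complete_congruence[OF Ner_like pita])

lemma Ner_internal_category: "X \<in> Cell0 C \<Longrightarrow> internal_category (under C) (Ner X)"
  by (rule nerve_like.nerve_internal_category[OF Ner_like])

text \<open>Here and in the next lemma functors are compared by the cocones that they induce;
  likewise transformations are compared by their whiskerings with \<open>cel\<close>.\<close>

lemma Nv1_id:
  assumes X: "X \<in> Cell0 C"
  shows "Nv1 C \<nu> (id1 C X) = id1 ICat (Ner X)"
proof -
  interpret A: nerve_like C "Ner X" X "inc X" "cel X" by (rule Ner_like[OF X])
  have "mor C (id1 C X) X X" using X by simp
  note F = Nv1_spec[OF this]
  show ?thesis
  proof (rule A.functor_eqI[OF F(1,3)])
    show "internal_functor (under C) (id1 ICat (Ner X))"
      by (rule U.internal_functor_id[OF A.nerve_internal_category])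
    show "F0 (Nv1 C \<nu> (id1 C X)) \<cdot> inc X = F0 (id1 ICat (Ner X)) \<cdot> inc X"
      unfolding F(4) by simp
    show "F1 (Nv1 C \<nu> (id1 C X)) \<rhd> cel X = F1 (id1 ICat (Ner X)) \<rhd> cel X"
      unfolding F(5) using A.th by simp
  qed (use F in simp_all)
qed

lemma Nv1_comp:
  assumes f: "mor C f X Y" and g: "mor C g Y Z"
  shows "Nv1 C \<nu> (f \<cdot> g) = comp1 ICat (Nv1 C \<nu> f) (Nv1 C \<nu> g)"
proof -
  have X: "X \<in> Cell0 C" "Y \<in> Cell0 C" "Z \<in> Cell0 C" using f g by auto
  interpret A: nerve_like C "Ner X" X "inc X" "cel X" by (rule Ner_like[OF X(1)])
  interpret B: nerve_like C "Ner Y" Y "inc Y" "cel Y" by (rule Ner_like[OF X(2)])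
  interpret E: nerve_like C "Ner Z" Z "inc Z" "cel Z" by (rule Ner_like[OF X(3)])
  have fg: "mor C (f \<cdot> g) X Z" using f g by simp
  note F = Nv1_spec[OF f] and G = Nv1_spec[OF g] and H = Nv1_spec[OF fg]
  have m: "mor C (F0 (Nv1 C \<nu> f)) (C0 (Ner X)) (C0 (Ner Y))"
    "mor C (F0 (Nv1 C \<nu> g)) (C0 (Ner Y)) (C0 (Ner Z))"
    "mor C (F1 (Nv1 C \<nu> f)) (C1 (Ner X)) (C1 (Ner Y))"
      "mor C (F1 (Nv1 C \<nu> g)) (C1 (Ner Y)) (C1 (Ner Z))"
    using F(1-3) G(1-3) by simp_all
  show ?thesis
  proof (rule E.functor_eqI[OF H(1,3)])
    show "internal_functor (under C) (comp1 ICat (Nv1 C \<nu> f) (Nv1 C \<nu> g))"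
      by (rule U.internal_functor_comp[OF F(1) G(1)]) (simp add: F G)
    have "(F0 (Nv1 C \<nu> f) \<cdot> F0 (Nv1 C \<nu> g)) \<cdot> inc Z = F0 (Nv1 C \<nu> f) \<cdot> (F0 (Nv1 C \<nu> g) \<cdot> inc Z)"
      using m by simp
    also have "\<dots> = (F0 (Nv1 C \<nu> f) \<cdot> inc Y) \<cdot> g" unfolding G(4) using m g by simp
    also have "\<dots> = inc X \<cdot> (f \<cdot> g)" unfolding F(4) using f g by simp
    finally show "F0 (Nv1 C \<nu> (f \<cdot> g)) \<cdot> inc Z = F0 (comp1 ICat (Nv1 C \<nu> f) (Nv1 C \<nu> g)) \<cdot> inc Z"
      unfolding H(4) by simp
    have "(F1 (Nv1 C \<nu> f) \<cdot> F1 (Nv1 C \<nu> g)) \<rhd> cel Z = F1 (Nv1 C \<nu> f) \<rhd> (F1 (Nv1 C \<nu> g) \<rhd> cel Z)"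
      using m E.th by simp
    also have "\<dots> = (F1 (Nv1 C \<nu> f) \<rhd> cel Y) \<lhd> g" unfolding G(5) using m g B.th by simp
    also have "\<dots> = cel X \<lhd> (f \<cdot> g)" unfolding F(5) using f g A.th by simp
    finally show "F1 (Nv1 C \<nu> (f \<cdot> g)) \<rhd> cel Z = F1 (comp1 ICat (Nv1 C \<nu> f) (Nv1 C \<nu> g)) \<rhd> cel Z"
      unfolding H(5) by simp
  qed (simp_all add: F G H)
qed

lemma Nv2_id:
  assumes f: "mor C f X Y"
  shows "Nv2 C \<nu> (id2 C f) = id2 ICat (Nv1 C \<nu> f)"
proof -
  have X: "X \<in> Cell0 C" "Y \<in> Cell0 C" using f by auto
  interpret A: nerve_like C "Ner X" X "inc X" "cel X" by (rule Ner_like[OF X(1)])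
  interpret B: nerve_like C "Ner Y" Y "inc Y" "cel Y" by (rule Ner_like[OF X(2)])
  have c: "cell C (id2 C f) f f" using f by simp
  note F = Nv1_spec[OF f] and N = Nv2_spec[OF c f]
  have m: "mor C (F0 (Nv1 C \<nu> f)) (C0 (Ner X)) (C0 (Ner Y))" using F(1-3) by simp
  show ?thesis
  proof (rule B.nat_eqI[OF N(1) U.internal_nat_id[OF F(1)]])
    have "ncomp (Nv2 C \<nu> (id2 C f)) \<rhd> cel Y = id2 C (inc X \<cdot> f)" unfolding N(4) using f by simp
    also have "\<dots> = (F0 (Nv1 C \<nu> f) \<cdot> ie (Ner Y)) \<rhd> cel Y"
      unfolding F(4)[symmetric] B.ie_pre_th[OF m] ..
    finally show "ncomp (Nv2 C \<nu> (id2 C f)) \<rhd> cel Y = ncomp (id2 ICat (Nv1 C \<nu> f)) \<rhd> cel Y"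
      by (simp only: U.IntCat_simps F(3) inat.simps under_simps)
  qed (simp_all add: F N)
qed

lemma Nv2_vcomp:
  assumes f: "mor C f X Y" and a: "cell C \<alpha> f g" and b: "cell C \<beta> g h"
  shows "Nv2 C \<nu> (\<alpha> \<bullet> \<beta>) = vcomp ICat (Nv2 C \<nu> \<alpha>) (Nv2 C \<nu> \<beta>)"
proof -
  have X: "X \<in> Cell0 C" "Y \<in> Cell0 C" using f by auto
  interpret A: nerve_like C "Ner X" X "inc X" "cel X" by (rule Ner_like[OF X(1)])
  interpret B: nerve_like C "Ner Y" Y "inc Y" "cel Y" by (rule Ner_like[OF X(2)])
  have g: "mor C g X Y" using a f cell2_closed(2,6,7)[of \<alpha>] by simp
  have c: "cell C (\<alpha> \<bullet> \<beta>) f h" using a b by simp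
  note NA = Nv2_spec[OF a f] and NB = Nv2_spec[OF b g] and NC = Nv2_spec[OF c f]
    and F = Nv1_spec[OF f] and G = Nv1_spec[OF g]
  have m: "mor C (ncomp (Nv2 C \<nu> \<alpha>)) (C0 (Ner X)) (C1 (Ner Y))"
    "mor C (ncomp (Nv2 C \<nu> \<beta>)) (C0 (Ner X)) (C1 (Ner Y))"
    using NA NB F G by simp_all
  have e: "ncomp (Nv2 C \<nu> \<alpha>) \<cdot> pi1 (Ner Y) = ncomp (Nv2 C \<nu> \<beta>) \<cdot> pi0 (Ner Y)"
    using under_inat_eqs[OF NA(1), of "Ner Y"] under_inat_eqs[OF NB(1), of "Ner Y"] NA NB F G
      by simp
  show ?thesis
  proof (rule B.nat_eqI[OF NC(1)])
    show "internal_nat (under C) (vcomp ICat (Nv2 C \<nu> \<alpha>) (Nv2 C \<nu> \<beta>))"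
      by (rule U.internal_nat_vcomp[OF NA(1) NB(1)]) (simp add: NA NB)
    have "ncomp (Nv2 C \<nu> (\<alpha> \<bullet> \<beta>)) \<rhd> cel Y = (inc X \<rhd> \<alpha>) \<bullet> (inc X \<rhd> \<beta>)" unfolding NC(4) using a b f
      by simp
    also have "\<dots> = icomp (under C) (Ner Y) (ncomp (Nv2 C \<nu> \<alpha>)) (ncomp (Nv2 C \<nu> \<beta>)) \<rhd> cel Y"
      unfolding B.icomp_mor(2)[OF m e] NA(4) NB(4) ..
    finally show "ncomp (Nv2 C \<nu> (\<alpha> \<bullet> \<beta>)) \<rhd> cel Y = ncomp (vcomp ICat (Nv2 C \<nu> \<alpha>) (Nv2 C \<nu> \<beta>)) \<rhd> cel
        Y"
      by (simp only: U.IntCat_simps NA(2) F(3) inat.simps)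
  qed (simp_all add: NA NB NC F G)
qed

text \<open>The two whiskerings in \<open>IntCat_hcomp\<close> name the two factors of \<alpha>
  \<star> \<beta> in \<open>hcomp_eq(1)\<close>, each preceded by \<open>inc X\<close>.\<close>

lemma Nv2_hcomp:
  assumes f: "mor C f X Y" and a: "cell C \<alpha> f g" and h: "mor C h Y Z" and b: "cell C \<beta> h k"
  shows "Nv2 C \<nu> (\<alpha> \<star> \<beta>) = hcomp ICat (Nv2 C \<nu> \<alpha>) (Nv2 C \<nu> \<beta>)"
proof -
  have X: "X \<in> Cell0 C" "Y \<in> Cell0 C" "Z \<in> Cell0 C" using f h by auto
  interpret A: nerve_like C "Ner X" X "inc X" "cel X" by (rule Ner_like[OF X(1)])
  interpret B: nerve_like C "Ner Y" Y "inc Y" "cel Y" by (rule Ner_like[OF X(2)])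
  interpret E: nerve_like C "Ner Z" Z "inc Z" "cel Z" by (rule Ner_like[OF X(3)])
  have g: "mor C g X Y" using a f cell2_closed(2,6,7)[of \<alpha>] by simp
  have k: "mor C k Y Z" using b h cell2_closed(2,6,7)[of \<beta>] by simp
  have c: "cell C (\<alpha> \<star> \<beta>) (f \<cdot> h) (g \<cdot> k)" using a b f h hcomp_closed[of \<alpha> \<beta>] by simp
  have fh: "mor C (f \<cdot> h) X Z" using f h by simp
  note NA = Nv2_spec[OF a f] and NB = Nv2_spec[OF b h] and NC = Nv2_spec[OF c fh]
    and F = Nv1_spec[OF f] and G = Nv1_spec[OF g] and H = Nv1_spec[OF h] and FH = Nv1_spec[OF fh]
  define x y where "x = ncomp (Nv2 C \<nu> \<alpha>) \<cdot> F1 (Nv1 C \<nu> h)" "y = F0 (Nv1 C \<nu> g) \<cdot> ncomp (Nv2 C \<nu> \<beta>)"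
  have m: "mor C (ncomp (Nv2 C \<nu> \<alpha>)) (C0 (Ner X)) (C1 (Ner Y))"
    "mor C (ncomp (Nv2 C \<nu> \<beta>)) (C0 (Ner Y)) (C1 (Ner Z))"
    "mor C (F1 (Nv1 C \<nu> h)) (C1 (Ner Y)) (C1 (Ner Z))"
      "mor C (F0 (Nv1 C \<nu> g)) (C0 (Ner X)) (C0 (Ner Y))"
      "mor C (F0 (Nv1 C \<nu> h)) (C0 (Ner Y)) (C0 (Ner Z))"
    using NA NB F G H by simp_all
  have xy: "mor C x (C0 (Ner X)) (C1 (Ner Z))" "mor C y (C0 (Ner X)) (C1 (Ner Z))" using m
    by (simp_all add: x_y_def)
  have "F1 (Nv1 C \<nu> h) \<cdot> pi1 (Ner Z) = pi1 (Ner Y) \<cdot> F0 (Nv1 C \<nu> h)"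
    using under_ifun_eqs(2)[OF H(1-3)] .
  then have "x \<cdot> pi1 (Ner Z) = (ncomp (Nv2 C \<nu> \<alpha>) \<cdot> pi1 (Ner Y)) \<cdot> F0 (Nv1 C \<nu> h)"
    unfolding x_y_def using m by simp
  moreover have "ncomp (Nv2 C \<nu> \<alpha>) \<cdot> pi1 (Ner Y) = F0 (Nv1 C \<nu> g)"
    using under_inat_eqs(2)[OF NA(1), of "Ner Y"] NA F by simp
  moreover have "y \<cdot> pi0 (Ner Z) = F0 (Nv1 C \<nu> g) \<cdot> F0 (Nv1 C \<nu> h)"
    unfolding x_y_def using under_inat_eqs(1)[OF NB(1), of "Ner Z"] NB H m by simp
  ultimately have e: "x \<cdot> pi1 (Ner Z) = y \<cdot> pi0 (Ner Z)" by simp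
  show ?thesis
  proof (rule E.nat_eqI[OF NC(1)])
    show "internal_nat (under C) (hcomp ICat (Nv2 C \<nu> \<alpha>) (Nv2 C \<nu> \<beta>))"
      by (rule U.internal_nat_hcomp[OF NA(1) NB(1)]) (simp add: NA NB F H)
    have "x \<rhd> cel Z = ncomp (Nv2 C \<nu> \<alpha>) \<rhd> (F1 (Nv1 C \<nu> h) \<rhd> cel Z)" unfolding x_y_def using m E.th
      by simp
    also have "\<dots> = (ncomp (Nv2 C \<nu> \<alpha>) \<rhd> cel Y) \<lhd> h" unfolding H(5) using m h B.th by simp
    finally have x: "x \<rhd> cel Z = (inc X \<rhd> \<alpha>) \<lhd> h" unfolding NA(4) .
    have "y \<rhd> cel Z = F0 (Nv1 C \<nu> g) \<rhd> (ncomp (Nv2 C \<nu> \<beta>) \<rhd> cel Z)" unfolding x_y_def using m E.th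
      by simp
    also have "\<dots> = (F0 (Nv1 C \<nu> g) \<cdot> inc Y) \<rhd> \<beta>" unfolding NB(4) using m h b by simp
    finally have y: "y \<rhd> cel Z = (inc X \<cdot> g) \<rhd> \<beta>" unfolding G(4) .
    have "ncomp (Nv2 C \<nu> (\<alpha> \<star> \<beta>)) \<rhd> cel Z = ((inc X \<rhd> \<alpha>) \<lhd> h) \<bullet> ((inc X \<cdot> g) \<rhd> \<beta>)"
      unfolding NC(4) using a b f g h k hcomp_eq(1)[of \<alpha> \<beta>] by simp
    also have "\<dots> = icomp (under C) (Ner Z) x y \<rhd> cel Z"
      unfolding E.icomp_mor(2)[OF xy e] x y ..
    finally show "ncomp (Nv2 C \<nu> (\<alpha> \<star> \<beta>)) \<rhd> cel Z = ncomp (hcomp ICat (Nv2 C \<nu> \<alpha>) (Nv2 C \<nu> \<beta>)) \<rhd> cel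
        Z"
      by (simp only: U.IntCat_hcomp U.IntCat_simps NA NB H(3) inat.simps ifun.simps under_simps
        x_y_def)
  qed (use NC NA NB FH F H G Nv1_comp[OF f h] Nv1_comp[OF g k] in \<open>simp_all add: U.IntCat_hcomp\<close>)
qed

theorem two_functor_Nv: "two_functor C (Cong C) (Nv C \<nu>)"
proof -
  let ?F = "\<lparr>fob = T0 (Nv C \<nu>), far = T1 (Nv C \<nu>)\<rparr>"
    and ?G = "\<lparr>fob = T1 (Nv C \<nu>), far = T2 (Nv C \<nu>)\<rparr>"
  interpret CC: two_category "Cong C" by (rule two_category_Cong)
  have 1: "is_functor (under C) (under (Cong C)) ?F"
    unfolding is_functor_def
  proof (intro conjI ballI impI under_category CC.under_category)
    fix X assume "X \<in> Ob (under C)"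
    then show "fob ?F X \<in> Ob (under (Cong C))"
      "far ?F (Idn (under C) X) = Idn (under (Cong C)) (fob ?F X)"
      using Ner_complete[of X] Ner_internal_category[of X] Nv1_id[of X] by simp_all
  next
    fix f assume "f \<in> Ar (under C)"
    then show "mor (Cong C) (far ?F f) (fob ?F (Dm (under C) f))
      (fob ?F (Cd (under C) f))"
      using Nv1_spec(1-3)[of f "dom1 C f" "cod1 C f"] Ner_complete by simp
  next
    fix f g assume "f \<in> Ar (under C)" "g \<in> Ar (under C)" "Cd (under C) f = Dm (under C) g"
    then show "far ?F (Cmp (under C) f g) =
       Cmp (under (Cong C)) (far ?F f) (far ?F g)"
      using Nv1_comp[of f "dom1 C f" "cod1 C f" g "cod1 C g"] by simp
  qed
  have 2: "is_functor (vert C) (vert (Cong C)) ?G"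
    unfolding is_functor_def
  proof (intro conjI ballI impI vert_category CC.vert_category)
    fix f assume "f \<in> Ob (vert C)"
    then show "fob ?G f \<in> Ob (vert (Cong C))"
      "far ?G (Idn (vert C) f) = Idn (vert (Cong C)) (fob ?G f)"
      using Nv1_spec(1-3)[of f "dom1 C f" "cod1 C f"] Ner_complete Nv2_id[of f "dom1 C f"
        "cod1 C f"] by simp_all
  next
    fix \<alpha> assume "\<alpha> \<in> Ar (vert C)"
    then show "cell (Cong C) (far ?G \<alpha>) (fob ?G (Dm (vert C) \<alpha>))
      (fob ?G (Cd (vert C) \<alpha>))"
      using Nv2_spec(1-3)[of \<alpha> "dom2 C \<alpha>" "cod2 C \<alpha>" "dom1 C (dom2 C \<alpha>)" "cod1 C (dom2 C \<alpha>)"]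
        Nv1_spec(1-3)[of "dom2 C \<alpha>" "dom1 C (dom2 C \<alpha>)" "cod1 C (dom2 C \<alpha>)"] Ner_complete by simp
  next
    fix \<alpha> \<beta> assume "\<alpha> \<in> Ar (vert C)" "\<beta> \<in> Ar (vert C)" "Cd (vert C) \<alpha> = Dm (vert C) \<beta>"
    then show "far ?G (Cmp (vert C) \<alpha> \<beta>) =
       Cmp (vert (Cong C)) (far ?G \<alpha>) (far ?G \<beta>)"
      using Nv2_vcomp[of "dom2 C \<alpha>" "dom1 C (dom2 C \<alpha>)"
        "cod1 C (dom2 C \<alpha>)" \<alpha> "cod2 C \<alpha>" \<beta> "cod2 C \<beta>"] by simp
  qed
  have 3: "T2 (Nv C \<nu>) (\<alpha> \<star> \<beta>) = hcomp (Cong C) (T2 (Nv C \<nu>) \<alpha>) (T2 (Nv C \<nu>) \<beta>)"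
    if "hcomposable C \<alpha> \<beta>" for \<alpha> \<beta>
    using Nv2_hcomp[of "dom2 C \<alpha>" "dom1 C (dom2 C \<alpha>)" "cod1 C (dom2 C \<alpha>)" \<alpha> "cod2 C \<alpha>" "dom2 C \<beta>"
      "cod1 C (dom2 C \<beta>)" \<beta> "cod2 C \<beta>"] that
    by (simp add: hcomposable_def)
  show ?thesis unfolding two_functor_def using 1 2 3 two_category_axioms two_category_Cong by blast
qed

text \<open>Sending an internal functor to its cocone identifies the codomain of \<open>Nv\<close>
  with cocones under \<open>Ner X\<close>. After this identification \<open>Nv\<close> is the
  comparison functor of the quotient, so bijectivity is transferred from there.\<close>

lemma Nv_local_iso:
  assumes X: "X \<in> Cell0 C" "Y \<in> Cell0 C" and q:
    "strict_quotient C (Ner X) X (tautological_cocone C (\<nu> X))"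
  shows "cat_isomorphism (Hom C X Y) (Hom (Cong C) (Ner X) (Ner Y)) \<lparr>fob = Nv1 C \<nu>, far = Nv2 C \<nu>\<rparr>"
    (is "cat_isomorphism ?H ?K ?N")
proof -
  interpret CC: two_category "Cong C" by (rule two_category_Cong)
  interpret A: nerve_like C "Ner X" X "inc X" "cel X" by (rule Ner_like[OF X(1)])
  interpret B: nerve_like C "Ner Y" Y "inc Y" "cel Y" by (rule Ner_like[OF X(2)])
  define \<Phi> where "\<Phi> = (\<lambda>f. (inc X \<cdot> f, cel X \<lhd> f))"
  let ?L = "cocone_cat C (Ner X) Y" and ?P = "\<lparr>fob = \<Phi>, far = (\<lambda>\<alpha>. (\<Phi> (dom2 C \<alpha>), \<Phi> (cod2 C \<alpha>),
      inc X \<rhd> \<alpha>))\<rparr>"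
  have iso: "cat_isomorphism ?H ?L
     ?P"
    using q X(2) by (simp add: strict_quotient_def tautological_cocone_def Let_def \<Phi>_def)
  show ?thesis
  proof (rule cat_isomorphismI)
    show "is_functor ?H ?K ?N"
      using two_functor_Hom[OF two_functor_Nv, of X Y] by simp
  next
    fix F assume "F \<in> Ob ?K"
    then have F: "internal_functor (under C) F" "fsrc F = Ner X" "ftrg F = Ner Y" by simp_all
    have "(F0 F \<cdot> inc Y, F1 F \<rhd> cel Y) \<in> Ob ?L"
      using B.functor_cocone[OF F] by (simp add: cocone_cat_def)
    then obtain f where f: "f \<in> Ob ?H" "\<Phi> f = (F0 F \<cdot> inc Y, F1 F \<rhd> cel Y)"
      using cat_isomorphism_ob_ex[OF iso] by fastforce
    then have f': "mor C f X Y" "inc X \<cdot> f = F0 F \<cdot> inc Y" "cel X \<lhd> f = F1 F \<rhd> cel Y"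
      by (simp_all add: \<Phi>_def)
    note N = Nv1_spec[OF f'(1)]
    have "Nv1 C \<nu> f = F" by (rule B.functor_eqI[OF N(1,3) F(1,3)]) (simp_all only: N F f')
    then show "\<exists>f \<in> Ob ?H. fob ?N f = F" using f(1) by auto
  next
    fix f g assume fg: "f \<in> Ob ?H" "g \<in> Ob ?H"
      "fob ?N f = fob ?N g"
    then have f: "mor C f X Y" "mor C g X Y" and e: "Nv1 C \<nu> f = Nv1 C \<nu> g" by simp_all
    have "\<Phi> f = \<Phi> g"
      unfolding \<Phi>_def Nv1_spec(4,5)[OF f(1), symmetric] Nv1_spec(4,5)[OF f(2), symmetric] e ..
    then show "f = g" using cat_isomorphism_ob_inj[OF iso fg(1,2)] by simp
  next
    fix f g \<psi> assume fg: "f \<in> Ob ?H" "g \<in> Ob ?H"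
      and p: "arr ?K \<psi> (fob ?N f) (fob ?N g)"
    then have f: "mor C f X Y" "mor C g X Y" by simp_all
    have n: "internal_nat (under C) \<psi>" "nsrc \<psi> = Nv1 C \<nu> f" "ntrg \<psi> = Nv1 C \<nu> g"
      using p by (simp_all add: CC.arr_Hom)
    note F = Nv1_spec[OF f(1)] and G = Nv1_spec[OF f(2)]
    have k: "fsrc (nsrc \<psi>) = Ner X" "ftrg (nsrc \<psi>) = Ner Y" using n F by simp_all
    define \<beta> where "\<beta> = ncomp \<psi> \<rhd> cel Y"
    note t = B.nat_th[OF n(1) k, folded \<beta>_def, unfolded n(2,3) F(4,5) G(4,5)]
    \<comment> \<open>Gives that \<Phi> of a morphism is a cocone, which the arrow constructed next
      needs at both ends.\<close>
    have "is_functor ?H ?L ?P"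
      using iso by (simp add: cat_isomorphism_def)
    from is_functorD(3)[OF this fg(1)] is_functorD(3)[OF this fg(2)]
    have c: "is_cocone C (Ner X) Y (\<Phi> f)" "is_cocone C (Ner X) Y (\<Phi> g)"
      by (simp_all add: cocone_cat_def)
    have "arr ?L (\<Phi> f, \<Phi> g, \<beta>) (\<Phi> f) (\<Phi> g)"
      unfolding arr_def cocone_cat_def using c t by (simp add: \<Phi>_def)
    then obtain \<alpha> where a: "arr ?H \<alpha> f g" "inc X \<rhd> \<alpha> = \<beta>"
      using cat_isomorphism_ar_ex[OF iso fg, of "(\<Phi> f, \<Phi> g, \<beta>)"] by auto
    have a': "cell C \<alpha> f g" using a(1) by (simp add: arr_Hom)
    note N = Nv2_spec[OF a' f(1)]
    have "Nv2 C \<nu> \<alpha> = \<psi>"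
      by (rule B.nat_eqI[OF N(1) n(1)]) (simp_all only: N n k a(2) \<beta>_def F)
    then show "\<exists>\<alpha>. arr ?H \<alpha> f g \<and> far ?N \<alpha> = \<psi>" using a(1) by auto
  next
    fix f g \<alpha> \<alpha>' assume fg: "f \<in> Ob ?H" "g \<in> Ob ?H" and a: "arr ?H \<alpha> f g" "arr ?H \<alpha>' f g"
      and e: "far ?N \<alpha> = far ?N \<alpha>'"
    have f: "mor C f X Y" using fg(1) by simp
    have c: "cell C \<alpha> f g" "cell C \<alpha>' f g" using a by (simp_all add: arr_Hom)
    have "inc X \<rhd> \<alpha> = inc X \<rhd> \<alpha>'"
      using Nv2_spec(4)[OF c(1) f] Nv2_spec(4)[OF c(2) f] e by simp
    then show "\<alpha> = \<alpha>'"
      by (intro cat_isomorphism_ar_inj[OF iso]) (use c f in simp_all)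
  qed
qed

text \<open>Each nerve carries a tautological cocone with vertex \<open>X\<close>, and each factors
  through the other. The two functors are mutually inverse because the composites induce the
  tautological cocones again, so the equivalence is even an isomorphism.\<close>

lemma nerve_equivalent:
  assumes N: "is_nerve_data C X N"
  shows "equivalent_in (Cong C) (nerve C X N) (Ner X)"
proof -
  interpret CC: two_category "Cong C" by (rule two_category_Cong)
  define K i \<theta> where "K = nerve C X N" "i = core0 N" "\<theta> = core1 N \<rhd> bdry (ev1 N)"
  interpret A: nerve_like C K X i \<theta> unfolding K_i_\<theta>_def by (rule nerve_like_nerve(1)[OF N])
  have X: "X \<in> Cell0 C" by simp
  interpret B: nerve_like C "Ner X" X "inc X" "cel X" by (rule Ner_like[OF X])
  obtain F where F: "internal_functor (under C) F" "fsrc F = K" "ftrg F = Ner X" "F0 F \<cdot> inc X = i"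
    "F1 F \<rhd> cel X = \<theta>"
    using B.functor_exists[OF A.nerve_internal_category A.gpd(1) A.tautological] by blast
  obtain G where G: "internal_functor (under C) G" "fsrc G = Ner X" "ftrg G = K" "F0 G \<cdot> i = inc X"
    "F1 G \<rhd> \<theta> = cel X"
    using A.functor_exists[OF B.nerve_internal_category B.gpd(1) B.tautological] by blast
  have m: "mor C (F0 F) (C0 K) (C0 (Ner X))" "mor C (F1 F) (C1 K) (C1 (Ner X))"
    "mor C (F0 G) (C0 (Ner X)) (C0 K)" "mor C (F1 G) (C1 (Ner X)) (C1 K)"
    using F(1-3) G(1-3) by simp_all
  have FG: "comp1 ICat F G = id1 ICat K"
  proof (rule A.functor_eqI)
    show "internal_functor (under C) (comp1 ICat F G)"
      by (rule U.internal_functor_comp[OF F(1) G(1)]) (simp add: F G)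
    show "internal_functor (under C) (id1 ICat K)"
      by (rule U.internal_functor_id[OF A.nerve_internal_category])
    have "(F0 F \<cdot> F0 G) \<cdot> i = F0 F \<cdot> (F0 G \<cdot> i)" using m by simp
    then show "F0 (comp1 ICat F G) \<cdot> i = F0 (id1 ICat K) \<cdot> i" unfolding G(4) F(4) by simp
    have "(F1 F \<cdot> F1 G) \<rhd> \<theta> = F1 F \<rhd> (F1 G \<rhd> \<theta>)" using m by simp
    then show "F1 (comp1 ICat F G) \<rhd> \<theta> = F1 (id1 ICat K) \<rhd> \<theta>" unfolding G(5) F(5) by simp
  qed (simp_all add: F G)
  have GF: "comp1 ICat G F = id1 ICat (Ner X)"
  proof (rule B.functor_eqI)
    show "internal_functor (under C) (comp1 ICat G F)"
      by (rule U.internal_functor_comp[OF G(1) F(1)]) (simp add: F G)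
    show "internal_functor (under C) (id1 ICat (Ner X))"
      by (rule U.internal_functor_id[OF B.nerve_internal_category])
    have "(F0 G \<cdot> F0 F) \<cdot> inc X = F0 G \<cdot> (F0 F \<cdot> inc X)" using m by simp
    then show "F0 (comp1 ICat G F) \<cdot> inc X = F0 (id1 ICat (Ner X)) \<cdot> inc X" unfolding G(4) F(4)
      by simp
    have "(F1 G \<cdot> F1 F) \<rhd> cel X = F1 G \<rhd> (F1 F \<rhd> cel X)" using m B.th by simp
    then show "F1 (comp1 ICat G F) \<rhd> cel X = F1 (id1 ICat (Ner X)) \<rhd> cel X" unfolding G(5) F(5)
      using B.th by simp
  qed (simp_all add: F G)
  have cK: "complete_congruence C K" by (rule A.nerve_complete_congruence[OF pita])
  have cX: "complete_congruence C (Ner X)" by (rule Ner_complete[OF X])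
  have obj: "K \<in> Cell0 (Cong C)" "Ner X \<in> Cell0 (Cong C)"
    using cK cX A.nerve_internal_category B.nerve_internal_category by simp_all
  have mF: "mor (Cong C) F K (Ner X)" "mor (Cong C) G (Ner X) K" using F G cK cX by simp_all
  let ?i = "id2 (Cong C) (id1 (Cong C) K)" and ?j = "id2 (Cong C) (id1 (Cong C) (Ner X))"
  have FG': "comp1 (Cong C) F G = id1 (Cong C) K" "comp1 (Cong C) G F = id1 (Cong C) (Ner X)"
    unfolding Cong_simps(8,9) by (rule FG GF)+
  have ij: "cell (Cong C) ?i (id1 (Cong C) K) (id1 (Cong C) K)"
    "cell (Cong C) ?j (id1 (Cong C) (Ner X)) (id1 (Cong C) (Ner X))"
    using CC.V.Idn_arr[of "id1 (Cong C) K"] CC.V.Idn_arr[of "id1 (Cong C) (Ner X)"]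
      CC.cell1_closed(3)[OF obj(1)] CC.cell1_closed(3)[OF obj(2)]
    unfolding vert_simps by blast+
  have iso: "isoc (Cong C) ?i" "isoc (Cong C) ?j"
    by (rule CC.isoc_id CC.cell1_closed(3) obj)+
  show ?thesis
    unfolding equivalent_in_def K_i_\<theta>_def(1)[symmetric]
    using mF FG' ij iso by metis
qed

end

text \<open>Guarantees that quantifying over all choices in the theorem is not vacuous. Cores are
  taken also of the two cotensors, one of which had to be constructed.\<close>

lemma (in two_category) nerve_choice_exists:
  assumes C: "pita C" and core: "\<forall>X \<in> Cell0 C. \<exists>i. is_core C X i"
  shows "\<exists>\<nu>. nerve_choice C \<nu>"
proof -
  have "\<exists>N. is_nerve_data C X N" if X: "X \<in> Cell0 C" for X
  proof -
    obtain P1 e1 where 1: "strict_cotensor C (ord_cat 1) X P1 e1" using C X unfolding pita_def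
      by blast
    obtain P2 e2 where 2: "strict_cotensor C (ord_cat 2) X P2 e2" using cotensor_2_exists[OF C X]
      by blast
    obtain i0 i1 i2 where "is_core C X i0" "is_core C P1 i1" "is_core C P2 i2"
      using core X cotensor_ord_diagram(3)[OF 1] cotensor_ord_diagram(3)[OF 2] by metis
    then have "is_nerve_data C X \<lparr>cot1 = P1, ev1 = e1, cot2 = P2, ev2 = e2, core0 = i0, core1 = i1,
        core2 = i2\<rparr>"
      using 1 2 by (simp add: is_nerve_data_def)
    then show ?thesis by blast
  qed
  then have "\<forall>X. \<exists>N. X \<in> Cell0 C \<longrightarrow> is_nerve_data C X N" by blast
  then show ?thesis unfolding nerve_choice_def by metis
qed

theorem theorem6p1p3:
  fixes C :: "('o, 'm, 'c) two_cat"
  assumes "two_category C" and "groupoidant C"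
  shows "(\<exists>\<nu>. nerve_choice C \<nu>) \<and>
    (\<forall>\<nu>. nerve_choice C \<nu> \<longrightarrow> strict_equivalence C (Cong C) (Nv C \<nu>))"
proof (intro conjI allI impI)
  interpret two_category C by (rule assms(1))
  have C: "pita C" and core: "\<forall>X \<in> Cell0 C. \<exists>i. is_core C X i"
    and cong: "\<And>K. complete_congruence C K \<Longrightarrow> \<exists>X \<in> Cell0 C. \<exists>N. is_nerve_data C X N \<and> K
        = nerve C X N"
    and quot: "\<And>X N. X \<in> Cell0 C \<Longrightarrow> is_nerve_data C X N
        \<Longrightarrow> strict_quotient C (nerve C X N) X (tautological_cocone C N)"
    using assms(2) unfolding groupoidant_def by blast+
  show "\<exists>\<nu>. nerve_choice C \<nu>" by (rule nerve_choice_exists[OF C core])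
  fix \<nu> assume \<nu>: "nerve_choice C \<nu>"
  interpret nerve_functor C \<nu> by unfold_locales (rule C \<nu>)+
  show "strict_equivalence C (Cong C) (Nv C \<nu>)"
    unfolding strict_equivalence_def
  proof (intro conjI ballI two_functor_Nv)
    fix K assume "K \<in> Cell0 (Cong C)"
    then have "complete_congruence C K" by simp
    \<comment> \<open>The congruence is a nerve for some choice \<open>N\<close>, whereas
      \<open>Nv\<close> uses \<nu>; \<open>nerve_equivalent\<close> compares the two.\<close>
    then obtain X N where X: "X \<in> Cell0 C" "is_nerve_data C X N" "K = nerve C X N" using cong
      by blast
    then show "\<exists>X \<in> Cell0 C. equivalent_in (Cong C) K (T0 (Nv C \<nu>) X)"
      using nerve_equivalent[OF X(2)] by auto
  next
    fix X Y assume X: "X \<in> Cell0 C" "Y \<in> Cell0 C"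
    \<comment> \<open>The quotient axiom enters here, for the nerve of \<open>X\<close> formed with
      the choice \<nu>.\<close>
    show "cat_isomorphism (Hom C X Y) (Hom (Cong C) (T0 (Nv C \<nu>) X) (T0 (Nv C \<nu>) Y))
        \<lparr>fob = T1 (Nv C \<nu>), far = T2 (Nv C \<nu>)\<rparr>"
      using Nv_local_iso[OF X quot[OF X(1) Ner_data[OF X(1)]]] by simp
  qed
qed

end
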